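(* Let $1<p<\infty$ and $F\in L^p(\Gamma,|\mathrm{d}\zeta|)$, and let $CF(w)=\frac1{2\pi\mathrm{i}}\int_\Gamma\frac{F(\zeta)}{\zeta-w}\,\mathrm{d}\zeta$ for $w\in\Omega_+\cup\Omega_-$ be the Cauchy integral of $F$ on $\Gamma$. Then $CF\in H^p(\Omega_+)$ and $CF\in H^p(\Omega_-)$ (for the restrictions of $CF$ to $\Omega_+$ and $\Omega_-$ respectively), and $$\lVert CF\rVert_{H^p(\Omega_+)}\leqslant \Big(\frac52\Big)^{\frac1p}A_p\lVert F\rVert_{L^p(\Gamma,|\mathrm{d}\zeta|)},\qquad \lVert CF\rVert_{H^p(\Omega_-)}\leqslant 3^{\frac1p}A_p\lVert F\rVert_{L^p(\Gamma,|\mathrm{d}\zeta|)},$$ where $A_p>0$ is given by $A_p^p=\max\{\frac{p}{p-1},\,p^{p-1}\}$.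
   Context: Fix $\sigma>0$. For $s>0$, $t\in\mathbb{R}$ let $D_{s,t}=\{u+\mathrm{i}v: |u|<s,\ v>t\}$ and let $\Gamma_{s,t}=\partial D_{s,t}=\{-s+\mathrm{i}v: v>t\}\cup\{u+\mathrm{i}t: |u|\leqslant s\}\cup\{s+\mathrm{i}v: v>t\}$, oriented so that $D_{s,t}$ lies on its left. Put $\Omega_+=D_{\sigma,0}$, $\Omega_-=\mathbb{C}\setminus\overline{D_{\sigma,0}}$, and $\Gamma=\Gamma_{\sigma,0}$ (their common boundary, oriented so that $\Omega_+=D_{\sigma,0}$ lies on its left). For $0<p<\infty$ let $m(s,t,F)=\big(\int_{\Gamma_{s,t}}|F(w)|^p|\mathrm{d}w|\big)^{1/p}$. $H^p(\Omega_+)$ is the set of $F$ analytic on $\Omega_+$ with $\lVert F\rVert_{H^p(\Omega_+)}=\sup_{0<s<\sigma,\,t>0}m(s,t,F)<\infty$; $H^p(\Omega_-)$ is the set of $F$ analytic on $\Omega_-$ with $\lVert F\rVert_{H^p(\Omega_-)}=\sup_{s>\sigma,\,t<0}m(s,t,F)<\infty$. *)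

theory Defs
  imports "HOL-Complex_Analysis.Complex_Analysis"
begin

definition half_strip :: "real \<Rightarrow> real \<Rightarrow> complex set" where
  "half_strip s t = {w. \<bar>Re w\<bar> < s \<and> t < Im w}"

abbreviation Omega_plus :: "real \<Rightarrow> complex set" where
  "Omega_plus \<sigma> \<equiv> half_strip \<sigma> 0"

abbreviation Omega_minus :: "real \<Rightarrow> complex set" where
  "Omega_minus \<sigma> \<equiv> - closure (half_strip \<sigma> 0)"

(* Unit-speed parametrization of the boundary of half_strip s t over the whole real line:
   down the left ray, along the bottom segment, up the right ray, so that half_strip s t
   lies on the left. *)
definition strip_path :: "real \<Rightarrow> real \<Rightarrow> real \<Rightarrow> complex" where
  "strip_path s t x =
     (if x < - s then Complex (- s) (t - s - x)
      else if x \<le> s then Complex x t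
      else Complex s (t - s + x))"

lemma closure_half_strip:
  assumes "s > 0"
  shows "closure (half_strip s t) = {w. \<bar>Re w\<bar> \<le> s \<and> t \<le> Im w}"
proof
  have "closed {w::complex. \<bar>Re w\<bar> \<le> s \<and> t \<le> Im w}"
    by (intro closed_Collect_conj closed_Collect_le continuous_intros)
  thus "closure (half_strip s t) \<subseteq> {w. \<bar>Re w\<bar> \<le> s \<and> t \<le> Im w}"
    by (intro closure_minimal) (auto simp: half_strip_def)
next
  show "{w. \<bar>Re w\<bar> \<le> s \<and> t \<le> Im w} \<subseteq> closure (half_strip s t)"
  proof
    fix z :: complex assume z: "z \<in> {w. \<bar>Re w\<bar> \<le> s \<and> t \<le> Im w}"
    define f where "f = (\<lambda>e::real. Complex ((1 - e) * Re z) (Im z + e))"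
    have lim: "(f \<longlongrightarrow> f 0) (at_right 0)"
      unfolding f_def Complex_eq by (intro tendsto_intros)
    have "\<forall>\<^sub>F e in at_right 0. f e \<in> half_strip s t"
    proof (rule eventually_at_rightI[of 0 1])
      fix e :: real assume e: "e \<in> {0<..<1}"
      have "(1 - e) * \<bar>Re z\<bar> \<le> (1 - e) * s"
        using z e by (intro mult_left_mono) auto
      also have "\<dots> < s" using e assms by (simp add: algebra_simps)
      finally show "f e \<in> half_strip s t"
        using z e by (auto simp: f_def half_strip_def abs_mult)
    qed simp
    hence "\<forall>\<^sub>F e in at_right 0. f e \<in> closure (half_strip s t)"
      by (rule eventually_mono) (use closure_subset in blast)
    from Lim_in_closed_set[OF closed_closure this _ lim]
    show "z \<in> closure (half_strip s t)" by (simp add: f_def)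
  qed
qed

lemma open_half_strip: "open (half_strip s t)"
  unfolding half_strip_def
  by (intro open_Collect_conj open_Collect_less continuous_intros)

lemma range_strip_path:
  assumes "s > 0"
  shows "range (strip_path s t) = frontier (half_strip s t)"
proof -
  have "range (strip_path s t) = {w. \<bar>Re w\<bar> \<le> s \<and> t \<le> Im w} - half_strip s t"
  proof (intro equalityI subsetI)
    fix w assume "w \<in> range (strip_path s t)"
    thus "w \<in> {w. \<bar>Re w\<bar> \<le> s \<and> t \<le> Im w} - half_strip s t"
      using assms by (auto simp: strip_path_def half_strip_def split: if_splits)
  next
    fix w assume w: "w \<in> {w. \<bar>Re w\<bar> \<le> s \<and> t \<le> Im w} - half_strip s t"
    consider "Im w = t" | "Re w = s" "Im w > t" | "Re w = - s" "Im w > t"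
      using w by (force simp: half_strip_def)
    thus "w \<in> range (strip_path s t)"
    proof cases
      case 1
      hence "w = strip_path s t (Re w)"
        using w by (auto simp: strip_path_def complex_eq_iff)
      thus ?thesis by blast
    next
      case 2
      hence "w = strip_path s t (s + (Im w - t))"
        using assms by (auto simp: strip_path_def complex_eq_iff)
      thus ?thesis by blast
    next
      case 3
      hence "w = strip_path s t (- s - (Im w - t))"
        by (auto simp: strip_path_def complex_eq_iff)
      thus ?thesis by blast
    qed
  qed
  thus ?thesis
    using open_half_strip by (simp add: frontier_def closure_half_strip assms interior_open)
qed

lemma inj_strip_path: "s > 0 \<Longrightarrow> inj (strip_path s t)"
  by (auto simp: inj_def strip_path_def split: if_splits)

lemma strip_path_has_vector_derivative:
  "x < - s \<Longrightarrow> s > 0 \<Longrightarrow> (strip_path s t has_vector_derivative - \<i>) (at x)"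
  "- s < x \<Longrightarrow> x < s \<Longrightarrow> (strip_path s t has_vector_derivative 1) (at x)"
  "x > s \<Longrightarrow> s > 0 \<Longrightarrow> (strip_path s t has_vector_derivative \<i>) (at x)"
proof -
  assume x: "x < - s" "s > 0"
  have "((\<lambda>x. Complex (- s) (t - s - x)) has_vector_derivative - \<i>) (at x)"
    unfolding Complex_eq by (auto intro!: derivative_eq_intros)
  thus "(strip_path s t has_vector_derivative - \<i>) (at x)"
    by (rule has_vector_derivative_transform_within_open[of _ _ _ "{..< - s}"])
       (use x in \<open>auto simp: strip_path_def\<close>)
next
  assume x: "- s < x" "x < s"
  have "((\<lambda>x. Complex x t) has_vector_derivative 1) (at x)"
    unfolding Complex_eq by (auto intro!: derivative_eq_intros)
  thus "(strip_path s t has_vector_derivative 1) (at x)"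
    by (rule has_vector_derivative_transform_within_open[of _ _ _ "{- s<..<s}"])
       (use x in \<open>auto simp: strip_path_def\<close>)
next
  assume x: "x > s" "s > 0"
  have "((\<lambda>x. Complex s (t - s + x)) has_vector_derivative \<i>) (at x)"
    unfolding Complex_eq by (auto intro!: derivative_eq_intros)
  thus "(strip_path s t has_vector_derivative \<i>) (at x)"
    by (rule has_vector_derivative_transform_within_open[of _ _ _ "{s<..}"])
       (use x in \<open>auto simp: strip_path_def\<close>)
qed

(* Arc length |dw| on the boundary curve: Lebesgue measure transported by the injective
   unit-speed parametrization; its space is the curve itself. *)
definition arc_measure :: "real \<Rightarrow> real \<Rightarrow> complex measure" where
  "arc_measure s t = embed_measure lebesgue (strip_path s t)"

definition enn_powr :: "ennreal \<Rightarrow> real \<Rightarrow> ennreal" where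
  "enn_powr x a = (if x = \<infinity> then \<infinity> else ennreal (enn2real x powr a))"

definition Lp_norm :: "real \<Rightarrow> 'a measure \<Rightarrow> ('a \<Rightarrow> complex) \<Rightarrow> ennreal" where
  "Lp_norm p M F = enn_powr (\<integral>\<^sup>+ w. ennreal (cmod (F w) powr p) \<partial>M) (1 / p)"

definition Lp_space :: "real \<Rightarrow> 'a measure \<Rightarrow> ('a \<Rightarrow> complex) set" where
  "Lp_space p M = {F \<in> borel_measurable M. Lp_norm p M F < \<infinity>}"

definition strip_mean :: "real \<Rightarrow> real \<Rightarrow> real \<Rightarrow> (complex \<Rightarrow> complex) \<Rightarrow> ennreal" where
  "strip_mean p s t F = Lp_norm p (arc_measure s t) F"

definition Hp_plus_norm :: "real \<Rightarrow> real \<Rightarrow> (complex \<Rightarrow> complex) \<Rightarrow> ennreal" where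
  "Hp_plus_norm \<sigma> p F = (SUP (s, t) \<in> {0<..<\<sigma>} \<times> {0<..}. strip_mean p s t F)"

definition Hp_minus_norm :: "real \<Rightarrow> real \<Rightarrow> (complex \<Rightarrow> complex) \<Rightarrow> ennreal" where
  "Hp_minus_norm \<sigma> p F = (SUP (s, t) \<in> {\<sigma><..} \<times> {..<0}. strip_mean p s t F)"

(* Functions are total; only their values on the respective domain are constrained. *)
definition Hp_plus :: "real \<Rightarrow> real \<Rightarrow> (complex \<Rightarrow> complex) set" where
  "Hp_plus \<sigma> p = {F. F analytic_on Omega_plus \<sigma> \<and> Hp_plus_norm \<sigma> p F < \<infinity>}"

definition Hp_minus :: "real \<Rightarrow> real \<Rightarrow> (complex \<Rightarrow> complex) set" where
  "Hp_minus \<sigma> p = {F. F analytic_on Omega_minus \<sigma> \<and> Hp_minus_norm \<sigma> p F < \<infinity>}"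

(* The library's contour_integral covers only paths over {0..1}; for the unbounded curve we
   integrate f (\<gamma> x) * \<gamma>' x in the same way.  At the two corners, a null set,
   the value of vector_derivative is irrelevant. *)
definition strip_contour_integral :: "real \<Rightarrow> real \<Rightarrow> (complex \<Rightarrow> complex) \<Rightarrow> complex" where
  "strip_contour_integral s t f =
     (\<integral>x. f (strip_path s t x) * vector_derivative (strip_path s t) (at x) \<partial>lebesgue)"

definition Cauchy_int :: "real \<Rightarrow> (complex \<Rightarrow> complex) \<Rightarrow> complex \<Rightarrow> complex" where
  "Cauchy_int \<sigma> F w =
     1 / (2 * of_real pi * \<i>) * strip_contour_integral \<sigma> 0 (\<lambda>\<zeta>. F \<zeta> / (\<zeta> - w))"

end

theory Submission
  imports Defs
begin

text \<open>
By duality the \<open>L\<^sup>p\<close> norm of the Cauchy integral of \<open>F\<close> on a half-strip boundary inside or outside \<open>\<Gamma>\<close> is, up to the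
factor \<open>2 \<pi>\<close>, a supremum of values of the bilinear form \<open>\<integral>\<integral> F(x) G(y) / (\<gamma>(x) - \<gamma>'(y)) dx dy\<close>, where \<open>\<gamma>\<close> and \<open>\<gamma>'\<close> are an outer and an
inner half-strip boundary parametrised by arc length. Interior and exterior differ only in the curve that carries
\<open>F\<close>. So both estimates follow from one: for \<open>r = max p p'\<close>, with \<open>p'\<close> the conjugate exponent, the form is bounded
by \<open>2 \<pi> K\<^sub>r\<close>, \<open>K\<^sub>r = (5/2)\<^sup>1\<^sup>/\<^sup>r r\<^sup>1\<^sup>-\<^sup>1\<^sup>/\<^sup>r\<close>, on unit vectors of exponents \<open>r\<close> and \<open>r'\<close>, whichever curve carries
which (\<open>form_bound\<close>, \<open>pair_bound_Kconst\<close>). The constants \<open>(5/2)\<^sup>1\<^sup>/\<^sup>p A\<^sub>p\<close> and \<open>3\<^sup>1\<^sup>/\<^sup>p A\<^sub>p\<close> are both at least \<open>K\<^sub>r\<close>.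

The form is estimated at the exponents \<open>r = 2, 4, 8, 16, \<dots>\<close> and interpolated in between by the Riesz-Thorin theorem
(\<open>form_bound_interpolate\<close>). In \<open>1/r\<close> the interpolated bound is log-affine and \<open>ln K\<^sub>r\<close> is convex, so a comparison
with suitable tangents is enough; for \<open>r \<ge> 8\<close> there is room for a uniform argument (\<open>pair_bound_octave\<close>).

At a dyadic exponent the curve carrying the source is split into its three sides. Each side lies on a line, and its
contribution is the Cauchy transform of that line, restricted to the other curve. Two facts about the Cauchy transform
of a line enter.

\<^item> Its norm \<open>c\<^sub>r\<close> from a line to a parallel line. At 4 it is at most the square root of 2, by an elementary inequality whose
correction term integrates to zero by Cauchy's theorem (\<open>Cbound_4\<close>); from there Cotlar's identity doubles the exponent
(\<open>Cbound_double\<close>, \<open>Tbound_double\<close>) and gives \<open>c\<^sub>r \<le> r/3\<close> for dyadic \<open>r \<ge> 8\<close>; conjugate exponents have the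
same norm (\<open>Cbound_dual\<close>).

\<^item> The passage from parallel lines to broken lines. In \<open>L\<^sup>2\<close> the transform on a half-plane is a Laplace transform,
and relative to the boundary a perpendicular ray carries at most half of the mass, a parallel line with one
perpendicular segment at most 27/25 and with two of them at most 32/25 of it (\<open>Jint_L2\<close>, \<open>admissible_hook\<close>,
\<open>admissible_comb\<close>). For other exponents \<open>q\<close> the function \<open>|C|\<^sup>q\<close> has a majorant \<open>|H|\<^sup>2\<close> with \<open>H\<close> holomorphic and with
equality on the boundary, obtained by dividing out zeros, so the same constants hold (\<open>power_majorant\<close>, \<open>Jint_shift\<close>).

Adding up what the other curve consists of, a vertical side costs at most \<open>54/25\<close> and a bottom at most \<open>1 + 32/25 = 57/25\<close>, and
Hoelder's inequality over the three sides yields the bound \<open>c\<^sub>r (2 (54/25)\<^sup>r\<^sup>-\<^sup>1 + (57/25)\<^sup>r\<^sup>-\<^sup>1)\<^sup>1\<^sup>/\<^sup>r\<close> (\<open>three_columns\<close>). At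
\<open>r = 2\<close> the two sides of each line share the mass of the source, which improves this to the square root of
86/25 (\<open>form_bound_2\<close>).
\<close>

section \<open>Lebesgue norms\<close>

text \<open>An upper bound for an \<open>L\<^sup>p\<close> norm. Only bounds are ever compared, so the norm itself, with its root and
the case of an infinite integral, does not have to be handled.\<close>

definition Lp_le :: "real \<Rightarrow> 'a measure \<Rightarrow> ('a \<Rightarrow> complex) \<Rightarrow> real \<Rightarrow> bool" where
  "Lp_le p M f a \<longleftrightarrow> f \<in> borel_measurable M \<and> 0 \<le> a \<and>
     (\<integral>\<^sup>+x. ennreal (cmod (f x) powr p) \<partial>M) \<le> ennreal (a powr p)"

lemma Lp_leD:
  assumes "Lp_le p M f a"
  shows "f \<in> borel_measurable M" "0 \<le> a" "(\<integral>\<^sup>+x. ennreal (cmod (f x) powr p) \<partial>M) \<le> ennreal (a powr p)"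
  using assms unfolding Lp_le_def by auto

lemma Lp_leD_integrable:
  assumes "Lp_le p M f a"
  shows "integrable M (\<lambda>x. cmod (f x) powr p)" "(\<integral>x. cmod (f x) powr p \<partial>M) \<le> a powr p"
proof -
  have [measurable]: "f \<in> borel_measurable M" using assms by (simp add: Lp_le_def)
  have le: "(\<integral>\<^sup>+x. ennreal (cmod (f x) powr p) \<partial>M) \<le> ennreal (a powr p)"
    using assms by (simp add: Lp_le_def)
  show i: "integrable M (\<lambda>x. cmod (f x) powr p)"
    by (rule integrableI_bounded) (use le in \<open>auto intro: le_less_trans simp: less_top[symmetric] top_unique\<close>)
  show "(\<integral>x. cmod (f x) powr p \<partial>M) \<le> a powr p"
    using le nn_integral_eq_integral[OF i] by simp
qed

lemma Lp_leI_integrable: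
  assumes "f \<in> borel_measurable M" "0 \<le> a" "integrable M (\<lambda>x. cmod (f x) powr p)"
    "(\<integral>x. cmod (f x) powr p \<partial>M) \<le> a powr p"
  shows "Lp_le p M f a"
  using assms nn_integral_eq_integral[OF assms(3)] by (simp add: Lp_le_def)

lemma Lp_le_mono: "Lp_le p M f a \<Longrightarrow> a \<le> b \<Longrightarrow> 0 \<le> p \<Longrightarrow> Lp_le p M f b"
  unfolding Lp_le_def by (auto intro: order_trans powr_mono2 ennreal_leI)

lemma Lp_le_dominated:
  assumes "Lp_le p M f a" "\<And>x. x \<in> space M \<Longrightarrow> cmod (g x) \<le> cmod (f x)" "g \<in> borel_measurable M" "0 \<le> p"
  shows "Lp_le p M g a"
proof -
  have "(\<integral>\<^sup>+x. ennreal (cmod (g x) powr p) \<partial>M) \<le> (\<integral>\<^sup>+x. ennreal (cmod (f x) powr p) \<partial>M)"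
    by (intro nn_integral_mono ennreal_leI powr_mono2) (simp_all add: assms)
  then show ?thesis using assms unfolding Lp_le_def by (auto intro: order_trans)
qed

lemma Lp_le_0_AE:
  assumes "Lp_le p M f 0"
  shows "AE x in M. f x = 0"
proof -
  have [measurable]: "f \<in> borel_measurable M" using assms by (simp add: Lp_le_def)
  have "(\<integral>\<^sup>+x. ennreal (cmod (f x) powr p) \<partial>M) = 0" using assms by (simp add: Lp_le_def)
  then have "AE x in M. ennreal (cmod (f x) powr p) = 0" by (subst (asm) nn_integral_0_iff_AE) auto
  then show ?thesis by eventually_elim (auto simp: ennreal_eq_0_iff)
qed

lemma Lp_le_cmult:
  assumes "Lp_le p M f a"
  shows "Lp_le p M (\<lambda>x. c * f x) (cmod c * a)"
proof -
  have [measurable]: "f \<in> borel_measurable M" using assms by (simp add: Lp_le_def)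
  have "(\<integral>\<^sup>+x. ennreal (cmod (c * f x) powr p) \<partial>M) = ennreal (cmod c powr p) * (\<integral>\<^sup>+x. ennreal (cmod (f x) powr p) \<partial>M)"
    by (subst nn_integral_cmult[symmetric]) (auto simp: norm_mult powr_mult ennreal_mult')
  also have "\<dots> \<le> ennreal (cmod c powr p) * ennreal (a powr p)"
    using assms by (intro mult_left_mono) (auto simp: Lp_le_def)
  also have "\<dots> = ennreal ((cmod c * a) powr p)" by (simp add: powr_mult ennreal_mult')
  finally show ?thesis using assms by (simp add: Lp_le_def)
qed

text \<open>The pointwise Young inequality for the normalised functions, integrated.\<close>

theorem Hoelder:
  assumes "p > 1" "q > 1" "1 / p + 1 / q = 1" and f: "Lp_le p M f a" and g: "Lp_le q M g b"
  shows "(\<integral>\<^sup>+x. ennreal (cmod (f x) * cmod (g x)) \<partial>M) \<le> ennreal (a * b)"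
proof -
  note [measurable] = Lp_leD(1)[OF f] Lp_leD(1)[OF g]
  have ab: "0 \<le> a" "0 \<le> b" using f g by (auto simp: Lp_le_def)
  show ?thesis
  proof (cases "a = 0 \<or> b = 0")
    case True
    have "AE x in M. ennreal (cmod (f x) * cmod (g x)) = 0"
      using True
    proof
      assume "a = 0" then show ?thesis using Lp_le_0_AE[of p M f] f by (auto elim!: AE_mp)
    next
      assume "b = 0" then show ?thesis using Lp_le_0_AE[of q M g] g by (auto elim!: AE_mp)
    qed
    then have "(\<integral>\<^sup>+x. ennreal (cmod (f x) * cmod (g x)) \<partial>M) = 0"
      by (subst nn_integral_0_iff_AE) auto
    then show ?thesis by simp
  next
    case False
    then have pos: "a > 0" "b > 0" using ab by auto
    let ?A = "\<lambda>x. cmod (f x) powr p" let ?B = "\<lambda>x. cmod (g x) powr q"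
    have pw: "cmod (f x) * cmod (g x) \<le> (a * b / (p * a powr p)) * ?A x + (a * b / (q * b powr q)) * ?B x" for x
    proof -
      have "(cmod (f x) / a) * (cmod (g x) / b) \<le> (cmod (f x) / a) powr p / p + (cmod (g x) / b) powr q / q"
        using assms pos by (intro Youngs_inequality) auto
      also have "\<dots> = ?A x / (p * a powr p) + ?B x / (q * b powr q)"
        using pos assms by (simp add: powr_divide field_simps)
      finally have "a * b * ((cmod (f x) / a) * (cmod (g x) / b)) \<le> a * b * (?A x / (p * a powr p) + ?B x / (q * b powr q))"
        using pos by (intro mult_left_mono) auto
      then show ?thesis using pos by (simp add: field_simps)
    qed
    have "(\<integral>\<^sup>+x. ennreal (cmod (f x) * cmod (g x)) \<partial>M)
        \<le> (\<integral>\<^sup>+x. ennreal (a * b / (p * a powr p)) * ennreal (?A x) + ennreal (a * b / (q * b powr q)) * ennreal (?B x) \<partial>M)"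
      using pos assms(1,2) pw
      by (intro nn_integral_mono) (simp flip: ennreal_mult' ennreal_plus)
    also have "\<dots> = ennreal (a * b / (p * a powr p)) * (\<integral>\<^sup>+x. ennreal (?A x) \<partial>M)
                + ennreal (a * b / (q * b powr q)) * (\<integral>\<^sup>+x. ennreal (?B x) \<partial>M)"
      by (subst nn_integral_add) (auto simp: nn_integral_cmult)
    also have "\<dots> \<le> ennreal (a * b / (p * a powr p)) * ennreal (a powr p) + ennreal (a * b / (q * b powr q)) * ennreal (b powr q)"
      using f g by (intro add_mono mult_left_mono) (auto simp: Lp_le_def)
    also have "\<dots> = ennreal (a * b / p + a * b / q)"
      using pos assms(1,2) by (simp flip: ennreal_mult' ennreal_plus)
    also have "a * b / p + a * b / q = a * b * (1 / p + 1 / q)" by (simp add: field_simps)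
    finally show ?thesis by (simp add: assms(3))
  qed
qed

corollary Hoelder_integral:
  assumes "p > 1" "q > 1" "1 / p + 1 / q = 1" and f: "Lp_le p M f a" and g: "Lp_le q M g b"
  shows "integrable M (\<lambda>x. f x * g x)" "cmod (\<integral>x. f x * g x \<partial>M) \<le> a * b"
proof -
  note [measurable] = Lp_leD(1)[OF f] Lp_leD(1)[OF g]
  have H: "(\<integral>\<^sup>+x. ennreal (cmod (f x * g x)) \<partial>M) \<le> ennreal (a * b)"
    using Hoelder[OF assms] by (simp add: norm_mult)
  show i: "integrable M (\<lambda>x. f x * g x)"
    by (rule integrableI_bounded) (use H in \<open>auto intro: le_less_trans\<close>)
  have "0 \<le> a * b" using f g by (auto simp: Lp_le_def)
  then have "(\<integral>x. cmod (f x * g x) \<partial>M) \<le> a * b"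
    using H nn_integral_eq_integral[OF integrable_norm[OF i]] by simp
  then show "cmod (\<integral>x. f x * g x \<partial>M) \<le> a * b"
    using integral_norm_bound[of M "\<lambda>x. f x * g x"] by linarith
qed

lemma powr_convex_combination:
  fixes x y l m :: real
  assumes "p \<ge> 1" "l > 0" "m > 0" "l + m = 1" "x \<ge> 0" "y \<ge> 0"
  shows "(l * x + m * y) powr p \<le> l * x powr p + m * y powr p"
proof (cases "x = 0 \<or> y = 0")
  case True
  have "l powr p \<le> l" "m powr p \<le> m"
    using powr_mono'[of 1 p l] powr_mono'[of 1 p m] assms by auto
  then show ?thesis using True assms by (auto simp: powr_mult intro!: mult_right_mono)
next
  case False
  then show ?thesis using powr_convex[OF assms(1)] assms unfolding convex_on_def
    by auto
qed

text \<open>Convexity of \<open>x powr p\<close>, applied to \<open>f + g\<close> as a convex combination of \<open>f / a\<close> and \<open>g / b\<close> with the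
weights \<open>a / (a + b)\<close> and \<open>b / (a + b)\<close>; hence the strict positivity of the two bounds.\<close>

theorem Minkowski:
  assumes "p \<ge> 1" and f: "Lp_le p M f a" and g: "Lp_le p M g b" and "a > 0" "b > 0"
  shows "Lp_le p M (\<lambda>x. f x + g x) (a + b)"
proof -
  note [measurable] = Lp_leD(1)[OF f] Lp_leD(1)[OF g]
  let ?s = "a + b"
  have pw: "cmod (f x + g x) powr p \<le> (?s powr p * (a / ?s) / a powr p) * cmod (f x) powr p
       + (?s powr p * (b / ?s) / b powr p) * cmod (g x) powr p" for x
  proof -
    have s: "?s \<noteq> 0" "a \<noteq> 0" "b \<noteq> 0" using assms by auto
    have "cmod (f x + g x) powr p \<le> (cmod (f x) + cmod (g x)) powr p"
      using assms by (intro powr_mono2) (auto simp: norm_triangle_ineq)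
    also have "cmod (f x) + cmod (g x) = ?s * ((a / ?s) * (cmod (f x) / a) + (b / ?s) * (cmod (g x) / b))"
      using s by (simp add: distrib_left)
    also have "\<dots> powr p = ?s powr p * ((a / ?s) * (cmod (f x) / a) + (b / ?s) * (cmod (g x) / b)) powr p"
      using assms by (simp add: powr_mult)
    also have "\<dots> \<le> ?s powr p * ((a / ?s) * (cmod (f x) / a) powr p + (b / ?s) * (cmod (g x) / b) powr p)"
      using assms by (intro mult_left_mono powr_convex_combination) (auto simp: add_divide_distrib[symmetric])
    also have "\<dots> = (?s powr p * (a / ?s) / a powr p) * cmod (f x) powr p
       + (?s powr p * (b / ?s) / b powr p) * cmod (g x) powr p"
      using assms by (simp add: powr_divide distrib_left)
    finally show ?thesis .
  qed
  let ?c = "?s powr p * (a / ?s) / a powr p" and ?d = "?s powr p * (b / ?s) / b powr p"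
  have "(\<integral>\<^sup>+x. ennreal (cmod (f x + g x) powr p) \<partial>M) \<le>
     (\<integral>\<^sup>+x. ennreal ?c * ennreal (cmod (f x) powr p) + ennreal ?d * ennreal (cmod (g x) powr p) \<partial>M)"
    using assms pw by (intro nn_integral_mono) (simp flip: ennreal_mult' ennreal_plus)
  also have "\<dots> = ennreal ?c * (\<integral>\<^sup>+x. ennreal (cmod (f x) powr p) \<partial>M) + ennreal ?d * (\<integral>\<^sup>+x. ennreal (cmod (g x) powr p) \<partial>M)"
    by (subst nn_integral_add) (auto simp: nn_integral_cmult)
  also have "\<dots> \<le> ennreal ?c * ennreal (a powr p) + ennreal ?d * ennreal (b powr p)"
    using f g by (intro add_mono mult_left_mono) (auto simp: Lp_le_def)
  also have "\<dots> = ennreal (?s powr p * (a / ?s + b / ?s))"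
    using assms by (simp flip: ennreal_mult' ennreal_plus) (simp add: distrib_left)
  also have "a / ?s + b / ?s = 1" using assms by (simp add: add_divide_distrib[symmetric])
  finally show ?thesis using assms by (simp add: Lp_le_def)
qed

text \<open>Fatou's lemma. All estimates below are proved for bounded functions of bounded support and reach the
general case through this limit.\<close>

lemma Lp_le_limit:
  assumes "\<And>n::nat. Lp_le p M (f n) (a n)" "\<And>x. x \<in> space M \<Longrightarrow> (\<lambda>n. f n x) \<longlonglongrightarrow> g x"
    "a \<longlonglongrightarrow> b" "p > 0"
  shows "Lp_le p M g b"
proof -
  have fm[measurable]: "f n \<in> borel_measurable M" for n using assms by (simp add: Lp_le_def)
  have gm[measurable]: "g \<in> borel_measurable M"
    using assms(2) by (rule borel_measurable_LIMSEQ_metric[rotated]) simp_all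
  have b: "0 \<le> b" using assms(1) by (intro LIMSEQ_le_const[OF assms(3)]) (auto simp: Lp_le_def)
  have lim: "(\<lambda>n. ennreal (cmod (f n x) powr p)) \<longlonglongrightarrow> ennreal (cmod (g x) powr p)" if "x \<in> space M" for x
    using assms(2)[OF that] \<open>p > 0\<close> by (intro tendsto_intros) auto
  have "(\<integral>\<^sup>+x. ennreal (cmod (g x) powr p) \<partial>M) = (\<integral>\<^sup>+x. liminf (\<lambda>n. ennreal (cmod (f n x) powr p)) \<partial>M)"
    by (intro nn_integral_cong) (metis lim lim_imp_Liminf sequentially_bot)
  also have "\<dots> \<le> liminf (\<lambda>n. \<integral>\<^sup>+x. ennreal (cmod (f n x) powr p) \<partial>M)"
    by (intro nn_integral_liminf) auto
  also have "\<dots> \<le> liminf (\<lambda>n. ennreal (a n powr p))"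
    using assms(1) by (intro Liminf_mono) (auto simp: Lp_le_def)
  also have "\<dots> = ennreal (b powr p)"
  proof (rule lim_imp_Liminf)
    show "(\<lambda>n. ennreal (a n powr p)) \<longlonglongrightarrow> ennreal (b powr p)"
    proof (rule tendsto_ennrealI, rule tendsto_powr')
      show "a \<longlonglongrightarrow> b" by fact
      show "(\<lambda>n. p) \<longlonglongrightarrow> p" by simp
      show "b \<noteq> 0 \<or> p > 0 \<and> (\<forall>\<^sub>F x in sequentially. 0 \<le> a x)"
        using assms by (auto simp: Lp_le_def)
    qed
  qed simp
  finally show ?thesis using b by (simp add: Lp_le_def)
qed

section \<open>Cauchy's theorem and formula on a half-plane\<close>

lemma nn_integral_even:
  fixes f :: "real \<Rightarrow> ennreal"
  assumes [measurable]: "f \<in> borel_measurable borel" and even: "\<And>x. f (- x) = f x"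
  shows "(\<integral>\<^sup>+x. f x \<partial>lborel) = 2 * (\<integral>\<^sup>+x. f x * indicator {0..} x \<partial>lborel)"
proof -
  have refl: "(\<integral>\<^sup>+x. f x * indicator {..0} x \<partial>lborel) = (\<integral>\<^sup>+x. f x * indicator {0..} x \<partial>lborel)"
    using nn_integral_real_affine[of "\<lambda>x. f x * indicator {..0::real} x" "-1" 0]
    by (simp add: even indicator_def cong: if_cong)
  have "(\<integral>\<^sup>+x. f x \<partial>lborel) = (\<integral>\<^sup>+x. f x * indicator {0..} x + f x * indicator {..0} x \<partial>lborel)"
    by (intro nn_integral_cong_AE)
       (use AE_lborel_singleton[of "0::real"] in \<open>eventually_elim; auto simp: indicator_def\<close>)
  also have "\<dots> = (\<integral>\<^sup>+x. f x * indicator {0..} x \<partial>lborel) + (\<integral>\<^sup>+x. f x * indicator {..0} x \<partial>lborel)"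
    by (subst nn_integral_add) auto
  finally show ?thesis by (simp add: refl mult_2)
qed

lemma nn_integral_power_decay:
  assumes "a > (1::real)"
  shows "(\<integral>\<^sup>+y. ennreal ((1 + \<bar>y\<bar>) powr (- a)) \<partial>lborel) = ennreal (2 / (a - 1))"
proof -
  let ?F = "\<lambda>y::real. - ((1 + y) powr (1 - a)) / (a - 1)"
  have lim: "(?F \<longlongrightarrow> - 0 / (a - 1)) at_top"
  proof -
    have "((\<lambda>y::real. (1 + y) powr (1 - a)) \<longlongrightarrow> 0) at_top"
      using assms by (intro tendsto_neg_powr filterlim_tendsto_add_at_top[OF tendsto_const filterlim_ident]) auto
    then show ?thesis using assms by (intro tendsto_intros) auto
  qed
  have "(\<integral>\<^sup>+y. ennreal ((1 + \<bar>y\<bar>) powr (- a)) * indicator {0..} y \<partial>lborel)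
      = (\<integral>\<^sup>+y. ennreal ((1 + y) powr (- a)) * indicator {0..} y \<partial>lborel)"
    by (intro nn_integral_cong) (auto simp: indicator_def)
  also have "\<dots> = ennreal (- 0 / (a - 1) - ?F 0)"
  proof (rule nn_integral_FTC_atLeast[OF _ _ _ lim])
    show "DERIV ?F y :> (1 + y) powr (- a)" if "0 \<le> y" for y
    proof -
      have "DERIV (\<lambda>y. (1 + y) powr (1 - a)) y :> (1 - a) * (1 + y) powr (- a)"
        using that by (auto intro!: derivative_eq_intros)
      then have "DERIV ?F y :> - ((1 - a) * (1 + y) powr (- a)) / (a - 1)"
        by (intro DERIV_cdivide DERIV_minus)
      moreover have "- ((1 - a) * (1 + y) powr (- a)) / (a - 1) = (1 + y) powr (- a)"
        using assms by (simp add: minus_divide_left flip: mult_minus_left)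
      ultimately show ?thesis by simp
    qed
  qed auto
  finally show ?thesis
    using assms by (subst nn_integral_even) (auto simp: ennreal_mult' mult_2 simp flip: ennreal_plus)
qed

lemma integrable_power_decay:
  assumes "a > (1::real)"
  shows "integrable lborel (\<lambda>y::real. (1 + \<bar>y\<bar>) powr (- a))"
  by (rule integrableI_nonneg) (use nn_integral_power_decay[OF assms] in auto)

lemma integrable_of_decay:
  fixes f :: "real \<Rightarrow> complex"
  assumes "f \<in> borel_measurable borel" "a > 1" "\<And>y. cmod (f y) \<le> D * (1 + \<bar>y\<bar>) powr (- a)"
  shows "integrable lborel f"
  by (rule Bochner_Integration.integrable_bound[OF integrable_mult_right[OF integrable_power_decay[OF assms(2)], of D]])
     (use assms in \<open>auto intro: order_trans[OF _ abs_ge_self]\<close>)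

lemma nn_integral_poisson0: "(\<integral>\<^sup>+y. ennreal (1 / (1 + y\<^sup>2)) \<partial>lborel) = ennreal pi"
proof -
  have "(\<integral>\<^sup>+y. ennreal (1 / (1 + y\<^sup>2)) * indicator {0..} y \<partial>lborel) = ennreal (pi / 2 - arctan 0)"
  proof (rule nn_integral_FTC_atLeast)
    show "(arctan \<longlongrightarrow> pi / 2) at_top" by (rule tendsto_arctan_at_top)
    show "DERIV arctan x :> 1 / (1 + x\<^sup>2)" for x :: real
      using DERIV_arctan[of x] by (simp add: inverse_eq_divide)
  qed (auto intro: add_nonneg_nonneg)
  then show ?thesis
    by (subst nn_integral_even) (auto simp: mult_2 simp flip: ennreal_plus)
qed

lemma poisson_integral:
  assumes "x > (0::real)"
  shows "(\<integral>\<^sup>+y. ennreal (x / (x\<^sup>2 + (y - u)\<^sup>2)) \<partial>lborel) = ennreal pi"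
    and "integrable lborel (\<lambda>y. x / (x\<^sup>2 + (y - u)\<^sup>2))"
    and "(\<integral>y. x / (x\<^sup>2 + (y - u)\<^sup>2) \<partial>lborel) = pi"
proof -
  have "(\<integral>\<^sup>+y. ennreal (x / (x\<^sup>2 + (y - u)\<^sup>2)) \<partial>lborel)
     = ennreal \<bar>x\<bar> * (\<integral>\<^sup>+y. ennreal (x / (x\<^sup>2 + (u + x * y - u)\<^sup>2)) \<partial>lborel)"
    by (rule nn_integral_real_affine) (use assms in auto)
  also have "\<dots> = (\<integral>\<^sup>+y. ennreal (\<bar>x\<bar> * (x / (x\<^sup>2 + (x * y)\<^sup>2))) \<partial>lborel)"
    by (subst nn_integral_cmult[symmetric]) (simp_all only: ennreal_mult'[OF abs_ge_zero] add_diff_cancel_left' measurable_lborel1, measurable)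
  also have "(\<lambda>y. \<bar>x\<bar> * (x / (x\<^sup>2 + (x * y)\<^sup>2))) = (\<lambda>y. 1 / (1 + y\<^sup>2))"
  proof
    fix y
    have "x\<^sup>2 + (x * y)\<^sup>2 = x * x * (1 + y\<^sup>2)" by (simp add: power2_eq_square algebra_simps)
    then show "\<bar>x\<bar> * (x / (x\<^sup>2 + (x * y)\<^sup>2)) = 1 / (1 + y\<^sup>2)" using assms by simp
  qed
  finally show N: "(\<integral>\<^sup>+y. ennreal (x / (x\<^sup>2 + (y - u)\<^sup>2)) \<partial>lborel) = ennreal pi"
    by (simp add: nn_integral_poisson0)
  have nn: "0 \<le> x / (x\<^sup>2 + (y - u)\<^sup>2)" for y using assms by auto
  show i: "integrable lborel (\<lambda>y. x / (x\<^sup>2 + (y - u)\<^sup>2))"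
    by (rule integrableI_nonneg) (use N nn in auto)
  show "(\<integral>y. x / (x\<^sup>2 + (y - u)\<^sup>2) \<partial>lborel) = pi"
    using nn_integral_eq_integral[OF i] N nn by simp
qed

text \<open>The functions to which Cauchy's theorem on the half-plane \<open>Re z > 0\<close> applies: holomorphic across the
boundary line, with a power rate of decay inside. Decay is asked for on the closed half-plane only,
because the strip \<open>- d < Re z < 0\<close> merely makes the boundary values smooth.\<close>

definition decaying :: "real \<Rightarrow> real \<Rightarrow> (complex \<Rightarrow> complex) \<Rightarrow> bool" where
  "decaying d a F \<longleftrightarrow> F holomorphic_on {z. Re z > - d} \<and>
     (\<exists>D\<ge>0. \<forall>z. 0 \<le> Re z \<longrightarrow> cmod (F z) \<le> D * (1 + cmod z) powr (- a))"

lemma open_rhp: "open {z::complex. Re z > c}" and convex_rhp: "convex {z::complex. Re z > c}"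
  by (simp_all add: open_halfspace_Re_gt convex_halfspace_Re_gt)

lemma Complex_measurable [measurable]: "(\<lambda>y. Complex x y) \<in> borel_measurable borel" "(\<lambda>x. Complex x y) \<in> borel_measurable borel"
  unfolding Complex_eq by measurable

lemma decaying_continuous:
  assumes "decaying d a F" "x > - d"
  shows "continuous_on UNIV (\<lambda>y. F (Complex x y))"
  by (rule continuous_on_compose2[OF holomorphic_on_imp_continuous_on])
     (use assms in \<open>auto simp: decaying_def Complex_eq intro!: continuous_intros\<close>)

lemma decaying_measurable:
  assumes "decaying d a F" "x > - d"
  shows "(\<lambda>y. F (Complex x y)) \<in> borel_measurable borel"
  using decaying_continuous[OF assms] by (rule borel_measurable_continuous_onI)

lemma cmod_Complex_ge: "\<bar>y\<bar> \<le> cmod (Complex x y)" "\<bar>x\<bar> \<le> cmod (Complex x y)"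
  using abs_Im_le_cmod[of "Complex x y"] abs_Re_le_cmod[of "Complex x y"] by auto

lemma decaying_bound:
  assumes "decaying d a F" "a \<ge> 0"
  obtains D where "D \<ge> 0" "\<And>x y. 0 \<le> x \<Longrightarrow> cmod (F (Complex x y)) \<le> D * (1 + \<bar>y\<bar>) powr (- a)"
proof -
  obtain D where D: "D \<ge> 0" "\<And>z. 0 \<le> Re z \<Longrightarrow> cmod (F z) \<le> D * (1 + cmod z) powr (- a)"
    using assms by (auto simp: decaying_def)
  show ?thesis
  proof (rule that[OF D(1)])
    fix x y :: real assume "0 \<le> x"
    then have "cmod (F (Complex x y)) \<le> D * (1 + cmod (Complex x y)) powr (- a)" by (intro D(2)) simp
    also have "\<dots> \<le> D * (1 + \<bar>y\<bar>) powr (- a)"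
      using D(1) assms(2) cmod_Complex_ge by (intro mult_left_mono powr_mono2') auto
    finally show "cmod (F (Complex x y)) \<le> D * (1 + \<bar>y\<bar>) powr (- a)" .
  qed
qed

lemma decaying_mult:
  assumes "decaying d a F" "decaying d b G"
  shows "decaying d (a + b) (\<lambda>z. F z * G z)"
proof -
  obtain D where D: "D \<ge> 0" "\<And>z. 0 \<le> Re z \<Longrightarrow> cmod (F z) \<le> D * (1 + cmod z) powr (- a)"
    using assms by (auto simp: decaying_def)
  obtain E where E: "E \<ge> 0" "\<And>z. 0 \<le> Re z \<Longrightarrow> cmod (G z) \<le> E * (1 + cmod z) powr (- b)"
    using assms by (auto simp: decaying_def)
  have "cmod (F z * G z) \<le> (D * E) * (1 + cmod z) powr (- (a + b))" if "0 \<le> Re z" for z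
  proof -
    have "cmod (F z * G z) \<le> (D * (1 + cmod z) powr (- a)) * (E * (1 + cmod z) powr (- b))"
      unfolding norm_mult using D E that by (intro mult_mono) auto
    also have "\<dots> = (D * E) * ((1 + cmod z) powr (- a) * (1 + cmod z) powr (- b))" by (simp add: ac_simps)
    also have "(1 + cmod z) powr (- a) * (1 + cmod z) powr (- b) = (1 + cmod z) powr (- (a + b))"
      by (subst powr_add[symmetric]) simp
    finally show ?thesis .
  qed
  then show ?thesis using assms D E unfolding decaying_def
    by (auto intro!: holomorphic_intros exI[of _ "D * E"])
qed

text \<open>Cauchy's theorem for the rectangle with vertices \<open>\<plusminus> i R\<close> and \<open>R \<plusminus> i R\<close>, in the form of a primitive \<open>G\<close>: the
increment of \<open>G\<close> along the boundary line is also its increment along the other three sides, whose length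
is \<open>4 R\<close> and on which \<open>F\<close> is of size \<open>R powr (- a)\<close>.\<close>

theorem halfplane_integral_zero:
  assumes F: "decaying d a F" and "d > 0" "a > 1"
  shows "integrable lborel (\<lambda>y. F (Complex 0 y))" "(\<integral>y. F (Complex 0 y) \<partial>lborel) = 0"
proof -
  obtain D where D: "D \<ge> 0" "\<And>z. 0 \<le> Re z \<Longrightarrow> cmod (F z) \<le> D * (1 + cmod z) powr (- a)"
    using F by (auto simp: decaying_def)
  have "a \<ge> 0" using \<open>a > 1\<close> by simp
  from decaying_bound[OF F this]
  obtain D' where D': "D' \<ge> 0" "\<And>x y. 0 \<le> x \<Longrightarrow> cmod (F (Complex x y)) \<le> D' * (1 + \<bar>y\<bar>) powr (- a)"
    by blast
  show int: "integrable lborel (\<lambda>y. F (Complex 0 y))"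
    using D'(2)[of 0] assms(2,3) by (intro integrable_of_decay[of _ a D'] decaying_measurable[OF F]) auto
  let ?S = "{z. Re z > - d}"
  obtain G where G: "\<And>z. z \<in> ?S \<Longrightarrow> (G has_field_derivative F z) (at z within ?S)"
    using holomorphic_convex_primitive'[OF convex_rhp open_rhp] F by (auto simp: decaying_def)
  have G': "(G has_field_derivative F z) (at z within T)" if "Re z \<ge> 0" for z T
    using G[of z] that assms(2) by (simp add: at_within_open[OF _ open_rhp] has_field_derivative_at_within)
  have seg: "cmod (G u - G v) \<le> D * (1 + R) powr (- a) * cmod (u - v)"
    if "convex T" "\<And>z. z \<in> T \<Longrightarrow> Re z \<ge> 0 \<and> R \<le> cmod z" "u \<in> T" "v \<in> T" "R > 0" for T u v and R :: real
  proof (rule field_differentiable_bound[OF that(1)])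
    show "(G has_field_derivative F z) (at z within T)" if "z \<in> T" for z
      using G' \<open>z \<in> T\<close> \<open>\<And>z. z \<in> T \<Longrightarrow> Re z \<ge> 0 \<and> R \<le> cmod z\<close> by auto
    show "cmod (F z) \<le> D * (1 + R) powr (- a)" if "z \<in> T" for z
    proof -
      have "0 \<le> Re z" "R \<le> cmod z" using \<open>z \<in> T\<close> \<open>\<And>z. z \<in> T \<Longrightarrow> Re z \<ge> 0 \<and> R \<le> cmod z\<close> by auto
      then have "D * (1 + cmod z) powr (- a) \<le> D * (1 + R) powr (- a)"
        using D(1) \<open>a > 1\<close> \<open>R > 0\<close> by (intro mult_left_mono powr_mono2') auto
      then show ?thesis using D(2)[OF \<open>0 \<le> Re z\<close>] by linarith
    qed
  qed (use that in auto)
  have bound: "cmod (\<integral>y. indicator {-R..R} y *\<^sub>R F (Complex 0 y) \<partial>lborel) \<le> 4 * D * (1 + R) powr (1 - a)"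
    if "R > 0" for R :: real
  proof -
    have der: "((\<lambda>y. - \<i> * G (Complex 0 y)) has_vector_derivative F (Complex 0 y)) (at y within {-R..R})" for y
    proof -
      have "((\<lambda>y. G (\<i> * of_real y)) has_vector_derivative \<i> * F (\<i> * of_real y)) (at y within {-R..R})"
      proof -
        have A: "((\<lambda>y. \<i> * of_real y) has_vector_derivative \<i>) (at y within {-R..R})"
          by (auto intro!: derivative_eq_intros)
        have B: "(G has_field_derivative F (\<i> * of_real y)) (at (\<i> * of_real y) within (\<lambda>y. \<i> * of_real y) ` {-R..R})"
          by (rule G') simp
        show ?thesis using field_vector_diff_chain_within[OF A B] by (simp add: o_def)
      qed
      then have "((\<lambda>y. - \<i> * G (\<i> * of_real y)) has_vector_derivative - \<i> * (\<i> * F (\<i> * of_real y))) (at y within {-R..R})"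
        by (rule has_vector_derivative_mult_right)
      then show ?thesis by (simp add: Complex_eq)
    qed
    have "(\<integral>y. indicator {-R..R} y *\<^sub>R F (Complex 0 y) \<partial>lborel) = - \<i> * G (Complex 0 R) - - \<i> * G (Complex 0 (-R))"
      using that assms(2) by (intro integral_FTC_Icc der continuous_on_subset[OF decaying_continuous[OF F]]) auto
    also have "\<dots> = - \<i> * (G (Complex 0 R) - G (Complex 0 (-R)))" by (simp add: algebra_simps)
    also have "cmod \<dots> = cmod ((G (Complex 0 R) - G (Complex R R)) + (G (Complex R R) - G (Complex R (-R)))
       + (G (Complex R (-R)) - G (Complex 0 (-R))))" by (simp add: norm_mult)
    also have "\<dots> \<le> D * (1 + R) powr (- a) * R + D * (1 + R) powr (- a) * (2 * R) + D * (1 + R) powr (- a) * R"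
    proof (intro norm_triangle_mono)
      have cv: "convex {z. Im z = c \<and> 0 \<le> Re z}" "convex {z. Re z = c}" for c
        by (auto intro!: convexI simp flip: distrib_right)
      have nb: "Im z = - R \<Longrightarrow> R \<le> cmod z" "Im z \<le> cmod z" "Re z \<le> cmod z" for z
        using abs_Im_le_cmod[of z] abs_Re_le_cmod[of z] by linarith+
      have c1: "Complex 0 R - Complex R R = of_real (- R)" "Complex R R - Complex R (- R) = \<i> * of_real (2 * R)"
        "Complex R (-R) - Complex 0 (-R) = of_real R" by (simp_all add: complex_eq_iff)
      show "cmod (G (Complex 0 R) - G (Complex R R)) \<le> D * (1 + R) powr (- a) * R"
      proof -
        have "cmod (G (Complex 0 R) - G (Complex R R)) \<le> D * (1 + R) powr (- a) * cmod (Complex 0 R - Complex R R)"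
          by (rule seg[OF cv(1)[of R]]) (use that in \<open>auto intro: nb\<close>)
        then show ?thesis unfolding c1 norm_of_real using that by simp
      qed
      show "cmod (G (Complex R R) - G (Complex R (-R))) \<le> D * (1 + R) powr (- a) * (2 * R)"
      proof -
        have "cmod (G (Complex R R) - G (Complex R (-R))) \<le> D * (1 + R) powr (- a) * cmod (Complex R R - Complex R (-R))"
          by (rule seg[OF cv(2)[of R]]) (use that in \<open>auto intro: nb\<close>)
        then show ?thesis unfolding c1 norm_of_real norm_mult using that by simp
      qed
      show "cmod (G (Complex R (-R)) - G (Complex 0 (-R))) \<le> D * (1 + R) powr (- a) * R"
      proof -
        have "cmod (G (Complex R (-R)) - G (Complex 0 (-R))) \<le> D * (1 + R) powr (- a) * cmod (Complex R (-R) - Complex 0 (-R))"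
          by (rule seg[OF cv(1)[of "-R"]]) (use that in \<open>auto intro: nb\<close>)
        then show ?thesis unfolding c1 norm_of_real using that by simp
      qed
    qed
    also have "\<dots> = 4 * D * (R * (1 + R) powr (- a))" by (simp add: algebra_simps)
    also have "\<dots> \<le> 4 * D * ((1 + R) * (1 + R) powr (- a))"
      using D(1) by (intro mult_left_mono mult_right_mono) auto
    also have "(1 + R) * (1 + R) powr (- a) = (1 + R) powr (1 - a)"
      using that by (simp add: powr_mult_base)
    finally show ?thesis .
  qed
  have "((\<lambda>R. 4 * D * (1 + R) powr (1 - a)) \<longlongrightarrow> 4 * D * 0) at_top"
    using \<open>a > 1\<close> by (intro tendsto_intros tendsto_neg_powr filterlim_tendsto_add_at_top[OF tendsto_const filterlim_ident]) auto
  then have lim1: "((\<lambda>R. 4 * D * (1 + R) powr (1 - a)) \<longlongrightarrow> 0) at_top" by simp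
  have lim0: "((\<lambda>R. \<integral>y. indicator {-R..R} y *\<^sub>R F (Complex 0 y) \<partial>lborel) \<longlongrightarrow> 0) at_top"
  proof (rule Lim_null_comparison[OF _ lim1])
    show "\<forall>\<^sub>F R in at_top. cmod (\<integral>y. indicator {-R..R} y *\<^sub>R F (Complex 0 y) \<partial>lborel) \<le> 4 * D * (1 + R) powr (1 - a)"
      using eventually_gt_at_top[of 0] by eventually_elim (rule bound)
  qed
  have "((\<lambda>R. \<integral>y. indicator {-R..R} y *\<^sub>R F (Complex 0 y) \<partial>lborel) \<longlongrightarrow> (\<integral>y. F (Complex 0 y) \<partial>lborel)) at_top"
  proof (rule integral_dominated_convergence_at_top[where w = "\<lambda>y. cmod (F (Complex 0 y))"])
    show "AE y in lborel. ((\<lambda>R. indicator {-R..R} y *\<^sub>R F (Complex 0 y)) \<longlongrightarrow> F (Complex 0 y)) at_top"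
    proof (intro AE_I2 tendsto_eventually)
      fix y show "\<forall>\<^sub>F R in at_top. indicator {-R..R} y *\<^sub>R F (Complex 0 y) = F (Complex 0 y)"
        by (rule eventually_mono[OF eventually_ge_at_top[of "\<bar>y\<bar>"]]) (auto simp: indicator_def)
    qed
    have m: "(\<lambda>y. F (Complex 0 y)) \<in> borel_measurable lborel"
      using decaying_measurable[OF F, of 0] \<open>d > 0\<close> by simp
    then show "(\<lambda>y. F (Complex 0 y)) \<in> borel_measurable lborel" .
    show "(\<lambda>y. indicator {-R..R} y *\<^sub>R F (Complex 0 y)) \<in> borel_measurable lborel" for R :: real
      by (intro borel_measurable_scaleR m) simp
    show "integrable lborel (\<lambda>y. cmod (F (Complex 0 y)))" using int by (rule integrable_norm)
    show "\<forall>\<^sub>F R in at_top. AE y in lborel. cmod (indicator {-R..R} y *\<^sub>R F (Complex 0 y)) \<le> cmod (F (Complex 0 y))"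
      by (intro always_eventually allI AE_I2) (simp add: indicator_def)
  qed
  then show "(\<integral>y. F (Complex 0 y) \<partial>lborel) = 0"
    by (rule tendsto_unique[OF trivial_limit_at_top_linorder _ lim0])
qed

lemma inverse_le_of_mult_le:
  fixes x s t K :: real
  assumes "x > 0" "s > 0" "t > 0" "x * s \<le> K * t"
  shows "inverse t \<le> K / x * inverse s"
  using assms by (simp add: field_simps)

text \<open>Near \<open>w\<close> the distance is at least \<open>x\<close>, and far away it is comparable to \<open>cmod z\<close>.\<close>

lemma distance_lower_bound:
  assumes "0 < x" "x \<le> cmod (w - z)"
  shows "inverse (cmod (w - z)) \<le> (1 + x + cmod w) / x * (1 + cmod z) powr (- 1)"
proof -
  have "cmod z \<le> cmod (w - z) + cmod w" by (metis norm_minus_commute norm_triangle_sub add.commute)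
  then have "x * (1 + cmod z) \<le> x + x * cmod (w - z) + x * cmod w"
    using assms by (simp add: algebra_simps) (metis assms(1) mult_le_cancel_left_pos distrib_left)
  also have "\<dots> \<le> (1 + x + cmod w) * cmod (w - z)"
    using assms mult_right_mono[OF assms(2), of "cmod w"] by (simp add: algebra_simps)
  finally have "x * (1 + cmod z) \<le> (1 + x + cmod w) * cmod (w - z)" .
  moreover have "1 + cmod z > 0" by (simp add: add_pos_nonneg)
  ultimately have "inverse (cmod (w - z)) \<le> (1 + x + cmod w) / x * inverse (1 + cmod z)"
    using assms by (intro inverse_le_of_mult_le) auto
  then show ?thesis using \<open>1 + cmod z > 0\<close> by (simp add: powr_minus)
qed

text \<open>The kernel is itself decaying on the half-plane when its pole lies outside.\<close>

lemma halfplane_Cauchy_outside: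
  assumes F: "decaying d a F" and "d > 0" "a > 0" "Re w < 0"
  shows "integrable lborel (\<lambda>y. F (Complex 0 y) / (w - Complex 0 y))"
        "(\<integral>y. F (Complex 0 y) / (w - Complex 0 y) \<partial>lborel) = 0"
proof -
  let ?d = "min d (- Re w)"
  have F': "decaying ?d a F" using F unfolding decaying_def by (auto elim: holomorphic_on_subset)
  have K: "decaying ?d 1 (\<lambda>z. inverse (w - z))"
  proof -
    have "cmod (inverse (w - z)) \<le> (1 + (- Re w) + cmod w) / (- Re w) * (1 + cmod z) powr (- 1)" if "0 \<le> Re z" for z
    proof -
      have "- Re w \<le> \<bar>Re (w - z)\<bar>" using that by auto
      also have "\<dots> \<le> cmod (w - z)" by (rule abs_Re_le_cmod)
      finally show ?thesis
        using distance_lower_bound[of "- Re w" w z] assms by (auto simp: norm_inverse)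
    qed
    moreover have "0 \<le> (1 + (- Re w) + cmod w) / (- Re w)"
      by (intro divide_nonneg_pos add_nonneg_nonneg) (use assms in auto)
    moreover have "(\<lambda>z. inverse (w - z)) holomorphic_on {z. Re z > - ?d}"
      by (auto intro!: holomorphic_intros)
    ultimately show ?thesis unfolding decaying_def by blast
  qed
  have "decaying ?d (a + 1) (\<lambda>z. F z * inverse (w - z))" by (rule decaying_mult[OF F' K])
  from halfplane_integral_zero[OF this] assms
  show "integrable lborel (\<lambda>y. F (Complex 0 y) / (w - Complex 0 y))"
        "(\<integral>y. F (Complex 0 y) / (w - Complex 0 y) \<partial>lborel) = 0"
    by (simp_all add: divide_inverse)
qed

text \<open>For a pole inside, subtract from \<open>F\<close> the multiple of \<open>1 / (z + cnj w)\<close> that agrees with \<open>F\<close> at \<open>w\<close>. The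
difference divided by \<open>z - w\<close> is decaying and integrates to zero, and on the boundary line the product of
the two kernels is a Poisson kernel, of integral \<open>pi\<close>.\<close>

theorem halfplane_Cauchy_formula:
  fixes F :: "complex \<Rightarrow> complex"
  assumes F: "decaying d a F" and d: "d > 0" and a: "a > 0" and w: "Re w > 0"
  shows "integrable lborel (\<lambda>y. F (Complex 0 y) / (w - Complex 0 y))"
        "(\<integral>y. F (Complex 0 y) / (w - Complex 0 y) \<partial>lborel) = 2 * pi * F w"
proof -
  define x where "x = Re w"
  have x: "x > 0" using w by (simp add: x_def)
  define d' where "d' = min d x"
  have d': "d' > 0" "d' \<le> x" "d' \<le> d" using d x by (auto simp: d'_def)
  define a' where "a' = min a 1"
  have a': "a' > 0" "a' \<le> a" "a' \<le> 1" using a by (auto simp: a'_def)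
  \<comment> \<open>the pole of this function is the mirror image of w, so it is holomorphic in the half-plane\<close>
  define k where "k = (\<lambda>z. F w * (2 * of_real x) / (z + cnj w))"
  define P where "P = (\<lambda>z. F z - k z)"
  \<comment> \<open>the removable singularity at w is filled in\<close>
  define Q where "Q = (\<lambda>z. if z = w then deriv P w else P z / (z - w))"
  have ww: "w + cnj w = of_real (2 * x)" by (simp add: x_def complex_eq_iff)
  have Pw: "P w = 0" using x ww by (simp add: P_def k_def)
  have holF: "F holomorphic_on {z. Re z > - d'}"
    using F d' unfolding decaying_def by (auto elim: holomorphic_on_subset)
  have ne: "z + cnj w \<noteq> 0" if "Re z > - d'" for z
  proof
    assume "z + cnj w = 0"
    then have "Re z + x = 0" by (metis Re_complex_div_eq_0 add.commute cnj.simps(1) plus_complex.simps(1) x_def zero_complex.simps(1))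
    then show False using that d' by auto
  qed
  have holk: "k holomorphic_on {z. Re z > - d'}"
    unfolding k_def using ne by (auto intro!: holomorphic_intros)
  have holP: "P holomorphic_on {z. Re z > - d'}" unfolding P_def by (intro holomorphic_intros holF holk)
  have holQ: "Q holomorphic_on {z. Re z > - d'}"
  proof -
    have "(\<lambda>z. if z = w then deriv P w else P z / (z - w) - P w / (z - w)) holomorphic_on {z. Re z > - d'}"
      by (rule pole_theorem_open[OF holP open_rhp]) auto
    then show ?thesis by (simp add: Pw Q_def cong: if_cong)
  qed
  obtain D where D: "D \<ge> 0" "\<And>z. 0 \<le> Re z \<Longrightarrow> cmod (F z) \<le> D * (1 + cmod z) powr (- a)"
    using F by (auto simp: decaying_def)
  have pw: "(1 + cmod z) powr (- b) \<le> (1 + cmod z) powr (- a')" if "a' \<le> b" for b z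
    using that by (intro powr_mono) auto
  define E where "E = cmod (F w * (2 * of_real x)) * ((1 + x + cmod w) / x)"
  have E: "E \<ge> 0" using x by (auto simp: E_def intro!: mult_nonneg_nonneg divide_nonneg_pos add_nonneg_nonneg)
  have kb: "cmod (k z) \<le> E * (1 + cmod z) powr (- 1)" if "0 \<le> Re z" for z
  proof -
    have "x \<le> \<bar>Re (- cnj w - z)\<bar>" using that x by (auto simp: x_def)
    also have "\<dots> \<le> cmod (- cnj w - z)" by (rule abs_Re_le_cmod)
    finally have "inverse (cmod (- cnj w - z)) \<le> (1 + x + cmod (- cnj w)) / x * (1 + cmod z) powr (- 1)"
      by (rule distance_lower_bound[OF x])
    moreover have "cmod (- cnj w - z) = cmod (z + cnj w)"
      by (metis add.commute minus_add_distrib norm_minus_cancel uminus_add_conv_diff diff_conv_add_uminus)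
    ultimately have "inverse (cmod (z + cnj w)) \<le> (1 + x + cmod w) / x * (1 + cmod z) powr (- 1)" by simp
    then have "cmod (F w * (2 * of_real x)) * inverse (cmod (z + cnj w)) \<le> cmod (F w * (2 * of_real x)) * ((1 + x + cmod w) / x * (1 + cmod z) powr (- 1))"
      by (intro mult_left_mono) auto
    moreover have "cmod (k z) = cmod (F w * (2 * of_real x)) * inverse (cmod (z + cnj w))"
      unfolding k_def by (subst norm_divide) (rule divide_inverse)
    moreover have "E * (1 + cmod z) powr (- 1) = cmod (F w * (2 * of_real x)) * ((1 + x + cmod w) / x * (1 + cmod z) powr (- 1))"
      by (simp only: E_def mult.assoc)
    ultimately show ?thesis by linarith
  qed
  have Pb: "cmod (P z) \<le> (D + E) * (1 + cmod z) powr (- a')" if "0 \<le> Re z" for z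
  proof -
    have "cmod (P z) \<le> D * (1 + cmod z) powr (- a) + E * (1 + cmod z) powr (- 1)"
      unfolding P_def using D(2)[OF that] kb[OF that] norm_triangle_ineq4[of "F z" "k z"] by linarith
    also have "\<dots> \<le> D * (1 + cmod z) powr (- a') + E * (1 + cmod z) powr (- a')"
      using D(1) E a' by (intro add_mono mult_left_mono pw) auto
    finally show ?thesis by (simp add: distrib_right)
  qed
  have "cball w (x / 2) \<subseteq> {z. Re z > - d'}"
  proof
    fix z assume "z \<in> cball w (x / 2)"
    then have "cmod (w - z) \<le> x / 2" by (simp add: dist_norm)
    then have "\<bar>Re (w - z)\<bar> \<le> x / 2" using abs_Re_le_cmod[of "w - z"] by linarith
    then have "Re w - Re z \<le> x / 2" using abs_ge_self[of "Re (w - z)"] by simp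
    then have "Re z \<ge> x / 2" by (simp add: x_def)
    then show "z \<in> {z. Re z > - d'}" using x d' by auto
  qed
  then have "compact (Q ` cball w (x / 2))"
    by (intro compact_continuous_image holomorphic_on_imp_continuous_on holomorphic_on_subset[OF holQ]) auto
  then obtain B where B: "\<And>z. z \<in> cball w (x / 2) \<Longrightarrow> cmod (Q z) \<le> B"
    by (meson bounded_iff compact_imp_bounded imageI)
  have "cmod (Q w) \<le> B" by (rule B) (use x in simp)
  then have B0: "B \<ge> 0" using norm_ge_zero[of "Q w"] by linarith
  define C1 where "C1 = B * (1 + cmod w + x) powr (a' + 1)"
  define C2 where "C2 = (D + E) * ((1 + x / 2 + cmod w) / (x / 2))"
  have C: "C1 \<ge> 0" "C2 \<ge> 0" using B0 D(1) E x by (auto simp: C1_def C2_def intro!: mult_nonneg_nonneg divide_nonneg_pos add_nonneg_nonneg)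
  have Qb: "cmod (Q z) \<le> (C1 + C2) * (1 + cmod z) powr (- (a' + 1))" if z: "0 \<le> Re z" for z
  proof (cases "z \<in> cball w (x / 2)")
    case True
    have "cmod z \<le> cmod w + x"
      using True x norm_triangle_sub[of z w] by (simp add: dist_norm norm_minus_commute)
    then have "(1 + cmod z) powr (a' + 1) \<le> (1 + cmod w + x) powr (a' + 1)" using a' by (intro powr_mono2) auto
    then have "B * (1 + cmod z) powr (a' + 1) \<le> C1" using B0 by (auto simp: C1_def intro: mult_left_mono)
    then have "B \<le> C1 * (1 + cmod z) powr (- (a' + 1))"
      unfolding powr_minus divide_inverse[symmetric] by (subst pos_le_divide_eq) (auto simp: add_nonneg_eq_0_iff)
    also have "\<dots> \<le> (C1 + C2) * (1 + cmod z) powr (- (a' + 1))" using C by (intro mult_right_mono) auto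
    finally show ?thesis using B[OF True] by linarith
  next
    case False
    then have zw: "z \<noteq> w" "x / 2 \<le> cmod (w - z)" using x by (auto simp: dist_norm)
    have "Q z = P z / (z - w)" using zw(1) by (simp add: Q_def)
    then have "cmod (Q z) = cmod (P z) / cmod (w - z)" by (simp add: norm_divide norm_minus_commute)
    also have "\<dots> = cmod (P z) * inverse (cmod (w - z))" by (rule divide_inverse)
    also have "\<dots> \<le> ((D + E) * (1 + cmod z) powr (- a')) * ((1 + x / 2 + cmod w) / (x / 2) * (1 + cmod z) powr (- 1))"
    proof (rule mult_mono)
      show "inverse (cmod (w - z)) \<le> (1 + x / 2 + cmod w) / (x / 2) * (1 + cmod z) powr (- 1)"
        by (rule distance_lower_bound) (use zw x in auto)
      show "0 \<le> (D + E) * (1 + cmod z) powr (- a')" using D(1) E by simp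
    qed (use Pb[OF z] in simp_all)
    also have "\<dots> = C2 * ((1 + cmod z) powr (- a') * (1 + cmod z) powr (- 1))" by (simp add: C2_def)
    also have "(1 + cmod z) powr (- a') * (1 + cmod z) powr (- 1) = (1 + cmod z) powr (- (a' + 1))"
      by (subst powr_add[symmetric]) simp
    also have "C2 * (1 + cmod z) powr (- (a' + 1)) \<le> (C1 + C2) * (1 + cmod z) powr (- (a' + 1))"
      using C by (intro mult_right_mono) auto
    finally show ?thesis .
  qed
  have "decaying d' (a' + 1) Q" unfolding decaying_def using holQ Qb C by (auto intro!: exI[of _ "C1 + C2"])
  from halfplane_integral_zero[OF this] d' a'
  have Q0: "integrable lborel (\<lambda>y. Q (Complex 0 y))" "(\<integral>y. Q (Complex 0 y) \<partial>lborel) = 0" by auto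
  have wy: "Complex 0 y \<noteq> w" for y using x by (auto simp: x_def)
  have key: "F (Complex 0 y) / (w - Complex 0 y) = - Q (Complex 0 y) + F w * of_real (2 * (x / (x\<^sup>2 + (y - Im w)\<^sup>2)))" for y
  proof -
    have "(Complex 0 y + cnj w) * (w - Complex 0 y) = of_real (x\<^sup>2 + (y - Im w)\<^sup>2)"
      by (simp add: complex_eq_iff x_def power2_eq_square algebra_simps)
    then have "k (Complex 0 y) / (w - Complex 0 y) = F w * (2 * of_real x) / of_real (x\<^sup>2 + (y - Im w)\<^sup>2)"
      by (simp add: k_def)
    also have "\<dots> = F w * of_real (2 * (x / (x\<^sup>2 + (y - Im w)\<^sup>2)))" by simp
    finally have "k (Complex 0 y) / (w - Complex 0 y) = F w * of_real (2 * (x / (x\<^sup>2 + (y - Im w)\<^sup>2)))" .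
    moreover have "- Q (Complex 0 y) = (F (Complex 0 y) - k (Complex 0 y)) / (w - Complex 0 y)"
      using wy[of y] by (simp add: Q_def P_def divide_simps) (simp add: algebra_simps)
    ultimately show ?thesis by (simp add: diff_divide_distrib)
  qed
  note p = poisson_integral[OF x, of "Im w"]
  have pc: "integrable lborel (\<lambda>y. F w * of_real (2 * (x / (x\<^sup>2 + (y - Im w)\<^sup>2))))"
    by (intro integrable_mult_right integrable_of_real p(2))
  show "integrable lborel (\<lambda>y. F (Complex 0 y) / (w - Complex 0 y))"
    unfolding key by (intro Bochner_Integration.integrable_add integrable_minus Q0 pc)
  have "(\<integral>y. F (Complex 0 y) / (w - Complex 0 y) \<partial>lborel) = - (\<integral>y. Q (Complex 0 y) \<partial>lborel)
      + (\<integral>y. F w * of_real (2 * (x / (x\<^sup>2 + (y - Im w)\<^sup>2))) \<partial>lborel)"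
    unfolding key by (subst Bochner_Integration.integral_add) (use Q0 pc in auto)
  also have "(\<integral>y. F w * of_real (2 * (x / (x\<^sup>2 + (y - Im w)\<^sup>2))) \<partial>lborel) = F w * of_real (\<integral>y. 2 * (x / (x\<^sup>2 + (y - Im w)\<^sup>2)) \<partial>lborel)"
    by (simp only: integral_mult_right_zero integral_complex_of_real)
  also have "(\<integral>y. 2 * (x / (x\<^sup>2 + (y - Im w)\<^sup>2)) \<partial>lborel) = 2 * pi" by (simp only: integral_mult_right_zero p(3))
  finally show "(\<integral>y. F (Complex 0 y) / (w - Complex 0 y) \<partial>lborel) = 2 * pi * F w"
    by (simp add: Q0)
qed

section \<open>The Cauchy transform of a line\<close>

text \<open>Differentiation under the integral sign; the curve and the measure are arbitrary, so that the lemma serves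
both straight lines and half-strip boundaries.\<close>

lemma Cauchy_kernel_derivative:
  fixes f \<gamma> :: "'a \<Rightarrow> complex"
  assumes [measurable]: "f \<in> borel_measurable M" "\<gamma> \<in> borel_measurable M"
    and d: "d > 0" "\<And>x. x \<in> space M \<Longrightarrow> d \<le> cmod (\<gamma> x - w)"
    and int: "integrable M (\<lambda>x. f x / (\<gamma> x - w))"
  shows "((\<lambda>w. \<integral>x. f x / (\<gamma> x - w) \<partial>M) has_field_derivative (\<integral>x. f x / (\<gamma> x - w)\<^sup>2 \<partial>M)) (at w)"
proof -
  let ?I = "\<lambda>w. \<integral>x. f x / (\<gamma> x - w) \<partial>M"
  let ?J = "\<integral>x. cmod (f x / (\<gamma> x - w)) \<partial>M"
  have nz: "\<gamma> x - w \<noteq> 0" if "x \<in> space M" for x using d(1) d(2)[OF that] by auto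
  have int2: "integrable M (\<lambda>x. f x / (\<gamma> x - w)\<^sup>2)"
  proof (rule Bochner_Integration.integrable_bound[OF integrable_mult_right[OF integrable_norm[OF int], of "1 / d"]])
    show "AE x in M. norm (f x / (\<gamma> x - w)\<^sup>2) \<le> norm (1 / d * norm (f x / (\<gamma> x - w)))"
    proof (rule AE_I2)
      fix x assume x: "x \<in> space M"
      have "inverse (cmod (\<gamma> x - w)) \<le> inverse d" using d(1) d(2)[OF x] by (rule le_imp_inverse_le[rotated])
      then have "cmod (f x / (\<gamma> x - w)) * inverse (cmod (\<gamma> x - w)) \<le> cmod (f x / (\<gamma> x - w)) * inverse d"
        by (intro mult_left_mono) auto
      then show "norm (f x / (\<gamma> x - w)\<^sup>2) \<le> norm (1 / d * norm (f x / (\<gamma> x - w)))"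
        using d(1) by (simp add: norm_divide norm_mult norm_inverse power2_eq_square divide_inverse mult_ac)
    qed
  qed measurable
  have est: "cmod ((?I (w + h) - ?I w) / h - (\<integral>x. f x / (\<gamma> x - w)\<^sup>2 \<partial>M)) \<le> cmod h * (2 / d\<^sup>2 * ?J)"
    if h: "h \<noteq> 0" "cmod h < d / 2" for h
  proof -
    have far: "d / 2 \<le> cmod (\<gamma> x - (w + h))" if "x \<in> space M" for x
      using d(2)[OF that] h(2) norm_triangle_ineq2[of "\<gamma> x - w" h] by (simp add: algebra_simps)
    have nz': "\<gamma> x - (w + h) \<noteq> 0" if "x \<in> space M" for x using far[OF that] d(1) by auto
    have inv: "inverse (cmod (\<gamma> x - (w + h))) \<le> 2 / d" if "x \<in> space M" for x
      using le_imp_inverse_le[OF far[OF that]] d(1) by (simp add: inverse_eq_divide)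
    have id: "f x / (\<gamma> x - (w + h)) = f x / (\<gamma> x - w) + h * (f x / (\<gamma> x - w)\<^sup>2) + h\<^sup>2 * (f x / ((\<gamma> x - w)\<^sup>2 * (\<gamma> x - (w + h))))"
      if "x \<in> space M" for x
      using nz[OF that] nz'[OF that] by (simp add: divide_simps) (simp add: algebra_simps power2_eq_square)
    have rb: "cmod (f x / ((\<gamma> x - w)\<^sup>2 * (\<gamma> x - (w + h)))) \<le> 2 / d\<^sup>2 * cmod (f x / (\<gamma> x - w))" if x: "x \<in> space M" for x
    proof -
      have "inverse (cmod (\<gamma> x - w)) \<le> 1 / d" using le_imp_inverse_le[OF d(2)[OF x] d(1)] by (simp add: inverse_eq_divide)
      then have "inverse (cmod (\<gamma> x - w)) * inverse (cmod (\<gamma> x - (w + h))) \<le> 1 / d * (2 / d)"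
        using inv[OF x] d(1) by (intro mult_mono) auto
      then have "cmod (f x / (\<gamma> x - w)) * (inverse (cmod (\<gamma> x - w)) * inverse (cmod (\<gamma> x - (w + h)))) \<le> cmod (f x / (\<gamma> x - w)) * (1 / d * (2 / d))"
        by (intro mult_left_mono) auto
      then show ?thesis
        by (simp add: norm_divide norm_mult norm_power norm_inverse power2_eq_square divide_inverse mult_ac)
    qed
    have intR: "integrable M (\<lambda>x. f x / ((\<gamma> x - w)\<^sup>2 * (\<gamma> x - (w + h))))"
      by (rule Bochner_Integration.integrable_bound[OF integrable_mult_right[OF integrable_norm[OF int], of "2 / d\<^sup>2"]])
         (use rb d(1) in \<open>auto intro!: AE_I2\<close>)
    have "?I (w + h) = (\<integral>x. f x / (\<gamma> x - w) + h * (f x / (\<gamma> x - w)\<^sup>2) + h\<^sup>2 * (f x / ((\<gamma> x - w)\<^sup>2 * (\<gamma> x - (w + h)))) \<partial>M)"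
      by (intro Bochner_Integration.integral_cong refl id)
    also have "\<dots> = ?I w + h * (\<integral>x. f x / (\<gamma> x - w)\<^sup>2 \<partial>M) + h\<^sup>2 * (\<integral>x. f x / ((\<gamma> x - w)\<^sup>2 * (\<gamma> x - (w + h))) \<partial>M)"
      using int int2 intR by (simp del: times_divide_eq_right)
    finally have "(?I (w + h) - ?I w) / h - (\<integral>x. f x / (\<gamma> x - w)\<^sup>2 \<partial>M) = h * (\<integral>x. f x / ((\<gamma> x - w)\<^sup>2 * (\<gamma> x - (w + h))) \<partial>M)"
      using h(1) by (simp add: field_simps power2_eq_square)
    also have "cmod \<dots> \<le> cmod h * (\<integral>x. 2 / d\<^sup>2 * cmod (f x / (\<gamma> x - w)) \<partial>M)"
      unfolding norm_mult using int intR rb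
      by (intro mult_left_mono order_trans[OF integral_norm_bound] integral_mono) auto
    finally show ?thesis by simp
  qed
  have "((\<lambda>h. (?I (w + h) - ?I w) / h) \<longlongrightarrow> (\<integral>x. f x / (\<gamma> x - w)\<^sup>2 \<partial>M)) (at 0)"
  proof (rule LIM_zero_cancel, rule Lim_null_comparison)
    have "((\<lambda>h. cmod h * (2 / d\<^sup>2 * ?J)) \<longlongrightarrow> cmod 0 * (2 / d\<^sup>2 * ?J)) (at 0)" by (intro tendsto_intros)
    then show "((\<lambda>h. cmod h * (2 / d\<^sup>2 * ?J)) \<longlongrightarrow> 0) (at (0::complex))" by simp
    show "\<forall>\<^sub>F h in at 0. cmod ((?I (w + h) - ?I w) / h - (\<integral>x. f x / (\<gamma> x - w)\<^sup>2 \<partial>M)) \<le> cmod h * (2 / d\<^sup>2 * ?J)"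
      unfolding eventually_at by (rule exI[of _ "d / 2"]) (use est d(1) in auto)
  qed
  then show ?thesis unfolding DERIV_def .
qed

text \<open>The test functions. On them every integral in sight converges absolutely.\<close>

definition nice :: "(real \<Rightarrow> complex) \<Rightarrow> bool" where
  "nice f \<longleftrightarrow> f \<in> borel_measurable borel \<and> (\<exists>M\<ge>0. \<forall>x. cmod (f x) \<le> M \<and> (M < \<bar>x\<bar> \<longrightarrow> f x = 0))"

text \<open>The Cauchy transform of a function on the imaginary axis, on both sides of it. With this factor a function
holomorphic on the right half-plane is the transform of its boundary values.\<close>

definition ctrans :: "(real \<Rightarrow> complex) \<Rightarrow> complex \<Rightarrow> complex" where
  "ctrans f w = complex_of_real (1 / (2 * pi)) * (\<integral>u. f u / (w - Complex 0 u) \<partial>lborel)"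

lemma nice_measurable [measurable_dest]: "nice f \<Longrightarrow> f \<in> borel_measurable borel"
  by (simp add: nice_def)

lemma nice_ex:
  assumes "nice f"
  shows "\<exists>M\<ge>0. (\<forall>x. cmod (f x) \<le> M) \<and> (\<forall>x. M < \<bar>x\<bar> \<longrightarrow> f x = 0)"
  using assms unfolding nice_def by blast

lemma niceI:
  assumes "f \<in> borel_measurable borel" "\<And>x. cmod (f x) \<le> B" "\<And>x. M < \<bar>x\<bar> \<Longrightarrow> f x = 0"
  shows "nice f"
  unfolding nice_def
proof (intro conjI exI[of _ "max 0 (max B M)"] allI impI)
  show "f x = 0" if "max 0 (max B M) < \<bar>x\<bar>" for x using assms(3) that by simp
  show "cmod (f x) \<le> max 0 (max B M)" for x using assms(2)[of x] by linarith
qed (use assms(1) in auto)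

lemma nice_integrable_powr:
  assumes "nice f" "p > 0"
  shows "integrable lborel (\<lambda>x. cmod (f x) powr p)"
proof -
  obtain M where M: "M \<ge> 0" "\<And>x. cmod (f x) \<le> M" "\<And>x. M < \<bar>x\<bar> \<Longrightarrow> f x = 0" using nice_ex[OF assms(1)] by auto
  note [measurable] = nice_measurable[OF assms(1)]
  have le: "norm (cmod (f x) powr p) \<le> norm (M powr p * indicator {-M..M} x)" for x
  proof (cases "M < \<bar>x\<bar>")
    case True then show ?thesis using M(3)[OF True] by simp
  next
    case False then show ?thesis using M assms(2) by (auto simp: indicator_def intro: powr_mono2)
  qed
  have i: "integrable lborel (\<lambda>x. M powr p * indicator {-M..M} x)"
    by (intro integrable_mult_right integrable_real_indicator) (auto simp: emeasure_lborel_Icc_eq)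
  show ?thesis
    by (rule Bochner_Integration.integrable_bound[OF i _ AE_I2]) (use le in simp_all)
qed

lemma nice_integrable: 
  assumes "nice f" shows "integrable lborel f"
  using nice_integrable_powr[OF assms, of 1] nice_measurable[OF assms] by (subst integrable_norm_iff[symmetric]) auto

lemma nice_Lp:
  assumes "nice f" "p > 0"
  shows "Lp_le p lborel f ((\<integral>x. cmod (f x) powr p \<partial>lborel) powr (1 / p))"
  using assms nice_integrable_powr[OF assms] nice_measurable[OF assms(1)]
  by (intro Lp_leI_integrable) (auto simp: powr_powr)

lemma nice_mult:
  assumes "nice f" "g \<in> borel_measurable borel" "\<And>x. cmod (g x) \<le> B"
  shows "nice (\<lambda>x. f x * g x)"
proof -
  obtain M where M: "M \<ge> 0" "\<And>x. cmod (f x) \<le> M" "\<And>x. M < \<bar>x\<bar> \<Longrightarrow> f x = 0" using nice_ex[OF assms(1)] by auto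
  note [measurable] = nice_measurable[OF assms(1)] assms(2)
  show ?thesis
  proof (rule niceI[of _ "M * B" M])
    show "cmod (f x * g x) \<le> M * B" for x
      unfolding norm_mult using M assms(3)[of x] by (intro mult_mono) auto
  qed (auto simp: M(3))
qed

lemma nice_cnj:
  assumes "nice f" shows "nice (\<lambda>x. cnj (f x))"
proof -
  obtain M where M: "M \<ge> 0" "\<And>x. cmod (f x) \<le> M" "\<And>x. M < \<bar>x\<bar> \<Longrightarrow> f x = 0" using nice_ex[OF assms(1)] by auto
  have "(\<lambda>x. cnj (f x)) \<in> borel_measurable borel"
    by (rule measurable_compose[OF nice_measurable[OF assms] borel_measurable_continuous_onI[OF continuous_on_cnj[OF continuous_on_id]]])
  then show ?thesis by (rule niceI[of _ M M]) (auto simp: M)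
qed

lemma nice_reflect:
  assumes "nice f" shows "nice (\<lambda>x. f (- x))"
proof -
  obtain M where M: "M \<ge> 0" "\<And>x. cmod (f x) \<le> M" "\<And>x. M < \<bar>x\<bar> \<Longrightarrow> f x = 0" using nice_ex[OF assms(1)] by auto
  note [measurable] = nice_measurable[OF assms(1)]
  show ?thesis by (rule niceI[of _ M M]) (auto simp: M)
qed

text \<open>Nice approximations dominated by the function itself.\<close>

definition trunc :: "nat \<Rightarrow> (real \<Rightarrow> complex) \<Rightarrow> real \<Rightarrow> complex" where
  "trunc n f x = (if \<bar>x\<bar> \<le> real n \<and> cmod (f x) \<le> real n then f x else 0)"

lemma nice_trunc: "f \<in> borel_measurable borel \<Longrightarrow> nice (trunc n f)"
  unfolding trunc_def by (rule niceI[of _ "real n" "real n"]) auto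

lemma trunc_tendsto: "(\<lambda>n. trunc n f x) \<longlonglongrightarrow> f x"
proof (rule tendsto_eventually)
  obtain N :: nat where "max \<bar>x\<bar> (cmod (f x)) \<le> real N" using real_arch_simple by blast
  then have "trunc n f x = f x" if "n \<ge> N" for n
    using that unfolding trunc_def by (auto simp: max_def split: if_splits intro: order_trans)
  then show "\<forall>\<^sub>F n in sequentially. trunc n f x = f x" unfolding eventually_sequentially by blast
qed

lemma cmod_trunc_le: "cmod (trunc n f x) \<le> cmod (f x)" by (simp add: trunc_def)

lemma kernel_measurable [measurable]: "(\<lambda>u. w - Complex 0 u) \<in> borel_measurable borel"
  by measurable

lemma kernel_bound: "\<bar>Re w\<bar> \<le> cmod (w - Complex 0 u)"
  using abs_Re_le_cmod[of "w - Complex 0 u"] by simp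

lemma integrable_kernel:
  assumes "integrable lborel f" "Re w \<noteq> 0"
  shows "integrable lborel (\<lambda>u. f u / (w - Complex 0 u))"
proof (rule Bochner_Integration.integrable_bound[OF integrable_mult_right[OF integrable_norm[OF assms(1)], of "1 / \<bar>Re w\<bar>"]])
  have [measurable]: "f \<in> borel_measurable borel" using assms(1) by simp
  show "(\<lambda>u. f u / (w - Complex 0 u)) \<in> borel_measurable lborel" by measurable
  show "AE u in lborel. norm (f u / (w - Complex 0 u)) \<le> norm (1 / \<bar>Re w\<bar> * cmod (f u))"
  proof (rule AE_I2)
    fix u
    have "cmod (f u) / cmod (w - Complex 0 u) \<le> cmod (f u) / \<bar>Re w\<bar>"
      using kernel_bound[of w u] assms(2) by (intro divide_left_mono mult_pos_pos) (auto intro: less_le_trans)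
    then show "norm (f u / (w - Complex 0 u)) \<le> norm (1 / \<bar>Re w\<bar> * cmod (f u))"
      by (simp add: norm_divide)
  qed
qed

lemma ctrans_trunc_tendsto:
  assumes [measurable]: "f \<in> borel_measurable borel" and int: "integrable lborel (\<lambda>u. f u / (w - Complex 0 u))"
  shows "(\<lambda>n. ctrans (trunc n f) w) \<longlonglongrightarrow> ctrans f w"
  unfolding ctrans_def
proof (intro tendsto_intros integral_dominated_convergence[where w = "\<lambda>u. cmod (f u / (w - Complex 0 u))"])
  show "AE u in lborel. (\<lambda>n. trunc n f u / (w - Complex 0 u)) \<longlonglongrightarrow> f u / (w - Complex 0 u)"
    unfolding divide_inverse by (intro AE_I2 tendsto_mult trunc_tendsto tendsto_const)
  show "integrable lborel (\<lambda>u. cmod (f u / (w - Complex 0 u)))" using int by (rule integrable_norm)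
  show "(\<lambda>u. trunc n f u / (w - Complex 0 u)) \<in> borel_measurable lborel" for n
    using nice_measurable[OF nice_trunc[OF assms(1), of n]] by measurable
  show "AE u in lborel. cmod (trunc n f u / (w - Complex 0 u)) \<le> cmod (f u / (w - Complex 0 u))" for n
    using cmod_trunc_le by (intro AE_I2) (simp add: norm_divide divide_right_mono)
qed measurable

lemma ctrans_holomorphic:
  assumes "nice f"
  shows "ctrans f holomorphic_on {w. Re w \<noteq> 0}"
proof -
  note [measurable] = nice_measurable[OF assms]
  have "open {w::complex. Re w \<noteq> 0}" by (intro open_Collect_neq continuous_intros)
  moreover have "ctrans f field_differentiable (at w)" if "Re w \<noteq> 0" for w
  proof -
    have "((\<lambda>w. \<integral>u. f u / (Complex 0 u - w) \<partial>lborel) has_field_derivative (\<integral>u. f u / (Complex 0 u - w)\<^sup>2 \<partial>lborel)) (at w)"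
    proof (rule Cauchy_kernel_derivative[where d = "\<bar>Re w\<bar>"])
      have "integrable lborel (\<lambda>u. - (f u / (w - Complex 0 u)))"
        using integrable_kernel[OF nice_integrable[OF assms] that] by (rule integrable_minus)
      moreover have "- (f u / (w - Complex 0 u)) = f u / (Complex 0 u - w)" for u
        by (metis minus_diff_eq minus_divide_right)
      ultimately show "integrable lborel (\<lambda>u. f u / (Complex 0 u - w))" by simp
      show "\<bar>Re w\<bar> \<le> cmod (Complex 0 u - w)" for u
        using kernel_bound[of w u] by (simp add: norm_minus_commute)
    qed (use that in auto)
    moreover have "ctrans f = (\<lambda>w. complex_of_real (1 / (2 * pi)) * - (\<integral>u. f u / (Complex 0 u - w) \<partial>lborel))"
    proof
      fix w
      have "f u / (w - Complex 0 u) = - (f u / (Complex 0 u - w))" for u by (metis minus_diff_eq minus_divide_right)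
      then show "ctrans f w = complex_of_real (1 / (2 * pi)) * - (\<integral>u. f u / (Complex 0 u - w) \<partial>lborel)"
        unfolding ctrans_def by simp
    qed
    ultimately show ?thesis
      by (simp only:) (intro field_differentiable_mult field_differentiable_minus field_differentiable_const, auto simp: field_differentiable_def)
  qed
  ultimately show ?thesis by (simp add: holomorphic_on_open field_differentiable_def)
qed

lemma ctrans_decaying:
  assumes "nice f" "e > 0"
  shows "decaying e 1 (\<lambda>z. ctrans f (z + of_real e))"
proof -
  obtain M where M: "M \<ge> 0" "\<And>x. cmod (f x) \<le> M" "\<And>x. M < \<bar>x\<bar> \<Longrightarrow> f x = 0" using nice_ex[OF assms(1)] by auto
  let ?K = "(1 + e + M) / e"
  let ?D = "1 / (2 * pi) * (?K * (\<integral>u. cmod (f u) \<partial>lborel))"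
  have K: "?K \<ge> 0" using M assms by auto
  have hol: "(\<lambda>z. ctrans f (z + of_real e)) holomorphic_on {z. Re z > - e}"
    by (rule holomorphic_on_compose_gen[unfolded o_def, of "\<lambda>z. z + of_real e" _ "ctrans f" "{w. Re w \<noteq> 0}"])
       (auto intro!: holomorphic_intros ctrans_holomorphic assms)
  have bd: "cmod (ctrans f (z + of_real e)) \<le> ?D * (1 + cmod z) powr (- 1)" if "0 \<le> Re z" for z
  proof -
    let ?w = "z + of_real e"
    have Rw: "Re ?w \<noteq> 0" using that assms(2) by simp
    have pw: "cmod (f u / (?w - Complex 0 u)) \<le> ?K * (1 + cmod z) powr (- 1) * cmod (f u)" for u
    proof (cases "M < \<bar>u\<bar>")
      case True then show ?thesis using M(3)[OF True] by simp
    next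
      case False
      have "e \<le> \<bar>Re (Complex 0 u - ?w)\<bar>" using that assms(2) by simp
      also have "\<dots> \<le> cmod (Complex 0 u - ?w)" by (rule abs_Re_le_cmod)
      finally have "inverse (cmod (Complex 0 u - ?w)) \<le> (1 + e + cmod (Complex 0 u)) / e * (1 + cmod ?w) powr (- 1)"
        by (rule distance_lower_bound[OF assms(2)])
      also have "\<dots> \<le> ?K * (1 + cmod z) powr (- 1)"
      proof (intro mult_mono divide_right_mono powr_mono2')
        show "1 + e + cmod (Complex 0 u) \<le> 1 + e + M" using False by (simp add: cmod_def)
        show "1 + cmod z \<le> 1 + cmod ?w" using that assms(2) by (simp add: cmod_def power_mono)
      qed (use assms(2) M(1) in \<open>auto intro: add_pos_nonneg\<close>)
      finally have "cmod (f u) * inverse (cmod (?w - Complex 0 u)) \<le> cmod (f u) * (?K * (1 + cmod z) powr (- 1))"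
        by (intro mult_left_mono) (auto simp: norm_minus_commute)
      then show ?thesis by (simp add: norm_mult norm_inverse divide_inverse mult_ac)
    qed
    have "cmod (\<integral>u. f u / (?w - Complex 0 u) \<partial>lborel) \<le> (\<integral>u. cmod (f u / (?w - Complex 0 u)) \<partial>lborel)"
      by (rule integral_norm_bound)
    also have "\<dots> \<le> (\<integral>u. ?K * (1 + cmod z) powr (- 1) * cmod (f u) \<partial>lborel)"
      using pw nice_integrable[OF assms(1)] Rw by (intro integral_mono integrable_norm integrable_kernel integrable_mult_right) auto
    finally have "1 / (2 * pi) * cmod (\<integral>u. f u / (?w - Complex 0 u) \<partial>lborel) \<le> 1 / (2 * pi) * (?K * (1 + cmod z) powr (- 1) * (\<integral>u. cmod (f u) \<partial>lborel))"
      by (intro mult_left_mono) auto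
    then show ?thesis unfolding ctrans_def norm_mult norm_of_real by (simp add: mult_ac)
  qed
  have "?D \<ge> 0" using K by (intro mult_nonneg_nonneg Bochner_Integration.integral_nonneg) auto
  then show ?thesis using hol bd unfolding decaying_def by blast
qed

lemma Complex_0_shift [simp]: "Complex 0 y + of_real e = Complex e y" "Complex x y + of_real e = Complex (x + e) y"
  by (simp_all add: complex_eq_iff)

lemma integral_reflect: "(\<integral>u. f (- u) \<partial>lborel) = (\<integral>u. f u \<partial>lborel)" for f :: "real \<Rightarrow> complex"
  using lborel_integral_real_affine[of "-1" f 0] by simp

text \<open>The point reflection of the plane exchanges the two sides of the line, so statements on the left half-plane
are statements on the right half-plane for the reflected function.\<close>

lemma ctrans_uminus: "ctrans f (- w) = - ctrans (\<lambda>u. f (- u)) w"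
proof -
  have "(\<integral>u. f u / (- w - Complex 0 u) \<partial>lborel) = (\<integral>u. f (- u) / (- w - Complex 0 (- u)) \<partial>lborel)"
    by (rule integral_reflect[symmetric])
  also have "(\<lambda>u. f (- u) / (- w - Complex 0 (- u))) = (\<lambda>u. - (f (- u) / (w - Complex 0 u)))"
  proof
    fix u
    have "- w - Complex 0 (- u) = - (w - Complex 0 u)" by (simp add: complex_eq_iff)
    then show "f (- u) / (- w - Complex 0 (- u)) = - (f (- u) / (w - Complex 0 u))" by (metis minus_divide_right)
  qed
  finally show ?thesis unfolding ctrans_def by simp
qed

lemma ctrans_left: "ctrans f (Complex (- e) y) = - ctrans (\<lambda>u. f (- u)) (Complex e (- y))"
proof -
  have "- Complex e (- y) = Complex (- e) y" by (simp add: complex_eq_iff)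
  then show ?thesis using ctrans_uminus[of f "Complex e (- y)"] by simp
qed

text \<open>Reflection in the line itself: up to conjugation the values on the left are also values on the right of a
Cauchy transform.\<close>

lemma ctrans_cnj: "ctrans (\<lambda>u. cnj (f u)) (Complex e y) = - cnj (ctrans f (Complex (- e) y))"
proof -
  have "cnj (\<integral>u. f u / (Complex (- e) y - Complex 0 u) \<partial>lborel) = (\<integral>u. cnj (f u / (Complex (- e) y - Complex 0 u)) \<partial>lborel)"
    by (rule Bochner_Integration.integral_cnj[symmetric])
  also have "(\<lambda>u. cnj (f u / (Complex (- e) y - Complex 0 u))) = (\<lambda>u. - (cnj (f u) / (Complex e y - Complex 0 u)))"
  proof
    fix u
    have "cnj (Complex (- e) y - Complex 0 u) = - (Complex e y - Complex 0 u)" by (simp add: complex_eq_iff)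
    then show "cnj (f u / (Complex (- e) y - Complex 0 u)) = - (cnj (f u) / (Complex e y - Complex 0 u))"
      by (metis complex_cnj_divide minus_divide_right)
  qed
  finally show ?thesis unfolding ctrans_def by simp
qed

section \<open>Norms of the Cauchy transform on parallel lines\<close>

lemma powr_le_imp_le:
  fixes x y s :: real
  assumes "s > 0" "x \<ge> 0" "y \<ge> 0" "x powr s \<le> y powr s"
  shows "x \<le> y"
  using powr_less_mono2[of s y x] assms by linarith

text \<open>The jump of the transform across the line, at distance \<open>e\<close>; this is a Poisson integral of \<open>f\<close>.\<close>

definition pois :: "real \<Rightarrow> (real \<Rightarrow> complex) \<Rightarrow> real \<Rightarrow> complex" where
  "pois e f y = ctrans f (Complex e y) - ctrans f (Complex (- e) y)"

text \<open>The sum of the values on both sides; up to a factor \<open>- \<i>\<close>, a smoothed Hilbert transform of \<open>f\<close>.\<close>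

definition csum :: "real \<Rightarrow> (real \<Rightarrow> complex) \<Rightarrow> real \<Rightarrow> complex" where
  "csum e f y = ctrans f (Complex e y) + ctrans f (Complex (- e) y)"

lemma pois_eq:
  assumes f: "nice f" and e: "e > 0"
  shows "integrable lborel (\<lambda>u. of_real (e / (e\<^sup>2 + (u - y)\<^sup>2) / pi) * f u)"
    and "pois e f y = (\<integral>u. of_real (e / (e\<^sup>2 + (u - y)\<^sup>2) / pi) * f u \<partial>lborel)"
proof -
  have i: "integrable lborel (\<lambda>u. f u / (Complex e y - Complex 0 u))" "integrable lborel (\<lambda>u. f u / (Complex (- e) y - Complex 0 u))"
    using e by (intro integrable_kernel nice_integrable[OF f]; simp)+
  have eq: "of_real (1 / (2 * pi)) * (f u / (Complex e y - Complex 0 u) - f u / (Complex (- e) y - Complex 0 u))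
     = of_real (e / (e\<^sup>2 + (u - y)\<^sup>2) / pi) * f u" for u
  proof -
    let ?a = "Complex e y - Complex 0 u" and ?b = "Complex (- e) y - Complex 0 u"
    have nz: "?a \<noteq> 0" "?b \<noteq> 0" using e by (auto simp: complex_eq_iff)
    have ab: "?a * ?b = - of_real (e\<^sup>2 + (u - y)\<^sup>2)"
      by (simp add: complex_eq_iff power2_eq_square algebra_simps)
    have "f u / ?a - f u / ?b = f u * (?b - ?a) / (?a * ?b)"
      using nz by (simp add: divide_simps) (simp add: algebra_simps)
    also have "?b - ?a = - of_real (2 * e)" by (simp add: complex_eq_iff)
    finally have "f u / ?a - f u / ?b = f u * of_real (2 * e) / of_real (e\<^sup>2 + (u - y)\<^sup>2)"
      unfolding ab mult_minus_right minus_divide_divide .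
    then show ?thesis by (simp add: mult_ac)
  qed
  have j: "integrable lborel (\<lambda>u. of_real (1 / (2 * pi)) * (f u / (Complex e y - Complex 0 u) - f u / (Complex (- e) y - Complex 0 u)))"
    by (intro integrable_mult_right Bochner_Integration.integrable_diff i)
  then show "integrable lborel (\<lambda>u. of_real (e / (e\<^sup>2 + (u - y)\<^sup>2) / pi) * f u)" unfolding eq .
  have "pois e f y = (\<integral>u. of_real (1 / (2 * pi)) * (f u / (Complex e y - Complex 0 u) - f u / (Complex (- e) y - Complex 0 u)) \<partial>lborel)"
    unfolding pois_def ctrans_def integral_mult_right_zero Bochner_Integration.integral_diff[OF i] by (simp add: right_diff_distrib)
  then show "pois e f y = (\<integral>u. of_real (e / (e\<^sup>2 + (u - y)\<^sup>2) / pi) * f u \<partial>lborel)" unfolding eq .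
qed

lemma ctrans_line_measurable:
  assumes "nice f" "e > 0"
  shows "(\<lambda>y. ctrans f (Complex e y)) \<in> borel_measurable borel" "(\<lambda>y. ctrans f (Complex (- e) y)) \<in> borel_measurable borel"
proof -
  have c: "continuous_on UNIV (\<lambda>y. ctrans f (Complex c y))" if "c \<noteq> 0" for c
    by (rule continuous_on_compose2[OF holomorphic_on_imp_continuous_on[OF ctrans_holomorphic[OF assms(1)]]])
       (use that in \<open>auto simp: Complex_eq intro!: continuous_intros\<close>)
  show "(\<lambda>y. ctrans f (Complex e y)) \<in> borel_measurable borel" "(\<lambda>y. ctrans f (Complex (- e) y)) \<in> borel_measurable borel"
    using c[of e] c[of "- e"] assms(2) by (auto intro: borel_measurable_continuous_onI)
qed

lemma pois_measurable:
  assumes "nice f" "e > 0" shows "pois e f \<in> borel_measurable borel" "csum e f \<in> borel_measurable borel"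
  using ctrans_line_measurable[OF assms] unfolding pois_def[abs_def] csum_def[abs_def] by measurable

text \<open>The Poisson kernel is a probability density in either variable, so Hoelder's inequality in one variable and
Tonelli's theorem in the other one give norm at most one.\<close>

lemma pois_Lp:
  assumes f: "nice f" and e: "e > 0" and p: "p > 1" and a: "Lp_le p lborel f a"
  shows "Lp_le p lborel (pois e f) a"
proof -
  note [measurable] = nice_measurable[OF f]
  define q where "q = p / (p - 1)"
  have q: "q > 1" "1 / p + 1 / q = 1" using p by (auto simp: q_def field_simps)
  define K where "K = (\<lambda>y u. e / (e\<^sup>2 + (u - y)\<^sup>2) / pi)"
  have K0: "K y u \<ge> 0" for y u using e by (auto simp: K_def)
  have [measurable]: "(\<lambda>(y, u). K y u) \<in> borel_measurable (borel \<Otimes>\<^sub>M borel)" "K y \<in> borel_measurable borel" for y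
    unfolding K_def by measurable
  have K1: "(\<integral>\<^sup>+u. ennreal (K y u) \<partial>lborel) = 1" for y
  proof -
    have "(\<integral>\<^sup>+u. ennreal (K y u) \<partial>lborel) = (\<integral>\<^sup>+u. ennreal (1 / pi) * ennreal (e / (e\<^sup>2 + (u - y)\<^sup>2)) \<partial>lborel)"
      by (intro nn_integral_cong) (simp add: K_def ennreal_mult'[symmetric] mult.commute)
    also have "\<dots> = ennreal (1 / pi) * ennreal pi"
      by (subst nn_integral_cmult) (simp_all add: poisson_integral(1)[OF e])
    also have "\<dots> = 1" by (simp add: ennreal_mult'[symmetric])
    finally show ?thesis .
  qed
  have sym: "K y u = K u y" for y u by (simp add: K_def power2_commute)
  have pw: "ennreal (cmod (pois e f y) powr p) \<le> (\<integral>\<^sup>+u. ennreal (K y u) * ennreal (cmod (f u) powr p) \<partial>lborel)" for y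
  proof (cases "(\<integral>\<^sup>+u. ennreal (K y u) * ennreal (cmod (f u) powr p) \<partial>lborel)")
    case (real x)
    let ?\<nu> = "density lborel (\<lambda>u. ennreal (K y u))"
    have "Lp_le p ?\<nu> f (x powr (1 / p))"
      using real p by (simp add: Lp_le_def nn_integral_density powr_powr)
    moreover have "Lp_le q ?\<nu> (\<lambda>_. 1) 1"
      using K1 by (simp add: Lp_le_def emeasure_density)
    ultimately have "(\<integral>\<^sup>+u. ennreal (cmod (f u) * cmod 1) \<partial>?\<nu>) \<le> ennreal (x powr (1 / p) * 1)"
      by (rule Hoelder[OF p q])
    then have H: "(\<integral>\<^sup>+u. ennreal (K y u) * ennreal (cmod (f u)) \<partial>lborel) \<le> ennreal (x powr (1 / p))"
      by (simp add: nn_integral_density)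
    have "ennreal (cmod (pois e f y)) \<le> (\<integral>\<^sup>+u. ennreal (cmod (of_real (K y u) * f u)) \<partial>lborel)"
      unfolding pois_eq(2)[OF f e] K_def by (rule integral_norm_bound_ennreal[OF pois_eq(1)[OF f e]])
    also have "\<dots> = (\<integral>\<^sup>+u. ennreal (K y u) * ennreal (cmod (f u)) \<partial>lborel)"
      using K0 by (intro nn_integral_cong) (simp add: norm_mult ennreal_mult')
    also have "\<dots> \<le> ennreal (x powr (1 / p))" by (rule H)
    finally have "cmod (pois e f y) \<le> x powr (1 / p)" by simp
    then have "cmod (pois e f y) powr p \<le> (x powr (1 / p)) powr p" using p by (intro powr_mono2) auto
    then show ?thesis using real p by (simp add: powr_powr)
  qed simp
  have "(\<integral>\<^sup>+y. ennreal (cmod (pois e f y) powr p) \<partial>lborel)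
     \<le> (\<integral>\<^sup>+y. \<integral>\<^sup>+u. ennreal (K y u) * ennreal (cmod (f u) powr p) \<partial>lborel \<partial>lborel)"
    by (intro nn_integral_mono pw)
  also have "\<dots> = (\<integral>\<^sup>+u. \<integral>\<^sup>+y. ennreal (K y u) * ennreal (cmod (f u) powr p) \<partial>lborel \<partial>lborel)"
    by (rule lborel_pair.Fubini'[symmetric]) measurable
  also have "\<dots> = (\<integral>\<^sup>+u. ennreal (cmod (f u) powr p) \<partial>lborel)"
  proof (intro nn_integral_cong)
    fix u
    have "(\<integral>\<^sup>+y. ennreal (K y u) * ennreal (cmod (f u) powr p) \<partial>lborel) = (\<integral>\<^sup>+y. ennreal (K u y) \<partial>lborel) * ennreal (cmod (f u) powr p)"
      unfolding sym[of _ u] by (rule nn_integral_multc) simp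
    then show "(\<integral>\<^sup>+y. ennreal (K y u) * ennreal (cmod (f u) powr p) \<partial>lborel) = ennreal (cmod (f u) powr p)"
      by (simp add: K1)
  qed
  also have "\<dots> \<le> ennreal (a powr p)" using a by (simp add: Lp_le_def)
  finally show ?thesis using a pois_measurable[OF f e] by (simp add: Lp_le_def)
qed

lemma ctrans_line_integrable_powr:
  assumes "nice f" "e > 0" "p > 1"
  shows "integrable lborel (\<lambda>y. cmod (ctrans f (Complex e y)) powr p)"
    "integrable lborel (\<lambda>y. cmod (ctrans f (Complex (- e) y)) powr p)"
proof -
  have main: "integrable lborel (\<lambda>y. cmod (ctrans f (Complex e y)) powr p)" if f: "nice f" for f
  proof -
    obtain D where D: "D \<ge> 0" "\<And>x y. 0 \<le> x \<Longrightarrow> cmod (ctrans f (Complex x y + of_real e)) \<le> D * (1 + \<bar>y\<bar>) powr (- 1)"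
      using decaying_bound[OF ctrans_decaying[OF f assms(2)]] by auto
    have le: "cmod (ctrans f (Complex e y)) powr p \<le> D powr p * (1 + \<bar>y\<bar>) powr (- p)" for y
    proof -
      have "cmod (ctrans f (Complex e y)) powr p \<le> (D * (1 + \<bar>y\<bar>) powr (- 1)) powr p"
        using D(2)[of 0 y] assms(3) by (intro powr_mono2) auto
      also have "\<dots> = D powr p * (1 + \<bar>y\<bar>) powr (- p)" unfolding powr_mult powr_powr by simp
      finally show ?thesis .
    qed
    show ?thesis
      by (rule Bochner_Integration.integrable_bound[OF integrable_mult_right[OF integrable_power_decay[OF assms(3)], of "D powr p"]])
         (use le ctrans_line_measurable[OF f assms(2)] in \<open>auto intro!: AE_I2\<close>)
  qed
  show "integrable lborel (\<lambda>y. cmod (ctrans f (Complex e y)) powr p)" by (rule main[OF assms(1)])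
  show "integrable lborel (\<lambda>y. cmod (ctrans f (Complex (- e) y)) powr p)"
    using main[OF nice_cnj[OF assms(1)]] unfolding ctrans_cnj by simp
qed

text \<open>The values from the right, and those from the left after conjugation, are boundary values of functions that
are holomorphic on the same half-plane; products of these integrate to zero.\<close>

lemma ctrans_cross_terms:
  assumes "nice f" "e > 0"
  defines "g \<equiv> \<lambda>y. ctrans f (Complex e y)" and "h \<equiv> \<lambda>y. ctrans (\<lambda>u. cnj (f u)) (Complex e y)"
  shows "integrable lborel (\<lambda>y. g y * h y)" "(\<integral>y. g y * h y \<partial>lborel) = 0"
    and "integrable lborel (\<lambda>y. (g y * h y) * (g y * h y))" "(\<integral>y. (g y * h y) * (g y * h y) \<partial>lborel) = 0"
proof -
  let ?G = "\<lambda>z. ctrans f (z + of_real e) * ctrans (\<lambda>u. cnj (f u)) (z + of_real e)"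
  have d: "decaying e (1 + 1) ?G"
    by (intro decaying_mult ctrans_decaying nice_cnj assms)
  show "integrable lborel (\<lambda>y. g y * h y)" "(\<integral>y. g y * h y \<partial>lborel) = 0"
    using halfplane_integral_zero[OF d assms(2)] unfolding g_def h_def by simp_all
  show "integrable lborel (\<lambda>y. (g y * h y) * (g y * h y))" "(\<integral>y. (g y * h y) * (g y * h y) \<partial>lborel) = 0"
    using halfplane_integral_zero[OF decaying_mult[OF d d] assms(2)] unfolding g_def h_def by simp_all
qed

text \<open>Since the cross term vanishes, the square integrals of the jump and of the sum both equal the sum of the
square integrals over the two sides.\<close>

lemma ctrans_L2:
  assumes f: "nice f" and e: "e > 0" and a: "Lp_le 2 lborel f a"
  shows "(\<integral>y. cmod (ctrans f (Complex e y)) powr 2 \<partial>lborel) + (\<integral>y. cmod (ctrans f (Complex (- e) y)) powr 2 \<partial>lborel) \<le> a\<^sup>2"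
    and "(\<integral>y. cmod (csum e f y) powr 2 \<partial>lborel) \<le> a\<^sup>2" "integrable lborel (\<lambda>y. cmod (csum e f y) powr 2)"
proof -
  define g where "g = (\<lambda>y. ctrans f (Complex e y))"
  define h where "h = (\<lambda>y. ctrans (\<lambda>u. cnj (f u)) (Complex e y))"
  have neg: "ctrans f (Complex (- e) y) = - cnj (h y)" for y by (simp add: h_def ctrans_cnj)
  have int: "integrable lborel (\<lambda>y. (cmod (g y))\<^sup>2)" "integrable lborel (\<lambda>y. (cmod (h y))\<^sup>2)"
    using ctrans_line_integrable_powr[of _ e 2] f e nice_cnj[OF f] by (simp_all add: g_def h_def)
  have X: "integrable lborel (\<lambda>y. g y * h y)" "(\<integral>y. g y * h y \<partial>lborel) = 0"
    unfolding g_def h_def by (fact ctrans_cross_terms(1,2)[OF f e])+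
  have XR: "integrable lborel (\<lambda>y. Re (g y * h y))" "(\<integral>y. Re (g y * h y) \<partial>lborel) = 0"
    using integrable_Re[OF X(1)] Bochner_Integration.integral_Re[OF X(1)] unfolding X(2) by (simp_all only: zero_complex.simps)
  have p: "(cmod (pois e f y))\<^sup>2 = (cmod (g y))\<^sup>2 + (cmod (h y))\<^sup>2 + 2 * Re (g y * h y)"
    and s: "(cmod (csum e f y))\<^sup>2 = (cmod (g y))\<^sup>2 + (cmod (h y))\<^sup>2 - 2 * Re (g y * h y)" for y
    unfolding pois_def csum_def neg cmod_power2 by (simp_all add: g_def power2_eq_square algebra_simps)
  have sum: "(\<integral>y. (cmod (pois e f y))\<^sup>2 \<partial>lborel) = (\<integral>y. (cmod (g y))\<^sup>2 \<partial>lborel) + (\<integral>y. (cmod (h y))\<^sup>2 \<partial>lborel)"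
    "(\<integral>y. (cmod (csum e f y))\<^sup>2 \<partial>lborel) = (\<integral>y. (cmod (g y))\<^sup>2 \<partial>lborel) + (\<integral>y. (cmod (h y))\<^sup>2 \<partial>lborel)"
    unfolding p s using int XR by (simp_all del: times_complex.simps)
  have "(\<integral>y. (cmod (pois e f y))\<^sup>2 \<partial>lborel) \<le> a\<^sup>2"
    using Lp_leD_integrable(2)[OF pois_Lp[OF f e _ a]] a by (simp add: Lp_le_def)
  then show "(\<integral>y. cmod (ctrans f (Complex e y)) powr 2 \<partial>lborel) + (\<integral>y. cmod (ctrans f (Complex (- e) y)) powr 2 \<partial>lborel) \<le> a\<^sup>2"
    "(\<integral>y. cmod (csum e f y) powr 2 \<partial>lborel) \<le> a\<^sup>2"
    using sum by (simp_all add: neg g_def)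
  show "integrable lborel (\<lambda>y. cmod (csum e f y) powr 2)"
    using int XR by (simp add: s del: times_complex.simps)
qed

text \<open>\<open>c\<close> bounds the \<open>L\<^sup>p\<close> norm of the Cauchy transform from a line to any parallel line.\<close>

definition Cbound :: "real \<Rightarrow> real \<Rightarrow> bool" where
  "Cbound p c \<longleftrightarrow> c \<ge> 0 \<and> (\<forall>f e a. nice f \<longrightarrow> e > 0 \<longrightarrow> Lp_le p lborel f a \<longrightarrow> Lp_le p lborel (\<lambda>y. ctrans f (Complex e y)) (c * a))"

text \<open>The same for the sum over both sides. The two constants feed each other when the exponent is doubled.\<close>

definition Tbound :: "real \<Rightarrow> real \<Rightarrow> bool" where
  "Tbound p c \<longleftrightarrow> c \<ge> 0 \<and> (\<forall>f e a. nice f \<longrightarrow> e > 0 \<longrightarrow> Lp_le p lborel f a \<longrightarrow> Lp_le p lborel (csum e f) (c * a))"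

lemma Cbound_mono:
  assumes "Cbound p c" "c \<le> d" "0 \<le> p"
  shows "Cbound p d"
  unfolding Cbound_def
proof (intro conjI allI impI)
  show "0 \<le> d" using assms by (auto simp: Cbound_def)
  fix f :: "real \<Rightarrow> complex" and e a :: real assume f: "nice f" "e > 0" "Lp_le p lborel f a"
  then have "Lp_le p lborel (\<lambda>y. ctrans f (Complex e y)) (c * a)" using assms(1) unfolding Cbound_def by blast
  then show "Lp_le p lborel (\<lambda>y. ctrans f (Complex e y)) (d * a)"
    by (rule Lp_le_mono) (use assms Lp_leD(2)[OF f(3)] in \<open>auto intro: mult_right_mono\<close>)
qed

lemma Tbound_2: "Tbound 2 1"
  unfolding Tbound_def
proof (intro conjI allI impI)
  fix f :: "real \<Rightarrow> complex" and e a :: real assume f: "nice f" and e: "e > 0" and a: "Lp_le 2 lborel f a"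
  show "Lp_le 2 lborel (csum e f) (1 * a)"
    using ctrans_L2[OF f e a] pois_measurable[OF f e] Lp_leD(2)[OF a] by (intro Lp_leI_integrable) auto
qed simp

text \<open>The term that is subtracted from \<open>4 |w + cnj z|\<^sup>4\<close> is the real part of a square of \<open>w z\<close>, which integrates to zero for the two
sides of a Cauchy transform. In terms of \<open>A = |w|\<^sup>2\<close>, \<open>B = |z|\<^sup>2\<close> and \<open>X = |w + cnj z|\<^sup>2\<close> the difference of
the two sides is \<open>(2 X - A)\<^sup>2 + 2 (X - B)\<^sup>2\<close>.\<close>

lemma quartic_inequality:
  fixes w z :: complex
  shows "cmod w ^ 4 \<le> 4 * cmod (w + cnj z) ^ 4 + 4 * Re ((w * z) * (w * z))"
proof -
  define A B c where "A = (cmod w)\<^sup>2" and "B = (cmod z)\<^sup>2" and "c = Re (w * z)"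
  define X where "X = (cmod (w + cnj z))\<^sup>2"
  have X: "X = A + B + 2 * c"
    unfolding X_def A_def B_def c_def cmod_power2 by (simp add: power2_eq_square algebra_simps)
  have R: "Re ((w * z) * (w * z)) = 2 * c\<^sup>2 - A * B"
    unfolding A_def B_def c_def cmod_power2 by (simp add: power2_eq_square algebra_simps)
  have "4 * X\<^sup>2 + 4 * (2 * c\<^sup>2 - A * B) - A\<^sup>2 = (2 * X - A)\<^sup>2 + 2 * (X - B)\<^sup>2"
    unfolding X by (simp add: power2_eq_square algebra_simps)
  then have "A\<^sup>2 \<le> 4 * X\<^sup>2 + 4 * (2 * c\<^sup>2 - A * B)"
    by (metis diff_ge_0_iff_ge add_nonneg_nonneg zero_le_power2 mult_nonneg_nonneg zero_le_numeral)
  then show ?thesis unfolding R by (simp add: A_def X_def flip: power_mult)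
qed

text \<open>Integrating the quartic inequality, with \<open>w + cnj z\<close> the Poisson integral of \<open>f\<close>, gives \<open>c\<^sup>4 = 4\<close>. Starting the
doubling from the exponent 2 instead would give a worse constant at 4 and at all later exponents.\<close>

lemma Cbound_4: "Cbound 4 (sqrt 2)"
  unfolding Cbound_def
proof (intro conjI allI impI)
  fix f :: "real \<Rightarrow> complex" and e a :: real assume f: "nice f" and e: "e > 0" and a: "Lp_le 4 lborel f a"
  define g where "g = (\<lambda>y. ctrans f (Complex e y))"
  define h where "h = (\<lambda>y. ctrans (\<lambda>u. cnj (f u)) (Complex e y))"
  have neg: "ctrans f (Complex (- e) y) = - cnj (h y)" for y by (simp add: h_def ctrans_cnj)
  have X: "integrable lborel (\<lambda>y. (g y * h y) * (g y * h y))" "(\<integral>y. (g y * h y) * (g y * h y) \<partial>lborel) = 0"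
    unfolding g_def h_def by (fact ctrans_cross_terms(3,4)[OF f e])+
  have XR: "integrable lborel (\<lambda>y. Re ((g y * h y) * (g y * h y)))" "(\<integral>y. Re ((g y * h y) * (g y * h y)) \<partial>lborel) = 0"
    using integrable_Re[OF X(1)] Bochner_Integration.integral_Re[OF X(1)] unfolding X(2) by (simp_all only: zero_complex.simps)
  note P = pois_Lp[OF f e _ a, simplified]
  have P4: "integrable lborel (\<lambda>y. cmod (pois e f y) ^ 4)" "(\<integral>y. cmod (pois e f y) ^ 4 \<partial>lborel) \<le> a ^ 4"
    using Lp_leD_integrable[OF P] Lp_leD(2)[OF a] by simp_all
  have g4: "integrable lborel (\<lambda>y. cmod (g y) ^ 4)"
    using ctrans_line_integrable_powr(1)[OF f e, of 4] by (simp add: g_def)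
  have "(\<integral>y. cmod (g y) ^ 4 \<partial>lborel) \<le> (\<integral>y. 4 * cmod (pois e f y) ^ 4 + 4 * Re ((g y * h y) * (g y * h y)) \<partial>lborel)"
  proof (intro integral_mono g4 Bochner_Integration.integrable_add integrable_mult_right P4 XR)
    show "cmod (g y) ^ 4 \<le> 4 * cmod (pois e f y) ^ 4 + 4 * Re ((g y * h y) * (g y * h y))" for y
      using quartic_inequality[of "g y" "h y"] by (simp add: pois_def neg g_def del: times_complex.simps)
  qed
  also have "\<dots> = 4 * (\<integral>y. cmod (pois e f y) ^ 4 \<partial>lborel)"
    using P4 XR by (simp del: times_complex.simps)
  also have "\<dots> \<le> 4 * a ^ 4" using P4 by simp
  also have "4 * a ^ 4 = (sqrt 2 * a) ^ 4" by (simp add: power_mult_distrib power4_eq_xxxx)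
  finally show "Lp_le 4 lborel (\<lambda>y. ctrans f (Complex e y)) (sqrt 2 * a)"
    using g4 ctrans_line_measurable[OF f e] Lp_leD(2)[OF a] by (intro Lp_leI_integrable) (auto simp: g_def)
qed simp

lemma ctrans_bound_integrable:
  assumes C: "Cbound p c" and p: "p > 0" and f: "Lp_le p lborel f a" "integrable lborel f" and e: "e > 0"
  shows "Lp_le p lborel (\<lambda>y. ctrans f (Complex e y)) (c * a)"
proof (rule Lp_le_limit[OF _ _ tendsto_const p])
  have m: "f \<in> borel_measurable borel" using f by simp
  show "Lp_le p lborel (\<lambda>y. ctrans (trunc n f) (Complex e y)) (c * a)" for n
  proof -
    have "Lp_le p lborel (trunc n f) a"
      using p nice_measurable[OF nice_trunc[OF m]] by (intro Lp_le_dominated[OF f(1)] cmod_trunc_le) auto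
    then show ?thesis using C nice_trunc[OF m] e unfolding Cbound_def by blast
  qed
  show "(\<lambda>n. ctrans (trunc n f) (Complex e y)) \<longlonglongrightarrow> ctrans f (Complex e y)" for y
    using e by (intro ctrans_trunc_tendsto m integrable_kernel f) simp
qed

lemma csum_bound_integrable:
  assumes C: "Tbound p c" and p: "p > 0" and f: "Lp_le p lborel f a" "integrable lborel f" and e: "e > 0"
  shows "Lp_le p lborel (csum e f) (c * a)"
proof (rule Lp_le_limit[OF _ _ tendsto_const p])
  have m: "f \<in> borel_measurable borel" using f by simp
  show "Lp_le p lborel (csum e (trunc n f)) (c * a)" for n
  proof -
    have "Lp_le p lborel (trunc n f) a"
      using p nice_measurable[OF nice_trunc[OF m]] by (intro Lp_le_dominated[OF f(1)] cmod_trunc_le) auto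
    then show ?thesis using C nice_trunc[OF m] e unfolding Tbound_def by blast
  qed
  show "(\<lambda>n. csum e (trunc n f) y) \<longlonglongrightarrow> csum e f y" for y
    unfolding csum_def using e by (intro tendsto_add ctrans_trunc_tendsto m integrable_kernel f) simp_all
qed

text \<open>Cotlar's device. With \<open>g\<close> and \<open>k\<close> the values on the right and on the left of the line, \<open>\<phi> = (g - k) (g + k) = g\<^sup>2 - k\<^sup>2\<close>
is the difference of boundary values of a function holomorphic on the right and one holomorphic on the left;
so the transform of \<open>\<phi>\<close> returns the two squares.\<close>

lemma Cotlar_identity:
  assumes f: "nice f" and e: "e > 0"
  defines "\<phi> \<equiv> \<lambda>u. pois e f u * csum e f u"
  shows "integrable lborel \<phi>"
    and "d > 0 \<Longrightarrow> ctrans \<phi> (Complex d y) = (ctrans f (Complex (e + d) y))\<^sup>2"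
    and "d > 0 \<Longrightarrow> ctrans \<phi> (Complex (- d) y) = (ctrans f (Complex (- (e + d)) y))\<^sup>2"
proof -
  let ?F = "\<lambda>z. ctrans f (z + of_real e) * ctrans f (z + of_real e)"
  let ?R = "\<lambda>u. f (- u)"
  let ?H = "\<lambda>z. ctrans ?R (z + of_real e) * ctrans ?R (z + of_real e)"
  have F: "decaying e (1 + 1) ?F" and H: "decaying e (1 + 1) ?H"
    by (intro decaying_mult ctrans_decaying nice_reflect f e)+
  have F2: "decaying e 2 ?F" and H2: "decaying e 2 ?H" using F H by simp_all
  have \<phi>: "\<phi> u = ?F (Complex 0 u) - ?H (Complex 0 (- u))" for u
    unfolding \<phi>_def pois_def csum_def ctrans_left Complex_0_shift by (simp add: algebra_simps)
  have Fi: "integrable lborel (\<lambda>u. ?F (Complex 0 u))" using halfplane_integral_zero(1)[OF F2 e] by simp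
  have Hi: "integrable lborel (\<lambda>u. ?H (Complex 0 u))" using halfplane_integral_zero(1)[OF H2 e] by simp
  have Hi': "integrable lborel (\<lambda>u. ?H (Complex 0 (- u)))"
    using lborel_integrable_real_affine[OF Hi, of "-1" 0] by simp
  show \<phi>i: "integrable lborel \<phi>" unfolding \<phi> by (rule Bochner_Integration.integrable_diff[OF Fi Hi'])
  have split: "(\<integral>u. \<phi> u / (w - Complex 0 u) \<partial>lborel) = (\<integral>u. ?F (Complex 0 u) / (w - Complex 0 u) \<partial>lborel) + (\<integral>u. ?H (Complex 0 u) / (- w - Complex 0 u) \<partial>lborel)"
    if "Re w \<noteq> 0" for w
  proof -
    have "(\<integral>u. \<phi> u / (w - Complex 0 u) \<partial>lborel) = (\<integral>u. ?F (Complex 0 u) / (w - Complex 0 u) - ?H (Complex 0 (- u)) / (w - Complex 0 u) \<partial>lborel)"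
      unfolding \<phi> diff_divide_distrib ..
    also have "\<dots> = (\<integral>u. ?F (Complex 0 u) / (w - Complex 0 u) \<partial>lborel) - (\<integral>u. ?H (Complex 0 (- u)) / (w - Complex 0 u) \<partial>lborel)"
      by (intro Bochner_Integration.integral_diff integrable_kernel Fi Hi' that)
    also have "(\<integral>u. ?H (Complex 0 (- u)) / (w - Complex 0 u) \<partial>lborel) = (\<integral>u. ?H (Complex 0 u) / (w - Complex 0 (- u)) \<partial>lborel)"
      using integral_reflect[of "\<lambda>u. ?H (Complex 0 u) / (w - Complex 0 (- u))"] by simp
    also have "(\<lambda>u. ?H (Complex 0 u) / (w - Complex 0 (- u))) = (\<lambda>u. - (?H (Complex 0 u) / (- w - Complex 0 u)))"
    proof
      fix u
      have "w - Complex 0 (- u) = - (- w - Complex 0 u)" by (simp add: complex_eq_iff)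
      then show "?H (Complex 0 u) / (w - Complex 0 (- u)) = - (?H (Complex 0 u) / (- w - Complex 0 u))"
        by (metis minus_divide_right)
    qed
    finally show ?thesis by simp
  qed
  show "ctrans \<phi> (Complex d y) = (ctrans f (Complex (e + d) y))\<^sup>2" if d: "d > 0"
  proof -
    have w: "Re (Complex d y) > 0" "Re (- Complex d y) < 0" using d by auto
    have "(\<integral>u. \<phi> u / (Complex d y - Complex 0 u) \<partial>lborel) = 2 * pi * ?F (Complex d y) + 0"
      using split[of "Complex d y"] halfplane_Cauchy_formula(2)[OF F2 e _ w(1)] halfplane_Cauchy_outside(2)[OF H2 e _ w(2)] w by simp
    then show ?thesis unfolding ctrans_def[of \<phi>] add.commute[of e d] by (simp add: power2_eq_square)
  qed
  show "ctrans \<phi> (Complex (- d) y) = (ctrans f (Complex (- (e + d)) y))\<^sup>2" if d: "d > 0"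
  proof -
    have w: "Re (- Complex (- d) y) > 0" "Re (Complex (- d) y) < 0" using d by auto
    have "(\<integral>u. \<phi> u / (Complex (- d) y - Complex 0 u) \<partial>lborel) = 0 + 2 * pi * ?H (- Complex (- d) y)"
      using split[of "Complex (- d) y"] halfplane_Cauchy_formula(2)[OF H2 e _ w(1)] halfplane_Cauchy_outside(2)[OF F2 e _ w(2)] w by simp
    moreover have "- Complex (- d) y = Complex d (- y)" by (simp add: complex_eq_iff)
    ultimately show ?thesis unfolding ctrans_left[of f "e + d"] unfolding ctrans_def[of \<phi>] add.commute[of e d] by (simp add: power2_eq_square)
  qed
qed

lemma Lp_le_product:
  assumes "p > 0" "Lp_le (2 * p) M f a" "Lp_le (2 * p) M g b"
  shows "Lp_le p M (\<lambda>x. f x * g x) (a * b)"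
proof -
  note [measurable] = Lp_leD(1)[OF assms(2)] Lp_leD(1)[OF assms(3)]
  have sq: "Lp_le 2 M (\<lambda>x. of_real (cmod (k x) powr p)) (c powr p)" if "Lp_le (2 * p) M k c" for k c
  proof -
    note [measurable] = Lp_leD(1)[OF that]
    have "(cmod (k x) powr p) powr 2 = cmod (k x) powr (2 * p)" "(c powr p) powr 2 = c powr (2 * p)" for x
      unfolding powr_powr by (simp_all add: mult.commute)
    then show ?thesis using that unfolding Lp_le_def by simp
  qed
  have "(\<integral>\<^sup>+x. ennreal (cmod (of_real (cmod (f x) powr p)) * cmod (of_real (cmod (g x) powr p))) \<partial>M) \<le> ennreal (a powr p * b powr p)"
    by (rule Hoelder[OF _ _ _ sq[OF assms(2)] sq[OF assms(3)]]) auto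
  then show ?thesis
    using Lp_leD(2)[OF assms(2)] Lp_leD(2)[OF assms(3)] by (simp add: Lp_le_def norm_mult powr_mult)
qed

lemma Lp_le_square_iff:
  assumes "p > 0" "b \<ge> 0" "f \<in> borel_measurable M"
  shows "Lp_le p M (\<lambda>x. (f x)\<^sup>2) b \<longleftrightarrow> Lp_le (2 * p) M f (sqrt b)"
proof -
  have 1: "(x\<^sup>2) powr p = x powr (2 * p)" if "x \<ge> 0" for x :: real
    by (metis powr_numeral powr_powr that)
  have 2: "b powr p = sqrt b powr (2 * p)" using 1[of "sqrt b"] assms(2) by simp
  show ?thesis unfolding Lp_le_def norm_power 1[OF norm_ge_zero] 2 using assms by auto
qed

text \<open>Cotlar's identity at half the distance: \<open>g\<^sup>2\<close> is the transform of the product of the jump, of norm at most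
\<open>a\<close>, and of the sum, of norm at most \<open>t a\<close>.\<close>

lemma Cbound_double:
  assumes C: "Cbound p c" and T: "Tbound (2 * p) t" and p: "p > 1"
  shows "Cbound (2 * p) (sqrt (c * t))"
  unfolding Cbound_def
proof (intro conjI allI impI)
  show "0 \<le> sqrt (c * t)" using C T by (simp add: Cbound_def Tbound_def)
  fix f :: "real \<Rightarrow> complex" and e a :: real assume f: "nice f" and e: "e > 0" and a: "Lp_le (2 * p) lborel f a"
  have e2: "e / 2 > 0" using e by simp
  have ct: "c \<ge> 0" "t \<ge> 0" "a \<ge> 0" using C T a by (auto simp: Cbound_def Tbound_def Lp_le_def)
  have "Lp_le (2 * p) lborel (pois (e / 2) f) a" using p by (intro pois_Lp f e2 a) simp
  moreover have "Lp_le (2 * p) lborel (csum (e / 2) f) (t * a)" using T f e2 a unfolding Tbound_def by blast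
  ultimately have \<phi>: "Lp_le p lborel (\<lambda>u. pois (e / 2) f u * csum (e / 2) f u) (a * (t * a))"
    using p by (intro Lp_le_product) auto
  have "Lp_le p lborel (\<lambda>y. ctrans (\<lambda>u. pois (e / 2) f u * csum (e / 2) f u) (Complex (e / 2) y)) (c * (a * (t * a)))"
    using p by (intro ctrans_bound_integrable[OF C _ \<phi> Cotlar_identity(1)[OF f e2] e2]) simp
  then have "Lp_le p lborel (\<lambda>y. (ctrans f (Complex e y))\<^sup>2) (c * (a * (t * a)))"
    unfolding Cotlar_identity(2)[OF f e2 e2] by simp
  then have "Lp_le (2 * p) lborel (\<lambda>y. ctrans f (Complex e y)) (sqrt (c * (a * (t * a))))"
    using p ct ctrans_line_measurable(1)[OF f e] by (subst (asm) Lp_le_square_iff) auto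
  moreover have "sqrt (c * (a * (t * a))) = sqrt (c * t) * a"
    using ct by (simp add: real_sqrt_mult)
  ultimately show "Lp_le (2 * p) lborel (\<lambda>y. ctrans f (Complex e y)) (sqrt (c * t) * a)" by simp
qed

text \<open>Let \<open>f\<close> be the jump \<open>g - k\<close> and \<open>W\<close> the sum \<open>g + k\<close>. Then \<open>W\<^sup>2 = 2 (g\<^sup>2 + k\<^sup>2) - f\<^sup>2\<close>, and by Cotlar's identity
\<open>g\<^sup>2 + k\<^sup>2\<close> is the sum over both sides for the function \<open>f W\<close>. Thus \<open>X = \<parallel>W\<parallel>\<close> satisfies the quadratic inequality
\<open>X\<^sup>2 \<le> 2 t a X + a\<^sup>2\<close>, whose larger root is the asserted bound.\<close>

lemma Tbound_double:
  assumes T: "Tbound p t" and p: "p > 1"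
  shows "Tbound (2 * p) (t + sqrt (t\<^sup>2 + 1))"
  unfolding Tbound_def
proof (intro conjI allI impI)
  have t: "t \<ge> 0" using T by (simp add: Tbound_def)
  then show "0 \<le> t + sqrt (t\<^sup>2 + 1)" by simp
  fix f :: "real \<Rightarrow> complex" and e a0 :: real assume f: "nice f" and e: "e > 0" and a0: "Lp_le (2 * p) lborel f a0"
  let ?W = "csum e f"
  note Wm = pois_measurable(2)[OF f e]
  have main: "Lp_le (2 * p) lborel ?W ((t + sqrt (t\<^sup>2 + 1)) * a)" if a: "Lp_le (2 * p) lborel f a" "a > 0" for a
  proof -
    have Wi: "integrable lborel (\<lambda>y. cmod (?W y) powr (2 * p))"
    proof -
      let ?g = "\<lambda>y. ctrans f (Complex e y)" and ?k = "\<lambda>y. ctrans f (Complex (- e) y)"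
      have i: "integrable lborel (\<lambda>y. 2 powr (2 * p) * (cmod (?g y) powr (2 * p) + cmod (?k y) powr (2 * p)))"
        using ctrans_line_integrable_powr[OF f e, of "2 * p"] p by simp
      show ?thesis
      proof (rule Bochner_Integration.integrable_bound[OF i])
        show "(\<lambda>y. cmod (?W y) powr (2 * p)) \<in> borel_measurable lborel" using Wm by simp
        show "AE y in lborel. norm (cmod (?W y) powr (2 * p)) \<le> norm (2 powr (2 * p) * (cmod (?g y) powr (2 * p) + cmod (?k y) powr (2 * p)))"
        proof (rule AE_I2)
          fix y
          have "cmod (?W y) \<le> 2 * max (cmod (?g y)) (cmod (?k y))"
            unfolding csum_def using norm_triangle_ineq[of "?g y" "?k y"] by linarith
          then have "cmod (?W y) powr (2 * p) \<le> (2 * max (cmod (?g y)) (cmod (?k y))) powr (2 * p)"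
            using p by (intro powr_mono2) auto
          also have "\<dots> = 2 powr (2 * p) * max (cmod (?g y)) (cmod (?k y)) powr (2 * p)" by (rule powr_mult)
          also have "\<dots> \<le> 2 powr (2 * p) * (cmod (?g y) powr (2 * p) + cmod (?k y) powr (2 * p))"
            by (intro mult_left_mono) (auto simp: max_def)
          finally show "norm (cmod (?W y) powr (2 * p)) \<le> norm (2 powr (2 * p) * (cmod (?g y) powr (2 * p) + cmod (?k y) powr (2 * p)))"
            by simp
        qed
      qed
    qed
    \<comment> \<open>the a priori finite norm that the quadratic inequality bounds\<close>
    define X where "X = (\<integral>y. cmod (?W y) powr (2 * p) \<partial>lborel) powr (1 / (2 * p))"
    have X0: "X \<ge> 0" by (simp add: X_def)
    have Xp: "X powr (2 * p) = (\<integral>y. cmod (?W y) powr (2 * p) \<partial>lborel)"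
      using p by (simp add: X_def powr_powr)
    have WX: "Lp_le (2 * p) lborel ?W X"
      using Wi Wm X0 by (intro Lp_leI_integrable) (auto simp: Xp)
    let ?V = "\<lambda>y. (ctrans f (Complex e y))\<^sup>2 + (ctrans f (Complex (- e) y))\<^sup>2"
    note cm = ctrans_line_measurable[OF f e]
    have \<phi>: "Lp_le p lborel (\<lambda>u. pois e f u * ?W u) (a * X)"
      using p by (intro Lp_le_product pois_Lp f e a WX) auto
    have V: "Lp_le p lborel ?V (t * (a * X))"
    proof (rule Lp_le_limit[OF _ _ tendsto_const])
      let ?d = "\<lambda>n. inverse (real (Suc n))"
      have d: "?d n > 0" for n by simp
      show "Lp_le p lborel (\<lambda>y. (ctrans f (Complex (e + ?d n) y))\<^sup>2 + (ctrans f (Complex (- (e + ?d n)) y))\<^sup>2) (t * (a * X))" for n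
      proof -
        have eq: "csum (?d n) (\<lambda>u. pois e f u * ?W u) = (\<lambda>y. (ctrans f (Complex (e + ?d n) y))\<^sup>2 + (ctrans f (Complex (- (e + ?d n)) y))\<^sup>2)"
          by (rule ext) (simp only: csum_def[of "?d n"] Cotlar_identity(2,3)[OF f e d])
        show ?thesis
          using csum_bound_integrable[OF T _ \<phi> Cotlar_identity(1)[OF f e] d[of n]] p unfolding eq by simp
      qed
      have ct: "(\<lambda>n. ctrans f (Complex (c n) y)) \<longlonglongrightarrow> ctrans f (Complex c0 y)" if "c \<longlonglongrightarrow> c0" "c0 \<noteq> 0" for c c0 y
      proof (rule isCont_tendsto_compose[of _ "ctrans f"])
        show "isCont (ctrans f) (Complex c0 y)"
          using holomorphic_on_imp_continuous_on[OF ctrans_holomorphic[OF f]] that(2)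
          by (subst (asm) continuous_on_eq_continuous_at) (auto intro!: open_Collect_neq continuous_intros)
        show "(\<lambda>n. Complex (c n) y) \<longlonglongrightarrow> Complex c0 y"
          unfolding Complex_eq by (intro tendsto_intros that)
      qed
      have l: "(\<lambda>n. e + ?d n) \<longlonglongrightarrow> e" using tendsto_add[OF tendsto_const LIMSEQ_inverse_real_of_nat, of e] by simp
      show "(\<lambda>n. (ctrans f (Complex (e + ?d n) y))\<^sup>2 + (ctrans f (Complex (- (e + ?d n)) y))\<^sup>2) \<longlonglongrightarrow> ?V y" for y
        using e by (intro tendsto_add tendsto_power ct tendsto_minus l) auto
    qed (use p in auto)
    have le: "X\<^sup>2 \<le> 2 * ((t + \<eta>) * (a * (X + \<eta>))) + a\<^sup>2" if \<eta>: "\<eta> > 0" for \<eta>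
    proof -
      let ?B = "(t + \<eta>) * (a * (X + \<eta>))"
      have B: "?B > 0" using t X0 a \<eta> by (auto intro!: mult_pos_pos add_nonneg_pos)
      have "t * (a * X) \<le> ?B" using t X0 a \<eta> by (intro mult_mono) auto
      then have "Lp_le p lborel ?V ?B" using V p by (intro Lp_le_mono[OF V]) auto
      from Lp_le_cmult[OF this, of 2]
      have 1: "Lp_le p lborel (\<lambda>y. 2 * ?V y) (2 * ?B)" by simp
      have "Lp_le (2 * p) lborel (pois e f) a" using p by (intro pois_Lp f e a) simp
      then have "Lp_le p lborel (\<lambda>y. (pois e f y)\<^sup>2) (a\<^sup>2)"
        using p a pois_measurable(1)[OF f e] by (subst Lp_le_square_iff) auto
      from Lp_le_cmult[OF this, of "-1"] have 2: "Lp_le p lborel (\<lambda>y. - 1 * (pois e f y)\<^sup>2) (a\<^sup>2)" by simp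
      have "Lp_le p lborel (\<lambda>y. 2 * ?V y + - 1 * (pois e f y)\<^sup>2) (2 * ?B + a\<^sup>2)"
        using p B a by (intro Minkowski 1 2) auto
      moreover have "2 * ?V y + - 1 * (pois e f y)\<^sup>2 = (?W y)\<^sup>2" for y
        by (simp add: pois_def csum_def power2_eq_square algebra_simps)
      ultimately have "Lp_le p lborel (\<lambda>y. (?W y)\<^sup>2) (2 * ?B + a\<^sup>2)" by simp
      then have "Lp_le (2 * p) lborel ?W (sqrt (2 * ?B + a\<^sup>2))"
        using p B a Wm by (subst (asm) Lp_le_square_iff) auto
      from Lp_leD_integrable(2)[OF this] have "X powr (2 * p) \<le> sqrt (2 * ?B + a\<^sup>2) powr (2 * p)"
        by (simp add: Xp)
      then have "X \<le> sqrt (2 * ?B + a\<^sup>2)"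
        using p X0 B a by (intro powr_le_imp_le[of "2 * p" X]) auto
      then have "X\<^sup>2 \<le> (sqrt (2 * ?B + a\<^sup>2))\<^sup>2" using X0 by (intro power_mono)
      then show ?thesis using B by simp
    qed
    have "X\<^sup>2 \<le> 2 * ((t + 0) * (a * (X + 0))) + a\<^sup>2"
    proof (rule tendsto_lowerbound)
      show "((\<lambda>\<eta>. 2 * ((t + \<eta>) * (a * (X + \<eta>))) + a\<^sup>2) \<longlongrightarrow> 2 * ((t + 0) * (a * (X + 0))) + a\<^sup>2) (at_right 0)"
        by (intro tendsto_intros)
      show "\<forall>\<^sub>F \<eta> in at_right 0. X\<^sup>2 \<le> 2 * ((t + \<eta>) * (a * (X + \<eta>))) + a\<^sup>2"
        using eventually_at_right_less[of 0] by eventually_elim (rule le)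
    qed simp
    then have "(X - t * a)\<^sup>2 \<le> a\<^sup>2 * (t\<^sup>2 + 1)" by (simp add: power2_eq_square algebra_simps)
    then have "X - t * a \<le> sqrt (a\<^sup>2 * (t\<^sup>2 + 1))" by (rule real_le_rsqrt)
    also have "\<dots> = a * sqrt (t\<^sup>2 + 1)" using a by (simp add: real_sqrt_mult)
    finally have "X \<le> (t + sqrt (t\<^sup>2 + 1)) * a" by (simp add: algebra_simps)
    then show ?thesis using p by (intro Lp_le_mono[OF WX]) auto
  qed
  have a0': "a0 \<ge> 0" using a0 by (simp add: Lp_le_def)
  show "Lp_le (2 * p) lborel ?W ((t + sqrt (t\<^sup>2 + 1)) * a0)"
  proof (rule Lp_le_limit)
    let ?a = "\<lambda>n. a0 + inverse (real (Suc n))"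
    show "Lp_le (2 * p) lborel ?W ((t + sqrt (t\<^sup>2 + 1)) * ?a n)" for n
    proof (rule main)
      show "0 < ?a n" using a0' by (intro add_nonneg_pos) auto
      show "Lp_le (2 * p) lborel f (?a n)" using p by (intro Lp_le_mono[OF a0]) auto
    qed
    have "?a \<longlonglongrightarrow> a0" using tendsto_add[OF tendsto_const LIMSEQ_inverse_real_of_nat, of a0] by simp
    then show "(\<lambda>n. (t + sqrt (t\<^sup>2 + 1)) * ?a n) \<longlonglongrightarrow> (t + sqrt (t\<^sup>2 + 1)) * a0" by (intro tendsto_mult tendsto_const)
  qed (use p in auto)
qed

text \<open>From \<open>sqrt (u\<^sup>2 + 1) \<le> u + 1 / 4\<close> for \<open>u \<ge> 2\<close>, doubling the exponent at most doubles the constant and adds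
\<open>1 / 4\<close>, which the term \<open>- 1 / 4\<close> absorbs.\<close>

lemma Tbound_dyadic: "k \<ge> 2 \<Longrightarrow> \<exists>t\<ge>0. Tbound (2 ^ k) t \<and> t \<le> 2 / 3 * 2 ^ k - 1 / 4"
proof (induction k rule: dec_induct)
  case base
  have "Tbound (2 * 2) (1 + sqrt (1\<^sup>2 + 1))" by (rule Tbound_double[OF Tbound_2]) simp
  then have "Tbound (2 ^ 2) (1 + sqrt 2)" by simp
  moreover have "sqrt 2 \<le> 17 / 12" by (rule real_le_lsqrt) (auto simp: power2_eq_square)
  ultimately show ?case by (intro exI[of _ "1 + sqrt 2"]) auto
next
  case (step k)
  then obtain t where t: "t \<ge> 0" "Tbound (2 ^ k) t" "t \<le> 2 / 3 * 2 ^ k - 1 / 4" by blast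
  define u :: real where "u = 2 / 3 * 2 ^ k - 1 / 4"
  have "(2::real) ^ k \<ge> 2 ^ 2" using step by (intro power_increasing) auto
  then have p: "(2::real) ^ k > 1" and u: "u \<ge> 2" by (auto simp: u_def)
  have "Tbound (2 * 2 ^ k) (t + sqrt (t\<^sup>2 + 1))" by (rule Tbound_double[OF t(2) p])
  moreover have "t + sqrt (t\<^sup>2 + 1) \<le> 2 / 3 * 2 ^ Suc k - 1 / 4"
  proof -
    have "t\<^sup>2 \<le> u\<^sup>2" using t by (auto simp: u_def intro: power_mono)
    then have "sqrt (t\<^sup>2 + 1) \<le> sqrt (u\<^sup>2 + 1)" by simp
    also have "\<dots> \<le> u + 1 / 4"
      using u by (intro real_le_lsqrt) (auto simp: power2_eq_square algebra_simps)
    finally show ?thesis using t(3) by (simp add: u_def)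
  qed
  moreover have "0 \<le> t + sqrt (t\<^sup>2 + 1)" using t by simp
  ultimately show ?case by auto
qed

lemma Cbound_8: "Cbound 8 (8 / 3)"
proof -
  have "Tbound (2 * 2) (1 + sqrt (1\<^sup>2 + 1))" by (rule Tbound_double[OF Tbound_2]) simp
  then have "Tbound 4 (1 + sqrt 2)" by simp
  from Tbound_double[OF this] have "Tbound (2 * 4) (1 + sqrt 2 + sqrt ((1 + sqrt 2)\<^sup>2 + 1))" by simp
  from Cbound_double[OF Cbound_4 this]
  have C: "Cbound 8 (sqrt (sqrt 2 * (1 + sqrt 2 + sqrt ((1 + sqrt 2)\<^sup>2 + 1))))" by simp
  have s: "sqrt 2 \<le> 141422 / 100000" by (rule real_le_lsqrt) (auto simp: power2_eq_square)
  have s2: "sqrt 2 * sqrt 2 = 2" by simp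
  have "(1 + sqrt 2)\<^sup>2 + 1 = 4 + 2 * sqrt 2" by (simp add: power2_eq_square algebra_simps)
  also have "\<dots> \<le> (26132 / 10000)\<^sup>2" using s by (simp add: power2_eq_square)
  finally have r: "sqrt ((1 + sqrt 2)\<^sup>2 + 1) \<le> 26132 / 10000" by (intro real_le_lsqrt) auto
  have "sqrt 2 * (1 + sqrt 2 + sqrt ((1 + sqrt 2)\<^sup>2 + 1)) \<le> sqrt 2 * (1 + sqrt 2 + 26132 / 10000)"
    using r by (intro mult_left_mono) auto
  also have "\<dots> = 2 + sqrt 2 * (36132 / 10000)" using s2 by (simp add: distrib_left)
  also have "\<dots> \<le> (8 / 3)\<^sup>2" using s by (simp add: power2_eq_square)
  finally have "sqrt (sqrt 2 * (1 + sqrt 2 + sqrt ((1 + sqrt 2)\<^sup>2 + 1))) \<le> 8 / 3" by (intro real_le_lsqrt) auto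
  then show ?thesis using C Cbound_mono by auto
qed

text \<open>The three sides of a half-strip will cost a further factor of about \<open>57 / 25\<close>, and the product stays below the exponent
\<open>2 ^ k\<close>.\<close>

lemma Cbound_dyadic: "k \<ge> 3 \<Longrightarrow> Cbound (2 ^ k) (2 ^ k / 3)"
proof (induction k rule: dec_induct)
  case base
  then show ?case using Cbound_8 by simp
next
  case (step k)
  obtain t where t: "t \<ge> 0" "Tbound (2 ^ Suc k) t" "t \<le> 2 / 3 * 2 ^ Suc k - 1 / 4"
    using Tbound_dyadic[of "Suc k"] step by auto
  have "(2::real) ^ k \<ge> 2 ^ 1" using step by (intro power_increasing) auto
  then have p: "(2::real) ^ k > 1" by simp
  have "Cbound (2 * 2 ^ k) (sqrt (2 ^ k / 3 * t))"
    by (rule Cbound_double[OF step.IH _ p]) (use t in simp)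
  moreover have "sqrt (2 ^ k / 3 * t) \<le> 2 ^ Suc k / 3"
  proof (rule real_le_lsqrt)
    have "2 ^ k / 3 * t \<le> 2 ^ k / 3 * (2 / 3 * 2 ^ Suc k)" using t by (intro mult_left_mono) auto
    then show "2 ^ k / 3 * t \<le> (2 ^ Suc k / 3)\<^sup>2" by (simp add: power2_eq_square)
  qed simp
  ultimately show ?case using Cbound_mono by auto
qed

section \<open>Spectral representation on a half-plane\<close>

text \<open>All the double integrals below are dominated by a product of integrable functions of the single variables.\<close>

lemma Fubini_dominated:
  fixes f :: "real \<Rightarrow> real \<Rightarrow> complex" and a b :: "real \<Rightarrow> real"
  assumes f[measurable]: "case_prod f \<in> borel_measurable (borel \<Otimes>\<^sub>M borel)"
    and a: "integrable lborel a" and b: "integrable lborel b"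
    and le: "\<And>x y. cmod (f x y) \<le> a x * b y"
  shows "(\<integral>y. (\<integral>x. f x y \<partial>lborel) \<partial>lborel) = (\<integral>x. (\<integral>y. f x y \<partial>lborel) \<partial>lborel)"
    and "integrable lborel (\<lambda>x. \<integral>y. f x y \<partial>lborel)"
    and "integrable lborel (\<lambda>y. \<integral>x. f x y \<partial>lborel)"
    and "integrable lborel (f x)" "integrable lborel (\<lambda>x. f x y)"
proof -
  have f': "case_prod f \<in> borel_measurable (lborel \<Otimes>\<^sub>M lborel)" by measurable
  have ix: "integrable lborel (f x)" for x
    by (rule Bochner_Integration.integrable_bound[OF integrable_mult_right[OF b, of "a x"]])
       (use f le in \<open>auto intro!: AE_I2 intro: order_trans[OF le abs_ge_self]\<close>)
  then show "integrable lborel (f x)" .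
  have iy: "integrable lborel (\<lambda>x. f x y)" for y
    by (rule Bochner_Integration.integrable_bound[OF integrable_mult_left[OF a, of "b y"]])
       (use f le in \<open>auto intro!: AE_I2 intro: order_trans[OF le abs_ge_self]\<close>)
  then show "integrable lborel (\<lambda>x. f x y)" .
  have "integrable lborel (\<lambda>x. \<integral>y. norm (f x y) \<partial>lborel)"
  proof (rule Bochner_Integration.integrable_bound[OF integrable_mult_left[OF a, of "\<integral>y. b y \<partial>lborel"]])
    show "(\<lambda>x. \<integral>y. norm (f x y) \<partial>lborel) \<in> borel_measurable lborel" by measurable
    show "AE x in lborel. norm (\<integral>y. norm (f x y) \<partial>lborel) \<le> norm (a x * (\<integral>y. b y \<partial>lborel))"
    proof (rule AE_I2)
      fix x
      have "(\<integral>y. norm (f x y) \<partial>lborel) \<le> (\<integral>y. a x * b y \<partial>lborel)"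
        by (intro integral_mono integrable_norm ix integrable_mult_right b le)
      then have "(\<integral>y. norm (f x y) \<partial>lborel) \<le> a x * (\<integral>y. b y \<partial>lborel)" by simp
      moreover have "0 \<le> (\<integral>y. norm (f x y) \<partial>lborel)" by (rule Bochner_Integration.integral_nonneg) simp
      ultimately show "norm (\<integral>y. norm (f x y) \<partial>lborel) \<le> norm (a x * (\<integral>y. b y \<partial>lborel))" by simp
    qed
  qed
  then have int: "integrable (lborel \<Otimes>\<^sub>M lborel) (case_prod f)"
    using f' ix by (intro lborel_pair.Fubini_integrable) auto
  show "(\<integral>y. (\<integral>x. f x y \<partial>lborel) \<partial>lborel) = (\<integral>x. (\<integral>y. f x y \<partial>lborel) \<partial>lborel)"
    by (rule lborel_pair.Fubini_integral[OF int])
  show "integrable lborel (\<lambda>x. \<integral>y. f x y \<partial>lborel)" by (rule lborel_pair.integrable_fst[OF int])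
  show "integrable lborel (\<lambda>y. \<integral>x. f x y \<partial>lborel)" by (rule lborel_pair.integrable_snd[OF int])
qed

lemma exp_decay_integral:
  assumes "x > (0::real)"
  shows "(\<integral>\<^sup>+k. ennreal (indicator {0..} k * exp (- (x * k))) \<partial>lborel) = ennreal (1 / x)"
    and "integrable lborel (\<lambda>k. indicator {0..} k * exp (- (x * k)))"
proof -
  have "(\<integral>\<^sup>+k. ennreal (exp (- (x * k))) * indicator {0..} k \<partial>lborel) = ennreal (0 - (- exp (- (x * 0)) / x))"
  proof (rule nn_integral_FTC_atLeast)
    show "DERIV (\<lambda>k. - exp (- (x * k)) / x) k :> exp (- (x * k))" for k
      using assms by (auto intro!: derivative_eq_intros)
    have "((\<lambda>k. exp (- (x * k))) \<longlongrightarrow> 0) at_top"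
      using assms by (intro filterlim_compose[OF exp_at_bot] filterlim_compose[OF filterlim_uminus_at_bot_at_top]
          filterlim_tendsto_pos_mult_at_top[OF tendsto_const _ filterlim_ident])
    then have "((\<lambda>k. - exp (- (x * k)) / x) \<longlongrightarrow> - 0 / x) at_top" using assms by (intro tendsto_intros) auto
    then show "((\<lambda>k. - exp (- (x * k)) / x) \<longlongrightarrow> 0) at_top" by simp
  qed auto
  moreover have "(\<integral>\<^sup>+k. ennreal (indicator {0..} k * exp (- (x * k))) \<partial>lborel) = (\<integral>\<^sup>+k. ennreal (exp (- (x * k))) * indicator {0..} k \<partial>lborel)"
    by (intro nn_integral_cong) (auto simp: indicator_def)
  ultimately show N: "(\<integral>\<^sup>+k. ennreal (indicator {0..} k * exp (- (x * k))) \<partial>lborel) = ennreal (1 / x)" by simp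
  show "integrable lborel (\<lambda>k. indicator {0..} k * exp (- (x * k)))"
    by (rule integrableI_nonneg) (use N in auto)
qed

lemma Laplace_exp:
  assumes w: "Re w > 0"
  shows "(\<integral>k. of_real (indicator {0..} k) * exp (- (w * of_real k)) \<partial>lborel) = 1 / w"
proof -
  have w0: "w \<noteq> 0" using w by auto
  let ?f = "\<lambda>k::real. exp (- (w * of_real k))"
  let ?w = "\<lambda>k. indicator {0..} k * exp (- (Re w * k)) :: real"
  have ft: "(\<integral>k. indicator {0..real n} k *\<^sub>R ?f k \<partial>lborel) = (1 - exp (- (w * of_real (real n)))) / w" for n
  proof -
    have "(\<integral>k. indicator {0..real n} k *\<^sub>R ?f k \<partial>lborel) = - exp (- (w * of_real (real n))) / w - - exp (- (w * of_real 0)) / w"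
    proof (rule integral_FTC_Icc)
      fix k :: real
      have "((\<lambda>z. - exp (- (w * z)) / w) has_field_derivative exp (- (w * of_real k))) (at (of_real k))"
        using w0 by (auto intro!: derivative_eq_intros)
      from has_vector_derivative_real_field[OF this]
      show "((\<lambda>k. - exp (- (w * of_real k)) / w) has_vector_derivative ?f k) (at k within {0..real n})" by simp
    qed (auto intro!: continuous_intros)
    then show ?thesis by (simp add: diff_divide_distrib)
  qed
  have "(\<lambda>n. \<integral>k. indicator {0..real n} k *\<^sub>R ?f k \<partial>lborel) \<longlonglongrightarrow> (\<integral>k. of_real (indicator {0..} k) * ?f k \<partial>lborel)"
  proof (rule integral_dominated_convergence[where w = ?w])
    show "integrable lborel ?w" by (rule exp_decay_integral(2)[OF w])
    show "AE k in lborel. (\<lambda>n. indicator {0..real n} k *\<^sub>R ?f k) \<longlonglongrightarrow> of_real (indicator {0..} k) * ?f k"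
    proof (rule AE_I2, rule tendsto_eventually)
      fix k :: real
      obtain N :: nat where "k \<le> real N" using real_arch_simple by blast
      then have "indicator {0..real n} k *\<^sub>R ?f k = of_real (indicator {0..} k) * ?f k" if "n \<ge> N" for n
        using that by (auto simp: indicator_def)
      then show "\<forall>\<^sub>F n in sequentially. indicator {0..real n} k *\<^sub>R ?f k = of_real (indicator {0..} k) * ?f k"
        unfolding eventually_sequentially by blast
    qed
    show "AE k in lborel. norm (indicator {0..real n} k *\<^sub>R ?f k) \<le> ?w k" for n
      by (rule AE_I2) (auto simp: indicator_def)
  qed measurable
  moreover have "(\<lambda>n. (1 - exp (- (w * of_real (real n)))) / w) \<longlonglongrightarrow> (1 - 0) / w"
  proof (intro tendsto_intros)
    show "(\<lambda>n. exp (- (w * of_real (real n)))) \<longlonglongrightarrow> 0"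
    proof (rule tendsto_norm_zero_cancel)
      have "(\<lambda>n. exp (- Re w) ^ n) \<longlonglongrightarrow> 0" using w by (intro LIMSEQ_realpow_zero) auto
      moreover have "norm (exp (- (w * of_real (real n)))) = exp (- Re w) ^ n" for n
        by (simp add: exp_of_nat_mult[symmetric] mult.commute)
      ultimately show "(\<lambda>n. norm (exp (- (w * of_real (real n))))) \<longlonglongrightarrow> 0" by simp
    qed
  qed (use w0 in auto)
  ultimately show ?thesis unfolding ft by (simp add: LIMSEQ_unique)
qed

text \<open>The Fourier transform, with the normalisation for which the Cauchy transform on the right half-plane is the
Laplace transform of its values at \<open>k \<ge> 0\<close>.\<close>

definition fhat :: "(real \<Rightarrow> complex) \<Rightarrow> real \<Rightarrow> complex" where
  "fhat g k = of_real (1 / (2 * pi)) * (\<integral>u. g u * cis (k * u) \<partial>lborel)"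

text \<open>The density over \<open>k \<ge> 0\<close> of the square integral on the boundary from the right; positive and negative
frequencies belong to the two sides of the line.\<close>

definition spec :: "(real \<Rightarrow> complex) \<Rightarrow> real \<Rightarrow> real" where
  "spec g k = 2 * pi * (indicator {0..} k * (cmod (fhat g k))\<^sup>2)"

lemma cis_measurable [measurable]: "f \<in> borel_measurable M \<Longrightarrow> (\<lambda>x. cis (f x)) \<in> borel_measurable M"
  unfolding cis_conv_exp by measurable

lemma fhat_measurable:
  assumes "nice g" shows "fhat g \<in> borel_measurable borel"
proof -
  note [measurable] = nice_measurable[OF assms]
  show ?thesis unfolding fhat_def[abs_def] by measurable
qed

lemma spec_measurable:
  assumes "nice g" shows "spec g \<in> borel_measurable borel"
proof -
  note [measurable] = fhat_measurable[OF assms]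
  show ?thesis unfolding spec_def[abs_def] by measurable
qed

lemma spec_nonneg: "spec g k \<ge> 0" by (simp add: spec_def)

lemma fhat_bound:
  assumes "nice g" shows "cmod (fhat g k) \<le> (\<integral>u. cmod (g u) \<partial>lborel)"
proof -
  have "cmod (fhat g k) = 1 / (2 * pi) * cmod (\<integral>u. g u * cis (k * u) \<partial>lborel)" unfolding fhat_def norm_mult norm_of_real by simp
  also have "\<dots> \<le> 1 * (\<integral>u. cmod (g u * cis (k * u)) \<partial>lborel)"
    using pi_gt3 by (intro mult_mono integral_norm_bound) auto
  finally show ?thesis by (simp add: norm_mult)
qed

lemma ctrans_Laplace:
  assumes g: "nice g" and x: "x > 0"
  shows "ctrans g (Complex x y) = (\<integral>k. of_real (indicator {0..} k * exp (- (x * k))) * cis (- (k * y)) * fhat g k \<partial>lborel)"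
    and "integrable lborel (\<lambda>k. of_real (indicator {0..} k * exp (- (x * k))) * cis (- (k * y)) * fhat g k)"
proof -
  note [measurable] = nice_measurable[OF g]
  let ?e = "\<lambda>k. of_real (indicator {0..} k * exp (- (x * k))) :: complex"
  let ?f = "\<lambda>u k. g u * (?e k * cis (- (k * y)) * cis (k * u))"
  have [measurable]: "case_prod ?f \<in> borel_measurable (borel \<Otimes>\<^sub>M borel)" by measurable
  note F = Fubini_dominated[of ?f "\<lambda>u. cmod (g u)" "\<lambda>k. indicator {0..} k * exp (- (x * k))", OF _ integrable_norm[OF nice_integrable[OF g]] exp_decay_integral(2)[OF x]]
  have le: "cmod (?f u k) \<le> cmod (g u) * (indicator {0..} k * exp (- (x * k)))" for u k
    by (simp add: norm_mult abs_mult)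
  have inner: "(\<integral>k. ?f u k \<partial>lborel) = g u / (Complex x y - Complex 0 u)" for u
  proof -
    have Re: "Re (Complex x y - Complex 0 u) > 0" using x by simp
    have "?f u k = g u * (of_real (indicator {0..} k) * exp (- ((Complex x y - Complex 0 u) * of_real k)))" for k
    proof -
      have "exp (- ((Complex x y - Complex 0 u) * of_real k)) = exp (of_real (- (x * k)) + \<i> * of_real (- (k * y)) + \<i> * of_real (k * u))"
        by (rule arg_cong[of _ _ exp]) (simp add: complex_eq_iff algebra_simps)
      also have "\<dots> = of_real (exp (- (x * k))) * cis (- (k * y)) * cis (k * u)"
        unfolding exp_add cis_conv_exp exp_of_real ..
      finally show ?thesis by (simp add: mult_ac)
    qed
    then have "(\<integral>k. ?f u k \<partial>lborel) = (\<integral>k. g u * (of_real (indicator {0..} k) * exp (- ((Complex x y - Complex 0 u) * of_real k))) \<partial>lborel)"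
      by (intro Bochner_Integration.integral_cong refl)
    also have "\<dots> = g u * (1 / (Complex x y - Complex 0 u))"
      unfolding integral_mult_right_zero Laplace_exp[OF Re] ..
    finally show ?thesis by simp
  qed
  have outer: "(\<integral>u. ?f u k \<partial>lborel) = of_real (2 * pi) * (?e k * cis (- (k * y)) * fhat g k)" for k
  proof -
    have "(\<integral>u. ?f u k \<partial>lborel) = (\<integral>u. (?e k * cis (- (k * y))) * (g u * cis (k * u)) \<partial>lborel)"
      by (intro Bochner_Integration.integral_cong refl) (simp add: mult_ac)
    also have "\<dots> = (?e k * cis (- (k * y))) * (\<integral>u. g u * cis (k * u) \<partial>lborel)" by (rule integral_mult_right_zero)
    finally show ?thesis by (simp add: fhat_def)
  qed
  have "integrable lborel (\<lambda>k. of_real (2 * pi) * (?e k * cis (- (k * y)) * fhat g k))"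
    using F(3)[OF _ le] unfolding outer by simp
  then have "integrable lborel (\<lambda>k. of_real (1 / (2 * pi)) * (of_real (2 * pi) * (?e k * cis (- (k * y)) * fhat g k)))"
    by (rule integrable_mult_right)
  moreover have "of_real (1 / (2 * pi)) * (of_real (2 * pi) * c) = c" for c :: complex
    by (simp add: mult.assoc[symmetric] of_real_mult[symmetric] del: of_real_mult)
  ultimately show "integrable lborel (\<lambda>k. ?e k * cis (- (k * y)) * fhat g k)" by simp
  have "(\<integral>u. g u / (Complex x y - Complex 0 u) \<partial>lborel) = (\<integral>k. of_real (2 * pi) * (?e k * cis (- (k * y)) * fhat g k) \<partial>lborel)"
    using F(1)[OF _ le] unfolding inner outer by simp
  also have "\<dots> = of_real (2 * pi) * (\<integral>k. ?e k * cis (- (k * y)) * fhat g k \<partial>lborel)" by (rule integral_mult_right_zero)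
  finally show "ctrans g (Complex x y) = (\<integral>k. ?e k * cis (- (k * y)) * fhat g k \<partial>lborel)"
    unfolding ctrans_def by simp
qed

lemma cnj_ctrans: "of_real (2 * pi) * cnj (ctrans g (Complex x y)) = (\<integral>u. cnj (g u) / (Complex (2 * x) u - Complex x y) \<partial>lborel)"
proof -
  have "cnj (ctrans g (Complex x y)) = - ctrans (\<lambda>u. cnj (g u)) (Complex (- x) y)"
    using ctrans_cnj[of g "- x" y] by simp
  also have "\<dots> = of_real (1 / (2 * pi)) * - (\<integral>u. cnj (g u) / (Complex (- x) y - Complex 0 u) \<partial>lborel)"
    unfolding ctrans_def by simp
  also have "- (\<integral>u. cnj (g u) / (Complex (- x) y - Complex 0 u) \<partial>lborel) = (\<integral>u. - (cnj (g u) / (Complex (- x) y - Complex 0 u)) \<partial>lborel)"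
    by (rule Bochner_Integration.integral_minus[symmetric])
  also have "(\<lambda>u. - (cnj (g u) / (Complex (- x) y - Complex 0 u))) = (\<lambda>u. cnj (g u) / (Complex (2 * x) u - Complex x y))"
  proof
    fix u
    have "Complex (2 * x) u - Complex x y = - (Complex (- x) y - Complex 0 u)" by (simp add: complex_eq_iff)
    then show "- (cnj (g u) / (Complex (- x) y - Complex 0 u)) = cnj (g u) / (Complex (2 * x) u - Complex x y)"
      by (simp only: minus_divide_right)
  qed
  finally have "cnj (ctrans g (Complex x y)) = of_real (1 / (2 * pi)) * (\<integral>u. cnj (g u) / (Complex (2 * x) u - Complex x y) \<partial>lborel)" .
  then show ?thesis by simp
qed

lemma cnj_fhat: "of_real (2 * pi) * cnj (fhat g k) = (\<integral>u. cnj (g u) * cis (- (k * u)) \<partial>lborel)"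
proof -
  have "(\<integral>u. cnj (g u) * cis (- (k * u)) \<partial>lborel) = (\<integral>u. cnj (g u * cis (k * u)) \<partial>lborel)"
    by (simp add: cis_cnj)
  also have "\<dots> = cnj (\<integral>u. g u * cis (k * u) \<partial>lborel)" by (rule Bochner_Integration.integral_cnj)
  finally show ?thesis unfolding fhat_def by simp
qed

text \<open>One factor of \<open>|K|\<^sup>2\<close> is written as an integral against \<open>g\<close>. The remaining integral over the line is a Cauchy
integral of \<open>K\<close> at the mirror point \<open>2 x + \<i> u\<close>, which the Laplace representation turns back into \<open>fhat\<close>.\<close>

lemma ctrans_Plancherel:
  assumes g: "nice g" and x: "x > 0"
  shows "(\<integral>\<^sup>+y. ennreal ((cmod (ctrans g (Complex x y)))\<^sup>2) \<partial>lborel) = (\<integral>\<^sup>+k. ennreal (exp (- (2 * x * k)) * spec g k) \<partial>lborel)"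
proof -
  note gm[measurable] = nice_measurable[OF g]
  note Km[measurable] = ctrans_line_measurable(1)[OF g x]
  note fm[measurable] = fhat_measurable[OF g]
  let ?K = "\<lambda>y. ctrans g (Complex x y)"
  let ?G = "\<lambda>z. ctrans g (z + of_real x)"
  have dec: "decaying x 1 ?G" by (rule ctrans_decaying[OF g x])
  obtain D where D: "D \<ge> 0" "\<And>y. cmod (?K y) \<le> D * (1 + \<bar>y\<bar>) powr (- 1)"
  proof -
    obtain D where "D \<ge> 0" "\<And>x' y. 0 \<le> x' \<Longrightarrow> cmod (?G (Complex x' y)) \<le> D * (1 + \<bar>y\<bar>) powr (- 1)"
      using decaying_bound[OF dec] by auto
    then show ?thesis using that[of D] by (metis Complex_0_shift(1) order_refl)
  qed
  obtain M where M: "M \<ge> 0" "\<And>u. cmod (g u) \<le> M" "\<And>u. M < \<bar>u\<bar> \<Longrightarrow> g u = 0" using nice_ex[OF g] by auto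
  let ?C = "(1 + x + (x + M)) / x"
  have C: "?C \<ge> 0" using x M by auto
  let ?f = "\<lambda>u y. cnj (g u) * (?K y / (Complex (2 * x) u - Complex x y))"
  have fle: "cmod (?f u y) \<le> cmod (g u) * (D * ?C * (1 + \<bar>y\<bar>) powr (- 2))" for u y
  proof (cases "M < \<bar>u\<bar>")
    case True then show ?thesis using M(3) by simp
  next
    case False
    have "x \<le> \<bar>Re (Complex x u - Complex 0 y)\<bar>" using x by simp
    also have "\<dots> \<le> cmod (Complex x u - Complex 0 y)" by (rule abs_Re_le_cmod)
    finally have "inverse (cmod (Complex x u - Complex 0 y)) \<le> (1 + x + cmod (Complex x u)) / x * (1 + cmod (Complex 0 y)) powr (- 1)"
      by (rule distance_lower_bound[OF x])
    also have "\<dots> \<le> ?C * (1 + \<bar>y\<bar>) powr (- 1)"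
    proof (intro mult_mono divide_right_mono)
      have "cmod (Complex x u) \<le> \<bar>x\<bar> + \<bar>u\<bar>" using cmod_le[of "Complex x u"] by simp
      then show "1 + x + cmod (Complex x u) \<le> 1 + x + (x + M)" using False x by simp
    qed (use x C in \<open>auto simp: cmod_def\<close>)
    finally have k: "inverse (cmod (Complex x u - Complex 0 y)) \<le> ?C * (1 + \<bar>y\<bar>) powr (- 1)" .
    have "cmod (?K y) * inverse (cmod (Complex x u - Complex 0 y)) \<le> (D * (1 + \<bar>y\<bar>) powr (- 1)) * (?C * (1 + \<bar>y\<bar>) powr (- 1))"
      using D k by (intro mult_mono) auto
    also have "\<dots> = D * ?C * ((1 + \<bar>y\<bar>) powr (- 1) * (1 + \<bar>y\<bar>) powr (- 1))" by (simp only: mult_ac)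
    also have "(1 + \<bar>y\<bar>) powr (- 1) * (1 + \<bar>y\<bar>) powr (- 1) = (1 + \<bar>y\<bar>) powr (- 2)"
      by (subst powr_add[symmetric]) simp
    finally have "cmod (g u) * (cmod (?K y) * inverse (cmod (Complex x u - Complex 0 y))) \<le> cmod (g u) * (D * ?C * (1 + \<bar>y\<bar>) powr (- 2))"
      by (intro mult_left_mono) auto
    moreover have "Complex (2 * x) u - Complex x y = Complex x u - Complex 0 y" by (simp add: complex_eq_iff)
    ultimately show ?thesis by (simp only: norm_mult norm_divide norm_inverse divide_inverse complex_mod_cnj)
  qed
  have fmeas: "case_prod ?f \<in> borel_measurable (borel \<Otimes>\<^sub>M borel)"
  proof -
    have [measurable]: "(\<lambda>x. cnj (g x)) \<in> borel_measurable borel" using nice_measurable[OF nice_cnj[OF g]] .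
    have [measurable]: "(\<lambda>p. ?K (snd p)) \<in> borel_measurable (borel \<Otimes>\<^sub>M borel)"
      by (rule measurable_compose[OF measurable_snd Km])
    have [measurable]: "(\<lambda>p. Complex (2 * x) (fst p) - Complex x (snd p)) \<in> borel_measurable (borel \<Otimes>\<^sub>M borel)"
      unfolding Complex_eq by (intro borel_measurable_diff borel_measurable_add borel_measurable_times borel_measurable_const
        measurable_compose[OF measurable_fst borel_measurable_of_real]
        measurable_compose[OF measurable_snd borel_measurable_of_real])
    show ?thesis unfolding case_prod_beta' by measurable
  qed
  have bint: "integrable lborel (\<lambda>y. D * ?C * (1 + \<bar>y\<bar>) powr (- 2))"
    by (intro integrable_mult_right integrable_power_decay) simp
  note F = Fubini_dominated[OF fmeas integrable_norm[OF nice_integrable[OF g]] bint fle]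
  \<comment> \<open>Cauchy formula on the line through x, at the mirror image of the point on the imaginary axis\<close>
  have inner1: "(\<integral>y. ?f u y \<partial>lborel) = of_real (2 * pi) * (cnj (g u) * ctrans g (Complex (2 * x) u))" for u
  proof -
    have "(\<integral>y. ?f u y \<partial>lborel) = cnj (g u) * (\<integral>y. ?G (Complex 0 y) / (Complex x u - Complex 0 y) \<partial>lborel)"
    proof -
      have "Complex (2 * x) u - Complex x y = Complex x u - Complex 0 y" for y by (simp add: complex_eq_iff)
      then show ?thesis by (simp del: times_divide_eq_right)
    qed
    also have "(\<integral>y. ?G (Complex 0 y) / (Complex x u - Complex 0 y) \<partial>lborel) = of_real (2 * pi) * ?G (Complex x u)"
      using halfplane_Cauchy_formula(2)[OF dec x, of "Complex x u"] x by simp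
    also have "Complex x u + of_real x = Complex (2 * x) u" by (simp add: complex_eq_iff)
    also have "cnj (g u) * (of_real (2 * pi) * ctrans g (Complex (2 * x) u)) = of_real (2 * pi) * (cnj (g u) * ctrans g (Complex (2 * x) u))"
      by (rule mult.left_commute)
    finally show ?thesis .
  qed
  have inner2: "(\<integral>u. ?f u y \<partial>lborel) = of_real (2 * pi) * (?K y * cnj (?K y))" for y
  proof -
    have c: "of_real (2 * pi) * cnj (?K y) = (\<integral>u. cnj (g u) / (Complex (2 * x) u - Complex x y) \<partial>lborel)"
      by (rule cnj_ctrans)
    have "(\<integral>u. ?f u y \<partial>lborel) = (\<integral>u. ?K y * (cnj (g u) / (Complex (2 * x) u - Complex x y)) \<partial>lborel)"
      by (intro Bochner_Integration.integral_cong refl) (simp add: mult_ac)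
    also have "\<dots> = ?K y * (\<integral>u. cnj (g u) / (Complex (2 * x) u - Complex x y) \<partial>lborel)" by (rule integral_mult_right_zero)
    finally show ?thesis unfolding c[symmetric] by (simp add: mult_ac)
  qed
  have step1: "(\<integral>y. ?K y * cnj (?K y) \<partial>lborel) = (\<integral>u. cnj (g u) * ctrans g (Complex (2 * x) u) \<partial>lborel)"
    using F(1) unfolding inner1 inner2 by simp
  let ?e = "\<lambda>k. of_real (indicator {0..} k * exp (- (2 * x * k))) :: complex"
  let ?h = "\<lambda>u k. cnj (g u) * (?e k * cis (- (k * u)) * fhat g k)"
  let ?B = "\<integral>u. cmod (g u) \<partial>lborel"
  have hle: "cmod (?h u k) \<le> cmod (g u) * ((indicator {0..} k * exp (- (2 * x * k))) * ?B)" for u k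
  proof -
    have "cmod (?h u k) = cmod (g u) * ((indicator {0..} k * exp (- (2 * x * k))) * cmod (fhat g k))"
      by (simp add: norm_mult abs_mult)
    also have "\<dots> \<le> cmod (g u) * ((indicator {0..} k * exp (- (2 * x * k))) * ?B)"
      by (intro mult_left_mono fhat_bound[OF g]) auto
    finally show ?thesis .
  qed
  have hmeas: "case_prod ?h \<in> borel_measurable (borel \<Otimes>\<^sub>M borel)"
  proof -
    have [measurable]: "(\<lambda>x. cnj (g x)) \<in> borel_measurable borel" using nice_measurable[OF nice_cnj[OF g]] .
    show ?thesis by measurable
  qed
  have x2: "2 * x > 0" using x by simp
  note H = Fubini_dominated[OF hmeas integrable_norm[OF nice_integrable[OF g]] integrable_mult_left[OF exp_decay_integral(2)[OF x2], of ?B] hle]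
  have hin1: "(\<integral>k. ?h u k \<partial>lborel) = cnj (g u) * ctrans g (Complex (2 * x) u)" for u
    unfolding ctrans_Laplace(1)[OF g x2] by (rule integral_mult_right_zero)
  have hin2: "(\<integral>u. ?h u k \<partial>lborel) = of_real (exp (- (2 * x * k)) * spec g k)" for k
  proof -
    have c: "of_real (2 * pi) * cnj (fhat g k) = (\<integral>u. cnj (g u) * cis (- (k * u)) \<partial>lborel)"
      by (rule cnj_fhat)
    have "(\<integral>u. ?h u k \<partial>lborel) = (\<integral>u. (?e k * fhat g k) * (cnj (g u) * cis (- (k * u))) \<partial>lborel)"
      by (intro Bochner_Integration.integral_cong refl) (simp add: mult_ac)
    also have "\<dots> = (?e k * fhat g k) * (of_real (2 * pi) * cnj (fhat g k))"
      unfolding c by (rule integral_mult_right_zero)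
    also have "\<dots> = of_real (2 * pi * (indicator {0..} k * exp (- (2 * x * k)))) * (fhat g k * cnj (fhat g k))"
      by (simp add: mult_ac)
    also have "fhat g k * cnj (fhat g k) = of_real ((cmod (fhat g k))\<^sup>2)" by (rule complex_norm_square[symmetric])
    finally show ?thesis by (simp add: spec_def mult_ac)
  qed
  have K2: "?K y * cnj (?K y) = of_real ((cmod (?K y))\<^sup>2)" for y by (rule complex_norm_square[symmetric])
  have i1: "integrable lborel (\<lambda>y. (cmod (?K y))\<^sup>2)"
    using ctrans_line_integrable_powr(1)[OF g x, of 2] by simp
  have "integrable lborel (\<lambda>k. complex_of_real (exp (- (2 * x * k)) * spec g k))" using H(3) unfolding hin2 .
  then have i2: "integrable lborel (\<lambda>k. exp (- (2 * x * k)) * spec g k)" using integrable_Re by fastforce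
  have "complex_of_real (\<integral>y. (cmod (?K y))\<^sup>2 \<partial>lborel) = complex_of_real (\<integral>k. exp (- (2 * x * k)) * spec g k \<partial>lborel)"
    using step1 H(1) unfolding hin1 hin2 K2 by (simp only: integral_complex_of_real)
  then have eq: "(\<integral>y. (cmod (?K y))\<^sup>2 \<partial>lborel) = (\<integral>k. exp (- (2 * x * k)) * spec g k \<partial>lborel)" by (simp only: of_real_eq_iff)
  show ?thesis
    using nn_integral_eq_integral[OF i1] nn_integral_eq_integral[OF i2] eq spec_nonneg by simp
qed

text \<open>Passage from parallel lines to the boundary by Fatou's lemma, for two spectral densities at a time.\<close>

lemma spec_le_lim:
  assumes g: "nice g" and le: "\<And>x. x > 0 \<Longrightarrow> (\<integral>\<^sup>+y. ennreal ((cmod (ctrans g (Complex x y)))\<^sup>2) \<partial>lborel) + C x \<le> A"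
    and C: "\<And>x. x > 0 \<Longrightarrow> C x = (\<integral>\<^sup>+k. ennreal (exp (- (2 * x * k)) * h k) \<partial>lborel)" "h \<in> borel_measurable borel" "\<And>k. h k \<ge> 0" "\<And>k. k < 0 \<Longrightarrow> h k = 0"
  shows "(\<integral>\<^sup>+k. ennreal (spec g k) \<partial>lborel) + (\<integral>\<^sup>+k. ennreal (h k) \<partial>lborel) \<le> A"
proof -
  note [measurable] = spec_measurable[OF g] C(2)
  let ?d = "\<lambda>n. inverse (real (Suc n))"
  let ?s = "\<lambda>n k. exp (- (2 * ?d n * k)) * (spec g k + h k)"
  have lim: "(\<lambda>n. ennreal (?s n k)) \<longlonglongrightarrow> ennreal (spec g k + h k)" for k
  proof -
    have "(\<lambda>n. exp (- (2 * ?d n * k)) * (spec g k + h k)) \<longlonglongrightarrow> exp (- (2 * 0 * k)) * (spec g k + h k)"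
      by (intro tendsto_intros LIMSEQ_inverse_real_of_nat)
    then show ?thesis by (intro tendsto_ennrealI) simp
  qed
  have "(\<integral>\<^sup>+k. ennreal (spec g k) \<partial>lborel) + (\<integral>\<^sup>+k. ennreal (h k) \<partial>lborel) = (\<integral>\<^sup>+k. ennreal (spec g k + h k) \<partial>lborel)"
    using C(3) spec_nonneg by (subst nn_integral_add[symmetric]) (auto simp: ennreal_plus)
  also have "\<dots> = (\<integral>\<^sup>+k. liminf (\<lambda>n. ennreal (?s n k)) \<partial>lborel)"
    by (intro nn_integral_cong) (metis lim lim_imp_Liminf sequentially_bot)
  also have "\<dots> \<le> liminf (\<lambda>n. \<integral>\<^sup>+k. ennreal (?s n k) \<partial>lborel)"
    by (intro nn_integral_liminf) auto
  also have "\<dots> \<le> liminf (\<lambda>n. A)"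
  proof (intro Liminf_mono always_eventually allI)
    fix n
    have d: "?d n > 0" by simp
    have "(\<integral>\<^sup>+k. ennreal (?s n k) \<partial>lborel) = (\<integral>\<^sup>+k. ennreal (exp (- (2 * ?d n * k)) * spec g k) + ennreal (exp (- (2 * ?d n * k)) * h k) \<partial>lborel)"
      using C(3) spec_nonneg by (intro nn_integral_cong) (simp add: distrib_left ennreal_plus[symmetric] del: ennreal_plus)
    also have "\<dots> = (\<integral>\<^sup>+k. ennreal (exp (- (2 * ?d n * k)) * spec g k) \<partial>lborel) + (\<integral>\<^sup>+k. ennreal (exp (- (2 * ?d n * k)) * h k) \<partial>lborel)"
      by (intro nn_integral_add) auto
    also have "\<dots> \<le> A" using le[OF d] unfolding ctrans_Plancherel[OF g d] C(1)[OF d] .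
    finally show "(\<integral>\<^sup>+k. ennreal (?s n k) \<partial>lborel) \<le> A" .
  qed
  also have "\<dots> = A" by (rule Liminf_const) simp
  finally show ?thesis .
qed

text \<open>The two sides of a line share one total mass. This orthogonality is what makes the exponent 2 cheaper than all
other exponents.\<close>

lemma spec_total:
  assumes g: "nice g" and a: "Lp_le 2 lborel g a"
  shows "(\<integral>\<^sup>+k. ennreal (spec g k) \<partial>lborel) + (\<integral>\<^sup>+k. ennreal (spec (\<lambda>u. g (- u)) k) \<partial>lborel) \<le> ennreal (a\<^sup>2)"
proof (rule spec_le_lim[OF g])
  note gr = nice_reflect[OF g]
  let ?C = "\<lambda>x. \<integral>\<^sup>+y. ennreal ((cmod (ctrans (\<lambda>u. g (- u)) (Complex x y)))\<^sup>2) \<partial>lborel"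
  show "?C x = (\<integral>\<^sup>+k. ennreal (exp (- (2 * x * k)) * spec (\<lambda>u. g (- u)) k) \<partial>lborel)" if "x > 0" for x
    by (rule ctrans_Plancherel[OF gr that])
  show "spec (\<lambda>u. g (- u)) \<in> borel_measurable borel" by (rule spec_measurable[OF gr])
  show "spec (\<lambda>u. g (- u)) k \<ge> 0" for k by (rule spec_nonneg)
  show "spec (\<lambda>u. g (- u)) k = 0" if "k < 0" for k using that by (simp add: spec_def)
  fix x :: real assume x: "x > 0"
  have i: "integrable lborel (\<lambda>y. (cmod (ctrans g (Complex x y)))\<^sup>2)" "integrable lborel (\<lambda>y. (cmod (ctrans g (Complex (- x) y)))\<^sup>2)"
    using ctrans_line_integrable_powr[OF g x, of 2] by simp_all
  have "?C x = (\<integral>\<^sup>+y. ennreal ((cmod (ctrans (\<lambda>u. g (- u)) (Complex x (- y))))\<^sup>2) \<partial>lborel)"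
    using nn_integral_real_affine[of "\<lambda>y. ennreal ((cmod (ctrans (\<lambda>u. g (- u)) (Complex x y)))\<^sup>2)" "-1" 0]
      ctrans_line_measurable(1)[OF gr x] by simp
  also have "\<dots> = (\<integral>\<^sup>+y. ennreal ((cmod (ctrans g (Complex (- x) y)))\<^sup>2) \<partial>lborel)"
    unfolding ctrans_left by simp
  finally have C: "?C x = (\<integral>\<^sup>+y. ennreal ((cmod (ctrans g (Complex (- x) y)))\<^sup>2) \<partial>lborel)" .
  show "(\<integral>\<^sup>+y. ennreal ((cmod (ctrans g (Complex x y)))\<^sup>2) \<partial>lborel) + ?C x \<le> ennreal (a\<^sup>2)"
    unfolding C nn_integral_eq_integral[OF i(1), simplified] nn_integral_eq_integral[OF i(2), simplified]
    using ctrans_L2(1)[OF g x a] by (simp flip: ennreal_plus add: Bochner_Integration.integral_nonneg)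
qed

lemma spec_mass:
  assumes "nice g" "Lp_le 2 lborel g a"
  shows "(\<integral>\<^sup>+k. ennreal (spec g k) \<partial>lborel) \<le> ennreal (a\<^sup>2)"
  using order_trans[OF _ spec_total[OF assms]] by simp

lemma Gamma_half_integral:
  assumes "x > 0"
  shows "(\<integral>\<^sup>+k. ennreal (indicator {0..} k * (exp (- (x * k)) * k powr (- (1 / 2)))) \<partial>lborel) = ennreal (sqrt (pi / x))"
proof -
  have "ennreal (sqrt pi) = (\<integral>\<^sup>+t. ennreal (indicator {0..} t * t powr (1 / 2 - 1) / exp t) \<partial>lborel)"
    unfolding Gamma_one_half_real[symmetric] by (rule Gamma_conv_nn_integral_real) simp
  also have "\<dots> = ennreal \<bar>x\<bar> * (\<integral>\<^sup>+k. ennreal (indicator {0..} (0 + x * k) * (0 + x * k) powr (1 / 2 - 1) / exp (0 + x * k)) \<partial>lborel)"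
    by (rule nn_integral_real_affine) (use assms in auto)
  also have "\<dots> = (\<integral>\<^sup>+k. ennreal (sqrt x) * ennreal (indicator {0..} k * (exp (- (x * k)) * k powr (- (1 / 2)))) \<partial>lborel)"
  proof (subst nn_integral_cmult[symmetric])
    have "x * x powr (- (1 / 2)) = sqrt x"
      using assms by (simp add: powr_mult_base powr_half_sqrt)
    then have "\<bar>x\<bar> * (indicator {0..} (0 + x * k) * (0 + x * k) powr (1 / 2 - 1) / exp (0 + x * k)) = sqrt x * (indicator {0..} k * (exp (- (x * k)) * k powr (- (1 / 2))))" for k
      using assms by (auto simp: indicator_def powr_mult exp_minus field_simps zero_le_mult_iff)
    then show "(\<integral>\<^sup>+k. ennreal \<bar>x\<bar> * ennreal (indicator {0..} (0 + x * k) * (0 + x * k) powr (1 / 2 - 1) / exp (0 + x * k)) \<partial>lborel)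
       = (\<integral>\<^sup>+k. ennreal (sqrt x) * ennreal (indicator {0..} k * (exp (- (x * k)) * k powr (- (1 / 2)))) \<partial>lborel)"
      using assms by (intro nn_integral_cong) (simp only: ennreal_mult'[symmetric] abs_ge_zero real_sqrt_ge_zero less_imp_le)
  qed simp
  also have "\<dots> = ennreal (sqrt x) * (\<integral>\<^sup>+k. ennreal (indicator {0..} k * (exp (- (x * k)) * k powr (- (1 / 2)))) \<partial>lborel)"
    by (rule nn_integral_cmult) simp
  finally have "ennreal (1 / sqrt x) * ennreal (sqrt pi) = ennreal (1 / sqrt x) * (ennreal (sqrt x) * (\<integral>\<^sup>+k. ennreal (indicator {0..} k * (exp (- (x * k)) * k powr (- (1 / 2)))) \<partial>lborel))"
    by simp
  also have "\<dots> = ennreal (1 / sqrt x * sqrt x) * (\<integral>\<^sup>+k. ennreal (indicator {0..} k * (exp (- (x * k)) * k powr (- (1 / 2)))) \<partial>lborel)"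
    using assms by (simp only: mult.assoc[symmetric] ennreal_mult' divide_nonneg_nonneg zero_le_one real_sqrt_ge_zero less_imp_le)
  also have "1 / sqrt x * sqrt x = 1" using assms by simp
  finally show ?thesis using assms by (simp add: ennreal_mult'[symmetric] real_sqrt_divide)
qed

text \<open>Cauchy-Schwarz for the Laplace representation with the weight \<open>k powr (- 1 / 4)\<close> split off: the first factor is
a Gamma integral, and the second one keeps enough decay in \<open>x\<close> to be integrated along a perpendicular ray,
uniformly in \<open>y\<close>.\<close>

lemma ctrans_pointwise:
  assumes g: "nice g" and x: "x > 0"
  shows "ennreal ((cmod (ctrans g (Complex x y)))\<^sup>2) \<le> ennreal (1 / (2 * sqrt (pi * x))) * (\<integral>\<^sup>+k. ennreal (exp (- (x * k)) * k powr (1 / 2) * spec g k) \<partial>lborel)"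
proof -
  note [measurable] = fhat_measurable[OF g] spec_measurable[OF g]
  define A where "A = (\<lambda>k. indicator {0..} k * (exp (- (x * k) / 2) * k powr (- (1 / 4))) :: real)"
  define B where "B = (\<lambda>k. indicator {0..} k * (exp (- (x * k) / 2) * k powr (1 / 4) * cmod (fhat g k)) :: real)"
  have AB0: "A k \<ge> 0" "B k \<ge> 0" for k by (auto simp: A_def B_def)
  have [measurable]: "A \<in> borel_measurable borel" "B \<in> borel_measurable borel" unfolding A_def B_def by measurable
  have ee: "exp (- (x * k) / 2) * exp (- (x * k) / 2) = exp (- (x * k))" for k by (simp flip: exp_add)
  have "ennreal (cmod (ctrans g (Complex x y))) \<le> (\<integral>\<^sup>+k. ennreal (cmod (of_real (indicator {0..} k * exp (- (x * k))) * cis (- (k * y)) * fhat g k)) \<partial>lborel)"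
    unfolding ctrans_Laplace(1)[OF g x] by (rule integral_norm_bound_ennreal[OF ctrans_Laplace(2)[OF g x]])
  also have "\<dots> = (\<integral>\<^sup>+k. ennreal (A k) * ennreal (B k) \<partial>lborel)"
  proof (rule nn_integral_cong_AE)
    show "AE k in lborel. ennreal (cmod (of_real (indicator {0..} k * exp (- (x * k))) * cis (- (k * y)) * fhat g k)) = ennreal (A k) * ennreal (B k)"
      using AE_lborel_singleton[of "0::real"]
    proof eventually_elim
      case (elim k)
      have "A k * B k = indicator {0..} k * ((exp (- (x * k) / 2) * exp (- (x * k) / 2)) * (k powr (- (1 / 4)) * k powr (1 / 4)) * cmod (fhat g k))"
        by (simp add: A_def B_def indicator_def)
      also have "\<dots> = indicator {0..} k * (exp (- (x * k)) * cmod (fhat g k))"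
        using elim unfolding ee by (simp add: indicator_def flip: powr_add)
      finally show ?case
        using AB0 by (simp add: norm_mult abs_mult ennreal_mult[symmetric])
    qed
  qed
  finally have "ennreal (cmod (ctrans g (Complex x y))) ^ 2 \<le> (\<integral>\<^sup>+k. ennreal (A k) * ennreal (B k) \<partial>lborel) ^ 2"
    by (rule power_mono) simp
  also have "\<dots> \<le> (\<integral>\<^sup>+k. ennreal (A k) ^ 2 \<partial>lborel) * (\<integral>\<^sup>+k. ennreal (B k) ^ 2 \<partial>lborel)"
    by (rule Cauchy_Schwarz_nn_integral) measurable
  also have "(\<integral>\<^sup>+k. ennreal (A k) ^ 2 \<partial>lborel) = ennreal (sqrt (pi / x))"
  proof -
    have "(A k)\<^sup>2 = indicator {0..} k * (exp (- (x * k)) * k powr (- (1 / 2)))" for k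
    proof -
      have "(A k)\<^sup>2 = indicator {0..} k * ((exp (- (x * k) / 2) * exp (- (x * k) / 2)) * (k powr (- (1 / 4)) * k powr (- (1 / 4))))"
        by (simp add: A_def power2_eq_square indicator_def)
      then show ?thesis unfolding ee powr_add[symmetric] by simp
    qed
    then show ?thesis using AB0 by (simp add: ennreal_power Gamma_half_integral[OF x])
  qed
  also have "(\<integral>\<^sup>+k. ennreal (B k) ^ 2 \<partial>lborel) = ennreal (1 / (2 * pi)) * (\<integral>\<^sup>+k. ennreal (exp (- (x * k)) * k powr (1 / 2) * spec g k) \<partial>lborel)"
  proof (subst nn_integral_cmult[symmetric])
    have "(B k)\<^sup>2 = 1 / (2 * pi) * (exp (- (x * k)) * k powr (1 / 2) * spec g k)" for k
    proof -
      have "(B k)\<^sup>2 = indicator {0..} k * ((exp (- (x * k) / 2) * exp (- (x * k) / 2)) * (k powr (1 / 4) * k powr (1 / 4)) * (cmod (fhat g k))\<^sup>2)"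
        by (simp add: B_def power2_eq_square indicator_def)
      then show ?thesis unfolding ee powr_add[symmetric] by (simp add: spec_def)
    qed
    then show "(\<integral>\<^sup>+k. ennreal (B k) ^ 2 \<partial>lborel) = (\<integral>\<^sup>+k. ennreal (1 / (2 * pi)) * ennreal (exp (- (x * k)) * k powr (1 / 2) * spec g k) \<partial>lborel)"
      using AB0 by (simp add: ennreal_power ennreal_mult'[symmetric])
  qed measurable
  also have "ennreal (sqrt (pi / x)) * (ennreal (1 / (2 * pi)) * (\<integral>\<^sup>+k. ennreal (exp (- (x * k)) * k powr (1 / 2) * spec g k) \<partial>lborel))
     = ennreal (sqrt (pi / x) * (1 / (2 * pi))) * (\<integral>\<^sup>+k. ennreal (exp (- (x * k)) * k powr (1 / 2) * spec g k) \<partial>lborel)"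
    using x by (simp only: mult.assoc[symmetric] ennreal_mult' real_sqrt_ge_zero divide_nonneg_nonneg pi_ge_zero less_imp_le)
  also have "sqrt (pi / x) * (1 / (2 * pi)) = 1 / (2 * sqrt (pi * x))"
  proof -
    have "sqrt pi * sqrt pi = pi" by simp
    then show ?thesis using x by (simp add: real_sqrt_divide real_sqrt_mult field_simps)
  qed
  finally show ?thesis by (simp add: ennreal_power)
qed

section \<open>Integrals over a line and perpendicular segments\<close>

text \<open>The integrand for a line at distance \<open>b\<close> together with two perpendicular segments that join it to the
boundary line, with weights. Having it in a single variable allows limits to be taken in all three
parts at once.\<close>

definition Jint :: "real \<Rightarrow> real \<Rightarrow> real \<Rightarrow> real \<Rightarrow> real \<Rightarrow> real \<Rightarrow> real \<Rightarrow> (complex \<Rightarrow> complex) \<Rightarrow> real \<Rightarrow> real" where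
  "Jint q b c0 c1 c2 y1 y2 F x = c0 * cmod (F (Complex b x)) powr q +
     indicator {0<..<b} x * (c1 * cmod (F (Complex x y1)) powr q + c2 * cmod (F (Complex x y2)) powr q)"

text \<open>With \<open>s\<^sup>2 = b k\<close>, this says that the weighted contributions of the frequency \<open>k\<close> do not exceed \<open>\<rho>\<close> times its
spectral density: it contributes \<open>exp (- 2 b k)\<close> on the line, and on a segment at most \<open>1 / 2\<close> and at most
\<open>sqrt (b k / pi)\<close>.\<close>

definition admissible :: "real \<Rightarrow> real \<Rightarrow> real \<Rightarrow> real \<Rightarrow> bool" where
  "admissible c0 c1 c2 \<rho> \<longleftrightarrow> c0 \<ge> 0 \<and> c1 \<ge> 0 \<and> c2 \<ge> 0 \<and> \<rho> \<ge> 0 \<and>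
     (\<forall>s\<ge>0. c0 * exp (- (2 * s\<^sup>2)) + (c1 + c2) * min (1 / 2) (s / sqrt pi) \<le> \<rho>)"

text \<open>The bound \<open>1 / 2\<close> is the integral over the whole ray; the other one drops the exponential.\<close>

lemma segment_inner:
  assumes b: "b > 0" and k: "k \<ge> 0"
  shows "ennreal (k powr (1 / 2) / (2 * sqrt pi)) * (\<integral>\<^sup>+x. ennreal (indicator {0<..<b} x * (exp (- (x * k)) * x powr (- (1 / 2)))) \<partial>lborel)
     \<le> ennreal (min (1 / 2) (sqrt (b * k) / sqrt pi))"
proof (cases "k = 0")
  case True then show ?thesis by simp
next
  case False
  then have k: "k > 0" using assms by simp
  let ?I = "\<integral>\<^sup>+x. ennreal (indicator {0<..<b} x * (exp (- (x * k)) * x powr (- (1 / 2)))) \<partial>lborel"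
  have kp: "k powr (1 / 2) = sqrt k" using k by (simp add: powr_half_sqrt)
  have "?I \<le> (\<integral>\<^sup>+x. ennreal (indicator {0..} x * (exp (- (k * x)) * x powr (- (1 / 2)))) \<partial>lborel)"
    by (intro nn_integral_mono ennreal_leI) (auto simp: indicator_def mult.commute)
  also have "\<dots> = ennreal (sqrt (pi / k))" by (rule Gamma_half_integral[OF k])
  finally have "ennreal (k powr (1 / 2) / (2 * sqrt pi)) * ?I \<le> ennreal (k powr (1 / 2) / (2 * sqrt pi)) * ennreal (sqrt (pi / k))"
    by (rule mult_left_mono) simp
  also have "\<dots> = ennreal (1 / 2)"
    using k by (simp add: ennreal_mult'[symmetric] kp real_sqrt_divide)
  finally have 1: "ennreal (k powr (1 / 2) / (2 * sqrt pi)) * ?I \<le> ennreal (1 / 2)" .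
  have "?I \<le> (\<integral>\<^sup>+x. ennreal (x powr (- (1 / 2))) * indicator {0..b} x \<partial>lborel)"
    using k by (intro nn_integral_mono) (auto simp: indicator_def intro!: ennreal_leI mult_left_le_one_le)
  also have "\<dots> = ennreal (b powr (- (1 / 2) + 1) / (- (1 / 2) + 1))"
  proof (rule nn_integral_has_integral_lebesgue')
    show "((\<lambda>x. x powr (- (1 / 2))) has_integral b powr (- (1 / 2) + 1) / (- (1 / 2) + 1)) {0..b}"
      by (rule has_integral_powr_from_0) (use b in auto)
  qed simp
  also have "b powr (- (1 / 2) + 1) / (- (1 / 2) + 1) = 2 * sqrt b" using b by (simp add: powr_half_sqrt)
  finally have "ennreal (k powr (1 / 2) / (2 * sqrt pi)) * ?I \<le> ennreal (k powr (1 / 2) / (2 * sqrt pi)) * ennreal (2 * sqrt b)"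
    by (rule mult_left_mono) simp
  also have "\<dots> = ennreal (sqrt (b * k) / sqrt pi)"
    using k b by (simp add: ennreal_mult'[symmetric] kp real_sqrt_mult mult.commute)
  finally have 2: "ennreal (k powr (1 / 2) / (2 * sqrt pi)) * ?I \<le> ennreal (sqrt (b * k) / sqrt pi)" .
  show ?thesis using 1 2 by (simp add: min_def)
qed

text \<open>Integrate the pointwise bound along the segment and exchange the integrals.\<close>

lemma segment_bound:
  assumes g: "nice g" and b: "b > 0"
  shows "(\<integral>\<^sup>+x. ennreal (indicator {0<..<b} x * (cmod (ctrans g (Complex x y)))\<^sup>2) \<partial>lborel)
     \<le> (\<integral>\<^sup>+k. ennreal (min (1 / 2) (sqrt (b * k) / sqrt pi) * spec g k) \<partial>lborel)"
proof -
  note [measurable] = spec_measurable[OF g]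
  let ?w = "\<lambda>x k. ennreal (indicator {0<..<b} x * (exp (- (x * k)) * x powr (- (1 / 2))))"
  let ?c = "\<lambda>k. ennreal (k powr (1 / 2) / (2 * sqrt pi) * spec g k)"
  have "(\<integral>\<^sup>+x. ennreal (indicator {0<..<b} x * (cmod (ctrans g (Complex x y)))\<^sup>2) \<partial>lborel) \<le> (\<integral>\<^sup>+x. \<integral>\<^sup>+k. ?c k * ?w x k \<partial>lborel \<partial>lborel)"
  proof (rule nn_integral_mono)
    fix x :: real
    show "ennreal (indicator {0<..<b} x * (cmod (ctrans g (Complex x y)))\<^sup>2) \<le> (\<integral>\<^sup>+k. ?c k * ?w x k \<partial>lborel)"
    proof (cases "x \<in> {0<..<b}")
      case True
      then have x: "x > 0" by simp
      have "ennreal ((cmod (ctrans g (Complex x y)))\<^sup>2) \<le> ennreal (1 / (2 * sqrt (pi * x))) * (\<integral>\<^sup>+k. ennreal (exp (- (x * k)) * k powr (1 / 2) * spec g k) \<partial>lborel)"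
        by (rule ctrans_pointwise[OF g x])
      also have "\<dots> = (\<integral>\<^sup>+k. ?c k * ?w x k \<partial>lborel)"
      proof (subst nn_integral_cmult[symmetric])
        have "x powr (- (1 / 2)) = 1 / sqrt x" using x by (simp add: powr_minus powr_half_sqrt inverse_eq_divide)
        then have "1 / (2 * sqrt (pi * x)) * (exp (- (x * k)) * k powr (1 / 2) * spec g k) = (k powr (1 / 2) / (2 * sqrt pi) * spec g k) * (indicator {0<..<b} x * (exp (- (x * k)) * x powr (- (1 / 2))))" for k
          using True by (simp add: real_sqrt_mult mult_ac)
        then show "(\<integral>\<^sup>+k. ennreal (1 / (2 * sqrt (pi * x))) * ennreal (exp (- (x * k)) * k powr (1 / 2) * spec g k) \<partial>lborel) = (\<integral>\<^sup>+k. ?c k * ?w x k \<partial>lborel)"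
          using spec_nonneg[of g] x by (intro nn_integral_cong) (simp only: ennreal_mult'[symmetric] mult_nonneg_nonneg divide_nonneg_nonneg powr_ge_zero real_sqrt_ge_zero pi_ge_zero zero_le_numeral zero_le_one less_imp_le)
      qed measurable
      finally show ?thesis using True by simp
    qed simp
  qed
  also have "\<dots> = (\<integral>\<^sup>+k. \<integral>\<^sup>+x. ?c k * ?w x k \<partial>lborel \<partial>lborel)"
    by (rule lborel_pair.Fubini'[symmetric]) measurable
  also have "\<dots> \<le> (\<integral>\<^sup>+k. ennreal (min (1 / 2) (sqrt (b * k) / sqrt pi) * spec g k) \<partial>lborel)"
  proof (rule nn_integral_mono)
    fix k :: real
    show "(\<integral>\<^sup>+x. ?c k * ?w x k \<partial>lborel) \<le> ennreal (min (1 / 2) (sqrt (b * k) / sqrt pi) * spec g k)"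
    proof (cases "k \<ge> 0")
      case True
      have "(\<integral>\<^sup>+x. ?c k * ?w x k \<partial>lborel) = ?c k * (\<integral>\<^sup>+x. ?w x k \<partial>lborel)" by (rule nn_integral_cmult) measurable
      also have "\<dots> = ennreal (spec g k) * ennreal (k powr (1 / 2) / (2 * sqrt pi)) * (\<integral>\<^sup>+x. ?w x k \<partial>lborel)"
        using spec_nonneg[of g k] by (simp add: ennreal_mult'[symmetric] mult.commute)
      also have "\<dots> \<le> ennreal (spec g k) * ennreal (min (1 / 2) (sqrt (b * k) / sqrt pi))"
        unfolding mult.assoc by (intro mult_left_mono segment_inner b True) simp
      also have "\<dots> = ennreal (min (1 / 2) (sqrt (b * k) / sqrt pi) * spec g k)"
        using spec_nonneg[of g k] by (simp add: ennreal_mult'[symmetric] mult.commute)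
      finally show ?thesis .
    next
      case False
      then show ?thesis by (simp add: spec_def)
    qed
  qed
  finally show ?thesis .
qed

lemma rhp_line_measurable:
  assumes "F holomorphic_on {z. Re z > 0}"
  shows "b > 0 \<Longrightarrow> (\<lambda>x. F (Complex b x)) \<in> borel_measurable borel"
    and "(\<lambda>x. indicator {0<..<b} x * (c * cmod (F (Complex x y)) powr q)) \<in> borel_measurable borel"
proof -
  have c: "continuous_on {z. Re z > 0} F" by (rule holomorphic_on_imp_continuous_on[OF assms])
  show "(\<lambda>x. F (Complex b x)) \<in> borel_measurable borel" if "b > 0"
    by (rule borel_measurable_continuous_onI, rule continuous_on_compose2[OF c])
       (use that in \<open>auto simp: Complex_eq intro!: continuous_intros\<close>)
  have "continuous_on {0<..<b} (\<lambda>x. F (Complex x y))"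
    by (rule continuous_on_compose2[OF c]) (auto simp: Complex_eq intro!: continuous_intros)
  then have "(\<lambda>x. indicator {0<..<b} x *\<^sub>R F (Complex x y)) \<in> borel_measurable borel"
    by (rule borel_measurable_continuous_on_indicator[rotated]) simp
  then have [measurable]: "(\<lambda>x. cmod (indicator {0<..<b} x *\<^sub>R F (Complex x y)) powr q) \<in> borel_measurable borel" by measurable
  have eq: "(\<lambda>x. indicator {0<..<b} x * (c * cmod (F (Complex x y)) powr q)) = (\<lambda>x. indicator {0<..<b} x * (c * cmod (indicator {0<..<b} x *\<^sub>R F (Complex x y)) powr q))"
    by (auto simp: indicator_def fun_eq_iff)
  show "(\<lambda>x. indicator {0<..<b} x * (c * cmod (F (Complex x y)) powr q)) \<in> borel_measurable borel"
    by (subst eq) measurable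
qed

lemma ctrans_holomorphic_rhp: "nice g \<Longrightarrow> ctrans g holomorphic_on {z. Re z > 0}"
  by (rule holomorphic_on_subset[OF ctrans_holomorphic]) auto

lemma Jint_nn_integral:
  assumes F: "F holomorphic_on {z. Re z > 0}" and b: "b > 0" and c: "c0 \<ge> 0" "c1 \<ge> 0" "c2 \<ge> 0"
  shows "(\<integral>\<^sup>+x. ennreal (Jint q b c0 c1 c2 y1 y2 F x) \<partial>lborel) =
     ennreal c0 * (\<integral>\<^sup>+x. ennreal (cmod (F (Complex b x)) powr q) \<partial>lborel)
     + ennreal c1 * (\<integral>\<^sup>+x. ennreal (indicator {0<..<b} x * cmod (F (Complex x y1)) powr q) \<partial>lborel)
     + ennreal c2 * (\<integral>\<^sup>+x. ennreal (indicator {0<..<b} x * cmod (F (Complex x y2)) powr q) \<partial>lborel)"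
    and "Jint q b c0 c1 c2 y1 y2 F \<in> borel_measurable borel"
proof -
  note [measurable] = rhp_line_measurable(1)[OF F b]
  have m[measurable]: "(\<lambda>x. indicator {0<..<b} x * cmod (F (Complex x y)) powr q) \<in> borel_measurable borel" for y
    using rhp_line_measurable(2)[OF F, of b 1 y q] by simp
  have J: "Jint q b c0 c1 c2 y1 y2 F x = c0 * cmod (F (Complex b x)) powr q + c1 * (indicator {0<..<b} x * cmod (F (Complex x y1)) powr q)
     + c2 * (indicator {0<..<b} x * cmod (F (Complex x y2)) powr q)" for x
    by (simp add: Jint_def algebra_simps)
  show "Jint q b c0 c1 c2 y1 y2 F \<in> borel_measurable borel" unfolding J[abs_def] by measurable
  have "(\<integral>\<^sup>+x. ennreal (Jint q b c0 c1 c2 y1 y2 F x) \<partial>lborel) = (\<integral>\<^sup>+x. ennreal c0 * ennreal (cmod (F (Complex b x)) powr q)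
     + ennreal c1 * ennreal (indicator {0<..<b} x * cmod (F (Complex x y1)) powr q)
     + ennreal c2 * ennreal (indicator {0<..<b} x * cmod (F (Complex x y2)) powr q) \<partial>lborel)"
    unfolding J using c by (intro nn_integral_cong) (simp add: ennreal_mult'[symmetric] ennreal_plus[symmetric] del: ennreal_plus)
  then show "(\<integral>\<^sup>+x. ennreal (Jint q b c0 c1 c2 y1 y2 F x) \<partial>lborel) =
     ennreal c0 * (\<integral>\<^sup>+x. ennreal (cmod (F (Complex b x)) powr q) \<partial>lborel)
     + ennreal c1 * (\<integral>\<^sup>+x. ennreal (indicator {0<..<b} x * cmod (F (Complex x y1)) powr q) \<partial>lborel)
     + ennreal c2 * (\<integral>\<^sup>+x. ennreal (indicator {0<..<b} x * cmod (F (Complex x y2)) powr q) \<partial>lborel)"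
    by (simp add: nn_integral_add nn_integral_cmult)
qed

lemma Jint_L2:
  assumes g: "nice g" and b: "b > 0" and ad: "admissible c0 c1 c2 \<rho>"
  shows "(\<integral>\<^sup>+x. ennreal (Jint 2 b c0 c1 c2 y1 y2 (ctrans g) x) \<partial>lborel) \<le> ennreal \<rho> * (\<integral>\<^sup>+k. ennreal (spec g k) \<partial>lborel)"
proof -
  note [measurable] = spec_measurable[OF g]
  have c: "c0 \<ge> 0" "c1 \<ge> 0" "c2 \<ge> 0" "\<rho> \<ge> 0" using ad by (auto simp: admissible_def)
  let ?m = "\<lambda>k. min (1 / 2) (sqrt (b * k) / sqrt pi)"
  have m0: "?m k * spec g k \<ge> 0" for k
    by (cases "k \<ge> 0") (use b in \<open>auto simp: spec_def\<close>)
  have "(\<integral>\<^sup>+x. ennreal (Jint 2 b c0 c1 c2 y1 y2 (ctrans g) x) \<partial>lborel)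
     \<le> ennreal c0 * (\<integral>\<^sup>+k. ennreal (exp (- (2 * b * k)) * spec g k) \<partial>lborel)
      + ennreal c1 * (\<integral>\<^sup>+k. ennreal (?m k * spec g k) \<partial>lborel) + ennreal c2 * (\<integral>\<^sup>+k. ennreal (?m k * spec g k) \<partial>lborel)"
    unfolding Jint_nn_integral(1)[OF ctrans_holomorphic_rhp[OF g] b c(1-3)]
    using ctrans_Plancherel[OF g b] segment_bound[OF g b]
    by (intro add_mono mult_left_mono) simp_all
  also have "\<dots> = (\<integral>\<^sup>+k. ennreal c0 * ennreal (exp (- (2 * b * k)) * spec g k) + ennreal c1 * ennreal (?m k * spec g k) + ennreal c2 * ennreal (?m k * spec g k) \<partial>lborel)"
    by (simp add: nn_integral_add nn_integral_cmult)
  also have "\<dots> \<le> (\<integral>\<^sup>+k. ennreal \<rho> * ennreal (spec g k) \<partial>lborel)"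
  proof (rule nn_integral_mono)
    fix k
    have "c0 * (exp (- (2 * b * k)) * spec g k) + c1 * (?m k * spec g k) + c2 * (?m k * spec g k) \<le> \<rho> * spec g k"
    proof (cases "k \<ge> 0")
      case True
      have "sqrt (b * k) \<ge> 0" using True b by simp
      then have "c0 * exp (- (2 * (sqrt (b * k))\<^sup>2)) + (c1 + c2) * ?m k \<le> \<rho>"
        using ad unfolding admissible_def by blast
      then have "(c0 * exp (- (2 * b * k)) + (c1 + c2) * ?m k) * spec g k \<le> \<rho> * spec g k"
        using True b spec_nonneg by (intro mult_right_mono) (simp_all add: mult.assoc)
      then show ?thesis by (simp add: algebra_simps)
    next
      case False then show ?thesis by (simp add: spec_def)
    qed
    then have "ennreal (c0 * (exp (- (2 * b * k)) * spec g k) + c1 * (?m k * spec g k) + c2 * (?m k * spec g k)) \<le> ennreal (\<rho> * spec g k)"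
      by (rule ennreal_leI)
    moreover have "ennreal (c0 * (exp (- (2 * b * k)) * spec g k) + c1 * (?m k * spec g k) + c2 * (?m k * spec g k)) =
       ennreal c0 * ennreal (exp (- (2 * b * k)) * spec g k) + ennreal c1 * ennreal (?m k * spec g k) + ennreal c2 * ennreal (?m k * spec g k)"
      using c m0[of k] spec_nonneg[of g k] by (simp only: ennreal_mult'[symmetric] ennreal_plus[symmetric] mult_nonneg_nonneg exp_ge_zero add_nonneg_nonneg)
    ultimately show "ennreal c0 * ennreal (exp (- (2 * b * k)) * spec g k) + ennreal c1 * ennreal (?m k * spec g k) + ennreal c2 * ennreal (?m k * spec g k) \<le> ennreal \<rho> * ennreal (spec g k)"
      using c(4) by (simp only: ennreal_mult')
  qed
  also have "\<dots> = ennreal \<rho> * (\<integral>\<^sup>+k. ennreal (spec g k) \<partial>lborel)" by (rule nn_integral_cmult) measurable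
  finally show ?thesis .
qed

section \<open>Transfer from the exponent 2 to other exponents\<close>

text \<open>A local factorisation extends to the whole domain, because the quotient is holomorphic away from the zero.\<close>

lemma holomorphic_remove_zero:
  assumes f: "f holomorphic_on S" and S: "open S" "connected S" and a: "a \<in> S" "f a = 0" and nc: "\<not> f constant_on S"
  obtains n :: nat and h where "h holomorphic_on S" "h a \<noteq> 0" "\<And>w. w \<in> S \<Longrightarrow> f w = (w - a) ^ n * h w"
proof -
  obtain g r n where g: "0 < n" "0 < r" "ball a r \<subseteq> S" "g holomorphic_on ball a r"
      "\<And>w. w \<in> ball a r \<Longrightarrow> f w = (w - a) ^ n * g w" "\<And>w. w \<in> ball a r \<Longrightarrow> g w \<noteq> 0"
    by (rule holomorphic_factor_zero_nonconstant[OF f S a nc]) (rule that)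
  define h where "h = (\<lambda>w. if w \<in> ball a r then g w else f w / (w - a) ^ n)"
  have "h holomorphic_on (ball a r \<union> (S - {a}))"
    unfolding h_def
  proof (rule holomorphic_on_If_Un)
    show "(\<lambda>w. f w / (w - a) ^ n) holomorphic_on S - {a}"
      by (intro holomorphic_intros holomorphic_on_subset[OF f]) auto
    show "open (S - {a})" using S by (simp add: open_delete)
    show "g z = f z / (z - a) ^ n" if "z \<in> ball a r" "z \<in> S - {a}" for z using g(5)[OF that(1)] that by auto
  qed (use g in auto)
  moreover have "ball a r \<union> (S - {a}) = S" using g a by auto
  ultimately have "h holomorphic_on S" by simp
  moreover have "h a \<noteq> 0" using g by (simp add: h_def)
  moreover have "f w = (w - a) ^ n * h w" if "w \<in> S" for w
    using g(2) g(5)[of w] by (cases "w = a") (auto simp: h_def)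
  ultimately show ?thesis by (rule that)
qed

text \<open>Decay near a given point follows by compactness; so it may be checked away from the point at which a zero is
divided out.\<close>

lemma decaying_of_outside:
  assumes hol: "F holomorphic_on {z. Re z > - d}" and d: "d > 0" and a: "a \<ge> 0" and D: "D \<ge> 0"
    and b: "\<And>z. 0 \<le> Re z \<Longrightarrow> 1 \<le> cmod (z - w) \<Longrightarrow> cmod (F z) \<le> D * (1 + cmod z) powr (- a)"
  shows "decaying d a F"
proof -
  have "compact (cball w 1 \<inter> {z. Re z \<ge> 0})" by (intro compact_Int_closed compact_cball closed_halfspace_Re_ge)
  moreover have "continuous_on (cball w 1 \<inter> {z. Re z \<ge> 0}) F"
    using d by (intro holomorphic_on_imp_continuous_on holomorphic_on_subset[OF hol]) auto
  ultimately have "compact (F ` (cball w 1 \<inter> {z. Re z \<ge> 0}))" by (rule compact_continuous_image[rotated])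
  then obtain B0 where B0: "\<And>z. z \<in> cball w 1 \<inter> {z. Re z \<ge> 0} \<Longrightarrow> cmod (F z) \<le> B0"
    by (meson bounded_iff compact_imp_bounded imageI)
  define B where "B = max 0 B0"
  define E where "E = B * (2 + cmod w) powr a"
  have E: "E \<ge> 0" by (simp add: E_def B_def)
  have "cmod (F z) \<le> (D + E) * (1 + cmod z) powr (- a)" if z: "0 \<le> Re z" for z
  proof (cases "1 \<le> cmod (z - w)")
    case True
    have "D * (1 + cmod z) powr (- a) \<le> (D + E) * (1 + cmod z) powr (- a)" using E by (intro mult_right_mono) auto
    then show ?thesis using b[OF z True] by linarith
  next
    case False
    have "cmod z \<le> 1 + cmod w" using False norm_triangle_sub[of z w] by linarith
    then have "(1 + cmod z) powr a \<le> (2 + cmod w) powr a" using a by (intro powr_mono2) auto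
    then have "B * (1 + cmod z) powr a \<le> E" unfolding E_def by (intro mult_left_mono) (auto simp: B_def)
    moreover have pos: "(1 + cmod z) powr a > 0" using norm_ge_zero[of z] by (simp add: add_nonneg_eq_0_iff)
    ultimately have "B \<le> E / (1 + cmod z) powr a" by (simp add: pos_le_divide_eq)
    also have "\<dots> = E * (1 + cmod z) powr (- a)" by (simp only: powr_minus divide_inverse)
    also have "\<dots> \<le> (D + E) * (1 + cmod z) powr (- a)" using D by (intro mult_right_mono) auto
    finally have "B \<le> (D + E) * (1 + cmod z) powr (- a)" .
    moreover have "cmod (F z) \<le> B" using B0[of z] False z by (auto simp: B_def dist_norm norm_minus_commute)
    ultimately show ?thesis by linarith
  qed
  then show ?thesis using hol D E unfolding decaying_def by (intro conjI exI[of _ "D + E"]) auto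
qed

text \<open>Finitely many zeros \<open>a\<close> are divided out by the factors \<open>(z - a) / (z + cnj a)\<close>, which are unimodular on the boundary
line and less than one inside.\<close>

lemma remove_zeros:
  assumes "finite Z" "Z = {z. Re z > - d \<and> F z = 0}" "\<And>z. z \<in> Z \<Longrightarrow> Re z \<ge> d" "d > 0" "decaying d 1 F"
  shows "\<exists>K. decaying d 1 K \<and> (\<forall>z. Re z > - d \<longrightarrow> K z \<noteq> 0) \<and> (\<forall>y. cmod (K (Complex 0 y)) = cmod (F (Complex 0 y)))
       \<and> (\<forall>z. Re z \<ge> 0 \<longrightarrow> cmod (F z) \<le> cmod (K z))"
  using assms
proof (induction Z arbitrary: F rule: finite_induct)
  case empty
  then show ?case by (intro exI[of _ F]) auto
next
  case (insert a Z)
  let ?S = "{z. Re z > - d}"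
  have aS: "a \<in> ?S" "F a = 0" "Re a \<ge> d" using insert.prems by auto
  have holF: "F holomorphic_on ?S" using insert.prems(4) by (simp add: decaying_def)
  have "\<not> F constant_on ?S"
  proof
    assume "F constant_on ?S"
    then have "?S \<subseteq> insert a Z" using aS insert.prems(1) unfolding constant_on_def by auto
    moreover have "infinite ?S"
    proof -
      have "(\<lambda>n::nat. of_nat n) ` UNIV \<subseteq> ?S" using insert.prems(3) by (auto intro: less_le_trans[of _ 0])
      moreover have "infinite (range (of_nat :: nat \<Rightarrow> complex))" by (rule range_inj_infinite) (simp add: inj_of_nat)
      ultimately show ?thesis using finite_subset by blast
    qed
    ultimately show False using insert.hyps(1) finite_subset by blast
  qed
  then obtain n h where h: "h holomorphic_on ?S" "h a \<noteq> 0" "\<And>w. w \<in> ?S \<Longrightarrow> F w = (w - a) ^ n * h w"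
    by (rule holomorphic_remove_zero[OF holF open_rhp convex_connected[OF convex_rhp] aS(1,2)]) (rule that)
  \<comment> \<open>the factor (w - a) ^ n is replaced by its mirror image, which has no zero in the half-plane\<close>
  define F1 where "F1 = (\<lambda>w. (w + cnj a) ^ n * h w)"
  have nz: "w + cnj a \<noteq> 0" if "w \<in> ?S" for w
  proof
    assume "w + cnj a = 0"
    then have "Re (w + cnj a) = 0" by simp
    then show False using that aS(3) by simp
  qed
  have le: "cmod (w - a) \<le> cmod (w + cnj a)" if "Re w \<ge> 0" for w
  proof -
    have "(Re w - Re a)\<^sup>2 \<le> (Re w + Re a)\<^sup>2" using that aS(3) insert.prems(3) by (simp add: power2_eq_square algebra_simps)
    then show ?thesis by (simp add: cmod_def)
  qed
  have eq: "cmod (Complex 0 y - a) = cmod (Complex 0 y + cnj a)" for y by (simp add: cmod_def)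
  have FF1: "cmod (F w) \<le> cmod (F1 w)" if "Re w \<ge> 0" for w
    using h(3)[of w] that insert.prems(3) le[OF that] by (simp add: F1_def norm_mult norm_power mult_right_mono power_mono)
  have bdy: "cmod (F1 (Complex 0 y)) = cmod (F (Complex 0 y))" for y
    using h(3)[of "Complex 0 y"] insert.prems(3) eq[of y] by (simp add: F1_def norm_mult norm_power)
  obtain D where D: "D \<ge> 0" "\<And>z. 0 \<le> Re z \<Longrightarrow> cmod (F z) \<le> D * (1 + cmod z) powr (- 1)"
    using insert.prems(4) by (auto simp: decaying_def)
  have "decaying d 1 F1"
  proof (rule decaying_of_outside[where w = a and D = "(1 + 2 * Re a) ^ n * D"])
    show "F1 holomorphic_on ?S" unfolding F1_def by (intro holomorphic_intros h)
    fix z assume z: "0 \<le> Re z" "1 \<le> cmod (z - a)"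
    have Ra: "0 \<le> Re a" using aS(3) insert.prems(3) by simp
    have "z + cnj a = (z - a) + of_real (2 * Re a)" by (simp add: complex_eq_iff)
    then have "cmod (z + cnj a) \<le> cmod (z - a) + cmod (of_real (2 * Re a))" by (metis norm_triangle_ineq)
    also have "cmod (of_real (2 * Re a)) = 2 * Re a" using Ra by simp
    also have "cmod (z - a) + 2 * Re a \<le> cmod (z - a) + 2 * Re a * cmod (z - a)"
      using z(2) Ra mult_left_mono[OF z(2), of "2 * Re a"] by simp
    finally have "cmod (z + cnj a) \<le> (1 + 2 * Re a) * cmod (z - a)" by (simp add: algebra_simps)
    then have "cmod (z + cnj a) ^ n \<le> ((1 + 2 * Re a) * cmod (z - a)) ^ n" by (rule power_mono) simp
    then have "cmod (F1 z) \<le> ((1 + 2 * Re a) * cmod (z - a)) ^ n * cmod (h z)"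
      by (simp add: F1_def norm_mult norm_power mult_right_mono)
    also have "\<dots> = (1 + 2 * Re a) ^ n * cmod (F z)"
      using h(3)[of z] z insert.prems(3) by (simp add: norm_mult norm_power power_mult_distrib)
    also have "\<dots> \<le> (1 + 2 * Re a) ^ n * (D * (1 + cmod z) powr (- 1))"
      using D(2)[OF z(1)] Ra by (intro mult_left_mono) auto
    finally show "cmod (F1 z) \<le> (1 + 2 * Re a) ^ n * D * (1 + cmod z) powr (- 1)" by (simp only: mult.assoc)
  qed (use D(1) insert.prems(3) aS(3) in auto)
  moreover have "Z = {z. Re z > - d \<and> F1 z = 0}"
  proof -
    have "F1 z = 0 \<longleftrightarrow> z \<noteq> a \<and> F z = 0" if "Re z > - d" for z
      using h(3)[of z] h(2) nz[of z] that aS(2) by (cases "z = a") (auto simp: F1_def)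
    then show ?thesis using insert.prems(1) insert.hyps(2) by auto
  qed
  moreover have "Re z \<ge> d" if "z \<in> Z" for z using insert.prems(2) that by simp
  ultimately obtain K where K: "decaying d 1 K" "\<forall>z. Re z > - d \<longrightarrow> K z \<noteq> 0" "\<forall>y. cmod (K (Complex 0 y)) = cmod (F1 (Complex 0 y))"
       "\<forall>z. Re z \<ge> 0 \<longrightarrow> cmod (F1 z) \<le> cmod (K z)"
    using insert.IH[of F1] insert.prems(3) by blast
  have "cmod (F z) \<le> cmod (K z)" if "0 \<le> Re z" for z
    using FF1[OF that] K(4) that by force
  then show ?case using K(1-3) bdy by (intro exI[of _ K]) simp
qed

text \<open>Once its zeros are divided out, a function on a half-plane has powers of every order. Its power \<open>q / 2\<close> carries estimates from
the exponent 2 to the exponent \<open>q\<close>, and the equality on the boundary keeps their constants.\<close>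

lemma power_majorant:
  assumes F: "decaying d 1 F" and d: "d > 0" and q: "q > 0"
    and fin: "finite {z. Re z > - d \<and> F z = 0}" and Z: "\<And>z. Re z > - d \<Longrightarrow> F z = 0 \<Longrightarrow> Re z \<ge> d"
  shows "\<exists>H. decaying d (q / 2) H \<and> (\<forall>y. (cmod (H (Complex 0 y)))\<^sup>2 = cmod (F (Complex 0 y)) powr q)
       \<and> (\<forall>z. Re z \<ge> 0 \<longrightarrow> cmod (F z) powr q \<le> (cmod (H z))\<^sup>2)"
proof -
  obtain K where K: "decaying d 1 K" "\<And>z. Re z > - d \<Longrightarrow> K z \<noteq> 0" "\<And>y. cmod (K (Complex 0 y)) = cmod (F (Complex 0 y))"
       "\<And>z. Re z \<ge> 0 \<Longrightarrow> cmod (F z) \<le> cmod (K z)"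
    using remove_zeros[OF fin refl _ d F] Z by blast
  have holK: "K holomorphic_on {z. Re z > - d}" using K(1) by (simp add: decaying_def)
  obtain l where l: "l holomorphic_on {z. Re z > - d}" "\<And>z. z \<in> {z. Re z > - d} \<Longrightarrow> K z = exp (l z)"
    by (rule contractible_imp_holomorphic_log[OF holK convex_imp_contractible[OF convex_rhp]]) (use K(2) in auto)
  define H where "H = (\<lambda>z. exp (of_real (q / 2) * l z))"
  have H: "cmod (H z) = cmod (K z) powr (q / 2)" if "Re z > - d" for z
    using l(2)[of z] that by (simp add: H_def powr_def)
  have H2: "(cmod (H z))\<^sup>2 = cmod (K z) powr q" if "Re z > - d" for z
    unfolding H[OF that] power2_eq_square powr_add[symmetric] by simp
  obtain D where D: "D \<ge> 0" "\<And>z. 0 \<le> Re z \<Longrightarrow> cmod (K z) \<le> D * (1 + cmod z) powr (- 1)"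
    using K(1) by (auto simp: decaying_def)
  have "cmod (H z) \<le> D powr (q / 2) * (1 + cmod z) powr (- (q / 2))" if "0 \<le> Re z" for z
  proof -
    have "cmod (K z) powr (q / 2) \<le> (D * (1 + cmod z) powr (- 1)) powr (q / 2)"
      using D(2)[OF that] q by (intro powr_mono2) auto
    also have "\<dots> = D powr (q / 2) * (1 + cmod z) powr (- (q / 2))" unfolding powr_mult powr_powr by simp
    finally show ?thesis using H[of z] that d by simp
  qed
  moreover have "H holomorphic_on {z. Re z > - d}" unfolding H_def by (intro holomorphic_intros l)
  ultimately have "decaying d (q / 2) H" unfolding decaying_def by (intro conjI exI[of _ "D powr (q / 2)"]) auto
  moreover have "(cmod (H (Complex 0 y)))\<^sup>2 = cmod (F (Complex 0 y)) powr q" for y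
    using H2[of "Complex 0 y"] d K(3) by simp
  moreover have "cmod (F z) powr q \<le> (cmod (H z))\<^sup>2" if "Re z \<ge> 0" for z
    using H2[of z] that d K(4)[OF that] q by (auto intro: powr_mono2)
  ultimately show ?thesis by blast
qed

lemma ctrans_holomorphic_far:
  assumes g: "nice g" and M: "M \<ge> 0" "\<And>x. M < \<bar>x\<bar> \<Longrightarrow> g x = 0"
  shows "ctrans g holomorphic_on {w. M < cmod w}"
proof -
  note gm[measurable] = nice_measurable[OF g]
  define \<gamma> where "\<gamma> = (\<lambda>u. Complex 0 (max (- M) (min M u)))"
  have \<gamma>M: "cmod (\<gamma> u) \<le> M" for u using M(1) by (auto simp: \<gamma>_def cmod_def)
  have \<gamma>m[measurable]: "\<gamma> \<in> borel_measurable borel" unfolding \<gamma>_def Complex_eq by measurable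
  have eq: "g u / (w - Complex 0 u) = g u / (w - \<gamma> u)" for u w
    using M by (cases "M < \<bar>u\<bar>") (auto simp: \<gamma>_def max_def min_def abs_le_iff)
  have opn: "open {w::complex. M < cmod w}" by (intro open_Collect_less continuous_intros)
  have "ctrans g field_differentiable (at w)" if w: "M < cmod w" for w
  proof -
    have d: "cmod w - M \<le> cmod (\<gamma> u - w)" for u
      using \<gamma>M[of u] norm_triangle_ineq2[of w "\<gamma> u"] by (simp add: norm_minus_commute)
    have int: "integrable lborel (\<lambda>u. g u / (\<gamma> u - w))"
    proof (rule Bochner_Integration.integrable_bound[OF integrable_mult_right[OF integrable_norm[OF nice_integrable[OF g]], of "1 / (cmod w - M)"]])
      show "(\<lambda>u. g u / (\<gamma> u - w)) \<in> borel_measurable lborel" by measurable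
      show "AE u in lborel. norm (g u / (\<gamma> u - w)) \<le> norm (1 / (cmod w - M) * cmod (g u))"
      proof (rule AE_I2)
        fix u
        have "cmod (g u) / cmod (\<gamma> u - w) \<le> cmod (g u) / (cmod w - M)"
          using d[of u] w by (intro divide_left_mono mult_pos_pos) auto
        then show "norm (g u / (\<gamma> u - w)) \<le> norm (1 / (cmod w - M) * cmod (g u))"
          using w by (simp add: norm_divide)
      qed
    qed
    have "((\<lambda>w. \<integral>u. g u / (\<gamma> u - w) \<partial>lborel) has_field_derivative (\<integral>u. g u / (\<gamma> u - w)\<^sup>2 \<partial>lborel)) (at w)"
      by (rule Cauchy_kernel_derivative[where d = "cmod w - M"]) (use w d int in auto)
    then have "((\<lambda>w. complex_of_real (- 1 / (2 * pi)) * (\<integral>u. g u / (\<gamma> u - w) \<partial>lborel)) has_field_derivative complex_of_real (- 1 / (2 * pi)) * (\<integral>u. g u / (\<gamma> u - w)\<^sup>2 \<partial>lborel)) (at w)"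
      by (rule DERIV_cmult)
    moreover have "ctrans g = (\<lambda>w. complex_of_real (- 1 / (2 * pi)) * (\<integral>u. g u / (\<gamma> u - w) \<partial>lborel))"
    proof
      fix w
      have "g u / (w - Complex 0 u) = - (g u / (\<gamma> u - w))" for u
        unfolding eq by (metis minus_diff_eq minus_divide_right)
      then show "ctrans g w = complex_of_real (- 1 / (2 * pi)) * (\<integral>u. g u / (\<gamma> u - w) \<partial>lborel)"
        unfolding ctrans_def by simp
    qed
    ultimately show ?thesis unfolding field_differentiable_def by auto
  qed
  then show ?thesis using opn by (auto simp: holomorphic_on_open field_differentiable_def)
qed

text \<open>The transform of a nice function is holomorphic at infinity, where zeros cannot accumulate.\<close>

lemma ctrans_nonzero_far:
  assumes g: "nice g" and nz: "Re w0 > 0" "ctrans g w0 \<noteq> 0"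
  shows "\<exists>R. \<forall>w. Re w > 0 \<longrightarrow> R < cmod w \<longrightarrow> ctrans g w \<noteq> 0"
proof -
  obtain M where M: "M \<ge> 0" "\<And>x. cmod (g x) \<le> M" "\<And>x. M < \<bar>x\<bar> \<Longrightarrow> g x = 0" using nice_ex[OF g] by auto
  have holK: "ctrans g holomorphic_on {w. M < cmod w}" by (rule ctrans_holomorphic_far[OF g M(1) M(3)])
  have "\<exists>w. M + 1 < cmod w \<and> ctrans g w \<noteq> 0"
  proof (rule ccontr)
    assume "\<not> ?thesis"
    then have z: "ctrans g w = 0" if "M + 1 < cmod w" for w using that by auto
    have "ctrans g w0 = 0"
    proof (rule analytic_continuation_open[where f = "ctrans g" and s = "{z. Re z > M + 1}" and s' = "{z. Re z > 0}" and g = "\<lambda>_. 0"])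
      show "ctrans g z = 0" if "z \<in> {z. Re z > M + 1}" for z
        using z[of z] that complex_Re_le_cmod[of z] by simp
      have "of_real (M + 2) \<in> {z. Re z > M + 1}" by simp
      then show "{z. Re z > M + 1} \<noteq> {}" by blast
    qed (use nz M(1) in \<open>auto intro!: open_rhp convex_connected convex_rhp ctrans_holomorphic_rhp g\<close>)
    then show False using nz by simp
  qed
  then obtain w1 where w1: "M + 1 < cmod w1" "ctrans g w1 \<noteq> 0" by blast
  let ?S = "ball (0::complex) (1 / (M + 1))"
  have inv: "M + 1 < cmod (inverse z)" if "z \<in> ?S - {0}" for z
  proof -
    have "cmod z < 1 / (M + 1)" "cmod z > 0" using that by (auto simp: dist_norm)
    then have "(M + 1) * cmod z < 1" using M(1) by (simp add: field_simps)
    then show ?thesis using \<open>cmod z > 0\<close> unfolding norm_inverse by (simp add: field_simps)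
  qed
  have "(\<lambda>z. ctrans g (inverse z)) holomorphic_on (?S - {0})"
    by (rule holomorphic_on_compose_gen[unfolded o_def, of inverse _ "ctrans g" "{w. M < cmod w}"])
       (use inv in \<open>force intro!: holomorphic_intros holK\<close>)+
  moreover have "\<exists>B. eventually (\<lambda>z. cmod (ctrans g (inverse z)) \<le> B) (at 0)"
  proof (rule exI[of _ "1 / (2 * pi) * (\<integral>u. cmod (g u) \<partial>lborel)"])
    have bd: "cmod (ctrans g w) \<le> 1 / (2 * pi) * (\<integral>u. cmod (g u) \<partial>lborel)" if w: "M + 1 < cmod w" for w
    proof -
      have le: "cmod (g u / (w - Complex 0 u)) \<le> cmod (g u)" for u
      proof (cases "M < \<bar>u\<bar>")
        case True then show ?thesis using M(3) by simp
      next
        case False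
        have "cmod (Complex 0 u) = \<bar>u\<bar>" by (simp add: cmod_def)
        then have "1 \<le> cmod (w - Complex 0 u)" using w False norm_triangle_ineq2[of w "Complex 0 u"] by linarith
        then have "cmod (g u) / cmod (w - Complex 0 u) \<le> cmod (g u) / 1" by (intro divide_left_mono) auto
        then show ?thesis by (simp add: norm_divide)
      qed
      have gi: "integrable lborel (\<lambda>u. cmod (g u))" by (rule integrable_norm[OF nice_integrable[OF g]])
      have mm: "(\<lambda>u. g u / (w - Complex 0 u)) \<in> borel_measurable lborel" using nice_measurable[OF g] by measurable
      have i: "integrable lborel (\<lambda>u. g u / (w - Complex 0 u))"
        by (rule Bochner_Integration.integrable_bound[OF gi mm]) (use le in auto)
      have "cmod (\<integral>u. g u / (w - Complex 0 u) \<partial>lborel) \<le> (\<integral>u. cmod (g u) \<partial>lborel)"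
        by (rule order_trans[OF integral_norm_bound]) (intro integral_mono integrable_norm i gi le)
      then show ?thesis unfolding ctrans_def norm_mult norm_of_real by (simp add: divide_right_mono)
    qed
    show "eventually (\<lambda>z. cmod (ctrans g (inverse z)) \<le> 1 / (2 * pi) * (\<integral>u. cmod (g u) \<partial>lborel)) (at 0)"
      unfolding eventually_at using inv bd M(1) by (intro exI[of _ "1 / (M + 1)"]) (auto simp: dist_norm)
  qed
  moreover have "0 \<in> interior ?S" using M(1) by simp
  ultimately obtain h where h: "h holomorphic_on ?S" "\<And>z. z \<in> ?S - {0} \<Longrightarrow> h z = ctrans g (inverse z)"
    using holomorphic_on_extend_bounded[of "\<lambda>z. ctrans g (inverse z)" ?S 0] by blast
  have w1S: "inverse w1 \<in> ?S - {0}"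
  proof -
    have "inverse (cmod w1) < 1 / (M + 1)" using w1(1) M(1) less_imp_inverse_less[of "M + 1" "cmod w1"] by (simp add: inverse_eq_divide)
    moreover have "w1 \<noteq> 0" using w1(1) M(1) by auto
    ultimately show ?thesis by (simp add: norm_inverse del: inverse_eq_divide)
  qed
  have "(\<lambda>z. z * h z) holomorphic_on ?S" by (intro holomorphic_intros h(1))
  moreover have "inverse w1 * h (inverse w1) \<noteq> 0" using h(2)[OF w1S] w1S w1(2) by auto
  moreover have "0 \<in> ?S" "inverse w1 \<in> ?S" using w1S M(1) by auto
  ultimately obtain r where r: "0 < r" "ball 0 r \<subseteq> ?S" "\<And>z. z \<in> ball 0 r - {0} \<Longrightarrow> z * h z \<noteq> 0"
    using isolated_zeros[of "\<lambda>z. z * h z" ?S 0 "inverse w1"] by (metis connected_ball mult_zero_left open_ball)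
  have "ctrans g w \<noteq> 0" if "1 / r < cmod w" for w
  proof -
    have "cmod w > 0" using that r(1) by (meson divide_pos_pos less_trans zero_less_one)
    then have "w \<noteq> 0" by auto
    have "cmod (inverse w) < r" using that r(1) \<open>cmod w > 0\<close> unfolding norm_inverse by (simp add: field_simps)
    then have i: "inverse w \<in> ball 0 r - {0}" using \<open>w \<noteq> 0\<close> by simp
    then have "h (inverse w) \<noteq> 0" using r(3) by auto
    then show ?thesis using h(2)[of "inverse w"] i r(2) by auto
  qed
  then show ?thesis by blast
qed

text \<open>The zeros with real part at least \<open>e0 / 2\<close> are finite in number, so slightly shifted boundary lines avoid them
together with a strip on either side.\<close>

lemma ctrans_zero_gap:
  assumes g: "nice g" and nz: "Re w0 > 0" "ctrans g w0 \<noteq> 0" and e0: "e0 > 0"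
  shows "\<exists>e d. 0 < e \<and> e < e0 \<and> 0 < d \<and> decaying d 1 (\<lambda>z. ctrans g (z + of_real e))
     \<and> finite {z. Re z > - d \<and> ctrans g (z + of_real e) = 0}
     \<and> (\<forall>z. Re z > - d \<longrightarrow> ctrans g (z + of_real e) = 0 \<longrightarrow> Re z \<ge> d)"
proof -
  let ?S = "{z::complex. Re z > 0}"
  obtain R where R: "\<And>w. Re w > 0 \<Longrightarrow> R < cmod w \<Longrightarrow> ctrans g w \<noteq> 0" using ctrans_nonzero_far[OF g nz] by blast
  define Z where "Z = {z. Re z \<ge> e0 / 2 \<and> ctrans g z = 0}"
  have hol: "ctrans g holomorphic_on ?S" by (rule ctrans_holomorphic_rhp[OF g])
  have finZ: "finite Z"
  proof (cases "ctrans g constant_on ?S")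
    case True
    then have "ctrans g z = ctrans g w0" if "Re z > 0" for z using that nz(1) unfolding constant_on_def by (metis mem_Collect_eq)
    then have "Z = {}" using nz(2) e0 unfolding Z_def by force
    then show ?thesis by simp
  next
    case False
    have "finite {z \<in> cball 0 R \<inter> {z. Re z \<ge> e0 / 2}. ctrans g z = 0}"
    proof (rule holomorphic_compact_finite_zeros[OF hol open_rhp convex_connected[OF convex_rhp] _ _ False])
      show "compact (cball 0 R \<inter> {z. Re z \<ge> e0 / 2})" by (intro compact_Int_closed compact_cball closed_halfspace_Re_ge)
    qed (use e0 in auto)
    moreover have "Z \<subseteq> {z \<in> cball 0 R \<inter> {z. Re z \<ge> e0 / 2}. ctrans g z = 0}"
    proof
      fix z assume "z \<in> Z"
      then have z: "Re z \<ge> e0 / 2" "ctrans g z = 0" by (auto simp: Z_def)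
      then have "\<not> R < cmod z" using R[of z] e0 by auto
      then show "z \<in> {z \<in> cball 0 R \<inter> {z. Re z \<ge> e0 / 2}. ctrans g z = 0}" using z by simp
    qed
    ultimately show ?thesis by (rule finite_subset[rotated])
  qed
  define A where "A = insert (e0 / 2) (Re ` {z \<in> Z. Re z < e0})"
  have finA: "finite A" using finZ by (simp add: A_def)
  \<comment> \<open>the largest real part below e0 of a zero, or e0 / 2; between alpha and e0 there are no zeros\<close>
  define \<alpha> where "\<alpha> = Max A"
  have "\<alpha> \<in> A" unfolding \<alpha>_def using finA by (intro Max_in) (auto simp: A_def)
  then have \<alpha>: "\<alpha> < e0" using e0 by (auto simp: A_def)
  have \<alpha>2: "e0 / 2 \<le> \<alpha>" unfolding \<alpha>_def using finA by (intro Max_ge) (auto simp: A_def)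
  define e d where "e = (\<alpha> + e0) / 2" and "d = (e0 - \<alpha>) / 2"
  have ed: "0 < e" "e < e0" "0 < d" "d \<le> e" "e - d = \<alpha>" "e + d = e0" using \<alpha> \<alpha>2 e0 by (auto simp: e_def d_def field_simps)
  have zer: "z + of_real e \<in> Z \<and> Re z \<ge> d" if "Re z > - d" "ctrans g (z + of_real e) = 0" for z
  proof -
    have R: "Re (z + of_real e) > \<alpha>" using that(1) ed by simp
    then have Z: "z + of_real e \<in> Z" using that(2) \<alpha>2 by (simp add: Z_def)
    have "\<not> Re (z + of_real e) < e0"
    proof
      assume "Re (z + of_real e) < e0"
      then have "Re (z + of_real e) \<in> A" using Z unfolding A_def by blast
      then have "Re (z + of_real e) \<le> \<alpha>" unfolding \<alpha>_def using finA by (rule Max_ge[rotated])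
      then show False using R by simp
    qed
    then show ?thesis using Z ed by simp
  qed
  have "{z. Re z > - d \<and> ctrans g (z + of_real e) = 0} \<subseteq> (\<lambda>w. w - of_real e) ` Z"
  proof
    fix z assume "z \<in> {z. Re z > - d \<and> ctrans g (z + of_real e) = 0}"
    then have "z + of_real e \<in> Z" using zer by blast
    then show "z \<in> (\<lambda>w. w - of_real e) ` Z" by (rule rev_image_eqI) simp
  qed
  then have fin: "finite {z. Re z > - d \<and> ctrans g (z + of_real e) = 0}" using finZ finite_surj by blast
  have dec: "decaying d 1 (\<lambda>z. ctrans g (z + of_real e))"
  proof -
    have "{z. Re z > - d} \<subseteq> {z. Re z > - e}" using ed by auto
    then show ?thesis
      using ctrans_decaying[OF g ed(1)] unfolding decaying_def by (blast intro: holomorphic_on_subset)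
  qed
  show ?thesis using ed fin dec zer by blast
qed

lemma Jint_Fatou:
  assumes lim: "\<And>z. Re z > 0 \<Longrightarrow> (\<lambda>n. F n z) \<longlonglongrightarrow> G z" and hol: "\<And>n. F n holomorphic_on {z. Re z > 0}"
    and b: "b > 0" and c: "c0 \<ge> 0" "c1 \<ge> 0" "c2 \<ge> 0" and q: "q > 0"
    and le: "\<And>n::nat. (\<integral>\<^sup>+x. ennreal (Jint q b c0 c1 c2 y1 y2 (F n) x) \<partial>lborel) \<le> A"
  shows "(\<integral>\<^sup>+x. ennreal (Jint q b c0 c1 c2 y1 y2 G x) \<partial>lborel) \<le> A"
proof -
  have p: "(\<lambda>n. cmod (F n z) powr q) \<longlonglongrightarrow> cmod (G z) powr q" if "Re z > 0" for z
    using lim[OF that] q by (intro tendsto_intros) auto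
  have J: "(\<lambda>n. Jint q b c0 c1 c2 y1 y2 (F n) x) \<longlonglongrightarrow> Jint q b c0 c1 c2 y1 y2 G x" for x
  proof -
    have 1: "(\<lambda>n. cmod (F n (Complex b x)) powr q) \<longlonglongrightarrow> cmod (G (Complex b x)) powr q" using b by (intro p) simp
    have 2: "(\<lambda>n. indicator {0<..<b} x * (c1 * cmod (F n (Complex x y1)) powr q + c2 * cmod (F n (Complex x y2)) powr q))
      \<longlonglongrightarrow> indicator {0<..<b} x * (c1 * cmod (G (Complex x y1)) powr q + c2 * cmod (G (Complex x y2)) powr q)"
    proof (cases "x \<in> {0<..<b}")
      case True
      then have "(\<lambda>n. cmod (F n (Complex x y)) powr q) \<longlonglongrightarrow> cmod (G (Complex x y)) powr q" for y by (intro p) simp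
      then show ?thesis by (intro tendsto_add tendsto_mult tendsto_const)
    qed simp
    show ?thesis unfolding Jint_def by (intro tendsto_add tendsto_mult_left 1 2)
  qed
  have "(\<integral>\<^sup>+x. ennreal (Jint q b c0 c1 c2 y1 y2 G x) \<partial>lborel) = (\<integral>\<^sup>+x. liminf (\<lambda>n. ennreal (Jint q b c0 c1 c2 y1 y2 (F n) x)) \<partial>lborel)"
    by (intro nn_integral_cong) (metis J lim_imp_Liminf sequentially_bot tendsto_ennrealI)
  also have "\<dots> \<le> liminf (\<lambda>n. \<integral>\<^sup>+x. ennreal (Jint q b c0 c1 c2 y1 y2 (F n) x) \<partial>lborel)"
  proof (rule nn_integral_liminf)
    show "(\<lambda>x. ennreal (Jint q b c0 c1 c2 y1 y2 (F n) x)) \<in> borel_measurable lborel" for n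
      using Jint_nn_integral(2)[OF hol b c, of q y1 y2 n] by simp
  qed
  also have "\<dots> \<le> liminf (\<lambda>n. A)" by (intro Liminf_mono always_eventually allI le)
  also have "\<dots> = A" by (rule Liminf_const) simp
  finally show ?thesis .
qed

text \<open>For a boundary line with no zeros nearby, replace the transform by its majorant \<open>H\<close>, for which the exponent is
2 and the spectral estimate applies: \<open>H\<close> is the transform of its own boundary values.\<close>

lemma Jint_shift:
  assumes g: "nice g" and q: "q > 1" and b: "b > 0" and ad: "admissible c0 c1 c2 \<rho>" and e0: "e0 > 0"
  shows "\<exists>e. 0 < e \<and> e < e0 \<and> (\<integral>\<^sup>+x. ennreal (Jint q b c0 c1 c2 y1 y2 (\<lambda>z. ctrans g (z + of_real e)) x) \<partial>lborel)
      \<le> ennreal (\<rho> * (\<integral>y. cmod (ctrans g (Complex e y)) powr q \<partial>lborel))"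
proof (cases "\<forall>w. Re w > 0 \<longrightarrow> ctrans g w = 0")
  case True
  then have "Jint q b c0 c1 c2 y1 y2 (\<lambda>z. ctrans g (z + of_real (e0 / 2))) x = 0" for x
    using e0 b q by (auto simp: Jint_def indicator_def)
  then show ?thesis using e0 by (intro exI[of _ "e0 / 2"]) simp
next
  case False
  then obtain w0 where w0: "Re w0 > 0" "ctrans g w0 \<noteq> 0" by blast
  have c: "c0 \<ge> 0" "c1 \<ge> 0" "c2 \<ge> 0" "\<rho> \<ge> 0" using ad by (auto simp: admissible_def)
  obtain e d where ed: "0 < e" "e < e0" "0 < d" "decaying d 1 (\<lambda>z. ctrans g (z + of_real e))"
     "finite {z. Re z > - d \<and> ctrans g (z + of_real e) = 0}"
     "\<And>z. Re z > - d \<Longrightarrow> ctrans g (z + of_real e) = 0 \<Longrightarrow> Re z \<ge> d"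
    using ctrans_zero_gap[OF g w0 e0] by blast
  let ?F = "\<lambda>z. ctrans g (z + of_real e)"
  have q0: "q > 0" using q by simp
  obtain H where H: "decaying d (q / 2) H" "\<And>y. (cmod (H (Complex 0 y)))\<^sup>2 = cmod (?F (Complex 0 y)) powr q"
      "\<And>z. Re z \<ge> 0 \<Longrightarrow> cmod (?F z) powr q \<le> (cmod (H z))\<^sup>2"
    using power_majorant[OF ed(4,3) q0 ed(5) ed(6)] by blast
  define X where "X = (\<integral>y. cmod (ctrans g (Complex e y)) powr q \<partial>lborel)"
  have X0: "X \<ge> 0" unfolding X_def by (intro Bochner_Integration.integral_nonneg) simp
  let ?h = "\<lambda>y. H (Complex 0 y)"
  have hm: "?h \<in> borel_measurable borel" using decaying_measurable[OF H(1)] ed(3) by simp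
  have hX: "Lp_le 2 lborel ?h (sqrt X)"
  proof (rule Lp_leI_integrable)
    have eq: "cmod (?h y) powr 2 = cmod (ctrans g (Complex e y)) powr q" for y using H(2)[of y] by simp
    show "integrable lborel (\<lambda>y. cmod (?h y) powr 2)"
      unfolding eq by (rule ctrans_line_integrable_powr(1)[OF g ed(1) q])
    show "(\<integral>y. cmod (?h y) powr 2 \<partial>lborel) \<le> sqrt X powr 2" unfolding eq using X0 by (simp add: X_def)
  qed (use hm X0 in auto)
  have lim: "(\<lambda>n. ctrans (trunc n ?h) z) \<longlonglongrightarrow> H z" if z: "Re z > 0" for z
  proof -
    note C = halfplane_Cauchy_formula[OF H(1) ed(3) _ z]
    have "ctrans ?h z = H z" unfolding ctrans_def using C(2) q by simp
    then show ?thesis using ctrans_trunc_tendsto[OF hm C(1)] q by simp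
  qed
  have "(\<integral>\<^sup>+x. ennreal (Jint q b c0 c1 c2 y1 y2 ?F x) \<partial>lborel) \<le> (\<integral>\<^sup>+x. ennreal (Jint 2 b c0 c1 c2 y1 y2 H x) \<partial>lborel)"
  proof (intro nn_integral_mono ennreal_leI)
    fix x
    have le: "cmod (?F z) powr q \<le> cmod (H z) powr 2" if "Re z > 0" for z using H(3)[of z] that by simp
    show "Jint q b c0 c1 c2 y1 y2 ?F x \<le> Jint 2 b c0 c1 c2 y1 y2 H x"
      unfolding Jint_def
    proof (rule add_mono[OF mult_left_mono[OF le c(1)]])
      show "0 < Re (Complex b x)" using b by simp
      show "indicator {0<..<b} x * (c1 * cmod (?F (Complex x y1)) powr q + c2 * cmod (?F (Complex x y2)) powr q)
         \<le> indicator {0<..<b} x * (c1 * cmod (H (Complex x y1)) powr 2 + c2 * cmod (H (Complex x y2)) powr 2)"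
      proof (cases "x \<in> {0<..<b}")
        case True
        then have "c1 * cmod (?F (Complex x y1)) powr q + c2 * cmod (?F (Complex x y2)) powr q \<le> c1 * cmod (H (Complex x y1)) powr 2 + c2 * cmod (H (Complex x y2)) powr 2"
          by (intro add_mono mult_left_mono le c) auto
        then show ?thesis using True by simp
      qed simp
    qed
  qed
  also have "\<dots> \<le> ennreal (\<rho> * X)"
  proof (rule Jint_Fatou[OF lim _ b c(1-3)])
    fix n
    have nn: "nice (trunc n ?h)" by (rule nice_trunc[OF hm])
    show "ctrans (trunc n ?h) holomorphic_on {z. Re z > 0}" by (rule ctrans_holomorphic_rhp[OF nn])
    have "Lp_le 2 lborel (trunc n ?h) (sqrt X)"
      using nice_measurable[OF nn] by (intro Lp_le_dominated[OF hX] cmod_trunc_le) auto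
    from spec_mass[OF nn this] have "(\<integral>\<^sup>+k. ennreal (spec (trunc n ?h) k) \<partial>lborel) \<le> ennreal X" using X0 by simp
    then have "ennreal \<rho> * (\<integral>\<^sup>+k. ennreal (spec (trunc n ?h) k) \<partial>lborel) \<le> ennreal \<rho> * ennreal X" by (rule mult_left_mono) simp
    then show "(\<integral>\<^sup>+x. ennreal (Jint 2 b c0 c1 c2 y1 y2 (ctrans (trunc n ?h)) x) \<partial>lborel) \<le> ennreal (\<rho> * X)"
      using order_trans[OF Jint_L2[OF nn b ad]] c(4) by (simp add: ennreal_mult')
  qed simp_all
  finally show ?thesis using ed by (intro exI[of _ e]) (auto simp: X_def)
qed

text \<open>\<open>m\<close> plays the role of the mass of \<open>g\<close> on the right of the line. It is independent of the curve on which the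
transform is tested; the geometry enters through \<open>\<rho>\<close> only.\<close>

definition side_mass :: "real \<Rightarrow> (real \<Rightarrow> complex) \<Rightarrow> ennreal \<Rightarrow> bool" where
  "side_mass q g m \<longleftrightarrow> (\<forall>b c0 c1 c2 y1 y2 \<rho>. b > 0 \<longrightarrow> admissible c0 c1 c2 \<rho> \<longrightarrow>
     (\<integral>\<^sup>+x. ennreal (Jint q b c0 c1 c2 y1 y2 (ctrans g) x) \<partial>lborel) \<le> ennreal \<rho> * m)"

lemma side_mass_2: "nice g \<Longrightarrow> side_mass 2 g (\<integral>\<^sup>+k. ennreal (spec g k) \<partial>lborel)"
  unfolding side_mass_def using Jint_L2 by blast

text \<open>The mass on lines arbitrarily close to the boundary is controlled by the bound between parallel lines.\<close>

lemma side_mass_Cbound: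
  assumes C: "Cbound q c" and q: "q > 1" and g: "nice g" and a: "Lp_le q lborel g a"
  shows "side_mass q g (ennreal ((c * a) powr q))"
  unfolding side_mass_def
proof (intro allI impI)
  fix b c0 c1 c2 y1 y2 \<rho> assume b: "b > (0::real)" and ad: "admissible c0 c1 c2 \<rho>"
  have c: "c0 \<ge> 0" "c1 \<ge> 0" "c2 \<ge> 0" "\<rho> \<ge> 0" using ad by (auto simp: admissible_def)
  have "\<exists>e. \<forall>n::nat. 0 < e n \<and> e n < inverse (real (Suc n)) \<and> (\<integral>\<^sup>+x. ennreal (Jint q b c0 c1 c2 y1 y2 (\<lambda>z. ctrans g (z + of_real (e n))) x) \<partial>lborel)
      \<le> ennreal (\<rho> * (\<integral>y. cmod (ctrans g (Complex (e n) y)) powr q \<partial>lborel))"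
    by (intro choice allI Jint_shift g q b ad) simp
  then obtain e where e: "\<And>n::nat. 0 < e n" "\<And>n. e n < inverse (real (Suc n))"
     "\<And>n. (\<integral>\<^sup>+x. ennreal (Jint q b c0 c1 c2 y1 y2 (\<lambda>z. ctrans g (z + of_real (e n))) x) \<partial>lborel)
      \<le> ennreal (\<rho> * (\<integral>y. cmod (ctrans g (Complex (e n) y)) powr q \<partial>lborel))" by blast
  have e0: "e \<longlonglongrightarrow> 0"
    by (rule real_tendsto_sandwich[OF _ _ tendsto_const LIMSEQ_inverse_real_of_nat])
       (use e in \<open>auto intro!: always_eventually less_imp_le\<close>)
  show "(\<integral>\<^sup>+x. ennreal (Jint q b c0 c1 c2 y1 y2 (ctrans g) x) \<partial>lborel) \<le> ennreal \<rho> * ennreal ((c * a) powr q)"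
  proof (rule Jint_Fatou[OF _ _ b c(1-3)])
    fix n
    show "(\<lambda>z. ctrans g (z + of_real (e n))) holomorphic_on {z. Re z > 0}"
      by (rule holomorphic_on_subset[where s = "{z. Re z > - e n}"])
         (use ctrans_decaying[OF g e(1)[of n]] e(1)[of n] in \<open>auto simp: decaying_def\<close>)
    have "Lp_le q lborel (\<lambda>y. ctrans g (Complex (e n) y)) (c * a)" using C g e(1) a unfolding Cbound_def by blast
    from Lp_leD_integrable(2)[OF this]
    have "\<rho> * (\<integral>y. cmod (ctrans g (Complex (e n) y)) powr q \<partial>lborel) \<le> \<rho> * (c * a) powr q"
      using c(4) by (intro mult_left_mono)
    then have "ennreal (\<rho> * (\<integral>y. cmod (ctrans g (Complex (e n) y)) powr q \<partial>lborel)) \<le> ennreal \<rho> * ennreal ((c * a) powr q)"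
      using c(4) by (simp add: ennreal_mult'[symmetric] ennreal_leI)
    then show "(\<integral>\<^sup>+x. ennreal (Jint q b c0 c1 c2 y1 y2 (\<lambda>z. ctrans g (z + of_real (e n))) x) \<partial>lborel) \<le> ennreal \<rho> * ennreal ((c * a) powr q)"
      using e(3)[of n] by (rule order_trans[rotated])
  next
    fix z :: complex assume z: "Re z > 0"
    show "(\<lambda>n. ctrans g (z + of_real (e n))) \<longlonglongrightarrow> ctrans g z"
    proof (rule isCont_tendsto_compose[of _ "ctrans g"])
      show "isCont (ctrans g) z"
        using holomorphic_on_imp_continuous_on[OF ctrans_holomorphic_rhp[OF g]] z
        by (simp add: continuous_on_eq_continuous_at open_rhp)
      have "(\<lambda>n. z + of_real (e n)) \<longlonglongrightarrow> z + of_real 0" by (intro tendsto_intros e0)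
      then show "(\<lambda>n. z + of_real (e n)) \<longlonglongrightarrow> z" by simp
    qed
  qed (use q in simp)
qed

lemma Lp_le_reflect:
  assumes "Lp_le p lborel f a"
  shows "Lp_le p lborel (\<lambda>x::real. f (- x)) a"
proof -
  have [measurable]: "f \<in> borel_measurable borel" using assms by (simp add: Lp_le_def)
  have "(\<integral>\<^sup>+x. ennreal (cmod (f (- x)) powr p) \<partial>lborel) = (\<integral>\<^sup>+x. ennreal (cmod (f x) powr p) \<partial>lborel)"
    using nn_integral_real_affine[of "\<lambda>x. ennreal (cmod (f x) powr p)" "-1" 0] by simp
  then show ?thesis using assms by (simp add: Lp_le_def)
qed

text \<open>Test against the truncations of the extremal function \<open>|k| powr (q - 2) * cnj k\<close>.\<close>

lemma Lp_le_dual: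
  fixes k :: "real \<Rightarrow> complex"
  assumes rq: "r > 1" "q > 1" "1 / r + 1 / q = 1" and km[measurable]: "k \<in> borel_measurable borel"
    and D: "\<And>y. cmod (k y) \<le> D" and C: "C \<ge> 0"
    and H: "\<And>h b. nice h \<Longrightarrow> Lp_le r lborel h b \<Longrightarrow> cmod (\<integral>y. k y * h y \<partial>lborel) \<le> C * b"
  shows "Lp_le q lborel k C"
proof -
  have qr: "(q - 1) * r = q" using rq by (simp add: field_simps)
  have trunc_bound: "Lp_le q lborel (\<lambda>y. indicator {- real n..real n} y * k y) C" for n
  proof -
    define h where "h = (\<lambda>y. indicator {- real n..real n} y * (cnj (k y) * of_real (cmod (k y) powr (q - 2))))"
    have hk: "cmod (h y) = indicator {- real n..real n} y * cmod (k y) powr (q - 1)" for y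
    proof (cases "k y = 0")
      case False
      then have "cmod (k y) * cmod (k y) powr (q - 2) = cmod (k y) powr (q - 1)"
        by (simp add: powr_mult_base)
      then show ?thesis by (simp add: h_def norm_mult indicator_def)
    qed (simp add: h_def)
    have kh: "k y * h y = of_real (indicator {- real n..real n} y * cmod (k y) powr q)" for y
    proof (cases "k y = 0")
      case False
      have "k y * h y = of_real (indicator {- real n..real n} y) * ((k y * cnj (k y)) * of_real (cmod (k y) powr (q - 2)))"
        by (simp add: h_def indicator_def)
      also have "k y * cnj (k y) = of_real (cmod (k y) powr 2)" using complex_norm_square[of "k y"] by simp
      also have "of_real (indicator {- real n..real n} y) * (of_real (cmod (k y) powr 2) * of_real (cmod (k y) powr (q - 2)))
         = complex_of_real (indicator {- real n..real n} y * (cmod (k y) powr 2 * cmod (k y) powr (q - 2)))" by (simp only: of_real_mult)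
      also have "cmod (k y) powr 2 * cmod (k y) powr (q - 2) = cmod (k y) powr q"
        unfolding powr_add[symmetric] by simp
      finally show ?thesis .
    qed (simp add: h_def)
    have cm: "(\<lambda>y. cnj (k y)) \<in> borel_measurable borel"
      by (rule measurable_compose[OF km borel_measurable_continuous_onI[OF continuous_on_cnj[OF continuous_on_id]]])
    have hm[measurable]: "h \<in> borel_measurable borel" unfolding h_def using cm by measurable
    have hn: "nice h"
    proof (rule niceI[of _ "D powr (q - 1)" "real n"])
      show "cmod (h y) \<le> D powr (q - 1)" for y
        unfolding hk using D rq(2) by (auto simp: indicator_def intro: powr_mono2)
      show "h y = 0" if "real n < \<bar>y\<bar>" for y using that by (auto simp: h_def indicator_def)
    qed simp
    have hr: "cmod (h y) powr r = indicator {- real n..real n} y * cmod (k y) powr q" for y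
      unfolding hk powr_mult powr_powr qr using rq by (auto simp: indicator_def)
    define X where "X = (\<integral>y. indicator {- real n..real n} y * cmod (k y) powr q \<partial>lborel)"
    have r0: "r > 0" using rq by simp
    have Xi: "integrable lborel (\<lambda>y. indicator {- real n..real n} y * cmod (k y) powr q)"
      using nice_integrable_powr[OF hn r0] unfolding hr .
    have X0: "X \<ge> 0" unfolding X_def by (intro Bochner_Integration.integral_nonneg) simp
    have hL: "Lp_le r lborel h (X powr (1 / r))"
      using nice_Lp[OF hn r0] unfolding hr X_def .
    have "(\<integral>y. k y * h y \<partial>lborel) = of_real X" unfolding kh X_def by (rule integral_complex_of_real)
    then have XX: "X \<le> C * X powr (1 / r)" using H[OF hn hL] X0 by simp
    have "X \<le> C powr q"
    proof (cases "X = 0")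
      case False
      then have Xp: "X > 0" using X0 by simp
      have "X powr (1 / q) * X powr (1 / r) = X" unfolding powr_add[symmetric] using rq(3) Xp by (simp add: add.commute)
      then have "X powr (1 / q) * X powr (1 / r) \<le> C * X powr (1 / r)" using XX by simp
      then have "X powr (1 / q) \<le> C" using Xp by simp
      then have "(X powr (1 / q)) powr q \<le> C powr q" using rq by (intro powr_mono2) auto
      then show ?thesis using rq Xp by (simp add: powr_powr)
    qed simp
    then show ?thesis
    proof (intro Lp_leI_integrable)
      have eq: "cmod (indicator {- real n..real n} y * k y) powr q = indicator {- real n..real n} y * cmod (k y) powr q" for y
        using rq by (auto simp: indicator_def)
      show "integrable lborel (\<lambda>y. cmod (indicator {- real n..real n} y * k y) powr q)" unfolding eq by (rule Xi)
      assume "X \<le> C powr q"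
      then show "(\<integral>y. cmod (indicator {- real n..real n} y * k y) powr q \<partial>lborel) \<le> C powr q" unfolding eq X_def .
    qed (use C in auto)
  qed
  show ?thesis
  proof (rule Lp_le_limit[OF trunc_bound _ tendsto_const])
    show "(\<lambda>n. indicator {- real n..real n} y * k y) \<longlonglongrightarrow> k y" for y
    proof (rule tendsto_eventually)
      obtain N :: nat where "\<bar>y\<bar> \<le> real N" using real_arch_simple by blast
      then have "indicator {- real n..real n} y * k y = k y" if "n \<ge> N" for n
        using that by (auto simp: indicator_def)
      then show "\<forall>\<^sub>F n in sequentially. indicator {- real n..real n} y * k y = k y" unfolding eventually_sequentially by blast
    qed
  qed (use rq in simp)
qed

text \<open>The kernel is symmetric up to point reflection, so its transpose is again a Cauchy transform.\<close>

theorem Cbound_dual: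
  assumes C: "Cbound r c" and rq: "r > 1" "q > 1" "1 / r + 1 / q = 1"
  shows "Cbound q c"
  unfolding Cbound_def
proof (intro conjI allI impI)
  show c0: "c \<ge> 0" using C by (simp add: Cbound_def)
  fix g :: "real \<Rightarrow> complex" and e a :: real assume g: "nice g" and e: "e > 0" and a: "Lp_le q lborel g a"
  have a0: "a \<ge> 0" using a by (simp add: Lp_le_def)
  note gm[measurable] = nice_measurable[OF g]
  define k where "k = (\<lambda>y. ctrans g (Complex e y))"
  have km[measurable]: "k \<in> borel_measurable borel" unfolding k_def by (rule ctrans_line_measurable(1)[OF g e])
  obtain D where D: "D \<ge> 0" "\<And>y. cmod (k y) \<le> D"
  proof -
    obtain D where D: "D \<ge> 0" "\<And>z. 0 \<le> Re z \<Longrightarrow> cmod (ctrans g (z + of_real e)) \<le> D * (1 + cmod z) powr (- 1)"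
      using ctrans_decaying[OF g e] unfolding decaying_def by blast
    have "cmod (k y) \<le> D" for y
    proof -
      have "cmod (k y) \<le> D * (1 + cmod (Complex 0 y)) powr (- 1)" using D(2)[of "Complex 0 y"] by (simp add: k_def)
      also have "\<dots> \<le> D * 1"
        using D(1) powr_mono2'[of "-1" 1 "1 + cmod (Complex 0 y)"] by (intro mult_left_mono) auto
      finally show ?thesis by simp
    qed
    then show ?thesis using that D(1) by blast
  qed
  have "Lp_le q lborel k (c * a)"
  proof (rule Lp_le_dual[OF rq km D(2)])
    fix h b assume hn: "nice h" and hL: "Lp_le r lborel h b"
    note [measurable] = nice_measurable[OF hn]
    have hr: "nice (\<lambda>y. h (- y))" by (rule nice_reflect[OF hn])
    let ?T = "\<lambda>u. ctrans (\<lambda>y. h (- y)) (Complex e (- u))"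
    have T: "Lp_le r lborel ?T (c * b)"
      using Lp_le_reflect[of r "\<lambda>u. ctrans (\<lambda>y. h (- y)) (Complex e u)" "c * b"] C hr e Lp_le_reflect[OF hL]
      unfolding Cbound_def by blast
    \<comment> \<open>integrated over y first, this is g times the transform of the reflected h\<close>
    let ?f = "\<lambda>u y. g u * (h y / (Complex e y - Complex 0 u))"
    have fm: "case_prod ?f \<in> borel_measurable (borel \<Otimes>\<^sub>M borel)"
    proof -
      have [measurable]: "(\<lambda>p. Complex e (snd p) - Complex 0 (fst p)) \<in> borel_measurable (borel \<Otimes>\<^sub>M borel)"
        unfolding Complex_eq by (intro borel_measurable_diff borel_measurable_add borel_measurable_times borel_measurable_const
          measurable_compose[OF measurable_fst borel_measurable_of_real]
          measurable_compose[OF measurable_snd borel_measurable_of_real])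
      show ?thesis unfolding case_prod_beta' by measurable
    qed
    have fle: "cmod (?f u y) \<le> cmod (g u) * (1 / e * cmod (h y))" for u y
    proof -
      have "e \<le> cmod (Complex e y - Complex 0 u)" using kernel_bound[of "Complex e y" u] e by simp
      then have "cmod (h y) / cmod (Complex e y - Complex 0 u) \<le> cmod (h y) / e"
        using e by (intro divide_left_mono mult_pos_pos) auto
      then have "cmod (g u) * (cmod (h y) / cmod (Complex e y - Complex 0 u)) \<le> cmod (g u) * (cmod (h y) / e)"
        by (intro mult_left_mono) auto
      then show ?thesis by (simp add: norm_mult norm_divide)
    qed
    note F = Fubini_dominated(1)[OF fm integrable_norm[OF nice_integrable[OF g]] integrable_mult_right[OF integrable_norm[OF nice_integrable[OF hn]], of "1 / e"] fle]
    have in1: "(\<integral>u. ?f u y \<partial>lborel) = of_real (2 * pi) * (k y * h y)" for y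
    proof -
      have "(\<integral>u. ?f u y \<partial>lborel) = (\<integral>u. h y * (g u / (Complex e y - Complex 0 u)) \<partial>lborel)"
        by (intro Bochner_Integration.integral_cong refl) (simp add: mult_ac)
      also have "\<dots> = h y * (\<integral>u. g u / (Complex e y - Complex 0 u) \<partial>lborel)" by (rule integral_mult_right_zero)
      also have "(\<integral>u. g u / (Complex e y - Complex 0 u) \<partial>lborel) = of_real (2 * pi) * k y" by (simp add: k_def ctrans_def)
      finally show ?thesis by (simp only: mult_ac)
    qed
    have in2: "(\<integral>y. ?f u y \<partial>lborel) = of_real (2 * pi) * (g u * ?T u)" for u
    proof -
      have "(\<integral>y. h (- y) / (Complex e (- u) - Complex 0 y) \<partial>lborel) = (\<integral>y. h (- y) / (Complex e (- y) - Complex 0 u) \<partial>lborel)"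
      proof -
        have "Complex e (- u) - Complex 0 y = Complex e (- y) - Complex 0 u" for y by (simp add: complex_eq_iff)
        then show ?thesis by simp
      qed
      also have "\<dots> = (\<integral>y. h y / (Complex e y - Complex 0 u) \<partial>lborel)" by (rule integral_reflect)
      finally have "of_real (2 * pi) * ?T u = (\<integral>y. h y / (Complex e y - Complex 0 u) \<partial>lborel)" by (simp add: ctrans_def)
      moreover have "(\<integral>y. ?f u y \<partial>lborel) = g u * (\<integral>y. h y / (Complex e y - Complex 0 u) \<partial>lborel)" by (rule integral_mult_right_zero)
      ultimately show ?thesis by (simp only: mult.left_commute)
    qed
    have "(\<integral>y. k y * h y \<partial>lborel) = (\<integral>u. g u * ?T u \<partial>lborel)"
      using F unfolding in1 in2 by simp
    moreover have "cmod (\<integral>u. g u * ?T u \<partial>lborel) \<le> a * (c * b)"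
      by (rule Hoelder_integral(2)[OF rq(2,1) _ a T]) (use rq(3) in simp)
    ultimately show "cmod (\<integral>y. k y * h y \<partial>lborel) \<le> c * a * b" by (simp only: mult_ac)
  qed (use c0 a0 in simp)
  then show "Lp_le q lborel (\<lambda>y. ctrans g (Complex e y)) (c * a)" unfolding k_def .
qed

section \<open>Admissible weights\<close>

lemma inverse_sqrt_pi_le: "1 / sqrt pi \<le> 113 / 200"
proof -
  have "(200 / 113)\<^sup>2 \<le> pi" using pi_approx by (simp add: power2_eq_square)
  then have "200 / 113 \<le> sqrt pi" by (rule real_le_rsqrt)
  then have "inverse (sqrt pi) \<le> inverse (200 / 113)" by (intro le_imp_inverse_le) auto
  then show ?thesis by (simp add: inverse_eq_divide)
qed

lemma exp_decay_le:
  fixes a s :: real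
  assumes "0 \<le> a" "a \<le> s"
  shows "exp (- (2 * s\<^sup>2)) * (1 + 2 * a\<^sup>2 + 2 * a ^ 4) \<le> 1"
proof -
  have sq: "a\<^sup>2 \<le> s\<^sup>2" using assms by (rule power_mono[rotated])
  have "1 + 2 * a\<^sup>2 + 2 * a ^ 4 = 1 + 2 * a\<^sup>2 + (2 * a\<^sup>2)\<^sup>2 / 2" by (simp add: power_mult_distrib)
  also have "\<dots> \<le> exp (2 * a\<^sup>2)" by (rule exp_lower_Taylor_quadratic) simp
  also have "\<dots> \<le> exp (2 * s\<^sup>2)" using sq by simp
  finally have "exp (- (2 * s\<^sup>2)) * (1 + 2 * a\<^sup>2 + 2 * a ^ 4) \<le> exp (- (2 * s\<^sup>2)) * exp (2 * s\<^sup>2)"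
    by (intro mult_left_mono) auto
  then show ?thesis by (simp add: exp_minus)
qed

lemma weight_step:
  fixes a b k s \<rho> :: real
  assumes "0 \<le> a" "a \<le> s" "s \<le> b" "0 \<le> k" "1 \<le> (\<rho> - k * b) * (1 + 2 * a\<^sup>2 + 2 * a ^ 4)"
  shows "exp (- (2 * s\<^sup>2)) + k * s \<le> \<rho>"
proof -
  let ?A = "1 + 2 * a\<^sup>2 + 2 * a ^ 4"
  have A: "?A > 0" by (intro add_pos_nonneg) auto
  have "exp (- (2 * s\<^sup>2)) * ?A \<le> (\<rho> - k * b) * ?A" using exp_decay_le[OF assms(1,2)] assms(5) by linarith
  then have "exp (- (2 * s\<^sup>2)) \<le> \<rho> - k * b" using A by simp
  moreover have "k * s \<le> k * b" using assms by (intro mult_left_mono) auto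
  ultimately show ?thesis by linarith
qed

text \<open>For small \<open>s\<close> the segments are bounded by \<open>s / sqrt pi\<close> and for large \<open>s\<close> by \<open>1 / 2\<close>; in the second range
the exponential is largest at \<open>b\<close>.\<close>

lemma weight_split:
  fixes s :: real
  assumes s: "s \<ge> 0" and k: "k \<ge> 0"
    and 1: "s \<le> b \<Longrightarrow> exp (- (2 * s\<^sup>2)) + k * (113 / 200) * s \<le> \<rho>"
    and b: "0 \<le> b" "1 \<le> (\<rho> - k / 2) * (1 + 2 * b\<^sup>2 + 2 * b ^ 4)"
  shows "1 * exp (- (2 * s\<^sup>2)) + k * min (1 / 2) (s / sqrt pi) \<le> \<rho>"
proof (cases "s \<le> b")
  case True
  have "s / sqrt pi \<le> 113 / 200 * s" using mult_right_mono[OF inverse_sqrt_pi_le s] by simp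
  then have "k * min (1 / 2) (s / sqrt pi) \<le> k * (113 / 200 * s)"
    by (intro mult_left_mono[OF _ k] order_trans[OF min.cobounded2])
  then show ?thesis using 1[OF True] by simp
next
  case False
  let ?A = "1 + 2 * b\<^sup>2 + 2 * b ^ 4"
  have A: "?A > 0" by (intro add_pos_nonneg) auto
  have "exp (- (2 * s\<^sup>2)) * ?A \<le> (\<rho> - k / 2) * ?A" using exp_decay_le[of b s] b False by linarith
  then have "exp (- (2 * s\<^sup>2)) \<le> \<rho> - k / 2" using A by simp
  moreover have "k * min (1 / 2) (s / sqrt pi) \<le> k * (1 / 2)" by (intro mult_left_mono[OF _ k] min.cobounded1)
  ultimately show ?thesis by linarith
qed

lemma admissible_line: "admissible 1 0 0 1"
  by (simp add: admissible_def)

lemma admissible_rays: "admissible 0 1 1 1"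
  by (auto simp: admissible_def)

text \<open>Line and one segment. The weight is largest, about 1.04, near \<open>s = 0.15\<close>. On each interval of the subdivision the exponential is taken at the left end and the linear term at the right end.\<close>

lemma admissible_hook: "admissible 1 1 0 (27 / 25)"
  unfolding admissible_def
proof (intro conjI allI impI)
  fix s :: real assume s: "0 \<le> s"
  have "1 * exp (- (2 * s\<^sup>2)) + 1 * min (1 / 2) (s / sqrt pi) \<le> 27 / 25"
  proof (rule weight_split[where b = "29 / 50"])
    assume "s \<le> 29 / 50"
    then consider "0 \<le> s" "s \<le> 7 / 50" | "7 / 50 \<le> s" "s \<le> 1 / 5" | "1 / 5 \<le> s" "s \<le> 27 / 100" | "27 / 100 \<le> s" "s \<le> 19 / 50" | "19 / 50 \<le> s" "s \<le> 29 / 50"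
      using s by linarith
    then show "exp (- (2 * s\<^sup>2)) + 1 * (113 / 200) * s \<le> 27 / 25"
    proof cases
      case 1 then show ?thesis by (intro weight_step[of "0" s "7 / 50"]) (simp_all add: power2_eq_square power4_eq_xxxx)
    next
      case 2 then show ?thesis by (intro weight_step[of "7 / 50" s "1 / 5"]) (simp_all add: power2_eq_square power4_eq_xxxx)
    next
      case 3 then show ?thesis by (intro weight_step[of "1 / 5" s "27 / 100"]) (simp_all add: power2_eq_square power4_eq_xxxx)
    next
      case 4 then show ?thesis by (intro weight_step[of "27 / 100" s "19 / 50"]) (simp_all add: power2_eq_square power4_eq_xxxx)
    next
      case 5 then show ?thesis by (intro weight_step[of "19 / 50" s "29 / 50"]) (simp_all add: power2_eq_square power4_eq_xxxx)
    qed
  qed (use s in \<open>simp_all add: power2_eq_square power4_eq_xxxx\<close>)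
  then show "1 * exp (- (2 * s\<^sup>2)) + (1 + 0) * min (1 / 2) (s / sqrt pi) \<le> 27 / 25" by simp
qed simp_all

text \<open>Line and two segments. The weight is largest, about 1.21, at \<open>s = sqrt pi / 2\<close>, where the two bounds for a segment agree.\<close>

lemma admissible_comb: "admissible 1 1 1 (32 / 25)"
  unfolding admissible_def
proof (intro conjI allI impI)
  fix s :: real assume s: "0 \<le> s"
  have "1 * exp (- (2 * s\<^sup>2)) + 2 * min (1 / 2) (s / sqrt pi) \<le> 32 / 25"
  proof (rule weight_split[where b = "7 / 8"])
    assume "s \<le> 7 / 8"
    then consider "0 \<le> s" "s \<le> 6 / 25" | "6 / 25 \<le> s" "s \<le> 17 / 50" | "17 / 50 \<le> s" "s \<le> 21 / 50" | "21 / 50 \<le> s" "s \<le> 1 / 2"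
      | "1 / 2 \<le> s" "s \<le> 29 / 50" | "29 / 50 \<le> s" "s \<le> 33 / 50" | "33 / 50 \<le> s" "s \<le> 73 / 100"
      | "73 / 100 \<le> s" "s \<le> 79 / 100" | "79 / 100 \<le> s" "s \<le> 21 / 25" | "21 / 25 \<le> s" "s \<le> 87 / 100" | "87 / 100 \<le> s" "s \<le> 7 / 8"
      using s by linarith
    then show "exp (- (2 * s\<^sup>2)) + 2 * (113 / 200) * s \<le> 32 / 25"
    proof cases
      case 1 then show ?thesis by (intro weight_step[of "0" s "6 / 25"]) (simp_all add: power2_eq_square power4_eq_xxxx)
    next
      case 2 then show ?thesis by (intro weight_step[of "6 / 25" s "17 / 50"]) (simp_all add: power2_eq_square power4_eq_xxxx)
    next
      case 3 then show ?thesis by (intro weight_step[of "17 / 50" s "21 / 50"]) (simp_all add: power2_eq_square power4_eq_xxxx)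
    next
      case 4 then show ?thesis by (intro weight_step[of "21 / 50" s "1 / 2"]) (simp_all add: power2_eq_square power4_eq_xxxx)
    next
      case 5 then show ?thesis by (intro weight_step[of "1 / 2" s "29 / 50"]) (simp_all add: power2_eq_square power4_eq_xxxx)
    next
      case 6 then show ?thesis by (intro weight_step[of "29 / 50" s "33 / 50"]) (simp_all add: power2_eq_square power4_eq_xxxx)
    next
      case 7 then show ?thesis by (intro weight_step[of "33 / 50" s "73 / 100"]) (simp_all add: power2_eq_square power4_eq_xxxx)
    next
      case 8 then show ?thesis by (intro weight_step[of "73 / 100" s "79 / 100"]) (simp_all add: power2_eq_square power4_eq_xxxx)
    next
      case 9 then show ?thesis by (intro weight_step[of "79 / 100" s "21 / 25"]) (simp_all add: power2_eq_square power4_eq_xxxx)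
    next
      case 10 then show ?thesis by (intro weight_step[of "21 / 25" s "87 / 100"]) (simp_all add: power2_eq_square power4_eq_xxxx)
    next
      case 11 then show ?thesis by (intro weight_step[of "87 / 100" s "7 / 8"]) (simp_all add: power2_eq_square power4_eq_xxxx)
    qed
  qed (use s in \<open>simp_all add: power2_eq_square power4_eq_xxxx\<close>)
  then show "1 * exp (- (2 * s\<^sup>2)) + (1 + 1) * min (1 / 2) (s / sqrt pi) \<le> 32 / 25" by simp
qed simp_all

section \<open>Half-strip boundaries\<close>

lemma borel_measurable_ctrans:
  assumes "nice g" shows "ctrans g \<in> borel_measurable borel"
proof -
  note [measurable] = nice_measurable[OF assms]
  have "(\<lambda>w. \<integral>u. g u / (w - Complex 0 u) \<partial>lborel) \<in> borel_measurable borel"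
  proof (rule lborel.borel_measurable_lebesgue_integral)
    have [measurable]: "(\<lambda>p::complex \<times> real. fst p - Complex 0 (snd p)) \<in> borel_measurable (borel \<Otimes>\<^sub>M lborel)"
      unfolding Complex_eq by (intro borel_measurable_diff borel_measurable_add borel_measurable_times borel_measurable_const
          measurable_compose[OF measurable_snd borel_measurable_of_real] measurable_fst) auto
    show "case_prod (\<lambda>w u. g u / (w - Complex 0 u)) \<in> borel_measurable (borel \<Otimes>\<^sub>M lborel)"
      unfolding case_prod_beta' by measurable
  qed
  then show ?thesis unfolding ctrans_def[abs_def] by measurable
qed

text \<open>What the columns below need to know about the \<open>q\<close>-th power of a transform on the right half-plane: its mass on a line, on a
line with one or two perpendicular segments, and on two perpendicular rays.\<close>

definition carleson :: "(complex \<Rightarrow> ennreal) \<Rightarrow> ennreal \<Rightarrow> bool" where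
  "carleson H m \<longleftrightarrow> H \<in> borel_measurable borel
    \<and> (\<forall>b>0. (\<integral>\<^sup>+x. H (Complex b x) \<partial>lborel) \<le> m)
    \<and> (\<forall>b>0. \<forall>y. (\<integral>\<^sup>+x. H (Complex b x) \<partial>lborel) + (\<integral>\<^sup>+x\<in>{0<..<b}. H (Complex x y) \<partial>lborel) \<le> ennreal (27 / 25) * m)
    \<and> (\<forall>b>0. \<forall>y1 y2. (\<integral>\<^sup>+x. H (Complex b x) \<partial>lborel) + (\<integral>\<^sup>+x\<in>{0<..<b}. H (Complex x y1) \<partial>lborel)
          + (\<integral>\<^sup>+x\<in>{0<..<b}. H (Complex x y2) \<partial>lborel) \<le> ennreal (32 / 25) * m)
    \<and> (\<forall>y1 y2. (\<integral>\<^sup>+x\<in>{0<..}. H (Complex x y1) \<partial>lborel) + (\<integral>\<^sup>+x\<in>{0<..}. H (Complex x y2) \<partial>lborel) \<le> m)"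

text \<open>The rays are limits of growing segments.\<close>

lemma carleson_ctrans:
  assumes g: "nice g" and m: "side_mass q g m"
  shows "carleson (\<lambda>z. ennreal (cmod (ctrans g z) powr q)) m"
proof -
  note [measurable] = borel_measurable_ctrans[OF g]
  let ?H = "\<lambda>z. ennreal (cmod (ctrans g z) powr q)"
  have J: "ennreal c0 * (\<integral>\<^sup>+x. ?H (Complex b x) \<partial>lborel) + ennreal c1 * (\<integral>\<^sup>+x\<in>{0<..<b}. ?H (Complex x y1) \<partial>lborel)
      + ennreal c2 * (\<integral>\<^sup>+x\<in>{0<..<b}. ?H (Complex x y2) \<partial>lborel) \<le> ennreal \<rho> * m"
    if ad: "admissible c0 c1 c2 \<rho>" and b: "b > 0" for b c0 c1 c2 \<rho> y1 y2
  proof -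
    have c: "c0 \<ge> 0" "c1 \<ge> 0" "c2 \<ge> 0" using ad by (auto simp: admissible_def)
    have eq: "ennreal (indicator {0<..<b} x * cmod (ctrans g (Complex x y)) powr q) = ?H (Complex x y) * indicator {0<..<b} x" for x y
      by (auto simp: indicator_def)
    have "(\<integral>\<^sup>+x. ennreal (Jint q b c0 c1 c2 y1 y2 (ctrans g) x) \<partial>lborel) \<le> ennreal \<rho> * m"
      using m ad b unfolding side_mass_def by blast
    then show ?thesis unfolding Jint_nn_integral(1)[OF ctrans_holomorphic_rhp[OF g] b c] eq .
  qed
  show ?thesis unfolding carleson_def
  proof (intro conjI allI impI)
    show "?H \<in> borel_measurable borel" by measurable
    fix b y y1 y2 :: real
    show "(\<integral>\<^sup>+x. ?H (Complex b x) \<partial>lborel) \<le> m" if "0 < b" using J[OF admissible_line that] by simp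
    show "(\<integral>\<^sup>+x. ?H (Complex b x) \<partial>lborel) + (\<integral>\<^sup>+x\<in>{0<..<b}. ?H (Complex x y) \<partial>lborel) \<le> ennreal (27 / 25) * m" if "0 < b"
      using J[OF admissible_hook that, of y] by simp
    show "(\<integral>\<^sup>+x. ?H (Complex b x) \<partial>lborel) + (\<integral>\<^sup>+x\<in>{0<..<b}. ?H (Complex x y1) \<partial>lborel)
          + (\<integral>\<^sup>+x\<in>{0<..<b}. ?H (Complex x y2) \<partial>lborel) \<le> ennreal (32 / 25) * m" if "0 < b"
      using J[OF admissible_comb that, of y1 y2] by simp
    let ?h = "\<lambda>x. ?H (Complex x y1) + ?H (Complex x y2)"
    have le: "(\<integral>\<^sup>+x. ?h x * indicator {0<..<real (Suc n)} x \<partial>lborel) \<le> m" for n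
    proof -
      have "(\<integral>\<^sup>+x. ?h x * indicator {0<..<real (Suc n)} x \<partial>lborel) = (\<integral>\<^sup>+x\<in>{0<..<real (Suc n)}. ?H (Complex x y1) \<partial>lborel) + (\<integral>\<^sup>+x\<in>{0<..<real (Suc n)}. ?H (Complex x y2) \<partial>lborel)"
        by (subst nn_integral_add[symmetric]) (auto simp: distrib_right)
      then show ?thesis using J[OF admissible_rays, of "real (Suc n)" y1 y2] by simp
    qed
    have lim: "(\<lambda>n. ?h x * indicator {0<..<real (Suc n)} x) \<longlonglongrightarrow> ?h x * indicator {0<..} x" for x
    proof (rule tendsto_eventually)
      obtain N :: nat where "x \<le> real N" using real_arch_simple by blast
      then have "?h x * indicator {0<..<real (Suc n)} x = ?h x * indicator {0<..} x" if "n \<ge> N" for n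
        using that by (auto simp: indicator_def)
      then show "\<forall>\<^sub>F n in sequentially. ?h x * indicator {0<..<real (Suc n)} x = ?h x * indicator {0<..} x" unfolding eventually_sequentially by blast
    qed
    have "(\<integral>\<^sup>+x. ?h x * indicator {0<..} x \<partial>lborel) = (\<integral>\<^sup>+x. liminf (\<lambda>n. ?h x * indicator {0<..<real (Suc n)} x) \<partial>lborel)"
      by (intro nn_integral_cong) (metis lim lim_imp_Liminf sequentially_bot)
    also have "\<dots> \<le> liminf (\<lambda>n. \<integral>\<^sup>+x. ?h x * indicator {0<..<real (Suc n)} x \<partial>lborel)"
      by (rule nn_integral_liminf) measurable
    also have "\<dots> \<le> liminf (\<lambda>n::nat. m)" by (intro Liminf_mono always_eventually allI le)
    also have "\<dots> = m" by (rule Liminf_const) simp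
    also have "(\<integral>\<^sup>+x. ?h x * indicator {0<..} x \<partial>lborel) = (\<integral>\<^sup>+x\<in>{0<..}. ?H (Complex x y1) \<partial>lborel) + (\<integral>\<^sup>+x\<in>{0<..}. ?H (Complex x y2) \<partial>lborel)"
      by (subst nn_integral_add[symmetric]) (auto simp: distrib_right)
    finally show "(\<integral>\<^sup>+x\<in>{0<..}. ?H (Complex x y1) \<partial>lborel) + (\<integral>\<^sup>+x\<in>{0<..}. ?H (Complex x y2) \<partial>lborel) \<le> m" .
  qed
qed

lemma nn_integral_shift:
  fixes f :: "real \<Rightarrow> ennreal"
  assumes "f \<in> borel_measurable borel"
  shows "(\<integral>\<^sup>+x. f (c + x) \<partial>lborel) = (\<integral>\<^sup>+x. f x \<partial>lborel)"
  using nn_integral_real_affine[OF assms, of 1 c] by simp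

lemma nn_integral_flip:
  fixes f :: "real \<Rightarrow> ennreal"
  assumes "f \<in> borel_measurable borel"
  shows "(\<integral>\<^sup>+x. f (c - x) \<partial>lborel) = (\<integral>\<^sup>+x. f x \<partial>lborel)"
  using nn_integral_real_affine[OF assms, of "-1" c] by simp

lemma nn_integral_three_pieces:
  fixes f :: "real \<Rightarrow> ennreal"
  assumes [measurable]: "f \<in> borel_measurable borel" and s: "s > 0"
  shows "(\<integral>\<^sup>+x. f x \<partial>lborel) = (\<integral>\<^sup>+u\<in>{t<..}. f (t - s - u) \<partial>lborel) + (\<integral>\<^sup>+x\<in>{-s..s}. f x \<partial>lborel)
     + (\<integral>\<^sup>+u\<in>{t<..}. f (s - t + u) \<partial>lborel)"
proof -
  have "(\<integral>\<^sup>+x. f x \<partial>lborel) = (\<integral>\<^sup>+x. (f x * indicator {..<-s} x + f x * indicator {-s..s} x) + f x * indicator {s<..} x \<partial>lborel)"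
    by (intro nn_integral_cong) (use s in \<open>auto simp: indicator_def\<close>)
  also have "\<dots> = (\<integral>\<^sup>+x. f x * indicator {..<-s} x \<partial>lborel) + (\<integral>\<^sup>+x\<in>{-s..s}. f x \<partial>lborel) + (\<integral>\<^sup>+x. f x * indicator {s<..} x \<partial>lborel)"
    by (subst nn_integral_add; (subst nn_integral_add)?) auto
  also have "(\<integral>\<^sup>+x. f x * indicator {..<-s} x \<partial>lborel) = (\<integral>\<^sup>+u. f (t - s - u) * indicator {..<-s} (t - s - u) \<partial>lborel)"
    by (rule nn_integral_flip[symmetric]) measurable
  also have "\<dots> = (\<integral>\<^sup>+u\<in>{t<..}. f (t - s - u) \<partial>lborel)"
    by (intro nn_integral_cong) (auto simp: indicator_def)
  also have "(\<integral>\<^sup>+x. f x * indicator {s<..} x \<partial>lborel) = (\<integral>\<^sup>+u. f (s - t + u) * indicator {s<..} (s - t + u) \<partial>lborel)"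
    by (rule nn_integral_shift[symmetric]) measurable
  also have "\<dots> = (\<integral>\<^sup>+u\<in>{t<..}. f (s - t + u) \<partial>lborel)"
    by (intro nn_integral_cong) (auto simp: indicator_def)
  finally show ?thesis .
qed

lemma borel_measurable_strip_path [measurable]: "strip_path s t \<in> borel_measurable borel"
  unfolding strip_path_def[abs_def] Complex_eq by measurable

text \<open>Each side of the half-strip is parametrised by its own coordinate, height or abscissa.\<close>

lemma nn_integral_strip_path:
  assumes [measurable]: "\<phi> \<in> borel_measurable borel" and s: "s > 0"
  shows "(\<integral>\<^sup>+x. \<phi> (strip_path s t x) \<partial>lborel) = (\<integral>\<^sup>+v\<in>{t<..}. \<phi> (Complex (- s) v) \<partial>lborel)
     + (\<integral>\<^sup>+x\<in>{-s..s}. \<phi> (Complex x t) \<partial>lborel) + (\<integral>\<^sup>+v\<in>{t<..}. \<phi> (Complex s v) \<partial>lborel)"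
proof -
  have "(\<integral>\<^sup>+u\<in>{t<..}. \<phi> (strip_path s t (t - s - u)) \<partial>lborel) = (\<integral>\<^sup>+v\<in>{t<..}. \<phi> (Complex (- s) v) \<partial>lborel)"
    by (intro nn_integral_cong) (auto simp: indicator_def strip_path_def)
  moreover have "(\<integral>\<^sup>+x\<in>{-s..s}. \<phi> (strip_path s t x) \<partial>lborel) = (\<integral>\<^sup>+x\<in>{-s..s}. \<phi> (Complex x t) \<partial>lborel)"
    by (intro nn_integral_cong) (auto simp: indicator_def strip_path_def)
  moreover have "(\<integral>\<^sup>+u\<in>{t<..}. \<phi> (strip_path s t (s - t + u)) \<partial>lborel) = (\<integral>\<^sup>+v\<in>{t<..}. \<phi> (Complex s v) \<partial>lborel)"
    by (intro nn_integral_cong) (use s in \<open>auto simp: indicator_def strip_path_def\<close>)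
  ultimately show ?thesis using nn_integral_three_pieces[of "\<lambda>x. \<phi> (strip_path s t x)" s t] s by simp
qed

lemma carlesonD:
  assumes "carleson H m" "0 < b"
  shows "H \<in> borel_measurable borel"
    "(\<integral>\<^sup>+x. H (Complex b x) \<partial>lborel) \<le> m"
    "(\<integral>\<^sup>+x. H (Complex b x) \<partial>lborel) + (\<integral>\<^sup>+x\<in>{0<..<b}. H (Complex x y) \<partial>lborel) \<le> ennreal (27 / 25) * m"
    "(\<integral>\<^sup>+x. H (Complex b x) \<partial>lborel) + (\<integral>\<^sup>+x\<in>{0<..<b}. H (Complex x y1) \<partial>lborel)
          + (\<integral>\<^sup>+x\<in>{0<..<b}. H (Complex x y2) \<partial>lborel) \<le> ennreal (32 / 25) * m"
    "(\<integral>\<^sup>+x\<in>{0<..}. H (Complex x y1) \<partial>lborel) + (\<integral>\<^sup>+x\<in>{0<..}. H (Complex x y2) \<partial>lborel) \<le> m"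
  using assms unfolding carleson_def by blast+

text \<open>The line \<open>Re z = c\<close> cuts an enclosing half-strip boundary into two hooks, each made of part of a vertical line and
of the part of the bottom that joins it to the cut.\<close>

lemma sides_outer:
  assumes R: "carleson H m1" and L: "carleson (\<lambda>z. H (- z)) m2" and c: "\<bar>c\<bar> < S"
  shows "(\<integral>\<^sup>+x. H (strip_path S T x - of_real c) \<partial>lborel) \<le> ennreal (27 / 25) * m1 + ennreal (27 / 25) * m2"
proof -
  have b: "S - c > 0" "S + c > 0" "S > 0" using c by auto
  note [measurable] = carlesonD(1)[OF R b(1)]
  have 1: "(\<integral>\<^sup>+v\<in>{T<..}. H (Complex S v - of_real c) \<partial>lborel) \<le> (\<integral>\<^sup>+v. H (Complex (S - c) v) \<partial>lborel)"
  proof (intro nn_integral_mono)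
    fix v
    have "Complex S v - of_real c = Complex (S - c) v" by (simp add: complex_eq_iff)
    then show "H (Complex S v - of_real c) * indicator {T<..} v \<le> H (Complex (S - c) v)" by (auto simp: indicator_def)
  qed
  have 2: "(\<integral>\<^sup>+v\<in>{T<..}. H (Complex (- S) v - of_real c) \<partial>lborel) \<le> (\<integral>\<^sup>+v. H (- Complex (S + c) v) \<partial>lborel)"
  proof -
    have "(\<integral>\<^sup>+v\<in>{T<..}. H (Complex (- S) v - of_real c) \<partial>lborel) \<le> (\<integral>\<^sup>+v. H (- Complex (S + c) (0 - v)) \<partial>lborel)"
    proof (intro nn_integral_mono)
      fix v
      have "Complex (- S) v - of_real c = - Complex (S + c) (0 - v)" by (simp add: complex_eq_iff)
      then show "H (Complex (- S) v - of_real c) * indicator {T<..} v \<le> H (- Complex (S + c) (0 - v))" by (auto simp: indicator_def)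
    qed
    also have "\<dots> = (\<integral>\<^sup>+v. H (- Complex (S + c) v) \<partial>lborel)" by (rule nn_integral_flip[where c = 0]) measurable
    finally show ?thesis .
  qed
  have 3: "(\<integral>\<^sup>+x\<in>{-S..S}. H (Complex x T - of_real c) \<partial>lborel)
     \<le> (\<integral>\<^sup>+x\<in>{0<..<S - c}. H (Complex x T) \<partial>lborel) + (\<integral>\<^sup>+x\<in>{0<..<S + c}. H (- Complex x (- T)) \<partial>lborel)"
  proof -
    have e: "Complex x T - of_real c = Complex (- c + x) T" for x by (simp add: complex_eq_iff)
    have "(\<integral>\<^sup>+x\<in>{-S..S}. H (Complex x T - of_real c) \<partial>lborel) = (\<integral>\<^sup>+x. H (Complex (- c + x) T) * indicator {-S - c..S - c} (- c + x) \<partial>lborel)"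
      unfolding e by (intro nn_integral_cong) (auto simp: indicator_def)
    also have "\<dots> = (\<integral>\<^sup>+x. H (Complex x T) * indicator {-S - c..S - c} x \<partial>lborel)" by (rule nn_integral_shift) measurable
    also have "\<dots> = (\<integral>\<^sup>+x. H (Complex x T) * indicator {0<..<S - c} x + H (Complex x T) * indicator {-S - c<..<0} x \<partial>lborel)"
    proof (rule nn_integral_cong_AE)
      have "AE x in lborel. x \<noteq> 0 \<and> x \<noteq> - S - c \<and> x \<noteq> S - c" by (intro AE_conjI AE_lborel_singleton)
      then show "AE x in lborel. H (Complex x T) * indicator {-S - c..S - c} x
           = H (Complex x T) * indicator {0<..<S - c} x + H (Complex x T) * indicator {-S - c<..<0} x"
        by eventually_elim (use b in \<open>auto simp: indicator_def\<close>)
    qed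
    also have "\<dots> = (\<integral>\<^sup>+x\<in>{0<..<S - c}. H (Complex x T) \<partial>lborel) + (\<integral>\<^sup>+x\<in>{-S - c<..<0}. H (Complex x T) \<partial>lborel)"
      by (rule nn_integral_add) measurable
    also have "(\<integral>\<^sup>+x\<in>{-S - c<..<0}. H (Complex x T) \<partial>lborel) = (\<integral>\<^sup>+x. H (Complex (0 - x) T) * indicator {-S - c<..<0} (0 - x) \<partial>lborel)"
      by (rule nn_integral_flip[symmetric]) measurable
    also have "\<dots> = (\<integral>\<^sup>+x\<in>{0<..<S + c}. H (- Complex x (- T)) \<partial>lborel)"
    proof (rule nn_integral_cong)
      fix x
      have "Complex (0 - x) T = - Complex x (- T)" by (simp add: complex_eq_iff)
      then show "H (Complex (0 - x) T) * indicator {-S - c<..<0} (0 - x) = H (- Complex x (- T)) * indicator {0<..<S + c} x"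
        by (auto simp: indicator_def)
    qed
    finally show ?thesis by simp
  qed
  have "(\<integral>\<^sup>+x. H (strip_path S T x - of_real c) \<partial>lborel) \<le> (\<integral>\<^sup>+v. H (- Complex (S + c) v) \<partial>lborel)
     + ((\<integral>\<^sup>+x\<in>{0<..<S - c}. H (Complex x T) \<partial>lborel) + (\<integral>\<^sup>+x\<in>{0<..<S + c}. H (- Complex x (- T)) \<partial>lborel))
     + (\<integral>\<^sup>+v. H (Complex (S - c) v) \<partial>lborel)"
    by (subst nn_integral_strip_path[of "\<lambda>w. H (w - of_real c)"]) (use b 1 2 3 in \<open>auto intro!: add_mono\<close>)
  also have "\<dots> = ((\<integral>\<^sup>+v. H (Complex (S - c) v) \<partial>lborel) + (\<integral>\<^sup>+x\<in>{0<..<S - c}. H (Complex x T) \<partial>lborel))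
     + ((\<integral>\<^sup>+v. H (- Complex (S + c) v) \<partial>lborel) + (\<integral>\<^sup>+x\<in>{0<..<S + c}. H (- Complex x (- T)) \<partial>lborel))"
    by (simp add: add_ac)
  also have "\<dots> \<le> ennreal (27 / 25) * m1 + ennreal (27 / 25) * m2"
    by (intro add_mono carlesonD(3)[OF R b(1)] carlesonD(3)[OF L b(2)])
  finally show ?thesis .
qed

text \<open>A half-strip boundary on one side of the line: the far side and the bottom form a hook, and the near side is a line.\<close>

lemma sides_inner_aux:
  assumes R: "carleson H m" and s: "0 < s" "s < c"
  shows "(\<integral>\<^sup>+x. H (strip_path s t x + of_real c) \<partial>lborel) \<le> ennreal (54 / 25) * m"
proof -
  have b: "c - s > 0" "c + s > 0" using s by auto
  note [measurable] = carlesonD(1)[OF R b(1)]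
  have 1: "(\<integral>\<^sup>+v\<in>{t<..}. H (Complex a v + of_real c) \<partial>lborel) \<le> (\<integral>\<^sup>+v. H (Complex (c + a) v) \<partial>lborel)" for a
  proof (intro nn_integral_mono)
    fix v
    have "Complex a v + of_real c = Complex (c + a) v" by (simp add: complex_eq_iff)
    then show "H (Complex a v + of_real c) * indicator {t<..} v \<le> H (Complex (c + a) v)" by (auto simp: indicator_def add.commute)
  qed
  have 3: "(\<integral>\<^sup>+x\<in>{-s..s}. H (Complex x t + of_real c) \<partial>lborel) \<le> (\<integral>\<^sup>+x\<in>{0<..<c + s}. H (Complex x t) \<partial>lborel)"
  proof -
    have e: "Complex x t + of_real c = Complex (c + x) t" for x by (simp add: complex_eq_iff)
    have "(\<integral>\<^sup>+x\<in>{-s..s}. H (Complex x t + of_real c) \<partial>lborel) \<le> (\<integral>\<^sup>+x. H (Complex (c + x) t) * indicator {0<..<c + s} (c + x) \<partial>lborel)"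
      unfolding e
    proof (rule nn_integral_mono_AE)
      show "AE x in lborel. H (Complex (c + x) t) * indicator {- s..s} x \<le> H (Complex (c + x) t) * indicator {0<..<c + s} (c + x)"
        using AE_lborel_singleton[of s] by eventually_elim (use s in \<open>auto simp: indicator_def\<close>)
    qed
    also have "\<dots> = (\<integral>\<^sup>+x\<in>{0<..<c + s}. H (Complex x t) \<partial>lborel)" by (rule nn_integral_shift) measurable
    finally show ?thesis .
  qed
  have "(\<integral>\<^sup>+x. H (strip_path s t x + of_real c) \<partial>lborel) \<le> (\<integral>\<^sup>+v. H (Complex (c - s) v) \<partial>lborel)
     + (\<integral>\<^sup>+x\<in>{0<..<c + s}. H (Complex x t) \<partial>lborel) + (\<integral>\<^sup>+v. H (Complex (c + s) v) \<partial>lborel)"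
    by (subst nn_integral_strip_path[of "\<lambda>w. H (w + of_real c)"]) (use s 1[of s] 1[of "- s"] 3 in \<open>auto intro!: add_mono\<close>)
  also have "\<dots> = (\<integral>\<^sup>+v. H (Complex (c - s) v) \<partial>lborel)
     + ((\<integral>\<^sup>+v. H (Complex (c + s) v) \<partial>lborel) + (\<integral>\<^sup>+x\<in>{0<..<c + s}. H (Complex x t) \<partial>lborel))" by (simp add: add_ac)
  also have "\<dots> \<le> ennreal (27 / 25) * m + ennreal (27 / 25) * m"
  proof (rule add_mono)
    have "ennreal 1 * m \<le> ennreal (27 / 25) * m" by (intro mult_right_mono ennreal_leI) auto
    then show "(\<integral>\<^sup>+v. H (Complex (c - s) v) \<partial>lborel) \<le> ennreal (27 / 25) * m"
      using order_trans[OF carlesonD(2)[OF R b(1)]] by simp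
  qed (rule carlesonD(3)[OF R b(2)])
  also have "\<dots> = ennreal (54 / 25) * m" by (simp add: distrib_right[symmetric] ennreal_plus[symmetric] del: ennreal_plus)
  finally show ?thesis .
qed

lemma strip_path_mirror: "s > 0 \<Longrightarrow> - strip_path s t (- x) = Complex (Re (strip_path s t x)) (- Im (strip_path s t x))"
  by (auto simp: strip_path_def complex_eq_iff)

lemma carleson_cnj:
  assumes H: "carleson H m"
  shows "carleson (\<lambda>z. H (cnj z)) m"
proof -
  have [measurable]: "H \<in> borel_measurable borel" using H by (simp add: carleson_def)
  have [measurable]: "cnj \<in> borel_measurable borel"
    by (intro borel_measurable_continuous_onI continuous_on_cnj continuous_on_id)
  have c: "cnj (Complex x y) = Complex x (0 - y)" for x y by (simp add: complex_eq_iff)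
  have "(\<integral>\<^sup>+x. H (Complex b (0 - x)) \<partial>lborel) = (\<integral>\<^sup>+x. H (Complex b x) \<partial>lborel)" for b
    by (rule nn_integral_flip) measurable
  then show ?thesis using H unfolding carleson_def c by simp
qed

text \<open>The case of the other side follows by the mirror symmetry of the half-strip.\<close>

lemma sides_inner:
  assumes R: "carleson H m" and L: "carleson (\<lambda>z. H (- z)) m" and s: "0 < s" "s < \<bar>c\<bar>"
  shows "(\<integral>\<^sup>+x. H (strip_path s t x - of_real c) \<partial>lborel) \<le> ennreal (54 / 25) * m"
proof (cases "c < 0")
  case True
  then show ?thesis using sides_inner_aux[OF R, of s "- c" t] s by simp
next
  case False
  have [measurable]: "H \<in> borel_measurable borel" using R by (simp add: carleson_def)
  have "- cnj (strip_path s t x + of_real c) = strip_path s t (0 - x) - of_real c" for x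
    using strip_path_mirror[OF s(1), of t x] by (simp add: complex_eq_iff)
  then have "(\<integral>\<^sup>+x. H (- cnj (strip_path s t x + of_real c)) \<partial>lborel) = (\<integral>\<^sup>+x. H (strip_path s t (0 - x) - of_real c) \<partial>lborel)"
    by simp
  also have "\<dots> = (\<integral>\<^sup>+x. H (strip_path s t x - of_real c) \<partial>lborel)" by (rule nn_integral_flip) measurable
  finally show ?thesis using sides_inner_aux[OF carleson_cnj[OF L] s(1), of c t] s False by simp
qed

text \<open>The transform of a horizontal line at height \<open>t\<close>, after a quarter turn. The line cuts an enclosing half-strip
boundary into two rays above, and a line with two perpendicular segments below.\<close>

lemma bottom_outer:
  assumes R: "carleson H m1" and L: "carleson (\<lambda>z. H (- z)) m2" and S: "0 < S" and t: "T < t"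
  shows "(\<integral>\<^sup>+x. H (Complex (Im (strip_path S T x) - t) (- Re (strip_path S T x))) \<partial>lborel) \<le> m1 + ennreal (32 / 25) * m2"
proof -
  have b: "t - T > 0" using t by simp
  note [measurable] = carlesonD(1)[OF R b]
  have [measurable]: "(\<lambda>w. Complex (Im w - t) (- Re w)) \<in> borel_measurable borel" unfolding Complex_eq by measurable
  have 1: "(\<integral>\<^sup>+x\<in>{-S..S}. H (Complex (T - t) (- x)) \<partial>lborel) \<le> (\<integral>\<^sup>+x. H (- Complex (t - T) x) \<partial>lborel)"
  proof (intro nn_integral_mono)
    fix x
    have "Complex (T - t) (- x) = - Complex (t - T) x" by (simp add: complex_eq_iff)
    then show "H (Complex (T - t) (- x)) * indicator {-S..S} x \<le> H (- Complex (t - T) x)" by (auto simp: indicator_def)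
  qed
  have 2: "(\<integral>\<^sup>+v\<in>{T<..}. H (Complex (v - t) a) \<partial>lborel) \<le> (\<integral>\<^sup>+x\<in>{0<..}. H (Complex x a) \<partial>lborel) + (\<integral>\<^sup>+x\<in>{0<..<t - T}. H (- Complex x (- a)) \<partial>lborel)" for a
  proof -
    have "(\<integral>\<^sup>+v\<in>{T<..}. H (Complex (v - t) a) \<partial>lborel) = (\<integral>\<^sup>+v. H (Complex (- t + v) a) * indicator {T - t<..} (- t + v) \<partial>lborel)"
      by (intro nn_integral_cong) (auto simp: indicator_def)
    also have "\<dots> = (\<integral>\<^sup>+x. H (Complex x a) * indicator {T - t<..} x \<partial>lborel)" by (rule nn_integral_shift) measurable
    also have "\<dots> = (\<integral>\<^sup>+x. H (Complex x a) * indicator {0<..} x + H (Complex x a) * indicator {T - t<..<0} x \<partial>lborel)"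
    proof (rule nn_integral_cong_AE)
      show "AE x in lborel. H (Complex x a) * indicator {T - t<..} x = H (Complex x a) * indicator {0<..} x + H (Complex x a) * indicator {T - t<..<0} x"
        using AE_lborel_singleton[of "0::real"] by eventually_elim (use b in \<open>auto simp: indicator_def\<close>)
    qed
    also have "\<dots> = (\<integral>\<^sup>+x\<in>{0<..}. H (Complex x a) \<partial>lborel) + (\<integral>\<^sup>+x\<in>{T - t<..<0}. H (Complex x a) \<partial>lborel)"
      by (rule nn_integral_add) measurable
    also have "(\<integral>\<^sup>+x\<in>{T - t<..<0}. H (Complex x a) \<partial>lborel) = (\<integral>\<^sup>+x. H (Complex (0 - x) a) * indicator {T - t<..<0} (0 - x) \<partial>lborel)"
      by (rule nn_integral_flip[symmetric]) measurable
    also have "\<dots> = (\<integral>\<^sup>+x\<in>{0<..<t - T}. H (- Complex x (- a)) \<partial>lborel)"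
    proof (rule nn_integral_cong)
      fix x
      have "Complex (0 - x) a = - Complex x (- a)" by (simp add: complex_eq_iff)
      then show "H (Complex (0 - x) a) * indicator {T - t<..<0} (0 - x) = H (- Complex x (- a)) * indicator {0<..<t - T} x"
        by (auto simp: indicator_def)
    qed
    finally show ?thesis by simp
  qed
  have "(\<integral>\<^sup>+x. H (Complex (Im (strip_path S T x) - t) (- Re (strip_path S T x))) \<partial>lborel)
    \<le> ((\<integral>\<^sup>+x\<in>{0<..}. H (Complex x S) \<partial>lborel) + (\<integral>\<^sup>+x\<in>{0<..<t - T}. H (- Complex x (- S)) \<partial>lborel))
      + (\<integral>\<^sup>+x. H (- Complex (t - T) x) \<partial>lborel)
      + ((\<integral>\<^sup>+x\<in>{0<..}. H (Complex x (- S)) \<partial>lborel) + (\<integral>\<^sup>+x\<in>{0<..<t - T}. H (- Complex x S) \<partial>lborel))"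
    by (subst nn_integral_strip_path[of "\<lambda>w. H (Complex (Im w - t) (- Re w))"])
       (use S 2[of S] 2[of "- S"] 1 in \<open>auto intro!: add_mono\<close>)
  also have "\<dots> = ((\<integral>\<^sup>+x\<in>{0<..}. H (Complex x S) \<partial>lborel) + (\<integral>\<^sup>+x\<in>{0<..}. H (Complex x (- S)) \<partial>lborel))
     + ((\<integral>\<^sup>+x. H (- Complex (t - T) x) \<partial>lborel) + (\<integral>\<^sup>+x\<in>{0<..<t - T}. H (- Complex x (- S)) \<partial>lborel) + (\<integral>\<^sup>+x\<in>{0<..<t - T}. H (- Complex x S) \<partial>lborel))"
    by (simp add: add_ac)
  also have "\<dots> \<le> m1 + ennreal (32 / 25) * m2"
    by (intro add_mono carlesonD(5)[OF R b] carlesonD(4)[OF L b])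
  finally show ?thesis .
qed

text \<open>Above the line, a half-strip boundary consists of a parallel segment and two rays.\<close>

lemma bottom_inner:
  assumes R: "carleson H m" and s: "0 < s" and t: "T < t"
  shows "(\<integral>\<^sup>+x. H (Complex (Im (strip_path s t x) - T) (- Re (strip_path s t x))) \<partial>lborel) \<le> ennreal (57 / 25) * m"
proof -
  have b: "t - T > 0" using t by simp
  note [measurable] = carlesonD(1)[OF R b]
  have [measurable]: "(\<lambda>w. Complex (Im w - T) (- Re w)) \<in> borel_measurable borel" unfolding Complex_eq by measurable
  have 1: "(\<integral>\<^sup>+x\<in>{-s..s}. H (Complex (t - T) (- x)) \<partial>lborel) \<le> (\<integral>\<^sup>+x. H (Complex (t - T) x) \<partial>lborel)"
  proof -
    have "(\<integral>\<^sup>+x\<in>{-s..s}. H (Complex (t - T) (- x)) \<partial>lborel) \<le> (\<integral>\<^sup>+x. H (Complex (t - T) (0 - x)) \<partial>lborel)"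
      by (intro nn_integral_mono) (auto simp: indicator_def)
    also have "\<dots> = (\<integral>\<^sup>+x. H (Complex (t - T) x) \<partial>lborel)" by (rule nn_integral_flip[where c = 0]) measurable
    finally show ?thesis .
  qed
  have 2: "(\<integral>\<^sup>+v\<in>{t<..}. H (Complex (v - T) a) \<partial>lborel) \<le> (\<integral>\<^sup>+x\<in>{0<..}. H (Complex x a) \<partial>lborel)" for a
  proof -
    have "(\<integral>\<^sup>+v\<in>{t<..}. H (Complex (v - T) a) \<partial>lborel) \<le> (\<integral>\<^sup>+v. H (Complex (- T + v) a) * indicator {0<..} (- T + v) \<partial>lborel)"
      by (intro nn_integral_mono) (use t in \<open>auto simp: indicator_def\<close>)
    also have "\<dots> = (\<integral>\<^sup>+x\<in>{0<..}. H (Complex x a) \<partial>lborel)" by (rule nn_integral_shift) measurable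
    finally show ?thesis .
  qed
  have "(\<integral>\<^sup>+x. H (Complex (Im (strip_path s t x) - T) (- Re (strip_path s t x))) \<partial>lborel)
    \<le> (\<integral>\<^sup>+x\<in>{0<..}. H (Complex x s) \<partial>lborel) + (\<integral>\<^sup>+x. H (Complex (t - T) x) \<partial>lborel) + (\<integral>\<^sup>+x\<in>{0<..}. H (Complex x (- s)) \<partial>lborel)"
    by (subst nn_integral_strip_path[of "\<lambda>w. H (Complex (Im w - T) (- Re w))"])
       (use s 2[of s] 2[of "- s"] 1 in \<open>auto intro!: add_mono\<close>)
  also have "\<dots> = ((\<integral>\<^sup>+x\<in>{0<..}. H (Complex x s) \<partial>lborel) + (\<integral>\<^sup>+x\<in>{0<..}. H (Complex x (- s)) \<partial>lborel)) + (\<integral>\<^sup>+x. H (Complex (t - T) x) \<partial>lborel)"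
    by (simp add: add_ac)
  also have "\<dots> \<le> m + m" by (intro add_mono carlesonD(5)[OF R b] carlesonD(2)[OF R b])
  also have "\<dots> = ennreal 2 * m" by (simp add: mult_2)
  also have "\<dots> \<le> ennreal (57 / 25) * m" by (intro mult_right_mono ennreal_leI) auto
  finally show ?thesis .
qed

section \<open>The bilinear form of two nested boundaries\<close>

text \<open>The parts of a function on the parametrised curve that live on its three sides, each as a function on the
full line containing that side and extended by zero.\<close>

definition side_right :: "real \<Rightarrow> real \<Rightarrow> (real \<Rightarrow> complex) \<Rightarrow> real \<Rightarrow> complex" where
  "side_right s t G u = (if t < u then G (s - t + u) else 0)"

definition side_left :: "real \<Rightarrow> real \<Rightarrow> (real \<Rightarrow> complex) \<Rightarrow> real \<Rightarrow> complex" where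
  "side_left s t G u = (if t < u then G (t - s - u) else 0)"

text \<open>Reflected, to match the quarter turn that takes the horizontal line to the imaginary axis.\<close>

definition side_bottom :: "real \<Rightarrow> (real \<Rightarrow> complex) \<Rightarrow> real \<Rightarrow> complex" where
  "side_bottom s G u = (if \<bar>u\<bar> \<le> s then G (- u) else 0)"

lemma nice_sides:
  assumes G: "nice G"
  shows "nice (side_right s t G)" "nice (side_left s t G)" "nice (side_bottom s G)"
proof -
  obtain M where M: "M \<ge> 0" "\<And>x. cmod (G x) \<le> M" "\<And>x. M < \<bar>x\<bar> \<Longrightarrow> G x = 0" using nice_ex[OF G] by auto
  note [measurable] = nice_measurable[OF G]
  show "nice (side_right s t G)"
  proof (rule niceI[of _ M "M + \<bar>s - t\<bar>"])
    show "side_right s t G \<in> borel_measurable borel" unfolding side_right_def[abs_def] by measurable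
  qed (use M in \<open>auto simp: side_right_def\<close>)
  show "nice (side_left s t G)"
  proof (rule niceI[of _ M "M + \<bar>s - t\<bar>"])
    show "side_left s t G \<in> borel_measurable borel" unfolding side_left_def[abs_def] by measurable
  qed (use M in \<open>auto simp: side_left_def\<close>)
  show "nice (side_bottom s G)"
  proof (rule niceI[of _ M M])
    show "side_bottom s G \<in> borel_measurable borel" unfolding side_bottom_def[abs_def] by measurable
  qed (use M in \<open>auto simp: side_bottom_def\<close>)
qed

lemma sides_powr:
  assumes G: "nice G" and s: "s > 0" and q: "q > 0"
  shows "(\<integral>u. cmod (side_left s t G u) powr q \<partial>lborel) + (\<integral>u. cmod (side_bottom s G u) powr q \<partial>lborel)
     + (\<integral>u. cmod (side_right s t G u) powr q \<partial>lborel) = (\<integral>u. cmod (G u) powr q \<partial>lborel)"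
proof -
  note [measurable] = nice_measurable[OF G]
  note n = nice_sides[OF G]
  let ?h = "\<lambda>x. ennreal (cmod (G x) powr q)"
  have I: "(\<integral>\<^sup>+u. ennreal (cmod (g u) powr q) \<partial>lborel) = ennreal (\<integral>u. cmod (g u) powr q \<partial>lborel)" if "nice g" for g
    using nn_integral_eq_integral[OF nice_integrable_powr[OF that q]] by simp
  have L: "(\<integral>\<^sup>+u\<in>{t<..}. ?h (t - s - u) \<partial>lborel) = (\<integral>\<^sup>+u. ennreal (cmod (side_left s t G u) powr q) \<partial>lborel)"
    by (intro nn_integral_cong) (use q in \<open>auto simp: side_left_def indicator_def\<close>)
  have R: "(\<integral>\<^sup>+u\<in>{t<..}. ?h (s - t + u) \<partial>lborel) = (\<integral>\<^sup>+u. ennreal (cmod (side_right s t G u) powr q) \<partial>lborel)"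
    by (intro nn_integral_cong) (use q in \<open>auto simp: side_right_def indicator_def\<close>)
  have "(\<integral>\<^sup>+x\<in>{-s..s}. ?h x \<partial>lborel) = (\<integral>\<^sup>+x. ?h (0 - x) * indicator {-s..s} (0 - x) \<partial>lborel)"
    by (rule nn_integral_flip[symmetric]) measurable
  also have "\<dots> = (\<integral>\<^sup>+u. ennreal (cmod (side_bottom s G u) powr q) \<partial>lborel)"
    by (intro nn_integral_cong) (use q in \<open>auto simp: side_bottom_def indicator_def abs_le_iff\<close>)
  finally have B: "(\<integral>\<^sup>+x\<in>{-s..s}. ?h x \<partial>lborel) = (\<integral>\<^sup>+u. ennreal (cmod (side_bottom s G u) powr q) \<partial>lborel)" .
  have "ennreal ((\<integral>u. cmod (side_left s t G u) powr q \<partial>lborel) + (\<integral>u. cmod (side_bottom s G u) powr q \<partial>lborel)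
     + (\<integral>u. cmod (side_right s t G u) powr q \<partial>lborel)) = ennreal (\<integral>u. cmod (G u) powr q \<partial>lborel)"
    using nn_integral_three_pieces[of ?h s t] s unfolding L B R I[OF n(1)] I[OF n(2)] I[OF n(3)] I[OF G]
    by (simp add: Bochner_Integration.integral_nonneg)
  then show ?thesis by (subst (asm) ennreal_inj) (auto intro!: add_nonneg_nonneg Bochner_Integration.integral_nonneg)
qed

text \<open>The Cauchy integral over the curve is the sum of three Cauchy transforms of lines. The contour factors
\<open>- \<i>\<close>, \<open>1\<close>, \<open>\<i>\<close> of the three sides are absent: they are unimodular and are put into \<open>G\<close>. The factor
\<open>- \<i>\<close> of the bottom term comes from the quarter turn.\<close>

lemma strip_transform:
  assumes G: "nice G" and s: "s > 0" and d: "\<delta> > 0" "\<And>y. \<delta> \<le> cmod (w - strip_path s t y)"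
  shows "(\<integral>y. G y / (w - strip_path s t y) \<partial>lborel) = of_real (2 * pi) *
     (ctrans (side_left s t G) (w + of_real s) - \<i> * ctrans (side_bottom s G) (Complex (Im w - t) (- Re w))
      + ctrans (side_right s t G) (w - of_real s))"
proof -
  note [measurable] = nice_measurable[OF G]
  let ?f = "\<lambda>y. G y / (w - strip_path s t y)"
  have int: "integrable lborel ?f"
  proof (rule Bochner_Integration.integrable_bound[OF integrable_mult_right[OF integrable_norm[OF nice_integrable[OF G]], of "1 / \<delta>"]])
    show "?f \<in> borel_measurable lborel" by measurable
    show "AE y in lborel. norm (?f y) \<le> norm (1 / \<delta> * cmod (G y))"
    proof (rule AE_I2)
      fix y
      have "cmod (G y) / cmod (w - strip_path s t y) \<le> cmod (G y) / \<delta>"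
        using d(2)[of y] d(1) by (intro divide_left_mono mult_pos_pos) auto
      then show "norm (?f y) \<le> norm (1 / \<delta> * cmod (G y))" using d(1) by (simp add: norm_divide)
    qed
  qed
  have ii: "integrable lborel (\<lambda>y. indicator A y *\<^sub>R ?f y)" if "A \<in> sets borel" for A
    using integrable_mult_indicator[OF _ int, of A] that by simp
  have "(\<integral>y. ?f y \<partial>lborel) = (\<integral>y. indicator {..<-s} y *\<^sub>R ?f y + indicator {-s..s} y *\<^sub>R ?f y + indicator {s<..} y *\<^sub>R ?f y \<partial>lborel)"
    by (intro Bochner_Integration.integral_cong refl) (use s in \<open>auto simp: indicator_def\<close>)
  also have "\<dots> = (\<integral>y. indicator {..<-s} y *\<^sub>R ?f y \<partial>lborel) + (\<integral>y. indicator {-s..s} y *\<^sub>R ?f y \<partial>lborel) + (\<integral>y. indicator {s<..} y *\<^sub>R ?f y \<partial>lborel)"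
    by (simp add: ii)
  also have "(\<integral>y. indicator {..<-s} y *\<^sub>R ?f y \<partial>lborel) = of_real (2 * pi) * ctrans (side_left s t G) (w + of_real s)"
  proof -
    have "(\<integral>y. indicator {..<-s} y *\<^sub>R ?f y \<partial>lborel) = (\<integral>u. indicator {..<-s} (t - s - u) *\<^sub>R ?f (t - s - u) \<partial>lborel)"
      using lborel_integral_real_affine[of "-1" "\<lambda>y. indicator {..<-s} y *\<^sub>R ?f y" "t - s"] by simp
    also have "\<dots> = (\<integral>u. side_left s t G u / (w + of_real s - Complex 0 u) \<partial>lborel)"
    proof (intro Bochner_Integration.integral_cong refl)
      fix u
      have "w - Complex (- s) u = w + of_real s - Complex 0 u" by (simp add: complex_eq_iff)
      then show "indicator {..<-s} (t - s - u) *\<^sub>R ?f (t - s - u) = side_left s t G u / (w + of_real s - Complex 0 u)"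
        by (simp add: side_left_def strip_path_def indicator_def)
    qed
    finally show ?thesis by (simp add: ctrans_def)
  qed
  also have "(\<integral>y. indicator {s<..} y *\<^sub>R ?f y \<partial>lborel) = of_real (2 * pi) * ctrans (side_right s t G) (w - of_real s)"
  proof -
    have "(\<integral>y. indicator {s<..} y *\<^sub>R ?f y \<partial>lborel) = (\<integral>u. indicator {s<..} (s - t + u) *\<^sub>R ?f (s - t + u) \<partial>lborel)"
      using lborel_integral_real_affine[of 1 "\<lambda>y. indicator {s<..} y *\<^sub>R ?f y" "s - t"] by simp
    also have "\<dots> = (\<integral>u. side_right s t G u / (w - of_real s - Complex 0 u) \<partial>lborel)"
    proof (intro Bochner_Integration.integral_cong refl)
      fix u
      have "w - Complex s u = w - of_real s - Complex 0 u" by (simp add: complex_eq_iff)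
      then show "indicator {s<..} (s - t + u) *\<^sub>R ?f (s - t + u) = side_right s t G u / (w - of_real s - Complex 0 u)"
        using s by (simp add: side_right_def strip_path_def indicator_def)
    qed
    finally show ?thesis by (simp add: ctrans_def)
  qed
  also have "(\<integral>y. indicator {-s..s} y *\<^sub>R ?f y \<partial>lborel) = - \<i> * (of_real (2 * pi) * ctrans (side_bottom s G) (Complex (Im w - t) (- Re w)))"
  proof -
    let ?z = "Complex (Im w - t) (- Re w)"
    have "(\<integral>y. indicator {-s..s} y *\<^sub>R ?f y \<partial>lborel) = (\<integral>u. indicator {-s..s} (- u) *\<^sub>R ?f (- u) \<partial>lborel)"
      by (rule integral_reflect[symmetric])
    also have "\<dots> = (\<integral>u. - \<i> * (side_bottom s G u / (?z - Complex 0 u)) \<partial>lborel)"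
    proof (intro Bochner_Integration.integral_cong refl)
      fix u
      have e: "w - Complex (- u) t = \<i> * (?z - Complex 0 u)" by (simp add: complex_eq_iff)
      show "indicator {-s..s} (- u) *\<^sub>R ?f (- u) = - \<i> * (side_bottom s G u / (?z - Complex 0 u))"
      proof (cases "\<bar>u\<bar> \<le> s")
        case True
        then have "indicator {-s..s} (- u) *\<^sub>R ?f (- u) = G (- u) / (\<i> * (?z - Complex 0 u))"
          unfolding e[symmetric] by (auto simp: strip_path_def indicator_def abs_le_iff)
        also have "\<dots> = - \<i> * (G (- u) / (?z - Complex 0 u))" by (simp add: divide_inverse)
        finally show ?thesis using True by (simp add: side_bottom_def)
      next
        case False
        then show ?thesis by (auto simp: side_bottom_def indicator_def abs_le_iff)
      qed
    qed
    also have "\<dots> = - \<i> * (\<integral>u. side_bottom s G u / (?z - Complex 0 u) \<partial>lborel)" by (rule integral_mult_right_zero)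
    finally show ?thesis by (simp add: ctrans_def)
  qed
  finally show ?thesis by (simp add: algebra_simps)
qed

lemma Minkowski_nonneg:
  assumes p: "p \<ge> 1" and f: "Lp_le p M f a" and g: "Lp_le p M g b"
  shows "Lp_le p M (\<lambda>x. f x + g x) (a + b)"
proof (rule Lp_le_limit)
  fix n :: nat
  let ?e = "inverse (real (Suc n))"
  have ab: "0 \<le> a" "0 \<le> b" using f g by (auto simp: Lp_le_def)
  have e: "?e > 0" by simp
  show "Lp_le p M (\<lambda>x. f x + g x) ((a + ?e) + (b + ?e))"
    by (rule Minkowski[OF p Lp_le_mono[OF f] Lp_le_mono[OF g]]) (use ab e p in linarith)+
next
  have "(\<lambda>n. (a + inverse (real (Suc n))) + (b + inverse (real (Suc n)))) \<longlonglongrightarrow> (a + 0) + (b + 0)"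
    by (intro tendsto_add tendsto_const LIMSEQ_inverse_real_of_nat)
  then show "(\<lambda>n. (a + inverse (real (Suc n))) + (b + inverse (real (Suc n)))) \<longlonglongrightarrow> a + b" by simp
qed (use p in auto)

text \<open>Hoelder's inequality for the counting measure on three points.\<close>

lemma Hoelder_three:
  fixes u v :: "nat \<Rightarrow> real"
  assumes rq: "r > 1" "q > 1" "1 / r + 1 / q = 1" and nn: "\<And>i. 0 \<le> u i" "\<And>i. 0 \<le> v i"
  shows "u 0 * v 0 + u 1 * v 1 + u 2 * v 2
     \<le> (u 0 powr r + u 1 powr r + u 2 powr r) powr (1 / r) * (v 0 powr q + v 1 powr q + v 2 powr q) powr (1 / q)"
proof -
  let ?M = "count_space {..<3::nat}"
  have set: "{..<3::nat} = {0, 1, 2}" by auto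
  have L: "Lp_le p ?M (\<lambda>i. of_real (w i)) ((w 0 powr p + w 1 powr p + w 2 powr p) powr (1 / p))" if "p > 1" "\<And>i. 0 \<le> w i" for p and w :: "nat \<Rightarrow> real"
    using that unfolding Lp_le_def
    by (auto simp: nn_integral_count_space_finite set powr_powr ennreal_plus[symmetric] add.assoc simp del: ennreal_plus)
  have "(\<integral>\<^sup>+i. ennreal (cmod (of_real (u i)) * cmod (of_real (v i))) \<partial>?M)
     \<le> ennreal ((u 0 powr r + u 1 powr r + u 2 powr r) powr (1 / r) * (v 0 powr q + v 1 powr q + v 2 powr q) powr (1 / q))"
    by (rule Hoelder[OF rq L L]) (use rq nn in auto)
  then show ?thesis
    using nn by (simp add: nn_integral_count_space_finite set ennreal_plus[symmetric] add.assoc del: ennreal_plus)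
qed

text \<open>A side with norm \<open>a\<^sub>j\<close> and column constant \<open>C\<^sub>j\<close> contributes at most \<open>C\<^sub>j powr (1 / q) * c * a\<^sub>j\<close>, and the
\<open>q\<close>-th powers of the \<open>a\<^sub>j\<close> add up to that of \<open>a\<close>. Hoelder's inequality over the three sides leads to the
exponent \<open>r / q = r - 1\<close> of the column constants.\<close>

lemma three_columns:
  assumes G: "nice G" and s: "s > 0" and d: "\<delta> > 0" "\<And>x y. \<delta> \<le> cmod (\<phi> x - strip_path s t y)"
    and phi[measurable]: "\<phi> \<in> borel_measurable borel"
    and rq: "r > 1" "q > 1" "1 / r + 1 / q = 1" and c: "c \<ge> 0" "C1 \<ge> 0" "C2 \<ge> 0" and a: "Lp_le q lborel G a"
    and col: "\<And>g a. nice g \<Longrightarrow> Lp_le q lborel g a \<Longrightarrow> (\<integral>\<^sup>+x. ennreal (cmod (ctrans g (\<phi> x + of_real s)) powr q) \<partial>lborel) \<le> ennreal (C1 * (c * a) powr q)"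
     "\<And>g a. nice g \<Longrightarrow> Lp_le q lborel g a \<Longrightarrow> (\<integral>\<^sup>+x. ennreal (cmod (ctrans g (\<phi> x - of_real s)) powr q) \<partial>lborel) \<le> ennreal (C1 * (c * a) powr q)"
     "\<And>g a. nice g \<Longrightarrow> Lp_le q lborel g a \<Longrightarrow> (\<integral>\<^sup>+x. ennreal (cmod (ctrans g (Complex (Im (\<phi> x) - t) (- Re (\<phi> x)))) powr q) \<partial>lborel) \<le> ennreal (C2 * (c * a) powr q)"
  shows "Lp_le q lborel (\<lambda>x. \<integral>y. G y / (\<phi> x - strip_path s t y) \<partial>lborel)
     (2 * pi * (c * (2 * C1 powr (r - 1) + C2 powr (r - 1)) powr (1 / r)) * a)"
proof -
  note n = nice_sides[OF G, of s]
  have a0: "a \<ge> 0" using a by (simp add: Lp_le_def)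
  let ?X = "\<lambda>g. \<integral>u. cmod (g u) powr q \<partial>lborel"
  define v where "v = (\<lambda>i::nat. if i = 0 then ?X (side_left s t G) powr (1 / q) else if i = 1 then ?X (side_right s t G) powr (1 / q) else ?X (side_bottom s G) powr (1 / q))"
  define u where "u = (\<lambda>i::nat. if i = 2 then C2 powr (1 / q) else C1 powr (1 / q))"
  have X0: "?X g \<ge> 0" for g :: "real \<Rightarrow> complex" by (intro Bochner_Integration.integral_nonneg) simp
  have rq1: "r / q = r - 1" using rq by (simp add: field_simps)
  have [measurable]: "(\<lambda>x. Complex (Im (\<phi> x) - t) (- Re (\<phi> x))) \<in> borel_measurable borel" unfolding Complex_eq by measurable
  have mk: "Lp_le q lborel (\<lambda>x. ctrans g (\<psi> x)) (c * (C powr (1 / q) * b))"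
    if "nice g" "\<psi> \<in> borel_measurable borel" "C \<ge> 0" "b \<ge> 0"
      "(\<integral>\<^sup>+x. ennreal (cmod (ctrans g (\<psi> x)) powr q) \<partial>lborel) \<le> ennreal (C * (c * b) powr q)" for g \<psi> C b
  proof -
    have "(c * (C powr (1 / q) * b)) powr q = C * (c * b) powr q"
      using that c rq by (simp add: powr_mult powr_powr)
    moreover have "(\<lambda>x. ctrans g (\<psi> x)) \<in> borel_measurable borel"
      using measurable_compose[OF that(2) borel_measurable_ctrans[OF that(1)]] .
    ultimately show ?thesis using that c unfolding Lp_le_def by simp
  qed
  have q0: "q > 0" using rq by simp
  have L1: "Lp_le q lborel (\<lambda>x. ctrans (side_left s t G) (\<phi> x + of_real s)) (c * (u 0 * v 0))"
    unfolding u_def v_def using mk[OF n(2) _ c(2) _ col(1)[OF n(2) nice_Lp[OF n(2) q0]]] X0 by simp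
  have L2: "Lp_le q lborel (\<lambda>x. ctrans (side_right s t G) (\<phi> x - of_real s)) (c * (u 1 * v 1))"
    unfolding u_def v_def using mk[OF n(1) _ c(2) _ col(2)[OF n(1) nice_Lp[OF n(1) q0]]] X0 by simp
  have L3: "Lp_le q lborel (\<lambda>x. ctrans (side_bottom s G) (Complex (Im (\<phi> x) - t) (- Re (\<phi> x)))) (c * (u 2 * v 2))"
    unfolding u_def v_def using mk[OF n(3) _ c(3) _ col(3)[OF n(3) nice_Lp[OF n(3) q0]]] X0 by simp
  have L3': "Lp_le q lborel (\<lambda>x. - \<i> * ctrans (side_bottom s G) (Complex (Im (\<phi> x) - t) (- Re (\<phi> x)))) (c * (u 2 * v 2))"
    using Lp_le_cmult[OF L3, of "- \<i>"] by simp
  have q1: "q \<ge> 1" using rq by simp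
  have sum: "Lp_le q lborel (\<lambda>x. of_real (2 * pi) * ((ctrans (side_left s t G) (\<phi> x + of_real s) + - \<i> * ctrans (side_bottom s G) (Complex (Im (\<phi> x) - t) (- Re (\<phi> x))))
      + ctrans (side_right s t G) (\<phi> x - of_real s))) (cmod (of_real (2 * pi)) * (c * (u 0 * v 0) + c * (u 2 * v 2) + c * (u 1 * v 1)))"
    by (intro Lp_le_cmult Minkowski_nonneg q1 L1 L2 L3')
  have "u 0 * v 0 + u 1 * v 1 + u 2 * v 2
     \<le> (u 0 powr r + u 1 powr r + u 2 powr r) powr (1 / r) * (v 0 powr q + v 1 powr q + v 2 powr q) powr (1 / q)"
    by (rule Hoelder_three[OF rq]) (auto simp: u_def v_def)
  also have "u 0 powr r + u 1 powr r + u 2 powr r = 2 * C1 powr (r - 1) + C2 powr (r - 1)"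
    unfolding u_def by (simp add: powr_powr rq1)
  also have "v 0 powr q + v 1 powr q + v 2 powr q = ?X G"
    using sides_powr[OF G s q0, of t] q0 X0 by (simp add: v_def powr_powr)
  also have "?X G powr (1 / q) \<le> a"
  proof -
    have "?X G \<le> a powr q" using Lp_leD_integrable(2)[OF a] .
    then have "?X G powr (1 / q) \<le> (a powr q) powr (1 / q)" using X0 q0 by (intro powr_mono2) auto
    then show ?thesis using q0 a0 by (simp add: powr_powr)
  qed
  finally have le: "u 0 * v 0 + u 1 * v 1 + u 2 * v 2 \<le> (2 * C1 powr (r - 1) + C2 powr (r - 1)) powr (1 / r) * a" by (simp add: mult_left_mono)
  have "cmod (of_real (2 * pi)) * (c * (u 0 * v 0) + c * (u 2 * v 2) + c * (u 1 * v 1)) = 2 * pi * (c * (u 0 * v 0 + u 1 * v 1 + u 2 * v 2))"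
    by (simp add: algebra_simps)
  also have "\<dots> \<le> 2 * pi * (c * ((2 * C1 powr (r - 1) + C2 powr (r - 1)) powr (1 / r) * a))"
    using le c by (intro mult_left_mono) auto
  finally have le': "cmod (of_real (2 * pi)) * (c * (u 0 * v 0) + c * (u 2 * v 2) + c * (u 1 * v 1))
     \<le> 2 * pi * (c * (2 * C1 powr (r - 1) + C2 powr (r - 1)) powr (1 / r)) * a" by (simp only: mult.assoc)
  have eq: "(\<integral>y. G y / (\<phi> x - strip_path s t y) \<partial>lborel) = of_real (2 * pi) * ((ctrans (side_left s t G) (\<phi> x + of_real s) + - \<i> * ctrans (side_bottom s G) (Complex (Im (\<phi> x) - t) (- Re (\<phi> x))))
      + ctrans (side_right s t G) (\<phi> x - of_real s))" for x
    using strip_transform[OF G s d(1) d(2)[of x]] by simp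
  show ?thesis unfolding eq using Lp_le_mono[OF sum le'] q0 by simp
qed

lemma strip_path_distance:
  assumes "0 < s" "s < S" "T < t"
  shows "min (S - s) (t - T) \<le> cmod (strip_path S T x - strip_path s t y)"
proof -
  let ?w = "strip_path S T x" and ?z = "strip_path s t y"
  have z: "\<bar>Re ?z\<bar> \<le> s" "t \<le> Im ?z" using assms by (auto simp: strip_path_def)
  have w: "\<bar>Re ?w\<bar> = S \<or> Im ?w = T" using assms by (auto simp: strip_path_def)
  have "S - s \<le> \<bar>Re (?w - ?z)\<bar> \<or> t - T \<le> \<bar>Im (?w - ?z)\<bar>"
    using z w assms by (auto simp: abs_if split: if_splits)
  then show ?thesis using abs_Re_le_cmod[of "?w - ?z"] abs_Im_le_cmod[of "?w - ?z"] by linarith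
qed

text \<open>The pairing of a function on the outer boundary with a function on the inner one through the Cauchy kernel.\<close>

definition strip_form :: "real \<Rightarrow> real \<Rightarrow> real \<Rightarrow> real \<Rightarrow> (real \<Rightarrow> complex) \<Rightarrow> (real \<Rightarrow> complex) \<Rightarrow> complex" where
  "strip_form S T s t F G = (\<integral>x. F x * (\<integral>y. G y / (strip_path S T x - strip_path s t y) \<partial>lborel) \<partial>lborel)"

text \<open>The bound is uniform in the two nested half-strips. It is what both halves of the theorem need, since the Cauchy
integral may start from the inner or from the outer curve.\<close>

definition form_bound :: "real \<Rightarrow> real \<Rightarrow> real \<Rightarrow> bool" where
  "form_bound p q N \<longleftrightarrow> (\<forall>S T s t F G a b. 0 < s \<longrightarrow> s < S \<longrightarrow> T < t \<longrightarrow> nice F \<longrightarrow> nice G \<longrightarrow>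
     Lp_le p lborel F a \<longrightarrow> Lp_le q lborel G b \<longrightarrow> cmod (strip_form S T s t F G) \<le> 2 * pi * N * a * b)"

text \<open>The kernel is bounded, since nested boundaries have positive distance; the sign comes from reversing the difference in it.\<close>

lemma strip_form_Fubini:
  assumes F: "nice F" and G: "nice G" and st: "0 < s" "s < S" "T < t"
  shows "strip_form S T s t F G = - (\<integral>y. G y * (\<integral>x. F x / (strip_path s t y - strip_path S T x) \<partial>lborel) \<partial>lborel)"
    "integrable lborel (\<lambda>x. F x * (\<integral>y. G y / (strip_path S T x - strip_path s t y) \<partial>lborel))"
    "integrable lborel (\<lambda>y. G y * (\<integral>x. F x / (strip_path s t y - strip_path S T x) \<partial>lborel))"
    "integrable lborel (\<lambda>y. G y / (strip_path S T x - strip_path s t y))"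
proof -
  note [measurable] = nice_measurable[OF F] nice_measurable[OF G]
  let ?d = "min (S - s) (t - T)"
  have d: "?d > 0" using st by simp
  let ?f = "\<lambda>x y. F x * (G y / (strip_path S T x - strip_path s t y))"
  have fm: "case_prod ?f \<in> borel_measurable (borel \<Otimes>\<^sub>M borel)" by measurable
  have fle: "cmod (?f x y) \<le> cmod (F x) * (1 / ?d * cmod (G y))" for x y
  proof -
    have "cmod (G y) / cmod (strip_path S T x - strip_path s t y) \<le> cmod (G y) / ?d"
      by (rule divide_left_mono[OF strip_path_distance[OF st] _ mult_pos_pos[OF less_le_trans[OF d strip_path_distance[OF st]] d]]) simp
    then have "cmod (F x) * (cmod (G y) / cmod (strip_path S T x - strip_path s t y)) \<le> cmod (F x) * (cmod (G y) / ?d)"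
      by (intro mult_left_mono) auto
    then show ?thesis by (simp add: norm_mult norm_divide)
  qed
  note Fu = Fubini_dominated(1,2,3)[OF fm integrable_norm[OF nice_integrable[OF F]] integrable_mult_right[OF integrable_norm[OF nice_integrable[OF G]], of "1 / ?d"] fle]
  have e1: "(\<integral>y. ?f x y \<partial>lborel) = F x * (\<integral>y. G y / (strip_path S T x - strip_path s t y) \<partial>lborel)" for x
    by (rule integral_mult_right_zero)
  have e2: "(\<integral>x. ?f x y \<partial>lborel) = - (G y * (\<integral>x. F x / (strip_path s t y - strip_path S T x) \<partial>lborel))" for y
  proof -
    have "?f x y = - G y * (F x / (strip_path s t y - strip_path S T x))" for x
      by (metis minus_diff_eq minus_divide_right mult.commute mult_minus_left mult_minus_right times_divide_eq_right)
    then have "(\<integral>x. ?f x y \<partial>lborel) = - G y * (\<integral>x. F x / (strip_path s t y - strip_path S T x) \<partial>lborel)"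
      by (simp only: integral_mult_right_zero)
    then show ?thesis by simp
  qed
  show "strip_form S T s t F G = - (\<integral>y. G y * (\<integral>x. F x / (strip_path s t y - strip_path S T x) \<partial>lborel) \<partial>lborel)"
    unfolding strip_form_def using Fu(1) unfolding e1 e2 by simp
  show "integrable lborel (\<lambda>x. F x * (\<integral>y. G y / (strip_path S T x - strip_path s t y) \<partial>lborel))"
    using Fu(2) unfolding e1 .
  show "integrable lborel (\<lambda>y. G y * (\<integral>x. F x / (strip_path s t y - strip_path S T x) \<partial>lborel))"
    using Fu(3) unfolding e2 by simp
  show "integrable lborel (\<lambda>y. G y / (strip_path S T x - strip_path s t y))"
  proof (rule Bochner_Integration.integrable_bound[OF integrable_mult_right[OF integrable_norm[OF nice_integrable[OF G]], of "1 / ?d"]])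
    show "AE y in lborel. norm (G y / (strip_path S T x - strip_path s t y)) \<le> norm (1 / ?d * cmod (G y))"
    proof (rule AE_I2)
      fix y
      have "cmod (G y) / cmod (strip_path S T x - strip_path s t y) \<le> cmod (G y) / ?d"
        by (rule divide_left_mono[OF strip_path_distance[OF st] _ mult_pos_pos[OF less_le_trans[OF d strip_path_distance[OF st]] d]]) simp
      then show "norm (G y / (strip_path S T x - strip_path s t y)) \<le> norm (1 / ?d * cmod (G y))"
        using d by (simp add: norm_divide del: min_less_iff_conj)
    qed
  qed measurable
qed

lemma carleson_Cbound:
  assumes C: "Cbound q c" and q: "q > 1" and g: "nice g" "Lp_le q lborel g b"
  shows "carleson (\<lambda>z. ennreal (cmod (ctrans g z) powr q)) (ennreal ((c * b) powr q))"
    and "carleson (\<lambda>z. ennreal (cmod (ctrans g (- z)) powr q)) (ennreal ((c * b) powr q))"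
  using carleson_ctrans[OF g(1) side_mass_Cbound[OF C q g]]
    carleson_ctrans[OF nice_reflect[OF g(1)] side_mass_Cbound[OF C q nice_reflect[OF g(1)] Lp_le_reflect[OF g(2)]]]
  by (simp_all add: ctrans_uminus)

text \<open>The source is the inner curve. Its vertical sides produce two hooks, with constant \<open>27 / 25\<close> each, and its
bottom two rays and a comb, with \<open>1 + 32 / 25\<close>.\<close>

lemma form_bound_outer:
  assumes C: "Cbound q c" and rq: "r > 1" "q > 1" "1 / r + 1 / q = 1"
  shows "form_bound r q (c * (2 * (54 / 25) powr (r - 1) + (57 / 25) powr (r - 1)) powr (1 / r))"
  unfolding form_bound_def
proof (intro allI impI)
  fix S T s t :: real and F G a b
  assume st: "0 < s" "s < S" "T < t" and F: "nice F" and G: "nice G" and a: "Lp_le r lborel F a" and b: "Lp_le q lborel G b"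
  have c: "c \<ge> 0" using C by (simp add: Cbound_def)
  note M = carleson_Cbound[OF C rq(2)]
  have side: "(\<integral>\<^sup>+x. ennreal (cmod (ctrans g (strip_path S T x - of_real x0)) powr q) \<partial>lborel) \<le> ennreal (54 / 25 * (c * b) powr q)"
    if "nice g" "Lp_le q lborel g b" "\<bar>x0\<bar> < S" for g b x0
    using sides_outer[OF M[OF that(1,2)] that(3), of T]
    by (simp add: ennreal_mult'[symmetric] ennreal_plus[symmetric] del: ennreal_plus)
  have "Lp_le q lborel (\<lambda>x. \<integral>y. G y / (strip_path S T x - strip_path s t y) \<partial>lborel)
     (2 * pi * (c * (2 * (54 / 25) powr (r - 1) + (57 / 25) powr (r - 1)) powr (1 / r)) * b)"
  proof (rule three_columns[OF G st(1) _ strip_path_distance[OF st] _ rq c _ _ b])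
    fix g b assume g: "nice g" "Lp_le q lborel g b"
    show "(\<integral>\<^sup>+x. ennreal (cmod (ctrans g (strip_path S T x + of_real s)) powr q) \<partial>lborel) \<le> ennreal (54 / 25 * (c * b) powr q)"
      using side[OF g, of "- s"] st by simp
    show "(\<integral>\<^sup>+x. ennreal (cmod (ctrans g (strip_path S T x - of_real s)) powr q) \<partial>lborel) \<le> ennreal (54 / 25 * (c * b) powr q)"
      using side[OF g, of s] st by simp
    show "(\<integral>\<^sup>+x. ennreal (cmod (ctrans g (Complex (Im (strip_path S T x) - t) (- Re (strip_path S T x)))) powr q) \<partial>lborel) \<le> ennreal (57 / 25 * (c * b) powr q)"
    proof -
      have "ennreal ((c * b) powr q) + ennreal (32 / 25) * ennreal ((c * b) powr q) = ennreal (57 / 25 * (c * b) powr q)"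
        by (simp add: ennreal_mult'[symmetric] ennreal_plus[symmetric] del: ennreal_plus)
      then show ?thesis using bottom_outer[OF M[OF g] _ st(3), of S] st by simp
    qed
  qed (use st in auto)
  from Hoelder_integral(2)[OF rq a this] show "cmod (strip_form S T s t F G) \<le> 2 * pi * (c * (2 * (54 / 25) powr (r - 1) + (57 / 25) powr (r - 1)) powr (1 / r)) * a * b"
    unfolding strip_form_def by (simp only: mult_ac)
qed

text \<open>With the outer curve as source the columns are no larger, so the constant is the same.\<close>

lemma form_bound_inner:
  assumes C: "Cbound q c" and rq: "r > 1" "q > 1" "1 / r + 1 / q = 1"
  shows "form_bound q r (c * (2 * (54 / 25) powr (r - 1) + (57 / 25) powr (r - 1)) powr (1 / r))"
  unfolding form_bound_def
proof (intro allI impI)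
  fix S T s t :: real and F G a b
  assume st: "0 < s" "s < S" "T < t" and F: "nice F" and G: "nice G" and a: "Lp_le q lborel F a" and b: "Lp_le r lborel G b"
  have c: "c \<ge> 0" using C by (simp add: Cbound_def)
  have S: "0 < S" using st by simp
  note M = carleson_Cbound[OF C rq(2)]
  have dist: "min (S - s) (t - T) \<le> cmod (strip_path s t x - strip_path S T y)" for x y
    using strip_path_distance[OF st, of y x] by (simp add: norm_minus_commute)
  have "Lp_le q lborel (\<lambda>x. \<integral>y. F y / (strip_path s t x - strip_path S T y) \<partial>lborel)
     (2 * pi * (c * (2 * (54 / 25) powr (r - 1) + (57 / 25) powr (r - 1)) powr (1 / r)) * a)"
  proof (rule three_columns[OF F S _ dist _ rq c _ _ a])
    fix g b assume g: "nice g" "Lp_le q lborel g b"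
    show "(\<integral>\<^sup>+x. ennreal (cmod (ctrans g (strip_path s t x + of_real S)) powr q) \<partial>lborel) \<le> ennreal (54 / 25 * (c * b) powr q)"
      using sides_inner[OF M[OF g], of s "- S" t] st by (simp add: ennreal_mult'[symmetric])
    show "(\<integral>\<^sup>+x. ennreal (cmod (ctrans g (strip_path s t x - of_real S)) powr q) \<partial>lborel) \<le> ennreal (54 / 25 * (c * b) powr q)"
      using sides_inner[OF M[OF g], of s S t] st by (simp add: ennreal_mult'[symmetric])
    show "(\<integral>\<^sup>+x. ennreal (cmod (ctrans g (Complex (Im (strip_path s t x) - T) (- Re (strip_path s t x)))) powr q) \<partial>lborel) \<le> ennreal (57 / 25 * (c * b) powr q)"
      using bottom_inner[OF M(1)[OF g] st(1,3)] by (simp add: ennreal_mult'[symmetric])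
  qed (use st in auto)
  from Hoelder_integral(2)[OF rq b this] show "cmod (strip_form S T s t F G) \<le> 2 * pi * (c * (2 * (54 / 25) powr (r - 1) + (57 / 25) powr (r - 1)) powr (1 / r)) * a * b"
    unfolding strip_form_Fubini(1)[OF F G st] by (simp only: norm_minus_cancel mult_ac)
qed

text \<open>At the exponent 2 the masses on the two sides of each line add up to the total mass, so each column constant is the larger of the
two one-sided constants and not their sum.\<close>

lemma form_bound_2: "form_bound 2 2 (sqrt (86 / 25))"
  unfolding form_bound_def
proof (intro allI impI)
  fix S T s t :: real and F G a b
  assume st: "0 < s" "s < S" "T < t" and F: "nice F" and G: "nice G" and a: "Lp_le 2 lborel F a" and b: "Lp_le 2 lborel G b"
  have M: "\<exists>m1 m2. carleson (\<lambda>z. ennreal (cmod (ctrans g z) powr 2)) m1 \<and> carleson (\<lambda>z. ennreal (cmod (ctrans g (- z)) powr 2)) m2 \<and> m1 + m2 \<le> ennreal ((1 * b) powr 2)"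
    if "nice g" "Lp_le 2 lborel g b" for g b
  proof -
    have b0: "b \<ge> 0" using that by (simp add: Lp_le_def)
    show ?thesis
      using carleson_ctrans[OF that(1) side_mass_2[OF that(1)]] carleson_ctrans[OF nice_reflect[OF that(1)] side_mass_2[OF nice_reflect[OF that(1)]]]
        spec_total[OF that] b0 unfolding ctrans_uminus by auto
  qed
  have side: "(\<integral>\<^sup>+x. ennreal (cmod (ctrans g (strip_path S T x - of_real x0)) powr 2) \<partial>lborel) \<le> ennreal (27 / 25 * (1 * b) powr 2)"
    if "nice g" "Lp_le 2 lborel g b" "\<bar>x0\<bar> < S" for g b x0
  proof -
    from M[OF that(1,2)] obtain m1 m2 where m: "carleson (\<lambda>z. ennreal (cmod (ctrans g z) powr 2)) m1" "carleson (\<lambda>z. ennreal (cmod (ctrans g (- z)) powr 2)) m2" "m1 + m2 \<le> ennreal ((1 * b) powr 2)"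
      by blast
    have "ennreal (27 / 25) * m1 + ennreal (27 / 25) * m2 \<le> ennreal (27 / 25) * ennreal ((1 * b) powr 2)"
      unfolding distrib_left[symmetric] by (rule mult_left_mono[OF m(3)]) simp
    then show ?thesis using order_trans[OF sides_outer[OF m(1,2) that(3), of T]] by (simp add: ennreal_mult'[symmetric])
  qed
  have "Lp_le 2 lborel (\<lambda>x. \<integral>y. G y / (strip_path S T x - strip_path s t y) \<partial>lborel)
     (2 * pi * (1 * (2 * (27 / 25) powr (2 - 1) + (32 / 25) powr (2 - 1)) powr (1 / 2)) * b)"
  proof (rule three_columns[OF G st(1) _ strip_path_distance[OF st] _ _ _ _ _ _ _ b])
    fix g b assume g: "nice g" "Lp_le 2 lborel g b"
    show "(\<integral>\<^sup>+x. ennreal (cmod (ctrans g (strip_path S T x + of_real s)) powr 2) \<partial>lborel) \<le> ennreal (27 / 25 * (1 * b) powr 2)"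
      using side[OF g, of "- s"] st by simp
    show "(\<integral>\<^sup>+x. ennreal (cmod (ctrans g (strip_path S T x - of_real s)) powr 2) \<partial>lborel) \<le> ennreal (27 / 25 * (1 * b) powr 2)"
      using side[OF g, of s] st by simp
    obtain m1 m2 where m: "carleson (\<lambda>z. ennreal (cmod (ctrans g z) powr 2)) m1" "carleson (\<lambda>z. ennreal (cmod (ctrans g (- z)) powr 2)) m2" "m1 + m2 \<le> ennreal ((1 * b) powr 2)"
      using M[OF g] by blast
    have "m1 + ennreal (32 / 25) * m2 = ennreal 1 * m1 + ennreal (32 / 25) * m2" by simp
    also have "\<dots> \<le> ennreal (32 / 25) * m1 + ennreal (32 / 25) * m2" by (intro add_mono mult_right_mono ennreal_leI) auto
    also have "\<dots> \<le> ennreal (32 / 25) * ennreal ((1 * b) powr 2)"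
      unfolding distrib_left[symmetric] by (rule mult_left_mono[OF m(3)]) simp
    finally show "(\<integral>\<^sup>+x. ennreal (cmod (ctrans g (Complex (Im (strip_path S T x) - t) (- Re (strip_path S T x)))) powr 2) \<partial>lborel) \<le> ennreal (32 / 25 * (1 * b) powr 2)"
      using order_trans[OF bottom_outer[OF m(1,2) _ st(3), of S]] st by (simp add: ennreal_mult'[symmetric])
  qed (use st in auto)
  moreover have "1 * (2 * (27 / 25) powr (2 - 1) + (32 / 25) powr (2 - 1)) powr (1 / 2) = sqrt (86 / 25)" by (simp add: powr_half_sqrt)
  ultimately have "Lp_le 2 lborel (\<lambda>x. \<integral>y. G y / (strip_path S T x - strip_path s t y) \<partial>lborel) (2 * pi * sqrt (86 / 25) * b)" by (simp only:)
  from Hoelder_integral(2)[OF _ _ _ a this] show "cmod (strip_form S T s t F G) \<le> 2 * pi * sqrt (86 / 25) * a * b"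
    unfolding strip_form_def by (simp add: mult_ac)
qed

section \<open>Interpolation of exponents\<close>

text \<open>The maximum principle on a rectangle, after multiplication by \<open>exp (\<epsilon> (z\<^sup>2 - 1))\<close>, which makes the function
small on the horizontal sides. Exponential sums with real frequencies are bounded on the strip, and are all that the
quantized functions below give rise to.\<close>

lemma three_lines_unit:
  fixes C :: "'k \<Rightarrow> complex" and u :: "'k \<Rightarrow> real"
  assumes K: "finite K" and Phi: "\<Phi> = (\<lambda>z. \<Sum>k\<in>K. C k * exp (of_real (u k) * z))"
    and b0: "\<And>y. cmod (\<Phi> (Complex 0 y)) \<le> 1" and b1: "\<And>y. cmod (\<Phi> (Complex 1 y)) \<le> 1"
    and th: "0 \<le> \<theta>" "\<theta> \<le> 1"
  shows "cmod (\<Phi> (of_real \<theta>)) \<le> 1"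
proof -
  define D where "D = (\<Sum>k\<in>K. cmod (C k) * exp \<bar>u k\<bar>)"
  have D0: "D \<ge> 0" unfolding D_def by (intro sum_nonneg) auto
  have bd: "cmod (\<Phi> z) \<le> D" if "0 \<le> Re z" "Re z \<le> 1" for z
    unfolding Phi D_def
  proof (rule order_trans[OF norm_sum sum_mono])
    fix k
    have "u k * Re z \<le> \<bar>u k\<bar> * Re z" using that by (intro mult_right_mono) auto
    also have "\<dots> \<le> \<bar>u k\<bar> * 1" using that by (intro mult_left_mono) auto
    finally show "cmod (C k * exp (of_real (u k) * z)) \<le> cmod (C k) * exp \<bar>u k\<bar>"
      by (auto simp: norm_mult intro!: mult_left_mono)
  qed
  have eps: "cmod (\<Phi> (of_real \<theta>)) * exp (\<epsilon> * (\<theta>\<^sup>2 - 1)) \<le> 1" if e: "\<epsilon> > 0" for \<epsilon>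
  proof -
    \<comment> \<open>large enough for the crude bound D to be damped below 1\<close>
    define R where "R = sqrt (D / \<epsilon>) + 1"
    have R: "R > 0" using D0 e by (simp add: R_def add_nonneg_pos)
    have R2: "D * exp (- (\<epsilon> * R\<^sup>2)) \<le> 1"
    proof -
      have "D / \<epsilon> = (sqrt (D / \<epsilon>))\<^sup>2" using D0 e by simp
      also have "\<dots> \<le> R\<^sup>2" unfolding R_def using D0 e by (intro power_mono) auto
      finally have "D \<le> \<epsilon> * R\<^sup>2" using e by (simp add: field_simps)
      also have "\<dots> \<le> exp (\<epsilon> * R\<^sup>2)" using exp_ge_add_one_self[of "\<epsilon> * R\<^sup>2"] by linarith
      finally show ?thesis by (simp add: exp_minus field_simps)
    qed
    define f where "f = (\<lambda>z. \<Phi> z * exp (of_real \<epsilon> * (z\<^sup>2 - 1)))"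
    have nf: "cmod (f z) = cmod (\<Phi> z) * exp (\<epsilon> * ((Re z)\<^sup>2 - (Im z)\<^sup>2 - 1))" for z
      by (simp add: f_def norm_mult power2_eq_square)
    let ?S = "cbox (Complex 0 (- R)) (Complex 1 R)"
    have hol: "f holomorphic_on UNIV" unfolding f_def Phi by (intro holomorphic_intros)
    have "cmod (f (of_real \<theta>)) \<le> 1"
    proof (rule maximum_modulus_frontier[where f = f and S = ?S])
      show "f holomorphic_on interior ?S" by (rule holomorphic_on_subset[OF hol]) simp
      show "continuous_on (closure ?S) f" by (rule continuous_on_subset[OF holomorphic_on_imp_continuous_on[OF hol]]) simp
      show "bounded ?S" by (rule bounded_cbox)
      show "of_real \<theta> \<in> ?S" using th R by (simp add: in_cbox_complex_iff)
      fix z assume "z \<in> frontier ?S"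
      then have z: "z \<in> ?S" "z \<notin> box (Complex 0 (- R)) (Complex 1 R)" by (auto simp: frontier_def)
      then have rz: "0 \<le> Re z" "Re z \<le> 1" by (auto simp: in_cbox_complex_iff)
      then have r2: "(Re z)\<^sup>2 \<le> 1" by (simp add: power_le_one)
      have "(Re z)\<^sup>2 - (Im z)\<^sup>2 - 1 \<le> 0" using r2 zero_le_power2[of "Im z"] by linarith
      then have "\<epsilon> * ((Re z)\<^sup>2 - (Im z)\<^sup>2 - 1) \<le> 0" using e by (intro mult_nonneg_nonpos) auto
      then have expo: "exp (\<epsilon> * ((Re z)\<^sup>2 - (Im z)\<^sup>2 - 1)) \<le> 1" by simp
      consider "Re z = 0" | "Re z = 1" | "\<bar>Im z\<bar> = R"
        using z by (auto simp: in_cbox_complex_iff in_box_complex_iff)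
      then show "cmod (f z) \<le> 1"
      proof cases
        case 3
        then have "(Im z)\<^sup>2 = R\<^sup>2" by (metis power2_abs)
        then have "\<epsilon> * ((Re z)\<^sup>2 - (Im z)\<^sup>2 - 1) \<le> \<epsilon> * (- R\<^sup>2)" using r2 e by (intro mult_left_mono) auto
        then have "exp (\<epsilon> * ((Re z)\<^sup>2 - (Im z)\<^sup>2 - 1)) \<le> exp (- (\<epsilon> * R\<^sup>2))" by simp
        then have "cmod (f z) \<le> D * exp (- (\<epsilon> * R\<^sup>2))" unfolding nf using bd[OF rz] D0 by (intro mult_mono) auto
        then show ?thesis using R2 by linarith
      next
        case 1
        then have "z = Complex 0 (Im z)" by (simp add: complex_eq_iff)
        then have "cmod (\<Phi> z) \<le> 1" using b0[of "Im z"] by simp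
        then show ?thesis unfolding nf using expo by (intro mult_le_one) auto
      next
        case 2
        then have "z = Complex 1 (Im z)" by (simp add: complex_eq_iff)
        then have "cmod (\<Phi> z) \<le> 1" using b1[of "Im z"] by simp
        then show ?thesis unfolding nf using expo by (intro mult_le_one) auto
      qed
    qed
    then show ?thesis unfolding nf by simp
  qed
  have "((\<lambda>\<epsilon>. cmod (\<Phi> (of_real \<theta>)) * exp (\<epsilon> * (\<theta>\<^sup>2 - 1))) \<longlongrightarrow> cmod (\<Phi> (of_real \<theta>)) * exp (0 * (\<theta>\<^sup>2 - 1))) (at_right 0)"
    by (intro tendsto_intros)
  then show ?thesis
    by (intro tendsto_upperbound[of _ _ "at_right (0::real)"]) (auto simp: eventually_at_filter eps)
qed

lemma three_lines:
  fixes C :: "'k \<Rightarrow> complex" and u :: "'k \<Rightarrow> real"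
  assumes K: "finite K" and Phi: "\<Phi> = (\<lambda>z. \<Sum>k\<in>K. C k * exp (of_real (u k) * z))" and M: "M0 > 0" "M1 > 0"
    and b0: "\<And>y. cmod (\<Phi> (Complex 0 y)) \<le> M0" and b1: "\<And>y. cmod (\<Phi> (Complex 1 y)) \<le> M1"
    and th: "0 \<le> \<theta>" "\<theta> \<le> 1"
  shows "cmod (\<Phi> (of_real \<theta>)) \<le> M0 powr (1 - \<theta>) * M1 powr \<theta>"
proof -
  define \<Psi> where "\<Psi> = (\<lambda>z. \<Sum>k\<in>K. (C k * of_real (inverse M0)) * exp (of_real (u k + (ln M0 - ln M1)) * z))"
  have eq: "\<Psi> z = \<Phi> z * (of_real (inverse M0) * exp (of_real (ln M0 - ln M1) * z))" for z
    unfolding \<Psi>_def Phi sum_distrib_right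
    by (intro sum.cong refl) (simp only: of_real_add ring_distribs exp_add mult_ac)
  have n: "cmod (\<Psi> z) = cmod (\<Phi> z) / (M0 powr (1 - Re z) * M1 powr Re z)" for z
  proof -
    have "inverse M0 * exp ((ln M0 - ln M1) * Re z) = inverse (M0 powr (1 - Re z) * M1 powr Re z)"
    proof -
      have "inverse M0 = exp (- ln M0)" using M by (simp add: exp_minus)
      then show ?thesis using M by (simp add: powr_def exp_minus[symmetric] exp_add[symmetric] algebra_simps)
    qed
    then show ?thesis unfolding eq norm_mult norm_exp_eq_Re norm_of_real using M by (simp add: divide_inverse)
  qed
  have "cmod (\<Psi> (of_real \<theta>)) \<le> 1"
  proof (rule three_lines_unit[OF K \<Psi>_def _ _ th])
    show "cmod (\<Psi> (Complex 0 y)) \<le> 1" for y unfolding n using b0[of y] M by simp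
    show "cmod (\<Psi> (Complex 1 y)) \<le> 1" for y unfolding n using b1[of y] M by simp
  qed
  then show ?thesis unfolding n using M by (simp add: divide_le_eq)
qed

text \<open>The phase of \<open>F\<close> where \<open>|F|\<close> lies in the \<open>j\<close>-th interval of length \<open>1 / n\<close>.\<close>

definition level :: "nat \<Rightarrow> (real \<Rightarrow> complex) \<Rightarrow> nat \<Rightarrow> real \<Rightarrow> complex" where
  "level n F j x = (if nat \<lfloor>real n * cmod (F x)\<rfloor> = j then sgn (F x) else 0)"

text \<open>\<open>F\<close> with its modulus rounded down to a multiple of \<open>1 / n\<close>; the phase is kept, since only powers of the modulus
are taken.\<close>

definition quantize :: "nat \<Rightarrow> (real \<Rightarrow> complex) \<Rightarrow> real \<Rightarrow> complex" where
  "quantize n F x = of_real (real (nat \<lfloor>real n * cmod (F x)\<rfloor>) / real n) * sgn (F x)"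

lemma nice_level:
  assumes "nice F" shows "nice (level n F j)"
proof -
  obtain M where M: "M \<ge> 0" "\<And>x. cmod (F x) \<le> M" "\<And>x. M < \<bar>x\<bar> \<Longrightarrow> F x = 0" using nice_ex[OF assms] by auto
  note [measurable] = nice_measurable[OF assms]
  show ?thesis
  proof (rule niceI[of _ 1 M])
    show "level n F j \<in> borel_measurable borel"
      unfolding level_def[abs_def] sgn_div_norm by measurable
  qed (auto simp: level_def norm_sgn M)
qed

lemma quantize_le: "cmod (quantize n F x) \<le> cmod (F x)"
proof (cases "n = 0 \<or> F x = 0")
  case False
  have "real (nat \<lfloor>real n * cmod (F x)\<rfloor>) \<le> real n * cmod (F x)" by simp
  then show ?thesis unfolding quantize_def norm_mult norm_of_real norm_sgn using False by (auto simp: divide_le_eq mult.commute)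
qed (auto simp: quantize_def)

lemma quantize_tendsto: "(\<lambda>n. quantize (Suc n) F x) \<longlonglongrightarrow> F x"
proof -
  have "cmod (quantize (Suc n) F x - F x) \<le> inverse (real (Suc n))" for n
  proof (cases "F x = 0")
    case False
    let ?r = "real (nat \<lfloor>real (Suc n) * cmod (F x)\<rfloor>) / real (Suc n)"
    have "F x = of_real (cmod (F x)) * sgn (F x)" using False by (simp add: sgn_div_norm scaleR_conv_of_real)
    then have "quantize (Suc n) F x - F x = of_real (?r - cmod (F x)) * sgn (F x)"
      unfolding quantize_def by (metis left_diff_distrib of_real_diff)
    then have "cmod (quantize (Suc n) F x - F x) = \<bar>?r - cmod (F x)\<bar>" using False by (simp only: norm_mult norm_of_real norm_sgn) simp
    moreover have "real (nat \<lfloor>real (Suc n) * cmod (F x)\<rfloor>) \<le> real (Suc n) * cmod (F x)" by simp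
    moreover have "real (Suc n) * cmod (F x) < real (nat \<lfloor>real (Suc n) * cmod (F x)\<rfloor>) + 1" by (simp del: of_nat_Suc) 
    moreover have "\<bar>K / N - c\<bar> \<le> inverse N" if "K \<le> N * c" "N * c < K + 1" "N > 0" for K N c :: real
    proof -
      have "\<bar>K / N - c\<bar> = \<bar>K - N * c\<bar> / N" using that(3) by (simp add: abs_if field_simps)
      also have "\<dots> \<le> 1 / N" using that by (intro divide_right_mono) auto
      finally show ?thesis by (simp add: inverse_eq_divide)
    qed
    ultimately show ?thesis by (simp del: of_nat_Suc)
  qed (simp add: quantize_def)
  then have "(\<lambda>n. quantize (Suc n) F x - F x) \<longlonglongrightarrow> 0"
    by (intro Lim_null_comparison[OF always_eventually LIMSEQ_inverse_real_of_nat]) simp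
  then show ?thesis using LIM_zero_iff by blast
qed

text \<open>At each point exactly one level is occupied.\<close>

lemma level_sum:
  assumes J: "real n * cmod (F x) < real J"
  shows "(\<Sum>j\<in>{1..<J}. c j * level n F j x) = (let j = nat \<lfloor>real n * cmod (F x)\<rfloor> in if j = 0 then 0 else c j * sgn (F x))"
proof -
  define i where "i = nat \<lfloor>real n * cmod (F x)\<rfloor>"
  have jJ: "i < J" using J by (simp add: i_def nat_less_iff floor_less_iff)
  have "(\<Sum>j\<in>{1..<J}. c j * level n F j x) = (\<Sum>j\<in>{1..<J}. if j = i then c j * sgn (F x) else 0)"
    by (intro sum.cong refl) (auto simp: level_def i_def)
  also have "\<dots> = (if i \<in> {1..<J} then c i * sgn (F x) else 0)" by (simp add: sum.delta')
  finally show ?thesis using jJ unfolding i_def[symmetric] by (auto simp: Let_def)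
qed

lemma nice_sum:
  assumes "finite K" "\<And>k. k \<in> K \<Longrightarrow> nice (f k)"
  shows "nice (\<lambda>x. \<Sum>k\<in>K. c k * f k x)"
  using assms
proof (induction K rule: finite_induct)
  case empty
  show ?case by (rule niceI[of _ 0 0]) auto
next
  case (insert k K)
  then have n: "nice (f k)" "nice (\<lambda>x. \<Sum>k\<in>K. c k * f k x)" by auto
  obtain M where M: "M \<ge> 0" "\<And>x. cmod (f k x) \<le> M" "\<And>x. M < \<bar>x\<bar> \<Longrightarrow> f k x = 0" using nice_ex[OF n(1)] by auto
  obtain N where N: "N \<ge> 0" "\<And>x. cmod (\<Sum>k\<in>K. c k * f k x) \<le> N" "\<And>x. N < \<bar>x\<bar> \<Longrightarrow> (\<Sum>k\<in>K. c k * f k x) = 0" using nice_ex[OF n(2)] by auto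
  note [measurable] = nice_measurable[OF n(1)] nice_measurable[OF n(2)]
  have "nice (\<lambda>x. c k * f k x + (\<Sum>k\<in>K. c k * f k x))"
  proof (rule niceI[of _ "cmod (c k) * M + N" "max M N"])
    show "(\<lambda>x. c k * f k x + (\<Sum>k\<in>K. c k * f k x)) \<in> borel_measurable borel" by measurable
    show "cmod (c k * f k x + (\<Sum>k\<in>K. c k * f k x)) \<le> cmod (c k) * M + N" for x
    proof (rule norm_triangle_le, rule add_mono)
      show "cmod (c k * f k x) \<le> cmod (c k) * M" unfolding norm_mult by (intro mult_left_mono M) auto
    qed (rule N)
    show "c k * f k x + (\<Sum>k\<in>K. c k * f k x) = 0" if "max M N < \<bar>x\<bar>" for x using M(3) N(3) that by simp
  qed
  then show ?case using insert.hyps by simp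
qed

lemma strip_form_sum:
  assumes st: "0 < s" "s < S" "T < t" and f: "finite K" "\<And>k. nice (f k)" and g: "finite L" "\<And>l. nice (g l)"
  shows "strip_form S T s t (\<lambda>x. \<Sum>k\<in>K. c k * f k x) (\<lambda>y. \<Sum>l\<in>L. d l * g l y)
     = (\<Sum>k\<in>K. \<Sum>l\<in>L. c k * d l * strip_form S T s t (f k) (g l))"
proof -
  let ?U = "\<lambda>l x. \<integral>y. g l y / (strip_path S T x - strip_path s t y) \<partial>lborel"
  have n0: "nice (\<lambda>x. 0)" by (rule niceI[of _ 0 0]) auto
  have i: "integrable lborel (\<lambda>y. d l * (g l y / (strip_path S T x - strip_path s t y)))" for l x
    by (intro integrable_mult_right strip_form_Fubini(4)[OF n0 g(2) st])
  have inner: "(\<integral>y. (\<Sum>l\<in>L. d l * g l y) / (strip_path S T x - strip_path s t y) \<partial>lborel) = (\<Sum>l\<in>L. d l * ?U l x)" for x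
  proof -
    have "(\<integral>y. (\<Sum>l\<in>L. d l * g l y) / (strip_path S T x - strip_path s t y) \<partial>lborel)
      = (\<integral>y. (\<Sum>l\<in>L. d l * (g l y / (strip_path S T x - strip_path s t y))) \<partial>lborel)"
      by (simp add: sum_divide_distrib)
    also have "\<dots> = (\<Sum>l\<in>L. \<integral>y. d l * (g l y / (strip_path S T x - strip_path s t y)) \<partial>lborel)"
      by (rule Bochner_Integration.integral_sum[OF i])
    finally show ?thesis by (simp only: integral_mult_right_zero)
  qed
  have j: "integrable lborel (\<lambda>x. c k * d l * (f k x * ?U l x))" for k l
    by (intro integrable_mult_right strip_form_Fubini(2)[OF f(2) g(2) st])
  have "strip_form S T s t (\<lambda>x. \<Sum>k\<in>K. c k * f k x) (\<lambda>y. \<Sum>l\<in>L. d l * g l y)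
     = (\<integral>x. (\<Sum>k\<in>K. \<Sum>l\<in>L. c k * d l * (f k x * ?U l x)) \<partial>lborel)"
    unfolding strip_form_def inner by (intro Bochner_Integration.integral_cong refl) (simp add: sum_product mult_ac)
  also have "\<dots> = (\<Sum>k\<in>K. \<integral>x. (\<Sum>l\<in>L. c k * d l * (f k x * ?U l x)) \<partial>lborel)"
    by (intro Bochner_Integration.integral_sum Bochner_Integration.integrable_sum j)
  also have "\<dots> = (\<Sum>k\<in>K. \<Sum>l\<in>L. \<integral>x. c k * d l * (f k x * ?U l x) \<partial>lborel)"
    by (intro sum.cong refl Bochner_Integration.integral_sum j)
  finally show ?thesis by (simp only: integral_mult_right_zero strip_form_def)
qed

text \<open>Dominated convergence in one argument at a time; in the second one after exchanging the integrals.\<close>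

lemma strip_form_tendsto:
  assumes st: "0 < s" "s < S" "T < t" and F: "nice F" and G: "nice G"
  shows "(\<And>n::nat. nice (f n)) \<Longrightarrow> (\<And>n x. cmod (f n x) \<le> cmod (F x)) \<Longrightarrow> (\<And>x. (\<lambda>n. f n x) \<longlonglongrightarrow> F x)
      \<Longrightarrow> (\<lambda>n. strip_form S T s t (f n) G) \<longlonglongrightarrow> strip_form S T s t F G"
    and "(\<And>n::nat. nice (g n)) \<Longrightarrow> (\<And>n x. cmod (g n x) \<le> cmod (G x)) \<Longrightarrow> (\<And>x. (\<lambda>n. g n x) \<longlonglongrightarrow> G x)
      \<Longrightarrow> (\<lambda>n. strip_form S T s t F (g n)) \<longlonglongrightarrow> strip_form S T s t F G"
proof -
  note Fu = strip_form_Fubini[OF F G st]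
  assume f: "\<And>n::nat. nice (f n)" "\<And>n x. cmod (f n x) \<le> cmod (F x)" "\<And>x. (\<lambda>n. f n x) \<longlonglongrightarrow> F x"
  show "(\<lambda>n. strip_form S T s t (f n) G) \<longlonglongrightarrow> strip_form S T s t F G"
    unfolding strip_form_def
  proof (rule integral_dominated_convergence[OF _ _ integrable_norm[OF Fu(2)]])
    show "(\<lambda>x. F x * (\<integral>y. G y / (strip_path S T x - strip_path s t y) \<partial>lborel)) \<in> borel_measurable lborel"
      using Fu(2) by (rule borel_measurable_integrable)
    show "(\<lambda>x. f n x * (\<integral>y. G y / (strip_path S T x - strip_path s t y) \<partial>lborel)) \<in> borel_measurable lborel" for n
      using strip_form_Fubini(2)[OF f(1) G st] by (rule borel_measurable_integrable)
    show "AE x in lborel. (\<lambda>n. f n x * (\<integral>y. G y / (strip_path S T x - strip_path s t y) \<partial>lborel)) \<longlonglongrightarrow> F x * (\<integral>y. G y / (strip_path S T x - strip_path s t y) \<partial>lborel)"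
      by (intro AE_I2 tendsto_mult_right f)
    show "AE x in lborel. norm (f n x * (\<integral>y. G y / (strip_path S T x - strip_path s t y) \<partial>lborel)) \<le> norm (F x * (\<integral>y. G y / (strip_path S T x - strip_path s t y) \<partial>lborel))" for n
      unfolding norm_mult by (intro AE_I2 mult_right_mono f) auto
  qed
next
  note Fu = strip_form_Fubini[OF F G st]
  assume f: "\<And>n::nat. nice (g n)" "\<And>n x. cmod (g n x) \<le> cmod (G x)" "\<And>x. (\<lambda>n. g n x) \<longlonglongrightarrow> G x"
  show "(\<lambda>n. strip_form S T s t F (g n)) \<longlonglongrightarrow> strip_form S T s t F G"
    unfolding Fu(1) strip_form_Fubini(1)[OF F f(1) st]
  proof (intro tendsto_minus integral_dominated_convergence[OF _ _ integrable_norm[OF Fu(3)]])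
    show "(\<lambda>y. G y * (\<integral>x. F x / (strip_path s t y - strip_path S T x) \<partial>lborel)) \<in> borel_measurable lborel"
      using Fu(3) by (rule borel_measurable_integrable)
    show "(\<lambda>y. g n y * (\<integral>x. F x / (strip_path s t y - strip_path S T x) \<partial>lborel)) \<in> borel_measurable lborel" for n
      using strip_form_Fubini(3)[OF F f(1) st] by (rule borel_measurable_integrable)
    show "AE y in lborel. (\<lambda>n. g n y * (\<integral>x. F x / (strip_path s t y - strip_path S T x) \<partial>lborel)) \<longlonglongrightarrow> G y * (\<integral>x. F x / (strip_path s t y - strip_path S T x) \<partial>lborel)"
      by (intro AE_I2 tendsto_mult_right f)
    show "AE y in lborel. norm (g n y * (\<integral>x. F x / (strip_path s t y - strip_path S T x) \<partial>lborel)) \<le> norm (G y * (\<integral>x. F x / (strip_path s t y - strip_path S T x) \<partial>lborel))" for n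
      unfolding norm_mult by (intro AE_I2 mult_right_mono f) auto
  qed
qed

text \<open>The analytic family \<open>|F| powr z * sgn F\<close> of interpolation theory, for the quantized modulus. It is a finite sum, so
the bilinear form of two such families is an exponential sum in \<open>z\<close>.\<close>

definition power_family :: "nat \<Rightarrow> (real \<Rightarrow> complex) \<Rightarrow> nat \<Rightarrow> complex \<Rightarrow> real \<Rightarrow> complex" where
  "power_family n F J z x = (\<Sum>j\<in>{1..<J}. exp (z * of_real (ln (real j / real n))) * level n F j x)"

text \<open>The modulus of the family at a point is at most \<open>|F| powr (p / r)\<close>, because the quantized modulus is rounded down.\<close>

lemma power_family_Lp:
  assumes F: "nice F" and n: "n > 0" and J: "\<And>x. real n * cmod (F x) < real J" and L: "Lp_le p lborel F 1"
    and r: "r > 0" "p > 0" "Re z * r = p"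
  shows "Lp_le r lborel (power_family n F J z) 1"
proof -
  have nf: "nice (power_family n F J z)"
    unfolding power_family_def[abs_def] by (intro nice_sum nice_level F) auto
  have le: "cmod (power_family n F J z x) powr r \<le> cmod (F x) powr p" for x
  proof -
    let ?j = "nat \<lfloor>real n * cmod (F x)\<rfloor>"
    have P: "power_family n F J z x = (let j = ?j in if j = 0 then 0 else exp (z * of_real (ln (real j / real n))) * sgn (F x))"
      unfolding power_family_def by (rule level_sum[OF J])
    show ?thesis
    proof (cases "?j = 0")
      case True then show ?thesis unfolding P by simp
    next
      case False
      then have j: "?j > 0" by simp
      have jn: "real ?j / real n > 0" using j n by simp
      have F0: "F x \<noteq> 0" using False by auto
      have "cmod (power_family n F J z x) = exp (Re z * ln (real ?j / real n))"
        unfolding P Let_def using False F0 by (simp add: norm_mult norm_sgn)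
      also have "\<dots> = (real ?j / real n) powr Re z"
      proof -
        have "exp (y * ln x) = x powr y" if "x > 0" for x y :: real using that by (simp add: powr_def)
        then show ?thesis using jn by blast
      qed
      finally have "cmod (power_family n F J z x) powr r = (real ?j / real n) powr p" by (simp only: powr_powr r(3))
      also have "\<dots> \<le> cmod (F x) powr p"
      proof (rule powr_mono2)
        have "real ?j \<le> real n * cmod (F x)" by simp
        then show "real ?j / real n \<le> cmod (F x)" using n by (simp add: divide_le_eq mult.commute)
      qed (use r in auto)
      finally show ?thesis .
    qed
  qed
  have "(\<integral>\<^sup>+x. ennreal (cmod (power_family n F J z x) powr r) \<partial>lborel) \<le> (\<integral>\<^sup>+x. ennreal (cmod (F x) powr p) \<partial>lborel)"
    by (intro nn_integral_mono ennreal_leI le)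
  then show ?thesis using L nice_measurable[OF nf] unfolding Lp_le_def by auto
qed

lemma power_family_1:
  assumes n: "n > 0" and J: "\<And>x. real n * cmod (F x) < real J"
  shows "power_family n F J 1 = quantize n F"
proof
  fix x
  have "power_family n F J 1 x = (let j = nat \<lfloor>real n * cmod (F x)\<rfloor> in if j = 0 then 0 else exp (1 * of_real (ln (real j / real n))) * sgn (F x))"
    unfolding power_family_def by (rule level_sum[OF J])
  then show "power_family n F J 1 x = quantize n F x"
    unfolding quantize_def using n by (cases "nat \<lfloor>real n * cmod (F x)\<rfloor>") (simp_all add: Let_def exp_of_real del: nat_eq_iff nat_0_iff of_nat_Suc)
qed

text \<open>The Riesz-Thorin theorem. For unit vectors, the powers of the moduli are chosen so that the two families have
norm at most one in the endpoint spaces on the lines \<open>Re z = 0\<close> and \<open>Re z = 1\<close> and pass through the given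
functions at \<open>\<theta>\<close>.\<close>

theorem form_bound_interpolate:
  assumes B0: "form_bound p0 q0 N0" and B1: "form_bound p1 q1 N1" and N: "N0 > 0" "N1 > 0"
    and pq: "p0 > 0" "q0 > 0" "p1 > 0" "q1 > 0" and th: "0 \<le> \<theta>" "\<theta> \<le> 1"
    and p: "p > 0" "1 / p = (1 - \<theta>) / p0 + \<theta> / p1" and q: "q > 0" "1 / q = (1 - \<theta>) / q0 + \<theta> / q1"
  shows "form_bound p q (N0 powr (1 - \<theta>) * N1 powr \<theta>)"
proof -
  let ?N = "N0 powr (1 - \<theta>) * N1 powr \<theta>"
  have quant: "cmod (strip_form S T s t (quantize n F) (quantize m G)) \<le> 2 * pi * ?N"
    if st: "0 < s" "s < S" "T < t" and F: "nice F" and G: "nice G" and L: "Lp_le p lborel F 1" "Lp_le q lborel G 1" and nm: "n > 0" "m > 0"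
    for S T s t F G n m
  proof -
    obtain J where J: "real n * cmod (F x) < real J" for x
    proof -
      obtain M where M: "M \<ge> 0" "\<And>x. cmod (F x) \<le> M" using nice_ex[OF F] by auto
      obtain J where J: "real n * M < real J" using reals_Archimedean2 by blast
      have "real n * cmod (F x) < real J" for x using mult_left_mono[OF M(2)[of x], of "real n"] J by simp
      then show ?thesis by (rule that)
    qed
    obtain J' where J': "real m * cmod (G x) < real J'" for x
    proof -
      obtain M where M: "M \<ge> 0" "\<And>x. cmod (G x) \<le> M" using nice_ex[OF G] by auto
      obtain J where J: "real m * M < real J" using reals_Archimedean2 by blast
      have "real m * cmod (G x) < real J" for x using mult_left_mono[OF M(2)[of x], of "real m"] J by simp
      then show ?thesis by (rule that)
    qed
    \<comment> \<open>the exponents p / p0 and p / p1 at the two ends, and 1 at theta\<close>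
    define a where "a = (\<lambda>z::complex. of_real (p / p0) + z * of_real (p * (1 / p1 - 1 / p0)))"
    define b where "b = (\<lambda>z::complex. of_real (q / q0) + z * of_real (q * (1 / q1 - 1 / q0)))"
    define \<Phi> where "\<Phi> = (\<lambda>z. strip_form S T s t (power_family n F J (a z)) (power_family m G J' (b z)))"
    have nP: "nice (power_family n F J z)" "nice (power_family m G J' z)" for z
      unfolding power_family_def[abs_def] by (intro nice_sum nice_level F G; simp)+
    let ?l = "\<lambda>j. ln (real j / real n)" and ?l' = "\<lambda>j. ln (real j / real m)"
    let ?B = "\<lambda>k l. strip_form S T s t (level n F k) (level m G l)"
    define C where "C = (\<lambda>(k, l). of_real (exp (p / p0 * ?l k + q / q0 * ?l' l)) * ?B k l)"
    define u where "u = (\<lambda>(k, l). p * (1 / p1 - 1 / p0) * ?l k + q * (1 / q1 - 1 / q0) * ?l' l)"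
    have Phi: "\<Phi> = (\<lambda>z. \<Sum>kl\<in>{1..<J} \<times> {1..<J'}. C kl * exp (of_real (u kl) * z))"
    proof
      fix z
      have "\<Phi> z = (\<Sum>k\<in>{1..<J}. \<Sum>l\<in>{1..<J'}. exp (a z * of_real (?l k)) * exp (b z * of_real (?l' l)) * ?B k l)"
        unfolding \<Phi>_def power_family_def[abs_def] by (intro strip_form_sum st nice_level F G finite_atLeastLessThan)
      also have "\<dots> = (\<Sum>k\<in>{1..<J}. \<Sum>l\<in>{1..<J'}. C (k, l) * exp (of_real (u (k, l)) * z))"
      proof (intro sum.cong refl)
        fix k l
        have "exp (a z * of_real (?l k)) * exp (b z * of_real (?l' l)) = exp (of_real (p / p0 * ?l k + q / q0 * ?l' l) + of_real (u (k, l)) * z)"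
          unfolding exp_add[symmetric] a_def b_def u_def by (rule arg_cong[of _ _ exp]) (simp add: algebra_simps)
        also have "\<dots> = of_real (exp (p / p0 * ?l k + q / q0 * ?l' l)) * exp (of_real (u (k, l)) * z)"
          unfolding exp_add exp_of_real ..
        finally show "exp (a z * of_real (?l k)) * exp (b z * of_real (?l' l)) * ?B k l = C (k, l) * exp (of_real (u (k, l)) * z)"
          unfolding C_def by (simp only: prod.case mult_ac)
      qed
      finally show "\<Phi> z = (\<Sum>kl\<in>{1..<J} \<times> {1..<J'}. C kl * exp (of_real (u kl) * z))"
        by (simp add: sum.cartesian_product)
    qed
    have "cmod (\<Phi> (of_real \<theta>)) \<le> (2 * pi * N0) powr (1 - \<theta>) * (2 * pi * N1) powr \<theta>"
    proof (rule three_lines[OF _ Phi])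
      fix y
      have "Lp_le p0 lborel (power_family n F J (a (Complex 0 y))) 1" "Lp_le q0 lborel (power_family m G J' (b (Complex 0 y))) 1"
        using pq p q by (auto intro!: power_family_Lp F G J J' L nm simp: a_def b_def)
      then show "cmod (\<Phi> (Complex 0 y)) \<le> 2 * pi * N0"
        using B0 st nP unfolding form_bound_def \<Phi>_def by fastforce
      have "Re (a (Complex 1 y)) = p / p1" "Re (b (Complex 1 y)) = q / q1" by (simp_all add: a_def b_def algebra_simps)
      then have "Lp_le p1 lborel (power_family n F J (a (Complex 1 y))) 1" "Lp_le q1 lborel (power_family m G J' (b (Complex 1 y))) 1"
        using pq p q by (auto intro!: power_family_Lp F G J J' L nm)
      then show "cmod (\<Phi> (Complex 1 y)) \<le> 2 * pi * N1"
        using B1 st nP unfolding form_bound_def \<Phi>_def by fastforce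
    qed (use N th in auto)
    also have "(2 * pi * N0) powr (1 - \<theta>) * (2 * pi * N1) powr \<theta> = ((2 * pi) powr (1 - \<theta>) * (2 * pi) powr \<theta>) * ?N"
      using N by (simp add: powr_mult mult_ac)
    also have "(2 * pi) powr (1 - \<theta>) * (2 * pi) powr \<theta> = 2 * pi" unfolding powr_add[symmetric] by simp
    finally have "cmod (\<Phi> (of_real \<theta>)) \<le> 2 * pi * ?N" .
    moreover have "a (of_real \<theta>) = 1"
    proof -
      have "a (of_real \<theta>) = of_real (p * ((1 - \<theta>) / p0 + \<theta> / p1))" unfolding a_def by (simp add: algebra_simps diff_divide_distrib)
      then show ?thesis using p(1) unfolding p(2)[symmetric] by simp
    qed
    moreover have "b (of_real \<theta>) = 1"
    proof -
      have "b (of_real \<theta>) = of_real (q * ((1 - \<theta>) / q0 + \<theta> / q1))" unfolding b_def by (simp add: algebra_simps diff_divide_distrib)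
      then show ?thesis using q(1) unfolding q(2)[symmetric] by simp
    qed
    ultimately show ?thesis unfolding \<Phi>_def using power_family_1[OF nm(1) J] power_family_1[OF nm(2) J'] by simp
  qed
  have nq: "nice (quantize n F)" if nF: "nice F" for n F
  proof -
    obtain M where M: "M \<ge> 0" "\<And>x. cmod (F x) \<le> M" "\<And>x. M < \<bar>x\<bar> \<Longrightarrow> F x = 0" using nice_ex[OF nF] by auto
    note [measurable] = nice_measurable[OF nF]
    show ?thesis
    proof (rule niceI[of _ M M])
      show "quantize n F \<in> borel_measurable borel" unfolding quantize_def[abs_def] sgn_div_norm by measurable
      show "cmod (quantize n F x) \<le> M" for x using quantize_le[of n F x] M(2)[of x] by linarith
      show "quantize n F x = 0" if "M < \<bar>x\<bar>" for x using M(3)[OF that] by (simp add: quantize_def)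
    qed
  qed
  have unit: "cmod (strip_form S T s t F G) \<le> 2 * pi * ?N"
    if st: "0 < s" "s < S" "T < t" and F: "nice F" and G: "nice G" and L: "Lp_le p lborel F 1" "Lp_le q lborel G 1" for S T s t F G
  proof -
    have "cmod (strip_form S T s t (quantize (Suc n) F) G) \<le> 2 * pi * ?N" for n
    proof (rule LIMSEQ_le_const2[OF tendsto_norm[OF strip_form_tendsto(2)[OF st nq[OF F] G nq[OF G] quantize_le quantize_tendsto]]])
      show "\<exists>N. \<forall>m\<ge>N. cmod (strip_form S T s t (quantize (Suc n) F) (quantize (Suc m) G)) \<le> 2 * pi * ?N"
        using quant[OF st F G L] by simp
    qed
    then show ?thesis
      by (intro LIMSEQ_le_const2[OF tendsto_norm[OF strip_form_tendsto(1)[OF st F G nq[OF F] quantize_le quantize_tendsto]]]) simp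
  qed
  have pos: "cmod (strip_form S T s t F G) \<le> 2 * pi * ?N * a * b"
    if st: "0 < s" "s < S" "T < t" and F: "nice F" and G: "nice G" and L: "Lp_le p lborel F a" "Lp_le q lborel G b" and ab: "a > 0" "b > 0" for S T s t F G a b
  proof -
    have nF: "nice (\<lambda>x. of_real (inverse a) * F x)" "nice (\<lambda>x. of_real (inverse b) * G x)"
      using nice_mult[OF F, of "\<lambda>_. of_real (inverse a)"] nice_mult[OF G, of "\<lambda>_. of_real (inverse b)"] by (auto simp: mult.commute)
    have "Lp_le p lborel (\<lambda>x. of_real (inverse a) * F x) 1" "Lp_le q lborel (\<lambda>x. of_real (inverse b) * G x) 1"
      using Lp_le_cmult[OF L(1), of "of_real (inverse a)"] Lp_le_cmult[OF L(2), of "of_real (inverse b)"] ab by (simp_all add: norm_inverse)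
    note unit[OF st nF this]
    also have "strip_form S T s t (\<lambda>x. of_real (inverse a) * F x) (\<lambda>x. of_real (inverse b) * G x) = of_real (inverse (a * b)) * strip_form S T s t F G"
      using strip_form_sum[OF st, of "{()}" "\<lambda>_. F" "{()}" "\<lambda>_. G" "\<lambda>_. of_real (inverse a)" "\<lambda>_. of_real (inverse b)"] F G by simp
    finally have "inverse (a * b) * cmod (strip_form S T s t F G) \<le> 2 * pi * ?N" using ab by (simp add: norm_mult norm_inverse)
    then show ?thesis using ab by (simp add: field_simps)
  qed
  show ?thesis unfolding form_bound_def
  proof (intro allI impI)
    fix S T s t a b :: real and F G :: "real \<Rightarrow> complex"
    assume st: "0 < s" "s < S" "T < t" and F: "nice F" and G: "nice G" and L: "Lp_le p lborel F a" "Lp_le q lborel G b"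
    have ab: "a \<ge> 0" "b \<ge> 0" using L by (auto simp: Lp_le_def)
    let ?e = "\<lambda>n. inverse (real (Suc n))"
    have "(\<lambda>n. 2 * pi * ?N * (a + ?e n) * (b + ?e n)) \<longlonglongrightarrow> 2 * pi * ?N * (a + 0) * (b + 0)"
      by (intro tendsto_intros LIMSEQ_inverse_real_of_nat)
    moreover have "cmod (strip_form S T s t F G) \<le> 2 * pi * ?N * (a + ?e n) * (b + ?e n)" for n
    proof (rule pos[OF st F G])
      have e: "?e n > 0" by simp
      show "Lp_le p lborel F (a + ?e n)" "Lp_le q lborel G (b + ?e n)"
        using Lp_le_mono[OF L(1), of "a + ?e n"] Lp_le_mono[OF L(2), of "b + ?e n"] e p q by simp_all
      show "a + ?e n > 0" "b + ?e n > 0" using e ab by linarith+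
    qed
    ultimately show "cmod (strip_form S T s t F G) \<le> 2 * pi * ?N * a * b"
      by (intro LIMSEQ_le_const[of _ "2 * pi * ?N * a * b"]) auto
  qed
qed

section \<open>Comparison of constants\<close>

text \<open>For \<open>r\<close> the larger of \<open>p\<close> and its conjugate exponent, this is at most \<open>(5 / 2) powr (1 / p)\<close> times the constant \<open>A\<^sub>p\<close>.\<close>

definition Kconst :: "real \<Rightarrow> real" where
  "Kconst r = (5 / 2) powr (1 / r) * r powr (1 - 1 / r)"

lemma form_bound_mono:
  assumes "form_bound p q N" "N \<le> N'"
  shows "form_bound p q N'"
  unfolding form_bound_def
proof (intro allI impI)
  fix S T s t a b :: real and F G :: "real \<Rightarrow> complex"
  assume st: "0 < s" "s < S" "T < t" "nice F" "nice G" and L: "Lp_le p lborel F a" "Lp_le q lborel G b"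
  have "cmod (strip_form S T s t F G) \<le> 2 * pi * N * a * b" using assms(1) st L unfolding form_bound_def by blast
  also have "\<dots> \<le> 2 * pi * N' * a * b" using L assms(2) by (intro mult_right_mono mult_left_mono) (auto simp: Lp_le_def)
  finally show "cmod (strip_form S T s t F G) \<le> 2 * pi * N' * a * b" .
qed

text \<open>The form with exponent \<open>r\<close> on either of the two curves and the conjugate exponent on the other one.\<close>

definition pair_bound :: "real \<Rightarrow> real \<Rightarrow> bool" where
  "pair_bound r N \<longleftrightarrow> form_bound r (r / (r - 1)) N \<and> form_bound (r / (r - 1)) r N"

lemma pair_bound_interpolate:
  assumes A: "pair_bound a A" and B: "pair_bound b B" and pos: "A > 0" "B > 0" and ab: "1 < a" "1 < b"
    and th: "0 \<le> \<theta>" "\<theta> \<le> 1" and r: "1 < r" "1 / r = (1 - \<theta>) / a + \<theta> / b"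
  shows "pair_bound r (A powr (1 - \<theta>) * B powr \<theta>)"
proof -
  have e: "1 / (x / (x - 1)) = 1 - 1 / x" if "x > 1" for x :: real using that by (simp add: field_simps)
  have c: "1 / (r / (r - 1)) = (1 - \<theta>) / (a / (a - 1)) + \<theta> / (b / (b - 1))"
  proof -
    have "(1 - \<theta>) / (a / (a - 1)) + \<theta> / (b / (b - 1)) = (1 - \<theta>) * (1 / (a / (a - 1))) + \<theta> * (1 / (b / (b - 1)))" by simp
    also have "\<dots> = 1 - ((1 - \<theta>) / a + \<theta> / b)" unfolding e[OF ab(1)] e[OF ab(2)] by (simp add: algebra_simps)
    finally show ?thesis unfolding e[OF r(1)] r(2) by simp
  qed
  have fb: "form_bound a (a / (a - 1)) A" "form_bound (a / (a - 1)) a A" "form_bound b (b / (b - 1)) B" "form_bound (b / (b - 1)) b B"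
    using A B by (simp_all add: pair_bound_def)
  have cp: "0 < a / (a - 1)" "0 < b / (b - 1)" "0 < r / (r - 1)" "0 < a" "0 < b" "0 < r" using ab r(1) by auto
  show ?thesis unfolding pair_bound_def
    using form_bound_interpolate[OF fb(1,3) pos cp(4,1,5,2) th cp(6) r(2) cp(3) c]
      form_bound_interpolate[OF fb(2,4) pos cp(1,4,2,5) th cp(3) c cp(6) r(2)] by blast
qed

lemma pair_bound_2: "pair_bound 2 (sqrt (86 / 25))"
  using form_bound_2 by (simp add: pair_bound_def)

text \<open>In both parts the transform is estimated at the exponent \<open>r / (r - 1)\<close>, where the column constants enter with the power
\<open>1 - 1 / r\<close>.\<close>

lemma pair_bound_Cbound:
  assumes C: "Cbound r c" and r: "r > 1"
  shows "pair_bound r (c * (2 * (54 / 25) powr (r - 1) + (57 / 25) powr (r - 1)) powr (1 / r))"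
proof -
  let ?q = "r / (r - 1)"
  have q: "r > 1" "?q > 1" "1 / r + 1 / ?q = 1" using r by (auto simp: field_simps)
  have "Cbound ?q c" by (rule Cbound_dual[OF C q])
  then show ?thesis unfolding pair_bound_def using form_bound_outer[OF _ q] form_bound_inner[OF _ q] by blast
qed

lemma ln_Kconst: "r > 0 \<Longrightarrow> ln (Kconst r) = ln (5 / 2) / r + (1 - 1 / r) * ln r"
  by (simp add: Kconst_def ln_mult ln_powr)

text \<open>The tangent at \<open>1 / r = 1 / c\<close> to \<open>ln K\<close>, which is a convex function of \<open>1 / r\<close>.\<close>

lemma ln_Kconst_tangent:
  assumes r1: "r \<ge> 1" and c: "c > 0"
  shows "(1 - 1 / r) * ln c - (c - 1) * (1 / r - 1 / c) + ln (5 / 2) / r \<le> ln (Kconst r)"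
proof -
  have r: "r > 0" using r1 by simp
  have "ln (c / r) \<le> c / r - 1" using ln_le_minus_one[of "c / r"] r c by simp
  then have "ln c - (c / r - 1) \<le> ln r" using r c by (simp add: ln_div)
  then have "(1 - 1 / r) * (ln c - (c / r - 1)) \<le> (1 - 1 / r) * ln r" using r1 by (intro mult_left_mono) auto
  moreover have "(1 - 1 / r) * (c / r - 1) \<le> (c - 1) * (1 / r - 1 / c)"
  proof -
    have "(c - 1) * (1 / r - 1 / c) - (1 - 1 / r) * (c / r - 1) = c * (1 / r - 1 / c)\<^sup>2"
      using r c by (simp add: power2_eq_square field_simps)
    moreover have "c * (1 / r - 1 / c)\<^sup>2 \<ge> 0" using c by simp
    ultimately show ?thesis by linarith
  qed
  ultimately show ?thesis unfolding ln_Kconst[OF r] by (simp add: right_diff_distrib)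
qed

text \<open>The interpolated bound is log-affine in \<open>1 / r\<close>, so it is enough to compare it with a tangent at the two ends.\<close>

lemma pair_bound_tangent:
  assumes A: "pair_bound a A" and B: "pair_bound b B" and pos: "A > 0" "B > 0" and ab: "1 < a" "a < b" and c: "c > 0"
    and T: "ln A \<le> (1 - 1 / a) * ln c - (c - 1) * (1 / a - 1 / c) + ln (5 / 2) / a"
      "ln B \<le> (1 - 1 / b) * ln c - (c - 1) * (1 / b - 1 / c) + ln (5 / 2) / b"
    and r: "a \<le> r" "r \<le> b"
  shows "pair_bound r (Kconst r)"
proof -
  define \<theta> where "\<theta> = (1 / a - 1 / r) / (1 / a - 1 / b)"
  have d: "1 / a - 1 / b > 0" using ab by (simp add: field_simps)
  have i: "1 / r \<le> 1 / a" "1 / b \<le> 1 / r" using ab r by (auto intro!: divide_left_mono mult_pos_pos)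
  have le: "1 / a - 1 / r \<ge> 0" "1 / a - 1 / r \<le> 1 * (1 / a - 1 / b)"
    unfolding mult_1 using diff_ge_0_iff_ge[THEN iffD2, OF i(1)] diff_left_mono[OF i(2)] by blast+
  have th: "0 \<le> \<theta>" "\<theta> \<le> 1"
    unfolding \<theta>_def pos_divide_le_eq[OF d] using divide_nonneg_pos[OF le(1) d] le(2) by blast+
  have ne: "1 / a - 1 / b \<noteq> 0" using d by linarith
  have "\<theta> * (1 / a - 1 / b) = 1 / a - 1 / r"
    unfolding \<theta>_def by (rule nonzero_eq_divide_eq[OF ne, THEN iffD1, OF refl])
  moreover have "x = (1 - t) * y + t * z" if "t * (y - z) = y - x" for x y z t :: real
    using that by (simp add: algebra_simps)
  ultimately have rr: "1 / r = (1 - \<theta>) * (1 / a) + \<theta> * (1 / b)" by blast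
  have "pair_bound r (A powr (1 - \<theta>) * B powr \<theta>)"
  proof (rule pair_bound_interpolate[OF A B pos _ _ th])
    show "1 / r = (1 - \<theta>) / a + \<theta> / b" using rr by (simp only: times_divide_eq_right mult_1_right)
  qed (use ab r in auto)
  moreover have "A powr (1 - \<theta>) * B powr \<theta> \<le> Kconst r"
  proof -
    have K0: "Kconst r > 0" using ab r by (simp add: Kconst_def)
    let ?T = "\<lambda>x. (1 - x) * ln c - (c - 1) * (x - 1 / c) + ln (5 / 2) * x"
    have "ln (A powr (1 - \<theta>) * B powr \<theta>) = (1 - \<theta>) * ln A + \<theta> * ln B" using pos by (simp add: ln_mult ln_powr)
    also have "\<dots> \<le> (1 - \<theta>) * ?T (1 / a) + \<theta> * ?T (1 / b)"
      using th T by (intro add_mono mult_left_mono) auto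
    also have "\<dots> = ?T ((1 - \<theta>) * (1 / a) + \<theta> * (1 / b))" by (simp only: algebra_simps)
    also have "\<dots> = ?T (1 / r)" by (simp only: rr)
    also have "\<dots> \<le> ln (Kconst r)" using ln_Kconst_tangent[of r c] ab r c by simp
    finally show ?thesis using K0 pos by (subst (asm) ln_le_cancel_iff) auto
  qed
  ultimately show ?thesis unfolding pair_bound_def using form_bound_mono by blast
qed

text \<open>Numerical inequalities between logarithms are reduced to inequalities between rational numbers of this form.\<close>

lemma ln_monomial:
  fixes x y z w :: real
  assumes "x > 0" "y > 0" "z > 0" "w > 0"
  shows "ln (x ^ m * y * z ^ n / w) = real m * ln x + ln y + real n * ln z - ln w"
  using assms by (simp add: ln_mult ln_div ln_realpow)

lemma ln_le_of_le_exp: "0 < x \<Longrightarrow> x \<le> exp y \<Longrightarrow> ln x \<le> (y::real)"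
  using ln_mono[of x "exp y"] by simp

lemma pair_bound_4: "pair_bound 4 (sqrt 2 * (500121 / 15625) powr (1 / 4))"
  using pair_bound_Cbound[OF Cbound_4] by (simp add: power3_eq_cube)

lemma ln_bound_4: "ln (sqrt 2 * (500121 / 15625) powr (1 / 4)) = (ln 4 + ln (500121 / 15625)) / (4::real)"
proof -
  have "ln (4::real) = 2 * ln 2" using ln_realpow[of 2 2] by simp
  then show ?thesis by (simp add: ln_mult ln_sqrt ln_powr)
qed

text \<open>The point of tangency 3 leaves room at both ends, of which the one at 4 is the smaller: it amounts to \<open>128.04 < 67.5 exp (2 / 3)\<close>.\<close>

lemma pair_bound_2_4:
  assumes r: "2 \<le> r" "r \<le> 4"
  shows "pair_bound r (Kconst r)"
proof (rule pair_bound_tangent[OF pair_bound_2 pair_bound_4 _ _ _ _ _ _ _ r, where c = 3])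
  have "86 / 25 \<le> 3 ^ 1 * (5 / 2) * (5 / 6) ^ 4 / (1::real)" by (simp add: power4_eq_xxxx)
  then have "ln (86 / 25) \<le> ln (3 ^ 1 * (5 / 2) * (5 / 6) ^ 4 / (1::real))" by (intro ln_mono) auto
  also have "\<dots> = real 1 * ln 3 + ln (5 / 2) + real 4 * ln (5 / 6) - ln 1" by (rule ln_monomial) auto
  also have "\<dots> \<le> ln 3 + ln (5 / 2) - 2 / 3" using ln_le_minus_one[of "5 / 6 :: real"] by simp
  finally show "ln (sqrt (86 / 25)) \<le> (1 - 1 / 2) * ln 3 - (3 - 1) * (1 / 2 - 1 / 3) + ln (5 / 2) / (2::real)"
    by (simp add: ln_sqrt)
next
  have e: "ln (25 / 18 :: real) \<le> 1 / 3"
    using exp_lower_Taylor_quadratic[of "1 / 3 :: real"] by (intro ln_le_of_le_exp) (auto simp: power2_eq_square)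
  have "500121 / 15625 \<le> 3 ^ 3 * (5 / 2) * (25 / 18) ^ 2 / (4::real)" by (simp add: power2_eq_square power3_eq_cube)
  then have "ln (500121 / 15625) \<le> ln (3 ^ 3 * (5 / 2) * (25 / 18) ^ 2 / (4::real))" by (intro ln_mono) auto
  also have "\<dots> = real 3 * ln 3 + ln (5 / 2) + real 2 * ln (25 / 18) - ln 4" by (rule ln_monomial) auto
  also have "\<dots> \<le> 3 * ln 3 + ln (5 / 2) + 2 / 3 - ln 4" using e by simp
  finally show "ln (sqrt 2 * (500121 / 15625) powr (1 / 4)) \<le> (1 - 1 / 4) * ln 3 - (3 - 1) * (1 / 4 - 1 / 3) + ln (5 / 2) / (4::real)"
    unfolding ln_bound_4 by (simp add: field_simps)
qed auto

lemma pair_bound_dyadic: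
  assumes k: "k \<ge> 3"
  defines "R \<equiv> (2::real) ^ k"
  shows "pair_bound R (R / 3 * (2 * (54 / 25) powr (R - 1) + (57 / 25) powr (R - 1)) powr (1 / R))"
proof -
  have "(2::real) ^ 3 \<le> R" unfolding R_def using k by (intro power_increasing) auto
  then show ?thesis unfolding R_def using pair_bound_Cbound[OF Cbound_dyadic[OF k]] by simp
qed

lemma pair_bound_4_8:
  assumes r: "4 \<le> r" "r \<le> 8"
  shows "pair_bound r (Kconst r)"
proof -
  let ?A = "2 * (54 / 25) ^ 7 + (57 / 25) ^ 7 :: real"
  have A: "?A > 0" by (intro add_pos_pos) auto
  have B8: "pair_bound 8 (8 / 3 * ?A powr (1 / 8))" using pair_bound_dyadic[of 3] by simp
  show ?thesis
  proof (rule pair_bound_tangent[OF pair_bound_4 B8 _ _ _ _ _ _ _ r, where c = 5])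
    have "500121 / 15625 \<le> 5 ^ 3 * (5 / 2) * (9 / 10) ^ 8 / (4::real)" by (simp add: power_divide)
    then have "ln (500121 / 15625) \<le> ln (5 ^ 3 * (5 / 2) * (9 / 10) ^ 8 / (4::real))" by (intro ln_mono) auto
    also have "\<dots> = real 3 * ln 5 + ln (5 / 2) + real 8 * ln (9 / 10) - ln 4" by (rule ln_monomial) auto
    also have "\<dots> \<le> 3 * ln 5 + ln (5 / 2) - 4 / 5 - ln 4" using ln_le_minus_one[of "9 / 10 :: real"] by simp
    finally show "ln (sqrt 2 * (500121 / 15625) powr (1 / 4)) \<le> (1 - 1 / 4) * ln 5 - (5 - 1) * (1 / 4 - 1 / 5) + ln (5 / 2) / (4::real)"
      unfolding ln_bound_4 by (simp add: field_simps)
  next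
    have e: "ln (89 / 50 :: real) \<le> 3 / 5"
      using exp_lower_Taylor_quadratic[of "3 / 5 :: real"] by (intro ln_le_of_le_exp) (auto simp: power2_eq_square)
    have "?A \<le> 5 ^ 7 * (5 / 2) * (89 / 50) ^ 4 / ((8 / 3) ^ 8)" by (simp add: power_divide)
    then have "ln ?A \<le> ln (5 ^ 7 * (5 / 2) * (89 / 50) ^ 4 / ((8 / 3) ^ 8 :: real))" using A by (intro ln_mono) auto
    also have "\<dots> = real 7 * ln 5 + ln (5 / 2) + real 4 * ln (89 / 50) - ln ((8 / 3) ^ 8)" by (rule ln_monomial) auto
    also have "ln ((8 / 3) ^ 8 :: real) = 8 * ln (8 / 3)" using ln_realpow[of "8 / 3 :: real" 8] by simp
    also have "real 7 * ln 5 + ln (5 / 2) + real 4 * ln (89 / 50) - 8 * ln (8 / 3 :: real) \<le> 7 * ln 5 + ln (5 / 2) + 12 / 5 - 8 * ln (8 / 3)" using e by simp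
    finally have L: "ln ?A \<le> 7 * ln 5 + ln (5 / 2) + 12 / 5 - 8 * ln (8 / 3)" .
    have "ln (8 / 3 * ?A powr (1 / 8)) = ln (8 / 3) + ln ?A / 8"
      using A by (subst ln_mult_pos) (auto simp: ln_powr)
    also have "\<dots> \<le> ln (8 / 3) + (7 * ln 5 + ln (5 / 2) + 12 / 5 - 8 * ln (8 / 3)) / 8" using L by (intro add_left_mono divide_right_mono) auto
    finally show "ln (8 / 3 * ?A powr (1 / 8)) \<le> (1 - 1 / 8) * ln 5 - (5 - 1) * (1 / 8 - 1 / 5) + ln (5 / 2) / (8::real)"
      by (simp add: field_simps)
  qed (use A in auto)
qed

text \<open>Up to the factor \<open>19 / 25 = (57 / 25) / 3\<close> the bound grows like \<open>R\<close>.\<close>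

lemma ln_dyadic_bound:
  fixes R :: real
  assumes R: "R \<ge> 8"
  defines "N \<equiv> R / 3 * (2 * (54 / 25) powr (R - 1) + (57 / 25) powr (R - 1)) powr (1 / R)"
  shows "N > 0" "ln N \<le> ln R + (1 - 1 / R) * ln (19 / 25)"
proof -
  let ?A = "2 * (54 / 25) powr (R - 1) + (57 / 25) powr (R - 1)"
  have A: "?A > 0" by (intro add_pos_pos) auto
  then show "N > 0" using R by (simp add: N_def)
  have "(54 / 25) powr (R - 1) \<le> (57 / 25) powr (R - 1)" using R by (intro powr_mono2) auto
  then have "?A \<le> 3 * (57 / 25) powr (R - 1)" by simp
  then have "ln ?A \<le> ln (3 * (57 / 25) powr (R - 1))" using A by (intro ln_mono) auto
  also have "\<dots> = ln 3 + (R - 1) * ln (57 / 25)" by (simp add: ln_mult ln_powr)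
  finally have "ln ?A / R \<le> (ln 3 + (R - 1) * ln (57 / 25)) / R" using R by (intro divide_right_mono) auto
  also have "\<dots> = ln 3 / R + (1 - 1 / R) * ln (57 / 25)" using R by (simp add: field_simps)
  finally have "ln ?A / R \<le> ln 3 / R + (1 - 1 / R) * ln (57 / 25)" .
  moreover have "ln N = ln R - ln 3 + ln ?A / R"
  proof -
    have "ln N = ln (R / 3) + ln (?A powr (1 / R))" unfolding N_def using R A by (intro ln_mult_pos) auto
    then show ?thesis using R A by (simp add: ln_div ln_powr)
  qed
  moreover have "ln (19 / 25 :: real) = ln (57 / 25) - ln 3"
  proof -
    have "ln (57 / 25 / 3 :: real) = ln (57 / 25) - ln 3" by (rule ln_divide_pos) auto
    then show ?thesis by simp
  qed
  moreover from this have "(1 - 1 / R) * ln (19 / 25) = (1 - 1 / R) * ln (57 / 25) - ln 3 + ln 3 / R"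
    by (simp only:) (simp add: algebra_simps)
  ultimately show "ln N \<le> ln R + (1 - 1 / R) * ln (19 / 25)" by linarith
qed

text \<open>With \<open>u = R / s\<close> between \<open>1 / 2\<close> and 1, the logarithm of the interpolated bound exceeds \<open>ln s\<close> by at most
\<open>ln u + 2 (1 - u) ln 2 + (1 - 1 / s) ln (19 / 25)\<close>, while \<open>ln K\<close> falls short of \<open>ln s\<close> by \<open>(ln s - ln (5 / 2)) / s\<close>.
The first two terms are at most 0.064, and the terms divided by \<open>s\<close> add up to \<open>(ln s - ln (19 / 10)) / s\<close>, at most 0.182;
\<open>ln (19 / 25) < - 0.27\<close> outweighs both.\<close>

lemma pair_bound_octave:
  assumes k: "k \<ge> 3" and s: "2 ^ k \<le> s" "s \<le> 2 ^ (k + 1)"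
  shows "pair_bound s (Kconst s)"
proof -
  define R where "R = (2::real) ^ k"
  let ?N = "\<lambda>R. R / 3 * (2 * (54 / 25) powr (R - 1) + (57 / 25) powr (R - 1)) powr (1 / R) :: real"
  have "(2::real) ^ 3 \<le> R" unfolding R_def using k by (intro power_increasing) auto
  then have R8: "R \<ge> 8" by simp
  have sR: "R \<le> s" "s \<le> 2 * R" using s by (auto simp: R_def)
  have P: "pair_bound R (?N R)" "pair_bound (2 * R) (?N (2 * R))"
    using pair_bound_dyadic[OF k] pair_bound_dyadic[of "k + 1"] k by (simp_all add: R_def)
  note L = ln_dyadic_bound[OF R8] and L2 = ln_dyadic_bound[of "2 * R"]
  have R16: "2 * R \<ge> 8" using R8 by simp
  define \<theta> where "\<theta> = 2 * (1 - R / s)"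
  have u: "1 / 2 \<le> R / s" "R / s \<le> 1" using sR R8 by (auto simp: field_simps)
  have "0 \<le> 2 * (1 - x)" "2 * (1 - x) \<le> 1" if "1 / 2 \<le> x" "x \<le> 1" for x :: real using that by auto
  from this[OF u] have th: "0 \<le> \<theta>" "\<theta> \<le> 1" unfolding \<theta>_def .
  have rr: "1 / s = (1 - \<theta>) / R + \<theta> / (2 * R)" using sR R8 by (simp add: \<theta>_def field_simps)
  have PB: "pair_bound s (?N R powr (1 - \<theta>) * ?N (2 * R) powr \<theta>)"
    by (rule pair_bound_interpolate[OF P L(1) L2(1)[OF R16] _ _ th _ rr]) (use R8 sR in auto)
  have K0: "Kconst s > 0" using R8 sR by (simp add: Kconst_def)
  let ?q = "ln (19 / 25 :: real)"
  have "ln (?N R powr (1 - \<theta>) * ?N (2 * R) powr \<theta>) = (1 - \<theta>) * ln (?N R) + \<theta> * ln (?N (2 * R))"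
  proof -
    have "ln (x powr v * y powr w) = v * ln x + w * ln y" if "x > 0" "y > 0" for x y v w :: real
      using that by (simp add: ln_mult ln_powr)
    from this[OF L(1) L2(1)[OF R16]] show ?thesis .
  qed
  also have "\<dots> \<le> (1 - \<theta>) * (ln R + (1 - 1 / R) * ?q) + \<theta> * (ln (2 * R) + (1 - 1 / (2 * R)) * ?q)"
    using L(2) L2(2)[OF R16] th by (intro add_mono mult_left_mono) auto
  also have "\<dots> = ln R + \<theta> * ln 2 + (1 - ((1 - \<theta>) / R + \<theta> / (2 * R))) * ?q"
  proof -
    have "ln (2 * R) = ln 2 + ln R" using R8 by (intro ln_mult_pos) auto
    then show ?thesis by (simp only:) (simp add: algebra_simps)
  qed
  also have "\<dots> = ln R + \<theta> * ln 2 + (1 - 1 / s) * ?q" by (simp only: rr)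
  also have "\<dots> \<le> ln (Kconst s)"
  proof -
    have s8: "s \<ge> 8" using sR R8 by simp
    have l2: "ln 2 \<le> (7 / 10 :: real)" using ln2_le_25_over_36 by simp
    \<comment> \<open>tangent of the logarithm at 5 / 7, close to the maximum at 1 / (2 ln 2)\<close>
    have a: "ln R - ln s + \<theta> * ln 2 \<le> 2 / 5 + ln (5 / 7)"
    proof -
      have "R / s > 0" using u by linarith
      then have "ln (R / s * (7 / 5)) \<le> R / s * (7 / 5) - 1" by (intro ln_le_minus_one) auto
      moreover have "ln (R / s * (7 / 5)) = ln R - ln s - ln (5 / 7)"
      proof -
        have "ln (R / s * (7 / 5)) = ln (R / s) + ln (7 / 5)" using \<open>R / s > 0\<close> by (intro ln_mult_pos) auto
        moreover have "ln (R / s) = ln R - ln s" using R8 s8 by (intro ln_divide_pos) auto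
        moreover have "ln (7 / 5 :: real) = - ln (5 / 7)" by (simp add: ln_div)
        ultimately show ?thesis by simp
      qed
      moreover have "\<theta> * ln 2 \<le> \<theta> * (7 / 10)" using th l2 by (intro mult_left_mono) auto
      moreover have "\<theta> * (7 / 10) = 7 / 5 - R / s * (7 / 5)" by (simp add: \<theta>_def)
      ultimately show ?thesis by linarith
    qed
    \<comment> \<open>tangent of the logarithm at 8, the smallest possible s\<close>
    have b: "(ln s - ln (19 / 10)) / s \<le> 363 / 2000"
    proof -
      have "ln (s / 8) \<le> s / 8 - 1" using s8 by (intro ln_le_minus_one) auto
      moreover have "ln (s / 8) = ln s - ln 8" using s8 by (intro ln_divide_pos) auto
      moreover have "ln (8::real) = ln (19 / 10) + ln (80 / 19)"
      proof -
        have "ln (19 / 10 * (80 / 19) :: real) = ln (19 / 10) + ln (80 / 19)" by (rule ln_mult_pos) auto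
        then show ?thesis by simp
      qed
      moreover have "ln (80 / 19 :: real) = 2 * ln 2 + ln (20 / 19)"
      proof -
        have "ln (2 ^ 2 * (20 / 19) :: real) = ln (2 ^ 2) + ln (20 / 19)" by (rule ln_mult_pos) auto
        then show ?thesis using ln_realpow[of 2 2] by simp
      qed
      moreover have "ln (20 / 19 :: real) \<le> 1 / 19" using ln_le_minus_one[of "20 / 19 :: real"] by simp
      ultimately have "ln s - ln (19 / 10) \<le> s / 8 - 1 + 1442 / 1000" using ln2_le_25_over_36 by linarith
      also have "\<dots> = s / 8 + 442 / 1000" by simp
      also have "\<dots> \<le> 363 / 2000 * s" using s8 by simp
      finally show ?thesis using s8 by (simp add: divide_le_eq)
    qed
    have c: "2 / 5 + ln (5 / 7) + ?q + 363 / 2000 \<le> (0::real)"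
    proof -
      have "19 / 35 \<le> (9273 / 10000) ^ 8 * (1::real)" by (simp add: power_divide)
      then have "ln (19 / 35) \<le> ln ((9273 / 10000) ^ 8 :: real)" by (intro ln_mono) auto
      also have "\<dots> = 8 * ln (9273 / 10000)" using ln_realpow[of "9273 / 10000 :: real" 8] by simp
      also have "\<dots> \<le> 8 * (9273 / 10000 - 1)" using ln_le_minus_one[of "9273 / 10000 :: real"] by simp
      finally have "ln (19 / 35 :: real) \<le> - (5815 / 10000)" by simp
      moreover have "ln (5 / 7 * (19 / 25) :: real) = ln (5 / 7) + ?q" by (rule ln_mult_pos) auto
      ultimately show ?thesis by simp
    qed
    have lq: "ln (5 / 2) + ?q = ln (19 / 10)"
      using ln_mult_pos[of "5 / 2 :: real" "19 / 25"] by simp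
    have "ln (Kconst s) - (ln R + \<theta> * ln 2 + (1 - 1 / s) * ?q) = - (ln R - ln s + \<theta> * ln 2) - ?q - (ln s - (ln (5 / 2) + ?q)) / s"
      using s8 by (subst ln_Kconst) (auto simp: field_simps)
    then show ?thesis using a b c unfolding lq by linarith
  qed
  finally have ln_le: "ln (?N R powr (1 - \<theta>) * ?N (2 * R) powr \<theta>) \<le> ln (Kconst s)" .
  have "0 < x powr v * y powr w" if "x > 0" "y > 0" for x y v w :: real using that by simp
  from this[OF L(1) L2(1)[OF R16]] have "?N R powr (1 - \<theta>) * ?N (2 * R) powr \<theta> \<le> Kconst s"
    using ln_le K0 by (subst (asm) ln_le_cancel_iff)
  then show ?thesis using PB unfolding pair_bound_def using form_bound_mono by blast
qed

theorem pair_bound_Kconst: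
  assumes r: "r \<ge> 2"
  shows "pair_bound r (Kconst r)"
proof (cases "r \<le> 8")
  case True
  then show ?thesis using pair_bound_2_4[of r] pair_bound_4_8[of r] r by (cases "r \<le> 4") auto
next
  case False
  define k where "k = nat \<lfloor>log 2 r\<rfloor>"
  have l3: "log 2 r \<ge> 3" using False by (simp add: le_log_iff)
  have k: "real k \<le> log 2 r" "log 2 r < real k + 1" using l3 by (auto simp: k_def)
  have k3: "k \<ge> 3" using l3 by (simp add: k_def le_nat_iff le_floor_iff)
  have "2 powr real k \<le> r" using k(1) False by (simp add: le_log_iff)
  moreover have "r \<le> 2 powr real (k + 1)" using k(2) False by (simp add: log_le_iff[symmetric] add.commute)
  ultimately show ?thesis using pair_bound_octave[OF k3, of r] by (simp only: powr_realpow zero_less_numeral)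
qed

section \<open>The Cauchy integral on a half-strip boundary\<close>

text \<open>Off the curve the kernel decays like the inverse of arc length, so it is in every \<open>L\<^sup>q\<close> with \<open>q > 1\<close>.\<close>

lemma strip_kernel_integrable:
  assumes f: "Lp_le p lborel f a" and p: "1 < p" and s: "0 < s" and d: "d > 0" "\<And>x. d \<le> cmod (strip_path s 0 x - w)"
  shows "integrable lborel (\<lambda>x. f x / (strip_path s 0 x - w))"
proof -
  let ?q = "p / (p - 1)"
  have q: "?q > 1" "1 / p + 1 / ?q = 1" using p by (auto simp: field_simps)
  let ?k = "\<lambda>x. inverse (strip_path s 0 x - w)"
  let ?D = "(1 + d + cmod w) / d * (1 + s)"
  have kb: "cmod (?k x) \<le> ?D * (1 + \<bar>x\<bar>) powr (- 1)" for x
  proof -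
    let ?z = "strip_path s 0 x"
    have pos: "1 + cmod ?z > 0" "1 + \<bar>x\<bar> > 0" by (auto intro: add_pos_nonneg)
    have "\<bar>x\<bar> \<le> s + cmod ?z" 
    proof -
      have "\<bar>x\<bar> \<le> s + \<bar>Im ?z\<bar>" using s by (auto simp: strip_path_def)
      then show ?thesis using abs_Im_le_cmod[of ?z] by linarith
    qed
    moreover have eq: "(1 + s) * (1 + cmod ?z) = 1 + s + cmod ?z + s * cmod ?z" by (simp add: algebra_simps)
    moreover have "0 \<le> s * cmod ?z" using s by simp
    ultimately have "1 + \<bar>x\<bar> \<le> 1 + s + cmod ?z + s * cmod ?z" by linarith
    then have "1 * (1 + \<bar>x\<bar>) \<le> (1 + s) * (1 + cmod ?z)" by (simp only: eq mult_1)
    then have "inverse (1 + cmod ?z) \<le> (1 + s) / 1 * inverse (1 + \<bar>x\<bar>)"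
      by (intro inverse_le_of_mult_le pos) auto
    then have 1: "(1 + cmod ?z) powr (- 1) \<le> (1 + s) * (1 + \<bar>x\<bar>) powr (- 1)"
      using pos by (simp add: powr_minus)
    have "cmod (?k x) \<le> (1 + d + cmod w) / d * (1 + cmod ?z) powr (- 1)"
      using distance_lower_bound[OF d(1), of w ?z] d(2)[of x] by (simp add: norm_inverse norm_minus_commute)
    also have "\<dots> \<le> (1 + d + cmod w) / d * ((1 + s) * (1 + \<bar>x\<bar>) powr (- 1))"
      using d 1 by (intro mult_left_mono) auto
    finally show ?thesis by (simp add: mult.assoc)
  qed
  have D0: "?D \<ge> 0" using d s by simp
  have i: "integrable lborel (\<lambda>x. cmod (?k x) powr ?q)"
  proof (rule Bochner_Integration.integrable_bound[OF integrable_mult_right[OF integrable_power_decay[OF q(1)], of "?D powr ?q"]])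
    show "(\<lambda>x. cmod (?k x) powr ?q) \<in> borel_measurable lborel" by measurable
    show "AE x in lborel. norm (cmod (?k x) powr ?q) \<le> norm (?D powr ?q * (1 + \<bar>x\<bar>) powr (- ?q))"
    proof (rule AE_I2)
      fix x :: real
      have "cmod (?k x) powr ?q \<le> (?D * (1 + \<bar>x\<bar>) powr (- 1)) powr ?q" using kb q by (intro powr_mono2) auto
      also have "\<dots> = ?D powr ?q * (1 + \<bar>x\<bar>) powr (- ?q)" unfolding powr_mult powr_powr by simp
      finally show "norm (cmod (?k x) powr ?q) \<le> norm (?D powr ?q * (1 + \<bar>x\<bar>) powr (- ?q))" by simp
    qed
  qed
  have "Lp_le ?q lborel ?k ((\<integral>x. cmod (?k x) powr ?q \<partial>lborel) powr (1 / ?q))"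
  proof (rule Lp_leI_integrable[OF _ _ i])
    have "(\<integral>x. cmod (?k x) powr ?q \<partial>lborel) \<ge> 0" by (intro Bochner_Integration.integral_nonneg) simp
    then show "(\<integral>x. cmod (?k x) powr ?q \<partial>lborel) \<le> ((\<integral>x. cmod (?k x) powr ?q \<partial>lborel) powr (1 / ?q)) powr ?q"
      unfolding powr_powr using p by simp
  qed auto
  from Hoelder_integral(1)[OF p q f this] show ?thesis by (simp add: divide_inverse)
qed

text \<open>Duality turns a bound for the bilinear form into a norm bound for the Cauchy integral on the second curve, at first for
truncated densities and then, by Fatou's lemma, in general.\<close>

lemma strip_form_to_Lp:
  assumes pq: "1 < p" "1 < q" "1 / p + 1 / q = 1" and s: "0 < s" and d: "d > 0" "\<And>x y. d \<le> cmod (strip_path s 0 x - \<phi> y)"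
    and phi[measurable]: "\<phi> \<in> borel_measurable borel" and K: "K \<ge> 0"
    and B: "\<And>u G a b. nice u \<Longrightarrow> nice G \<Longrightarrow> Lp_le p lborel u a \<Longrightarrow> Lp_le q lborel G b \<Longrightarrow>
      cmod (\<integral>y. G y * (\<integral>x. u x / (strip_path s 0 x - \<phi> y) \<partial>lborel) \<partial>lborel) \<le> K * a * b"
    and f: "Lp_le p lborel f a"
  shows "Lp_le p lborel (\<lambda>y. \<integral>x. f x / (strip_path s 0 x - \<phi> y) \<partial>lborel) (K * a)"
proof -
  have a0: "a \<ge> 0" and fm[measurable]: "f \<in> borel_measurable borel" using f by (auto simp: Lp_le_def)
  let ?T = "\<lambda>u y. \<integral>x. u x / (strip_path s 0 x - \<phi> y) \<partial>lborel"
  have trunc: "Lp_le p lborel (?T (trunc n f)) (K * a)" for n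
  proof -
    let ?u = "trunc n f"
    have n: "nice ?u" by (rule nice_trunc[OF fm])
    note [measurable] = nice_measurable[OF n]
    have L: "Lp_le p lborel ?u a" by (rule Lp_le_dominated[OF f]) (use pq in \<open>auto simp: cmod_trunc_le\<close>)
    show ?thesis
    proof (rule Lp_le_dual[OF pq(2) pq(1)])
      show "1 / q + 1 / p = 1" using pq by simp
      have "(\<lambda>(y, x). ?u x / (strip_path s 0 x - \<phi> y)) \<in> borel_measurable (borel \<Otimes>\<^sub>M lborel)" by measurable
      then show "?T ?u \<in> borel_measurable borel" by (rule lborel.borel_measurable_lebesgue_integral)
      show "cmod (?T ?u y) \<le> 1 / d * (\<integral>x. cmod (?u x) \<partial>lborel)" for y
      proof -
        have le: "cmod (?u x / (strip_path s 0 x - \<phi> y)) \<le> 1 / d * cmod (?u x)" for x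
        proof -
          have "cmod (?u x) / cmod (strip_path s 0 x - \<phi> y) \<le> cmod (?u x) / d"
            using d(2)[of x y] d(1) by (intro divide_left_mono mult_pos_pos) auto
          then show ?thesis by (simp add: norm_divide)
        qed
        have i: "integrable lborel (\<lambda>x. 1 / d * cmod (?u x))" by (intro integrable_mult_right integrable_norm nice_integrable n)
        have "cmod (?T ?u y) \<le> (\<integral>x. cmod (?u x / (strip_path s 0 x - \<phi> y)) \<partial>lborel)" by (rule integral_norm_bound)
        also have "\<dots> \<le> (\<integral>x. 1 / d * cmod (?u x) \<partial>lborel)"
        proof (rule integral_mono[OF _ i le])
          show "integrable lborel (\<lambda>x. cmod (?u x / (strip_path s 0 x - \<phi> y)))"
            by (rule Bochner_Integration.integrable_bound[OF i]) (use le d(1) in \<open>auto intro!: AE_I2\<close>)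
        qed
        finally show ?thesis by simp
      qed
      show "K * a \<ge> 0" using K a0 by simp
      fix h b assume h: "nice h" "Lp_le q lborel h b"
      show "cmod (\<integral>y. ?T ?u y * h y \<partial>lborel) \<le> K * a * b"
        using B[OF n h(1) L h(2)] by (simp add: mult.commute)
    qed measurable
  qed
  show ?thesis
  proof (rule Lp_le_limit[OF trunc _ tendsto_const])
    fix y
    have int: "integrable lborel (\<lambda>x. f x / (strip_path s 0 x - \<phi> y))"
      by (rule strip_kernel_integrable[OF f pq(1) s d(1)]) (rule d(2))
    show "(\<lambda>n. ?T (trunc n f) y) \<longlonglongrightarrow> ?T f y"
    proof (rule integral_dominated_convergence[OF _ _ integrable_norm[OF int]])
      show "(\<lambda>x. trunc n f x / (strip_path s 0 x - \<phi> y)) \<in> borel_measurable lborel" for n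
        using nice_measurable[OF nice_trunc[OF fm]] by measurable
      show "AE x in lborel. (\<lambda>n. trunc n f x / (strip_path s 0 x - \<phi> y)) \<longlonglongrightarrow> f x / (strip_path s 0 x - \<phi> y)"
      proof (rule AE_I2)
        fix x
        have "strip_path s 0 x - \<phi> y \<noteq> 0" using d(2)[of x y] d(1) by auto
        then show "(\<lambda>n. trunc n f x / (strip_path s 0 x - \<phi> y)) \<longlonglongrightarrow> f x / (strip_path s 0 x - \<phi> y)"
          by (intro tendsto_divide trunc_tendsto tendsto_const)
      qed
      show "AE x in lborel. norm (trunc n f x / (strip_path s 0 x - \<phi> y)) \<le> norm (f x / (strip_path s 0 x - \<phi> y))" for n
        unfolding norm_divide by (intro AE_I2 divide_right_mono cmod_trunc_le) auto
    qed measurable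
  qed (use pq in auto)
qed

text \<open>For \<open>p \<ge> 2\<close> the constant \<open>K\<close> is taken at \<open>r = p\<close>, and for \<open>p < 2\<close> at the conjugate exponent; these two cases are the two
terms of the maximum that defines \<open>A\<close>.\<close>

lemma form_bound_target_constant:
  assumes p: "1 < p" and A: "A > 0" "A powr p = max (p / (p - 1)) (p powr (p - 1))"
  obtains K where "K \<ge> 0" "K \<le> (5 / 2) powr (1 / p) * A" "K \<le> 3 powr (1 / p) * A"
    "form_bound p (p / (p - 1)) K" "form_bound (p / (p - 1)) p K"
proof -
  have Ap: "A = (A powr p) powr (1 / p)" unfolding powr_powr using A(1) p by simp
  have "\<exists>K\<ge>0. K \<le> (5 / 2) powr (1 / p) * A \<and> form_bound p (p / (p - 1)) K \<and> form_bound (p / (p - 1)) p K"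
  proof (cases "p \<ge> 2")
    case True
    have "p powr (1 - 1 / p) = (p powr (p - 1)) powr (1 / p)" using p by (simp add: powr_powr field_simps)
    also have "\<dots> \<le> (A powr p) powr (1 / p)" unfolding A(2) using p by (intro powr_mono2) auto
    finally have "Kconst p \<le> (5 / 2) powr (1 / p) * A"
      unfolding Kconst_def Ap[symmetric] by (intro mult_left_mono) auto
    moreover have "Kconst p \<ge> 0" by (simp add: Kconst_def)
    ultimately show ?thesis using pair_bound_Kconst[OF True] unfolding pair_bound_def by blast
  next
    case False
    define r where "r = p / (p - 1)"
    have r: "r \<ge> 2" using p False by (simp add: r_def field_simps)
    have rp: "r / (r - 1) = p" using p by (simp add: r_def field_simps)
    have e: "1 - 1 / r = 1 / p" using p by (simp add: r_def field_simps)
    have "r powr (1 / p) \<le> (A powr p) powr (1 / p)" unfolding A(2) using p by (intro powr_mono2) (auto simp: r_def)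
    then have "r powr (1 / p) \<le> A" unfolding Ap[symmetric] .
    moreover have "(5 / 2) powr (1 / r) \<le> (5 / 2) powr (1 / p)"
      using p False r by (intro powr_mono divide_left_mono) (auto simp: )
    ultimately have "Kconst r \<le> (5 / 2) powr (1 / p) * A"
      unfolding Kconst_def e by (intro mult_mono) auto
    moreover have "Kconst r \<ge> 0" by (simp add: Kconst_def)
    ultimately show ?thesis using pair_bound_Kconst[OF r] unfolding pair_bound_def rp r_def[symmetric] by blast
  qed
  moreover have "(5 / 2) powr (1 / p) * A \<le> 3 powr (1 / p) * A"
    using p A by (intro mult_right_mono powr_mono2) auto
  ultimately show ?thesis using that by (meson order_trans)
qed

lemma Lp_norm_arc_measure:
  assumes s: "s > 0" and F: "(\<lambda>x. F (strip_path s t x)) \<in> borel_measurable lebesgue"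
  shows "Lp_norm p (arc_measure s t) F = enn_powr (\<integral>\<^sup>+x. ennreal (cmod (F (strip_path s t x)) powr p) \<partial>lborel) (1 / p)"
proof -
  have [measurable]: "F \<in> borel_measurable (arc_measure s t)"
    unfolding arc_measure_def by (rule measurable_embed_measure1[where f = "strip_path s t" and g = F, OF F])
  have m: "(\<lambda>w. ennreal (cmod (F w) powr p)) \<in> borel_measurable (arc_measure s t)" by measurable
  have "(\<integral>\<^sup>+ w. ennreal (cmod (F w) powr p) \<partial>arc_measure s t) = (\<integral>\<^sup>+x. ennreal (cmod (F (strip_path s t x)) powr p) \<partial>lebesgue)"
    using nn_integral_embed_measure[OF inj_strip_path[OF s, of t] m[unfolded arc_measure_def]] unfolding arc_measure_def .
  then show ?thesis unfolding Lp_norm_def by (simp add: nn_integral_completion)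
qed

lemma enn_powr_le:
  assumes "X \<le> ennreal (a powr p)" "a \<ge> 0" "p > 0"
  shows "enn_powr X (1 / p) \<le> ennreal a"
proof -
  have fin: "X \<noteq> \<infinity>" using assms(1) by (auto simp: top_unique)
  have "enn2real X \<le> a powr p" using assms(1) by (simp add: enn2real_leI)
  then have "enn2real X powr (1 / p) \<le> (a powr p) powr (1 / p)" using assms(3) by (intro powr_mono2) auto
  also have "\<dots> = a" using assms by (simp add: powr_powr)
  finally show ?thesis using fin by (simp add: enn_powr_def ennreal_leI)
qed

text \<open>The convention that infinity is mapped to infinity makes the integral recoverable from a finite norm.\<close>

lemma enn_powr_finite:
  assumes "enn_powr X (1 / p) < \<infinity>" "p > 0"
  shows "X = ennreal (enn2real (enn_powr X (1 / p)) powr p)"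
proof -
  have fin: "X \<noteq> \<infinity>" using assms(1) by (auto simp: enn_powr_def)
  then have "X = ennreal (enn2real X)" by (simp add: less_top)
  then show ?thesis using fin assms(2) by (simp add: enn_powr_def powr_powr)
qed

text \<open>A Lebesgue measurable density is replaced by a Borel one, which absorbs the unimodular contour factor
\<open>- \<i>\<close>, \<open>1\<close> or \<open>\<i>\<close>.\<close>

lemma Lp_space_arc_measureE:
  assumes F: "F \<in> Lp_space p (arc_measure \<sigma> 0)" and s: "\<sigma> > 0" and p: "p > 1"
  obtains f a where "Lp_le p lborel f a" "ennreal a = Lp_norm p (arc_measure \<sigma> 0) F"
    "\<And>w. Cauchy_int \<sigma> F w = 1 / (2 * of_real pi * \<i>) * (\<integral>x. f x / (strip_path \<sigma> 0 x - w) \<partial>lborel)"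
proof -
  let ?\<gamma> = "strip_path \<sigma> 0"
  have Fm: "F \<in> borel_measurable (arc_measure \<sigma> 0)" using F by (simp add: Lp_space_def)
  have gm: "(\<lambda>x. F (?\<gamma> x)) \<in> borel_measurable lebesgue"
    using measurable_compose[OF measurable_embed_measure2[OF inj_strip_path[OF s]] Fm[unfolded arc_measure_def]] .
  define a where "a = enn2real (Lp_norm p (arc_measure \<sigma> 0) F)"
  have fin: "Lp_norm p (arc_measure \<sigma> 0) F < \<infinity>" using F by (simp add: Lp_space_def)
  have m: "(\<lambda>x. Re (F (?\<gamma> x))) \<in> borel_measurable lebesgue" "(\<lambda>x. Im (F (?\<gamma> x))) \<in> borel_measurable lebesgue"
    using gm by measurable
  obtain f1 where f1: "f1 \<in> borel_measurable lborel" "AE x in lborel. Re (F (?\<gamma> x)) = f1 x"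
    using completion_ex_borel_measurable_real[OF m(1)] by blast
  obtain f2 where f2: "f2 \<in> borel_measurable lborel" "AE x in lborel. Im (F (?\<gamma> x)) = f2 x"
    using completion_ex_borel_measurable_real[OF m(2)] by blast
  note f12 = f1(1) f2(1) f1(2) f2(2)
  note [measurable] = f12(1,2)
  define e where "e = (\<lambda>x. if x < - \<sigma> then - \<i> else if x \<le> \<sigma> then 1 else \<i>)"
  define f where "f = (\<lambda>x. (of_real (f1 x) + \<i> * of_real (f2 x)) * e x)"
  have e1: "cmod (e x) = 1" for x by (simp add: e_def)
  have [measurable]: "e \<in> borel_measurable borel" unfolding e_def by measurable
  have fm[measurable]: "f \<in> borel_measurable borel" unfolding f_def by measurable
  have AEf: "AE x in lborel. f x = F (?\<gamma> x) * vector_derivative ?\<gamma> (at x)"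
    using f12(3,4) AE_lborel_singleton[of \<sigma>] AE_lborel_singleton[of "- \<sigma>"]
  proof eventually_elim
    case (elim x)
    then have "F (?\<gamma> x) = of_real (f1 x) + \<i> * of_real (f2 x)" by (simp add: complex_eq_iff)
    moreover have "vector_derivative ?\<gamma> (at x) = e x"
    proof -
      consider "x < - \<sigma>" | "- \<sigma> < x" "x < \<sigma>" | "x > \<sigma>" using elim by fastforce
      then show ?thesis
        using strip_path_has_vector_derivative[where x = x and s = \<sigma> and t = 0] s by cases (auto simp: e_def intro!: vector_derivative_at)
    qed
    ultimately show ?case by (simp add: f_def)
  qed
  have cm: "AE x in lborel. cmod (f x) = cmod (F (?\<gamma> x))"
    using f12(3,4)
  proof eventually_elim
    case (elim x)
    then have "F (?\<gamma> x) = of_real (f1 x) + \<i> * of_real (f2 x)" by (simp add: complex_eq_iff)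
    then show ?case by (simp add: f_def norm_mult e1)
  qed
  have "(\<integral>\<^sup>+x. ennreal (cmod (f x) powr p) \<partial>lborel) = (\<integral>\<^sup>+x. ennreal (cmod (F (?\<gamma> x)) powr p) \<partial>lborel)"
    by (rule nn_integral_cong_AE) (use cm in eventually_elim, simp)
  also have "\<dots> = ennreal (a powr p)"
    using enn_powr_finite[of "\<integral>\<^sup>+x. ennreal (cmod (F (?\<gamma> x)) powr p) \<partial>lborel" p] fin p
    unfolding Lp_norm_arc_measure[OF s gm] a_def by simp
  finally have L: "Lp_le p lborel f a" unfolding Lp_le_def by (simp add: a_def)
  have CF: "Cauchy_int \<sigma> F w = 1 / (2 * of_real pi * \<i>) * (\<integral>x. f x / (?\<gamma> x - w) \<partial>lborel)" for w
  proof -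
    have "strip_contour_integral \<sigma> 0 (\<lambda>\<zeta>. F \<zeta> / (\<zeta> - w)) = (\<integral>x. f x / (?\<gamma> x - w) \<partial>lebesgue)"
      unfolding strip_contour_integral_def
    proof (rule integral_cong_AE)
      have AE: "AE x in lborel. F (?\<gamma> x) / (?\<gamma> x - w) * vector_derivative ?\<gamma> (at x) = f x / (?\<gamma> x - w)"
        using AEf by eventually_elim simp
      then show AE': "AE x in lebesgue. F (?\<gamma> x) / (?\<gamma> x - w) * vector_derivative ?\<gamma> (at x) = f x / (?\<gamma> x - w)"
        by (rule AE_completion)
      have "(\<lambda>x. f x / (?\<gamma> x - w)) \<in> borel_measurable lborel" by measurable
      then show m: "(\<lambda>x. f x / (?\<gamma> x - w)) \<in> borel_measurable lebesgue" by (rule measurable_completion)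
      show "(\<lambda>x. F (?\<gamma> x) / (?\<gamma> x - w) * vector_derivative ?\<gamma> (at x)) \<in> borel_measurable lebesgue"
        by (rule borel_measurable_AE[OF m]) (use AE' in eventually_elim, erule sym)
    qed
    also have "\<dots> = (\<integral>x. f x / (?\<gamma> x - w) \<partial>lborel)"
      by (rule integral_completion) measurable
    finally show ?thesis unfolding Cauchy_int_def by simp
  qed
  have "ennreal a = Lp_norm p (arc_measure \<sigma> 0) F" using fin by (simp add: a_def)
  from that[OF L this CF] show ?thesis .
qed

text \<open>At positive distance from the curve the kernel may be differentiated under the integral sign.\<close>

lemma Cauchy_int_analytic:
  assumes f: "Lp_le p lborel f a" and s: "\<sigma> > 0" and p: "p > 1"
    and CF: "\<And>w. G w = 1 / (2 * of_real pi * \<i>) * (\<integral>x. f x / (strip_path \<sigma> 0 x - w) \<partial>lborel)"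
    and W: "open W" "W \<inter> range (strip_path \<sigma> 0) = {}"
  shows "G analytic_on W"
proof -
  have [measurable]: "f \<in> borel_measurable borel" using f by (simp add: Lp_le_def)
  have "G field_differentiable (at w)" if w: "w \<in> W" for w
  proof -
    obtain d where d: "d > 0" "ball w d \<subseteq> W" using W(1) w openE by blast
    have dist: "d \<le> cmod (strip_path \<sigma> 0 x - w)" for x
    proof (rule ccontr)
      assume "\<not> ?thesis"
      then have "strip_path \<sigma> 0 x \<in> ball w d" by (simp add: dist_norm norm_minus_commute)
      then show False using d(2) W(2) by blast
    qed
    have "((\<lambda>w. \<integral>x. f x / (strip_path \<sigma> 0 x - w) \<partial>lborel) has_field_derivative (\<integral>x. f x / (strip_path \<sigma> 0 x - w)\<^sup>2 \<partial>lborel)) (at w)"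
      by (rule Cauchy_kernel_derivative[OF _ _ d(1)]) (use dist strip_kernel_integrable[OF f p s d(1) dist] in auto)
    then have "((\<lambda>w. 1 / (2 * of_real pi * \<i>) * (\<integral>x. f x / (strip_path \<sigma> 0 x - w) \<partial>lborel)) has_field_derivative
        1 / (2 * of_real pi * \<i>) * (\<integral>x. f x / (strip_path \<sigma> 0 x - w)\<^sup>2 \<partial>lborel)) (at w)"
      by (rule DERIV_cmult)
    moreover have "G = (\<lambda>w. 1 / (2 * of_real pi * \<i>) * (\<integral>x. f x / (strip_path \<sigma> 0 x - w) \<partial>lborel))" using CF by blast
    ultimately show ?thesis unfolding field_differentiable_def by auto
  qed
  then have "G holomorphic_on W" using W(1) by (auto simp: holomorphic_on_open field_differentiable_def)
  then show ?thesis using W(1) by (simp add: analytic_on_open)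
qed

lemma strip_mean_le:
  assumes L: "Lp_le p lborel (\<lambda>y. \<integral>x. f x / (strip_path \<sigma> 0 x - strip_path s t y) \<partial>lborel) (2 * pi * K * a)" and s: "s > 0" and p: "p > 1"
    and K: "K \<ge> 0" "a \<ge> 0"
    and CF: "\<And>w. G w = 1 / (2 * of_real pi * \<i>) * (\<integral>x. f x / (strip_path \<sigma> 0 x - w) \<partial>lborel)"
  shows "strip_mean p s t G \<le> ennreal (K * a)"
proof -
  have "Lp_le p lborel (\<lambda>y. G (strip_path s t y)) (cmod (1 / (2 * of_real pi * \<i>)) * (2 * pi * K * a))"
    unfolding CF by (rule Lp_le_cmult[OF L])
  moreover have "cmod (1 / (2 * of_real pi * \<i>)) * (2 * pi * K * a) = K * a" by (simp add: norm_divide norm_mult)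
  ultimately have L': "Lp_le p lborel (\<lambda>y. G (strip_path s t y)) (K * a)" by (simp only:)
  then have "(\<lambda>y. G (strip_path s t y)) \<in> borel_measurable lborel" by (simp add: Lp_le_def)
  then have m: "(\<lambda>y. G (strip_path s t y)) \<in> borel_measurable lebesgue" by (rule measurable_completion)
  show ?thesis unfolding strip_mean_def Lp_norm_arc_measure[OF s m]
    by (rule enn_powr_le) (use L' p in \<open>auto simp: Lp_le_def\<close>)
qed

theorem theorem4p9:
  fixes \<sigma> p A :: real and F :: "complex \<Rightarrow> complex"
  assumes "\<sigma> > 0" and "1 < p"
    and "F \<in> Lp_space p (arc_measure \<sigma> 0)"
    and "A > 0" and "A powr p = max (p / (p - 1)) (p powr (p - 1))"
  shows "Cauchy_int \<sigma> F \<in> Hp_plus \<sigma> p \<and>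
         Cauchy_int \<sigma> F \<in> Hp_minus \<sigma> p \<and>
         Hp_plus_norm \<sigma> p (Cauchy_int \<sigma> F)
           \<le> ennreal ((5 / 2) powr (1 / p) * A) * Lp_norm p (arc_measure \<sigma> 0) F \<and>
         Hp_minus_norm \<sigma> p (Cauchy_int \<sigma> F)
           \<le> ennreal (3 powr (1 / p) * A) * Lp_norm p (arc_measure \<sigma> 0) F"
proof -
  let ?q = "p / (p - 1)"
  have pq: "1 < p" "1 < ?q" "1 / p + 1 / ?q = 1" using assms(2) by (auto simp: field_simps)
  obtain f a where f: "Lp_le p lborel f a" and a: "ennreal a = Lp_norm p (arc_measure \<sigma> 0) F"
    and CF: "\<And>w. Cauchy_int \<sigma> F w = 1 / (2 * of_real pi * \<i>) * (\<integral>x. f x / (strip_path \<sigma> 0 x - w) \<partial>lborel)"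
    by (rule Lp_space_arc_measureE[OF assms(3,1,2)]) (rule that)
  obtain K where K: "K \<ge> 0" "K \<le> (5 / 2) powr (1 / p) * A" "K \<le> 3 powr (1 / p) * A"
    "form_bound p ?q K" "form_bound ?q p K" by (rule form_bound_target_constant[OF assms(2,4,5)]) (rule that)
  have a0: "a \<ge> 0" using f by (simp add: Lp_le_def)
  have plus: "strip_mean p s t (Cauchy_int \<sigma> F) \<le> ennreal (K * a)" if st: "0 < s" "s < \<sigma>" "0 < t" for s t
  proof (rule strip_mean_le[OF _ st(1) assms(2) K(1) a0 CF])
    show "Lp_le p lborel (\<lambda>y. \<integral>x. f x / (strip_path \<sigma> 0 x - strip_path s t y) \<partial>lborel) (2 * pi * K * a)"
    proof (rule strip_form_to_Lp[OF pq assms(1) _ strip_path_distance[OF st] _ _ _ f])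
      fix u G a b assume u: "nice u" "nice G" "Lp_le p lborel u a" "Lp_le ?q lborel G b"
      have neg: "(\<integral>x. u x / (strip_path s t y - strip_path \<sigma> 0 x) \<partial>lborel) = - (\<integral>x. u x / (strip_path \<sigma> 0 x - strip_path s t y) \<partial>lborel)" for y
        by (subst integral_minus[symmetric]) (intro Bochner_Integration.integral_cong refl, metis minus_diff_eq minus_divide_right)
      have "strip_form \<sigma> 0 s t u G = (\<integral>y. G y * (\<integral>x. u x / (strip_path \<sigma> 0 x - strip_path s t y) \<partial>lborel) \<partial>lborel)"
        unfolding strip_form_Fubini(1)[OF u(1,2) st] neg by simp
      moreover have "cmod (strip_form \<sigma> 0 s t u G) \<le> 2 * pi * K * a * b"
        using K(4) st u unfolding form_bound_def by blast
      ultimately show "cmod (\<integral>y. G y * (\<integral>x. u x / (strip_path \<sigma> 0 x - strip_path s t y) \<partial>lborel) \<partial>lborel) \<le> 2 * pi * K * a * b"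
        by (simp only:)
    qed (use st K in auto)
  qed
  have minus: "strip_mean p s t (Cauchy_int \<sigma> F) \<le> ennreal (K * a)" if st: "\<sigma> < s" "t < 0" for s t
  proof (rule strip_mean_le[OF _ _ assms(2) K(1) a0 CF])
    show "Lp_le p lborel (\<lambda>y. \<integral>x. f x / (strip_path \<sigma> 0 x - strip_path s t y) \<partial>lborel) (2 * pi * K * a)"
    proof (rule strip_form_to_Lp[OF pq assms(1) _ _ _ _ _ f])
      show "min (s - \<sigma>) (0 - t) \<le> cmod (strip_path \<sigma> 0 x - strip_path s t y)" for x y
        using strip_path_distance[OF assms(1) st, of y x] by (simp add: norm_minus_commute)
      fix u G a b assume u: "nice u" "nice G" "Lp_le p lborel u a" "Lp_le ?q lborel G b"
      have neg: "(\<integral>x. u x / (strip_path s t y - strip_path \<sigma> 0 x) \<partial>lborel) = - (\<integral>x. u x / (strip_path \<sigma> 0 x - strip_path s t y) \<partial>lborel)" for y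
        by (subst integral_minus[symmetric]) (intro Bochner_Integration.integral_cong refl, metis minus_diff_eq minus_divide_right)
      have "strip_form s t \<sigma> 0 G u = - (\<integral>y. G y * (\<integral>x. u x / (strip_path \<sigma> 0 x - strip_path s t y) \<partial>lborel) \<partial>lborel)"
        unfolding strip_form_def neg by simp
      moreover have "cmod (strip_form s t \<sigma> 0 G u) \<le> 2 * pi * K * b * a"
        using K(5) assms(1) st u unfolding form_bound_def by blast
      ultimately have "cmod (\<integral>y. G y * (\<integral>x. u x / (strip_path \<sigma> 0 x - strip_path s t y) \<partial>lborel) \<partial>lborel) \<le> 2 * pi * K * b * a"
        by (simp only: norm_minus_cancel)
      then show "cmod (\<integral>y. G y * (\<integral>x. u x / (strip_path \<sigma> 0 x - strip_path s t y) \<partial>lborel) \<partial>lborel) \<le> 2 * pi * K * a * b"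
        by (simp only: mult_ac)
    qed (use st K in auto)
  qed (use assms(1) st in auto)
  have P: "Hp_plus_norm \<sigma> p (Cauchy_int \<sigma> F) \<le> ennreal (K * a)"
    unfolding Hp_plus_norm_def by (rule SUP_least) (auto intro: plus)
  have M: "Hp_minus_norm \<sigma> p (Cauchy_int \<sigma> F) \<le> ennreal (K * a)"
    unfolding Hp_minus_norm_def by (rule SUP_least) (auto intro: minus)
  have le: "ennreal (K * a) \<le> ennreal L * Lp_norm p (arc_measure \<sigma> 0) F" if "K \<le> L" for L
  proof -
    have "ennreal (K * a) \<le> ennreal (L * a)" using that a0 by (intro ennreal_leI mult_right_mono)
    also have "\<dots> = ennreal L * Lp_norm p (arc_measure \<sigma> 0) F" unfolding a[symmetric] using that K(1) a0 by (intro ennreal_mult) auto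
    finally show ?thesis .
  qed
  have r: "range (strip_path \<sigma> 0) = closure (half_strip \<sigma> 0) - half_strip \<sigma> 0"
    using range_strip_path[OF assms(1)] open_half_strip by (simp add: frontier_def interior_open)
  have "Cauchy_int \<sigma> F analytic_on Omega_plus \<sigma>"
    by (rule Cauchy_int_analytic[OF f assms(1,2) CF open_half_strip]) (auto simp: r)
  moreover have "Cauchy_int \<sigma> F analytic_on Omega_minus \<sigma>"
    by (rule Cauchy_int_analytic[OF f assms(1,2) CF]) (auto simp: r)
  ultimately show ?thesis
    unfolding Hp_plus_def Hp_minus_def
    using order_trans[OF P le[OF K(2)]] order_trans[OF M le[OF K(3)]] le_less_trans[OF P, of \<infinity>] le_less_trans[OF M, of \<infinity>] by simp
qed

end
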